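(* Let $2\le\ell\in\mathbb N$ and $2n:=\ell(\ell-1)$. Then $\mathrm{Ext}^0_{(k\mathsf{db})_{(-;-)}}\big(k\mathsf{FB},\Lambda_\odot^*(\mathcal C_{(k,\mathrm{id})})\big)(\mathbf{2n})$ contains the simple $kS_{2n}$-module $S_{(\ell^{\ell-1})}$ as a submodule, and the cohomology given by $$S_{(\ell^{\ell-1})}\subseteq\mathrm{Ext}^0_{(k\mathsf{db})_{(-;-)}}\big(k\mathsf{FB},\Lambda_\odot^*(\mathcal C_{(k,\mathrm{id})})\big)(\mathbf{2n})$$ is not torsion with respect to the $(k\mathsf{ub})_{(-;+)}$-module structure of $\mathrm{Ext}^*_{(k\mathsf{db})_{(-;-)}}\big(k\mathsf{FB},\Lambda_\odot^*(\mathcal C_{(k,\mathrm{id})})\big)$.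
   Context: $k$ is a field of characteristic zero, $\mathbf n=\{1,\dots,n\}$, $S_n$ the symmetric group, $\mathrm{sgn}_n$ its sign representation. $S_\lambda$ is the simple $kS_d$-module indexed by the partition $\lambda\vdash d$, with $S_{(d)}$ trivial; $(\ell^{\ell-1})$ is the partition with $\ell-1$ parts equal to $\ell$. For a $k$-linear category $\mathcal A$, an $\mathcal A$-module is a $k$-linear functor from $\mathcal A$ to $k$-vector spaces. $\mathsf{FB}$ is the category of finite sets and bijections, $k\mathsf{FB}$ its $k$-linearization. Twisted Brauer categories. For finite sets $X,Y$ with $|Y|-|X|=2t$, $t\in\mathbb N$, let $D(X,Y)$ be the set of bijections $X\amalg\mathbf{2t}\to Y$; the composite of $f\colon X\amalg\mathbf{2s}\to Y$ and $g\colon Y\amalg\mathbf{2t}\to Z$ is $X\amalg\mathbf{2(s+t)}\cong X\amalg\mathbf{2s}\amalg\mathbf{2t}\to Y\amalg\mathbf{2t}\to Z$ (using the order-preserving identification with $\mathbf{2s}$ first). The group $S_2\wr S_t\subset S_{2t}$ (permutations preserving the partition of $\mathbf{2t}$ into the pairs $\{2i-1,2i\}$) acts on the right on $D(X,Y)$ by precomposition. Its representations $k_{(\epsilon;\delta)}$ are: $k_{(+;+)}$ trivial; $k_{(-;+)}$ the restriction of $\mathrm{sgn}_{2t}$; $k_{(+;-)}$ the pullback of $\mathrm{sgn}_t$ along $S_2\wr S_t\to S_t$; $k_{(-;-)}=k_{(-;+)}\otimes k_{(+;-)}$. The $k$-linear category $(k\mathsf{ub})_{(\epsilon;\delta)}$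 has objects finite sets and morphisms $X\to Y$ given by $kD(X,Y)\otimes_{k[S_2\wr S_t]}k_{(\epsilon;\delta)}$ if $|Y|-|X|=2t\ge 0$ and $0$ otherwise, with composition induced by that of $D$; such morphisms have degree $t$ and the degree $0$ part is $k\mathsf{FB}$. $(k\mathsf{db})_{(\epsilon;\delta)}$ is the opposite category; its degree $0$ part is identified with $k\mathsf{FB}$ by inverting bijections. For an ordered pair $(u,v)$ of distinct elements of $X$, $g_{u,v}\colon X\to X\setminus\{u,v\}$ denotes the morphism of $(k\mathsf{db})_{(\epsilon;\delta)}$ given by the class of the bijection $(X\setminus\{u,v\})\amalg\mathbf 2\to X$ that is the identity on $X\setminus\{u,v\}$ and sends $1\mapsto u$, $2\mapsto v$. The module. $\mathcal C=\mathcal C_{(k,\mathrm{id})}$ is the cyclic operad supported on sets of cardinality $2$, with $\mathcal C(\{x,y\})=k$ (bijections acting trivially) and composition $\iota_{u,v}\colon\mathcal C(\{x,u\})\otimes\mathcal C(\{v,y\})\to\mathcal C(\{x,y\})$ the multiplication of $k$. For a $k\mathsf{FB}$-module $F$, $F^{\odot n}(X)=\bigoplus_{X=U_1\amalg\dots\amalg U_n}F(U_1)\otimes\dots\otimes F(U_n)$ and $\Lambda_\odot^n(F)=(\mathrm{sgn}_n\otimes F^{\odot n})/S_n$, $\Lambda_\odot^*=\bigoplus_n\Lambda_\odot^n$. $\Lambda_\odot^*(\mathcal C)$ is a $(k\mathsf{db})_{(-;-)}$-module: for $c_i\in\mathcal C(U_i)$, $X=\amalg U_i$, $g_{u,v}$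 sends $c_1\wedge\dots\wedge c_n$ to $0$ if $u,v$ are in the same $U_i$, and to $c_1\wedge\dots\wedge c_{n-2}\wedge\iota_{u,v}(c_{n-1}\otimes c_n)$ if $u\in U_{n-1}$, $v\in U_n$ (other cases by reordering with sign). Ext. For a finite set $X$ let $P_X=k\mathsf{FB}(X,-)$, a $(k\mathsf{db})_{(-;-)}$-module with all positive-degree morphisms acting by zero. $\mathrm{Ext}^*_{(k\mathsf{db})_{(-;-)}}(k\mathsf{FB},N)$ denotes $X\mapsto\mathrm{Ext}^*(P_X,N)$. By Koszul duality $\mathrm{Ext}^*(k\mathsf{FB},k\mathsf{FB})\cong(k\mathsf{ub})_{(-;+)}$, where $(k\mathsf{ub})_{(-;+)}(X,Y)$, $|Y|-|X|=2d$, corresponds to $\mathrm{Ext}^d(P_Y,P_X)$; the $(k\mathsf{ub})_{(-;+)}$-module structure on $\mathrm{Ext}^*(k\mathsf{FB},N)$ is given by the Yoneda product. Equivalently, it is the structure on the cohomology of the Koszul complex with terms $\bigoplus_s(k\mathsf{ub})_{(-;+)}(\mathbf s,-)\otimes_{kS_s}N(\mathbf s)$, with differential induced by $\mathrm{id}_{\mathbf s}\otimes x\mapsto\sum_{i<j}g_{i,j}\otimes g_{i,j}x$ (the first $g_{i,j}$ viewed as a morphism $\mathbf s\setminus\{i,j\}\to\mathbf s$ of $(k\mathsf{ub})_{(-;+)}$, identifying $\mathbf s\setminus\{i,j\}\cong\mathbf{s-2}$ preserving order). Torsion. For a $(k\mathsf{ub})_{(-;+)}$-module $M$, an element $x\in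 M(\mathbf m)$ is torsion if the submodule of $M$ generated by $x$ vanishes on $\mathbf t$ for all $t\gg0$; a set of elements is torsion if all its elements are. *)

theory Defs
  imports
    Complex_Main
    "HOL-Library.Poly_Mapping"
    "HOL-Library.FuncSet"
    "HOL-Library.Function_Algebras"
    "HOL-Combinatorics.Permutations"
begin

section \<open>Free vector spaces and quotients\<close>

text \<open>The free \<open>k\<close>-vector space on a set \<open>B\<close> is the set of all \<open>f :: 'b \<Rightarrow>\<^sub>0 'k\<close> with keys in \<open>B\<close>.\<close>

definition fscale :: "'k::field \<Rightarrow> ('b \<Rightarrow>\<^sub>0 'k) \<Rightarrow> ('b \<Rightarrow>\<^sub>0 'k)" where
  "fscale c f = Poly_Mapping.map (\<lambda>x. c * x) f"

definition free_on :: "'b set \<Rightarrow> ('b \<Rightarrow>\<^sub>0 'k::field) set" where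
  "free_on B = {f. Poly_Mapping.keys f \<subseteq> B}"

text \<open>Linear extension of a map given on basis elements, with values in a space with scaling \<open>s\<close>.\<close>

definition lin_ext :: "('k \<Rightarrow> 'v \<Rightarrow> 'v) \<Rightarrow> ('b \<Rightarrow> 'v) \<Rightarrow> ('b \<Rightarrow>\<^sub>0 'k::field) \<Rightarrow> 'v::ab_group_add" where
  "lin_ext s g f = (\<Sum>b\<in>Poly_Mapping.keys f. s (Poly_Mapping.lookup f b) (g b))"

definition bilin_ext :: "('k \<Rightarrow> 'v \<Rightarrow> 'v) \<Rightarrow> ('a \<Rightarrow> 'b \<Rightarrow> 'v)
    \<Rightarrow> ('a \<Rightarrow>\<^sub>0 'k::field) \<Rightarrow> ('b \<Rightarrow>\<^sub>0 'k) \<Rightarrow> 'v::ab_group_add" where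
  "bilin_ext s g e f = lin_ext s (\<lambda>a. lin_ext s (g a) f) e"

text \<open>
  The quotient of a vector space \<open>V\<close> by a subspace \<open>W\<close> is modelled as \<open>quot_map s W ` V\<close>, where
  \<open>quot_map s W\<close> is a chosen linear projection of the ambient space with kernel exactly \<open>W\<close>
  (so it is the quotient map \<open>V \<rightarrow> V/W\<close>, and \<open>v\<close> and \<open>w\<close> have the same class iff \<open>v - w \<in> W\<close>).
  Every element of the quotient, being fixed by the projection, is a representative of itself; for
  \<open>W \<subseteq> V\<close> this representative lies in \<open>V\<close>.
\<close>

definition quot_map :: "('k::field \<Rightarrow> 'v \<Rightarrow> 'v) \<Rightarrow> 'v set \<Rightarrow> 'v \<Rightarrow> 'v::ab_group_add" where
  "quot_map s W = (SOME p. Vector_Spaces.linear s s p \<and> (\<forall>v. p (p v) = p v) \<and> {v. p v = 0} = W)"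

lemma quot_map_props:
  fixes s :: "'k::field \<Rightarrow> 'v \<Rightarrow> 'v::ab_group_add"
  assumes "vector_space s" and "module.subspace s W"
  shows "Vector_Spaces.linear s s (quot_map s W)"
    and "quot_map s W (quot_map s W v) = quot_map s W v"
    and "quot_map s W v = 0 \<longleftrightarrow> v \<in> W"
proof -
  interpret vector_space s by fact
  interpret vp: vector_space_pair s s by unfold_locales
  obtain B where B: "B \<subseteq> W" "independent B" "W \<subseteq> span B"
    using basis_exists[of W] by metis
  define C where "C = extend_basis B"
  have BC: "B \<subseteq> C" and iC: "independent C" and sC: "span C = UNIV"
    unfolding C_def using B(2) extend_basis_superset independent_extend_basis span_extend_basis by auto
  have spB: "span B = W"
    using B assms(2) span_minimal by blast
  define p where "p = vp.construct C (\<lambda>b. if b \<in> B then 0 else b)"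
  have lp: "Vector_Spaces.linear s s p"
    unfolding p_def by (rule vp.linear_construct[OF iC])
  have pb: "p b = (if b \<in> B then 0 else b)" if "b \<in> C" for b
    unfolding p_def using vp.construct_basis[OF iC that] by simp
  have lin_pp: "Vector_Spaces.linear s s (p \<circ> p)"
    using lp lp by (rule Vector_Spaces.linear_compose)
  have p0: "p 0 = 0" using lp by (rule vp.linear_0)
  have pp: "p (p v) = p v" for v
  proof -
    have "(p \<circ> p) v = p v"
      by (rule vp.linear_eq_on[OF lin_pp lp, of v C]) (use sC pb p0 in auto)
    then show ?thesis by simp
  qed
  have kerW: "p v = 0" if "v \<in> W" for v
  proof (rule vp.linear_eq_0_on_span[OF lp])
    show "v \<in> span B" using that spB by simp
    show "p x = 0" if "x \<in> B" for x using pb that BC by auto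
  qed
  have diff: "v - p v \<in> W" for v
  proof -
    have "v \<in> span C" using sC by simp
    then show ?thesis
    proof (induction rule: span_induct_alt)
      case base
      show ?case using p0 subspace_0[OF assms(2)] by simp
    next
      case (step c x y)
      have "p (s c x + y) = s c (p x) + p y"
        using vp.linear_add[OF lp] vp.linear_scale[OF lp] by simp
      then have eq: "s c x + y - p (s c x + y) = s c (x - p x) + (y - p y)"
        by (simp add: scale_right_diff_distrib)
      have "x - p x \<in> W"
        using pb[OF step(1)] B(1) subspace_0[OF assms(2)] by auto
      then show ?case
        unfolding eq using step(2) assms(2) by (intro subspace_add subspace_scale)
    qed
  qed
  have "v \<in> W" if "p v = 0" for v
    using diff[of v] that by simp
  then have "\<exists>p. Vector_Spaces.linear s s p \<and> (\<forall>v. p (p v) = p v) \<and> {v. p v = 0} = W"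
    using lp pp kerW by (intro exI[of _ p]) blast
  from someI_ex[OF this]
  show "Vector_Spaces.linear s s (quot_map s W)"
    and "quot_map s W (quot_map s W v) = quot_map s W v"
    and "quot_map s W v = 0 \<longleftrightarrow> v \<in> W"
    unfolding quot_map_def by blast+
qed


section \<open>Linear categories, their modules, and Ext\<close>

text \<open>
  \<open>cmp A X Y Z g f\<close> is the composite \<open>g \<circ> f\<close> of \<open>f \<in> hom A X Y\<close> and \<open>g \<in> hom A Y Z\<close>. A module \<open>M\<close>
  over \<open>A\<close> sends \<open>X\<close> to the subspace \<open>sp M X\<close> of an ambient vector space and \<open>f \<in> hom A X Y\<close> to
  \<open>act M X Y f\<close>. The records carry data only; the functor laws hold for the instances below.
\<close>

record ('o, 'a, 'k) lincat =
  obj :: "'o set"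
  hom :: "'o \<Rightarrow> 'o \<Rightarrow> 'a set"
  idt :: "'o \<Rightarrow> 'a"
  cmp :: "'o \<Rightarrow> 'o \<Rightarrow> 'o \<Rightarrow> 'a \<Rightarrow> 'a \<Rightarrow> 'a"
  hscale :: "'k \<Rightarrow> 'a \<Rightarrow> 'a"

record ('o, 'a, 'v, 'k) linmod =
  sp :: "'o \<Rightarrow> 'v set"
  act :: "'o \<Rightarrow> 'o \<Rightarrow> 'a \<Rightarrow> 'v \<Rightarrow> 'v"
  mscale :: "'k \<Rightarrow> 'v \<Rightarrow> 'v"

definition opposite :: "('o, 'a, 'k) lincat \<Rightarrow> ('o, 'a, 'k) lincat" where
  "opposite A = \<lparr>obj = obj A, hom = (\<lambda>X Y. hom A Y X), idt = idt A,
     cmp = (\<lambda>X Y Z g f. cmp A Z Y X f g), hscale = hscale A\<rparr>"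

definition submodule :: "('o, 'a, 'k::field) lincat \<Rightarrow> ('o, 'a, 'v::ab_group_add, 'k) linmod
    \<Rightarrow> ('o \<Rightarrow> 'v set) \<Rightarrow> bool" where
  "submodule A M U \<longleftrightarrow>
     (\<forall>X\<in>obj A. U X \<subseteq> sp M X \<and> module.subspace (mscale M) (U X)) \<and>
     (\<forall>X\<in>obj A. \<forall>Y\<in>obj A. \<forall>f\<in>hom A X Y. \<forall>x\<in>U X. act M X Y f x \<in> U Y)"

definition generated :: "('o, 'a, 'k::field) lincat \<Rightarrow> ('o, 'a, 'v::ab_group_add, 'k) linmod
    \<Rightarrow> 'o \<Rightarrow> 'v \<Rightarrow> 'o \<Rightarrow> 'v set" where
  "generated A M X x Y = \<Inter> {U Y | U. submodule A M U \<and> x \<in> U X}"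

text \<open>
  Ext over \<open>A\<close> is computed by the bar resolution
  \<open>B\<^sub>p(M) = \<Oplus> A(x\<^sub>p, -) \<otimes> A(x\<^bsub>p-1\<^esub>, x\<^sub>p) \<otimes> \<dots> \<otimes> A(x\<^sub>0, x\<^sub>1) \<otimes> M(x\<^sub>0)\<close>, which is a projective
  resolution of \<open>M\<close> because \<open>k\<close> is a field. A natural map \<open>B\<^sub>p(M) \<rightarrow> N\<close> is a family of multilinear
  maps \<open>c [x\<^sub>0,\<dots>,x\<^sub>p] [f\<^sub>1,\<dots>,f\<^sub>p] m \<in> N(x\<^sub>p)\<close>, for \<open>f\<^sub>i \<in> A(x\<^bsub>i-1\<^esub>, x\<^sub>i)\<close> and \<open>m \<in> M(x\<^sub>0)\<close>; outside
  this domain \<open>c\<close> is normalised to \<open>0\<close>.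
\<close>

type_synonym ('o, 'a, 'v, 'w) cochain = "'o list \<Rightarrow> 'a list \<Rightarrow> 'v \<Rightarrow> 'w"

definition bar_dom :: "('o, 'a, 'k::field) lincat \<Rightarrow> ('o, 'a, 'v::ab_group_add, 'k) linmod
    \<Rightarrow> nat \<Rightarrow> 'o list \<Rightarrow> 'a list \<Rightarrow> 'v \<Rightarrow> bool" where
  "bar_dom A M p xs fs m \<longleftrightarrow> length fs = p \<and> length xs = Suc p \<and> set xs \<subseteq> obj A \<and>
     (\<forall>i<p. fs ! i \<in> hom A (xs ! i) (xs ! Suc i)) \<and> m \<in> sp M (hd xs)"

definition cochains :: "('o, 'a::ab_group_add, 'k::field) lincat \<Rightarrow> ('o, 'a, 'v::ab_group_add, 'k) linmod
    \<Rightarrow> ('o, 'a, 'w::ab_group_add, 'k) linmod \<Rightarrow> nat \<Rightarrow> ('o, 'a, 'v, 'w) cochain set" where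
  "cochains A M N p = {c.
     (\<forall>xs fs m. bar_dom A M p xs fs m \<longrightarrow> c xs fs m \<in> sp N (last xs)) \<and>
     (\<forall>xs fs m. \<not> bar_dom A M p xs fs m \<longrightarrow> c xs fs m = 0) \<and>
     (\<forall>xs fs m m' a b. bar_dom A M p xs fs m \<and> bar_dom A M p xs fs m' \<longrightarrow>
        c xs fs (mscale M a m + mscale M b m') =
          mscale N a (c xs fs m) + mscale N b (c xs fs m')) \<and>
     (\<forall>xs fs m i f a b. bar_dom A M p xs fs m \<and> i < p \<and> f \<in> hom A (xs ! i) (xs ! Suc i) \<longrightarrow>
        c xs (fs[i := hscale A a (fs ! i) + hscale A b f]) m =
          mscale N a (c xs fs m) + mscale N b (c xs (fs[i := f]) m))}"

definition bar_diff :: "('o, 'a::ab_group_add, 'k::field) lincat \<Rightarrow> ('o, 'a, 'v::ab_group_add, 'k) linmod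
    \<Rightarrow> ('o, 'a, 'w::ab_group_add, 'k) linmod \<Rightarrow> nat
    \<Rightarrow> ('o, 'a, 'v, 'w) cochain \<Rightarrow> ('o, 'a, 'v, 'w) cochain" where
  "bar_diff A M N p c xs fs m =
     (if bar_dom A M (Suc p) xs fs m then
        c (tl xs) (tl fs) (act M (xs ! 0) (xs ! 1) (fs ! 0) m)
        + (\<Sum>i<p. mscale N ((-1) ^ Suc i)
             (c (take (Suc i) xs @ drop (Suc (Suc i)) xs)
                (take i fs
                  @ [cmp A (xs ! i) (xs ! Suc i) (xs ! Suc (Suc i)) (fs ! Suc i) (fs ! i)]
                  @ drop (Suc (Suc i)) fs) m))
        + mscale N ((-1) ^ Suc p)
             (act N (xs ! p) (xs ! Suc p) (fs ! p) (c (butlast xs) (butlast fs) m))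
      else 0)"

definition cocycles where
  "cocycles A M N p = {c \<in> cochains A M N p. bar_diff A M N p c = 0}"

definition coboundaries where
  "coboundaries A M N p =
     (case p of 0 \<Rightarrow> {0} | Suc q \<Rightarrow> bar_diff A M N q ` cochains A M N q)"

definition cscale :: "('o, 'a, 'w::ab_group_add, 'k::field) linmod \<Rightarrow> 'k
    \<Rightarrow> ('o, 'a, 'v, 'w) cochain \<Rightarrow> ('o, 'a, 'v, 'w) cochain" where
  "cscale N k c = (\<lambda>xs fs m. mscale N k (c xs fs m))"

definition ext_class :: "('o, 'a::ab_group_add, 'k::field) lincat \<Rightarrow> ('o, 'a, 'v::ab_group_add, 'k) linmod
    \<Rightarrow> ('o, 'a, 'w::ab_group_add, 'k) linmod \<Rightarrow> nat
    \<Rightarrow> ('o, 'a, 'v, 'w) cochain \<Rightarrow> ('o, 'a, 'v, 'w) cochain" where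
  "ext_class A M N p = quot_map (cscale N) (coboundaries A M N p)"

definition Ext :: "('o, 'a::ab_group_add, 'k::field) lincat \<Rightarrow> ('o, 'a, 'v::ab_group_add, 'k) linmod
    \<Rightarrow> ('o, 'a, 'w::ab_group_add, 'k) linmod \<Rightarrow> nat \<Rightarrow> ('o, 'a, 'v, 'w) cochain set" where
  "Ext A M N p = ext_class A M N p ` cocycles A M N p"

text \<open>
  Yoneda product of \<open>b \<in> C\<^sup>*(M, N)\<close> with \<open>a \<in> C\<^sup>q(L, M)\<close> on bar cochains. With the sign convention
  of \<open>bar_diff\<close> one has \<open>d(b a) = b (d a) + (-1)\<^sup>q (d b) a\<close>, so it descends to Ext.
\<close>

definition yoneda :: "nat \<Rightarrow> ('o, 'a, 'v, 'w) cochain \<Rightarrow> ('o, 'a, 'u, 'v) cochain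
    \<Rightarrow> ('o, 'a, 'u, 'w) cochain" where
  "yoneda q b a = (\<lambda>xs fs m. b (drop q xs) (drop q fs) (a (take (Suc q) xs) (take q fs) m))"


section \<open>Twisted Brauer categories\<close>

text \<open>
  Objects are the finite subsets of \<open>nat\<close>. In \<open>X \<amalg> {1..2t} \<rightarrow> Y\<close> the two summands are tagged by
  \<open>Inl\<close> and \<open>Inr\<close>, and \<open>2t = |Y| - |X|\<close>.
\<close>

type_synonym brauer = "nat + nat \<Rightarrow> nat"
type_synonym 'k arr = "brauer \<Rightarrow>\<^sub>0 'k"

definition D :: "nat set \<Rightarrow> nat set \<Rightarrow> brauer set" where
  "D X Y = {b. card X \<le> card Y \<and> even (card Y - card X) \<and>
     b \<in> extensional (X <+> {1..card Y - card X}) \<and>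
     bij_betw b (X <+> {1..card Y - card X}) Y}"

definition D_comp :: "nat set \<Rightarrow> nat set \<Rightarrow> nat set \<Rightarrow> brauer \<Rightarrow> brauer \<Rightarrow> brauer" where
  "D_comp X Y Z g f =
     restrict (case_sum
         (\<lambda>x. g (Inl (f (Inl x))))
         (\<lambda>i. if i \<le> card Y - card X then g (Inl (f (Inr i))) else g (Inr (i - (card Y - card X)))))
       (X <+> {1..card Z - card X})"

definition wreath :: "nat \<Rightarrow> (nat \<Rightarrow> nat) set" where
  "wreath t = {h. h permutes {1..2 * t} \<and>
     (\<forall>i\<in>{1..t}. \<exists>j\<in>{1..t}. h ` {2 * i - 1, 2 * i} = {2 * j - 1, 2 * j})}"

definition wreath_proj :: "nat \<Rightarrow> (nat \<Rightarrow> nat) \<Rightarrow> nat \<Rightarrow> nat" where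
  "wreath_proj t h = (\<lambda>i. if i \<in> {1..t} then (h (2 * i) + 1) div 2 else i)"

datatype pm = Plus | Minus

definition twist :: "pm \<Rightarrow> pm \<Rightarrow> nat \<Rightarrow> (nat \<Rightarrow> nat) \<Rightarrow> int" where
  "twist \<epsilon> \<delta> t h = (if \<epsilon> = Minus then sign h else 1) * (if \<delta> = Minus then sign (wreath_proj t h) else 1)"

definition ub_rel :: "pm \<Rightarrow> pm \<Rightarrow> nat set \<Rightarrow> nat set \<Rightarrow> 'k::field arr set" where
  "ub_rel \<epsilon> \<delta> X Y = module.span fscale
     {Poly_Mapping.single (case_sum (b \<circ> Inl) (b \<circ> Inr \<circ> h)) 1
        - Poly_Mapping.single b (of_int (twist \<epsilon> \<delta> ((card Y - card X) div 2) h))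
      | b h. b \<in> D X Y \<and> h \<in> wreath ((card Y - card X) div 2)}"

abbreviation ub_quot :: "pm \<Rightarrow> pm \<Rightarrow> nat set \<Rightarrow> nat set \<Rightarrow> 'k::field arr \<Rightarrow> 'k arr" where
  "ub_quot \<epsilon> \<delta> X Y \<equiv> quot_map fscale (ub_rel \<epsilon> \<delta> X Y)"

definition ub :: "pm \<Rightarrow> pm \<Rightarrow> (nat set, 'k::field arr, 'k) lincat" where
  "ub \<epsilon> \<delta> = \<lparr>obj = {X. finite X},
     hom = (\<lambda>X Y. ub_quot \<epsilon> \<delta> X Y ` free_on (D X Y)),
     idt = (\<lambda>X. ub_quot \<epsilon> \<delta> X X
              (Poly_Mapping.single (restrict (case_sum id id) (X <+> {})) 1)),
     cmp = (\<lambda>X Y Z g f. ub_quot \<epsilon> \<delta> X Z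
              (bilin_ext fscale (\<lambda>g' f'. Poly_Mapping.single (D_comp X Y Z g' f') 1) g f)),
     hscale = fscale\<rparr>"

definition db :: "pm \<Rightarrow> pm \<Rightarrow> (nat set, 'k::field arr, 'k) lincat" where
  "db \<epsilon> \<delta> = opposite (ub \<epsilon> \<delta>)"

text \<open>
  \<open>P X = kFB(X, -)\<close>. A degree \<open>0\<close> morphism \<open>Y \<rightarrow> Z\<close> of \<open>db\<close> is represented by bijections \<open>b : Z \<rightarrow> Y\<close>
  and acts as the bijection \<open>b\<^sup>-\<^sup>1 : Y \<rightarrow> Z\<close>.
\<close>

type_synonym 'k bij_sp = "(nat \<Rightarrow> nat) \<Rightarrow>\<^sub>0 'k"

definition P :: "nat set \<Rightarrow> (nat set, 'k::field arr, 'k bij_sp, 'k) linmod" where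
  "P X = \<lparr>sp = (\<lambda>Y. free_on {p \<in> extensional X. bij_betw p X Y}),
     act = (\<lambda>Y Z. if card Y = card Z
       then bilin_ext fscale (\<lambda>b p. Poly_Mapping.single
              (restrict (\<lambda>x. inv_into Z (b \<circ> Inl) (p x)) X) 1)
       else (\<lambda>_ _. 0)),
     mscale = fscale\<rparr>"


section \<open>The module of exterior powers of the cyclic operad supported on two-element sets\<close>

text \<open>
  The cyclic operad has value \<open>k\<close> on two-element sets and \<open>0\<close> on all other sets. Hence the
  \<open>n\<close>-th convolution power of it has on \<open>X\<close> the basis of ordered decompositions
  \<open>X = U\<^sub>1 \<amalg> \<dots> \<amalg> U\<^sub>n\<close> into two-element sets, the list \<open>[U\<^sub>1, \<dots>, U\<^sub>n]\<close> standing for \<open>1 \<otimes> \<dots> \<otimes> 1\<close>.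
\<close>

type_synonym 'k lam = "nat set list \<Rightarrow>\<^sub>0 'k"

definition decomp2 :: "nat set \<Rightarrow> nat set list set" where
  "decomp2 X = {Us. (\<forall>U\<in>set Us. card U = 2) \<and> sorted_wrt (\<lambda>U V. U \<inter> V = {}) Us \<and> \<Union> (set Us) = X}"

definition lam_rel :: "nat set \<Rightarrow> 'k::field lam set" where
  "lam_rel X = module.span fscale
     {Poly_Mapping.single (permute_list \<sigma> Us) 1 - Poly_Mapping.single Us (of_int (sign \<sigma>))
      | \<sigma> Us. Us \<in> decomp2 X \<and> \<sigma> permutes {..<length Us}}"

text \<open>
  Contraction by \<open>g\<^bsub>u,v\<^esub>\<close>, where \<open>u\<close> lies in the block with index \<open>i\<close> and \<open>v\<close> in the block with index
  \<open>j\<close> (indices start at \<open>0\<close>): for \<open>i \<noteq> j\<close>, these blocks are first moved to the last two positions,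
  in this order; the sign is that of this reordering.
\<close>

definition block_of :: "nat set list \<Rightarrow> nat \<Rightarrow> nat" where
  "block_of Us u = (THE i. i < length Us \<and> u \<in> Us ! i)"

definition contract :: "nat \<Rightarrow> nat \<Rightarrow> nat set list \<Rightarrow> 'k::field lam" where
  "contract u v Us = (let i = block_of Us u; j = block_of Us v in
     if i = j then 0
     else Poly_Mapping.single (nths Us (- {i, j}) @ [(Us ! i \<union> Us ! j) - {u, v}])
            ((-1) ^ (if i < j then i + j + 1 else i + j)))"

text \<open>
  In \<open>D\<close> a bijection \<open>b : Z \<amalg> {1..2t} \<rightarrow> X\<close> is the composite of the bijection of \<open>Z\<close> onto its image,
  of the morphism adding the pair \<open>(b 1, b 2)\<close>, of the one adding \<open>(b 3, b 4)\<close>, and so on. In the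
  opposite category the last pair is therefore removed first.
\<close>

fun contract_pairs :: "brauer \<Rightarrow> nat \<Rightarrow> 'k::field lam \<Rightarrow> 'k lam" where
  "contract_pairs b 0 y = y"
| "contract_pairs b (Suc t) y =
     contract_pairs b t (lin_ext fscale (contract (b (Inr (2 * t + 1))) (b (Inr (2 * t + 2)))) y)"

definition relabel :: "brauer \<Rightarrow> nat set \<Rightarrow> 'k::field lam \<Rightarrow> 'k lam" where
  "relabel b Z = lin_ext fscale
     (\<lambda>Us. Poly_Mapping.single (map (\<lambda>U. {z \<in> Z. b (Inl z) \<in> U}) Us) 1)"

definition Lambda_C :: "(nat set, 'k::field arr, 'k lam, 'k) linmod" where
  "Lambda_C = \<lparr>sp = (\<lambda>X. quot_map fscale (lam_rel X) ` free_on (decomp2 X)),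
     act = (\<lambda>X Z \<phi> y. quot_map fscale (lam_rel Z)
       (lin_ext fscale (\<lambda>b. relabel b Z (contract_pairs b ((card X - card Z) div 2) y)) \<phi>)),
     mscale = fscale\<rparr>"


section \<open>Ext with coefficients as a module over the Koszul dual category\<close>

text \<open>
  The category \<open>ub Minus Plus\<close> is identified with \<open>Ext\<^sup>*(kFB, kFB)\<close> over \<open>db Minus Minus\<close>.
  A bijection \<open>b : X \<rightarrow> Y\<close> corresponds to precomposition \<open>P Y \<rightarrow> P X\<close>. The morphism
  \<open>g\<^bsub>u,v\<^esub> : Y - {u,v} \<rightarrow> Y\<close> corresponds to the class of the \<open>1\<close>-cocycle \<open>koszul_gen u v Y\<close> from \<open>P Y\<close> to
  \<open>P (Y - {u,v})\<close>, dual to \<open>g\<^bsub>u,v\<^esub>\<close>: it sends \<open>\<phi> \<otimes> p\<close>, for a bijection \<open>p : Y \<rightarrow> A\<close> and \<open>\<phi>\<close> of degree \<open>1\<close>,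
  to \<open>h\<close> if \<open>\<phi> \<circ> p = h \<circ> g\<^bsub>u,v\<^esub>\<close> with \<open>h\<close> a bijection, and to \<open>0\<close> if \<open>\<phi> \<circ> p\<close> removes a pair other
  than \<open>{u,v}\<close>. Composition goes to the (contravariant) Yoneda product.
\<close>

definition koszul_gen :: "nat \<Rightarrow> nat \<Rightarrow> nat set
    \<Rightarrow> (nat set, 'k::field arr, 'k bij_sp, 'k bij_sp) cochain" where
  "koszul_gen u v Y xs fs m =
     (if bar_dom (db Minus Minus) (P Y) 1 xs fs m \<and> card (xs ! 0) = card (xs ! 1) + 2
      then bilin_ext fscale
        (\<lambda>b p. Poly_Mapping.single (restrict (\<lambda>y. inv_into (xs ! 1) (b \<circ> Inl) (p y)) (Y - {u, v}))
           (if b (Inr 1) = p u \<and> b (Inr 2) = p v then 1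
            else if b (Inr 1) = p v \<and> b (Inr 2) = p u then - 1 else 0))
        (fs ! 0) m
      else 0)"

definition koszul_bij :: "brauer \<Rightarrow> nat set \<Rightarrow> nat set
    \<Rightarrow> (nat set, 'k::field arr, 'k bij_sp, 'k bij_sp) cochain" where
  "koszul_bij b X Y xs fs m =
     (if bar_dom (db Minus Minus) (P Y) 0 xs fs m
      then lin_ext fscale (\<lambda>p. Poly_Mapping.single (restrict (\<lambda>x. p (b (Inl x))) X) 1) m
      else 0)"

fun koszul_pairs :: "brauer \<Rightarrow> nat set \<Rightarrow> nat
    \<Rightarrow> (nat set, 'k::field arr, 'k bij_sp, 'k bij_sp) cochain" where
  "koszul_pairs b X 0 = koszul_bij b X (b ` (X <+> {}))"
| "koszul_pairs b X (Suc t) =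
     yoneda 1 (koszul_pairs b X t)
       (koszul_gen (b (Inr (2 * t + 1))) (b (Inr (2 * t + 2))) (b ` (X <+> {1..2 * t + 2})))"

definition koszul :: "nat set \<Rightarrow> nat set \<Rightarrow> 'k::field arr
    \<Rightarrow> (nat set, 'k arr, 'k bij_sp, 'k bij_sp) cochain" where
  "koszul X Y = lin_ext (cscale (P X)) (\<lambda>b. koszul_pairs b X ((card Y - card X) div 2))"

text \<open>
  The \<open>ub Minus Plus\<close>-module \<open>X \<mapsto> Ext\<^sup>*(P X, N)\<close>. Its elements are finitely supported families
  indexed by the cohomological degree.
\<close>

definition Ext_module :: "(nat set, 'k::field arr, 'w::ab_group_add, 'k) linmod
    \<Rightarrow> (nat set, 'k arr, nat \<Rightarrow> (nat set, 'k arr, 'k bij_sp, 'w) cochain, 'k) linmod" where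
  "Ext_module N = \<lparr>
     sp = (\<lambda>X. {e. (\<forall>p. e p \<in> Ext (db Minus Minus) (P X) N p) \<and> finite {p. e p \<noteq> 0}}),
     act = (\<lambda>X Y f e p. let d = (card Y - card X) div 2 in
       if d \<le> p
       then ext_class (db Minus Minus) (P Y) N p (yoneda d (e (p - d)) (koszul X Y f))
       else 0),
     mscale = (\<lambda>a e p. cscale N a (e p))\<rparr>"

definition Ext0 :: "(nat set, 'k::field arr, 'w::ab_group_add, 'k) linmod \<Rightarrow> nat set
    \<Rightarrow> (nat \<Rightarrow> (nat set, 'k arr, 'k bij_sp, 'w) cochain) set" where
  "Ext0 N X = {e \<in> sp (Ext_module N) X. \<forall>p>0. e p = 0}"

type_synonym 'k ext_lam = "nat \<Rightarrow> (nat set, 'k arr, 'k bij_sp, 'k lam) cochain"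

definition Ext_Lambda :: "(nat set, 'k::field arr, 'k ext_lam, 'k) linmod" where
  "Ext_Lambda = Ext_module Lambda_C"

definition torsion_elem :: "(nat set, 'k::field arr, 'v::ab_group_add, 'k) linmod
    \<Rightarrow> nat set \<Rightarrow> 'v \<Rightarrow> bool" where
  "torsion_elem M X x \<longleftrightarrow>
     (\<exists>t0. \<forall>t\<ge>t0. generated (ub Minus Plus) M X x {1..t} = {0})"

definition torsion_set :: "(nat set, 'k::field arr, 'v::ab_group_add, 'k) linmod
    \<Rightarrow> nat set \<Rightarrow> 'v set \<Rightarrow> bool" where
  "torsion_set M X S \<longleftrightarrow> (\<forall>x\<in>S. torsion_elem M X x)"


section \<open>Simple modules of symmetric groups\<close>

text \<open>
  The cells of the Young diagram of \<open>\<mu>\<close> are numbered \<open>1, 2, \<dots>\<close> row by row. The simple module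
  indexed by \<open>\<mu>\<close> is the left ideal of the group algebra generated by the Young symmetrizer
  \<open>\<Sum> sign q \<cdot> p q\<close>, for \<open>p\<close> in the row group and \<open>q\<close> in the column group; for \<open>\<mu> = (d)\<close> it is trivial.
\<close>

definition row_of :: "nat list \<Rightarrow> nat \<Rightarrow> nat" where
  "row_of \<mu> i = (LEAST r. i \<le> sum_list (take (Suc r) \<mu>))"

definition col_of :: "nat list \<Rightarrow> nat \<Rightarrow> nat" where
  "col_of \<mu> i = i - sum_list (take (row_of \<mu> i) \<mu>)"

definition stabilizer :: "nat \<Rightarrow> (nat \<Rightarrow> nat) \<Rightarrow> (nat \<Rightarrow> nat) set" where
  "stabilizer d c = {p. p permutes {1..d} \<and> (\<forall>i\<in>{1..d}. c (p i) = c i)}"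

definition grp_mult :: "'k::field bij_sp \<Rightarrow> 'k bij_sp \<Rightarrow> 'k bij_sp" where
  "grp_mult = bilin_ext fscale (\<lambda>p q. Poly_Mapping.single (p \<circ> q) 1)"

definition young_symmetrizer :: "nat list \<Rightarrow> 'k::field bij_sp" where
  "young_symmetrizer \<mu> =
     (\<Sum>p\<in>stabilizer (sum_list \<mu>) (row_of \<mu>). \<Sum>q\<in>stabilizer (sum_list \<mu>) (col_of \<mu>).
        Poly_Mapping.single (p \<circ> q) (of_int (sign q)))"

definition specht :: "nat list \<Rightarrow> 'k::field bij_sp set" where
  "specht \<mu> = (\<lambda>a. grp_mult a (young_symmetrizer \<mu>)) ` free_on {p. p permutes {1..sum_list \<mu>}}"

text \<open>The action of a permutation of \<open>{1..d}\<close> on the value at \<open>{1..d}\<close> of a \<open>ub Minus Plus\<close>-module.\<close>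

definition sym_act :: "(nat set, 'k::field arr, 'v::ab_group_add, 'k) linmod
    \<Rightarrow> nat \<Rightarrow> (nat \<Rightarrow> nat) \<Rightarrow> 'v \<Rightarrow> 'v" where
  "sym_act M d \<sigma> = act M {1..d} {1..d} (ub_quot Minus Plus {1..d} {1..d}
     (Poly_Mapping.single (restrict (case_sum \<sigma> id) ({1..d} <+> {})) 1))"

definition sym_submodule :: "(nat set, 'k::field arr, 'v::ab_group_add, 'k) linmod
    \<Rightarrow> nat \<Rightarrow> 'v set \<Rightarrow> bool" where
  "sym_submodule M d S \<longleftrightarrow> S \<subseteq> sp M {1..d} \<and> module.subspace (mscale M) S \<and>
     (\<forall>\<sigma>. \<sigma> permutes {1..d} \<longrightarrow> (\<forall>x\<in>S. sym_act M d \<sigma> x \<in> S))"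

definition iso_specht :: "nat list \<Rightarrow> (nat set, 'k::field arr, 'v::ab_group_add, 'k) linmod
    \<Rightarrow> 'v set \<Rightarrow> bool" where
  "iso_specht \<mu> M S \<longleftrightarrow> (\<exists>\<theta>. bij_betw \<theta> (specht \<mu>) S \<and>
     (\<forall>a\<in>specht \<mu>. \<forall>b\<in>specht \<mu>. \<forall>c. \<theta> (a + fscale c b) = \<theta> a + mscale M c (\<theta> b)) \<and>
     (\<forall>\<sigma>. \<sigma> permutes {1..sum_list \<mu>} \<longrightarrow> (\<forall>a\<in>specht \<mu>.
        \<theta> (grp_mult (Poly_Mapping.single \<sigma> 1) a) = sym_act M (sum_list \<mu>) \<sigma> (\<theta> a))))"

end

theory Submission
  imports Defs
begin

text \<open>
  A basis element of \<open>Lambda_C\<close> is a perfect matching with ordered edges, and reordering the edges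
  multiplies it by the sign. Colour the points of a matching and antisymmetrize it over the
  permutations that preserve the colours. The result vanishes if an edge joins two points of the same
  colour, because the transposition of its ends is odd and fixes the matching. It also vanishes if two
  edges join the same two colours, because exchanging them is an even permutation of the points that
  transposes two edges. So only matchings that induce a simple graph on the set of colours survive.
  With \<open>l\<close> colours such a graph has at most \<open>l (l - 1) / 2\<close> edges, and hence every
  antisymmetrized matching on more than \<open>l (l - 1)\<close> points vanishes (\<open>isum_alt_too_many\<close>). On exactly
  \<open>l (l - 1)\<close> points, coloured by the \<open>l\<close> columns of a rectangle with \<open>l - 1\<close> rows, the complete graph
  gives a nonzero vector \<open>y0\<close> (\<open>isum_alt_nonzero\<close>).

  The vector \<open>y0\<close> is annihilated by all contractions (\<open>y0_contract\<close>). Contracting two points of one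
  column leaves a graph with one deficient vertex and all others of full degree, which is impossible.
  A Garnir relation, which holds since a column with \<open>l\<close> points is impossible as well, reduces
  the contraction of two points of different columns to this case. Therefore the translates of \<open>y0\<close> are
  natural transformations on \<open>kFB\<close>, that is, classes in \<open>Ext\<close> of degree zero.

  Sending a group algebra element \<open>z\<close> to its action on the complete matching maps the Specht module,
  the left ideal generated by the Young symmetrizer \<open>\<alpha> \<beta>\<close>, to these classes. The map is injective if
  \<open>\<alpha> \<beta>\<close> does not annihilate the matching (\<open>specht_injective\<close>). To see this, the product of the
  operators \<open>r + J\<^sub>z\<close>, for \<open>r = l - 1\<close> and the Jucys-Murphy elements \<open>J\<^sub>z\<close>, is expanded as a sum of
  symmetrizers over all colourings with \<open>r\<close> colours. Column antisymmetry and the Garnir relations show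
  that the product acts on \<open>y0\<close> by a product of positive integers, so one of the symmetrizers is nonzero
  on \<open>y0\<close>; since no colour class can have more than \<open>l\<close> points, it belongs to a translate of the row
  colouring (\<open>y0_row\<close>). Young's lemma, which for rectangles is a counting argument, completes the
  proof (\<open>young\<close>).

  For the second claim, every copy of the Specht module contains a nonzero column-antisymmetric class
  \<open>x\<close> (\<open>antisymmetric_vector\<close>). Products of \<open>x\<close> with elements of degree \<open>t\<close> are tested on an explicit
  chain of the bar complex: the signed sum over all sequences of \<open>t\<close> colour-preserving permutations,
  where all points outside of the rectangle have the same colour as the first column. The inner
  faces of this chain cancel, because in the \<open>(-;-)\<close>-twisted category two added pairs anticommute. Its
  last face contracts an antisymmetrized matching with \<open>l\<close> colours on too many points, which is zero.
  Hence the pairing with the chain vanishes on coboundaries (\<open>bar_cycle_coboundary\<close>). On the product of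
  \<open>x\<close> with the class that adds \<open>t\<close> pairs, the pairing is a positive integer multiple of the value of
  \<open>x\<close> at the identity (\<open>koszul_pairing_nonzero\<close>). This value is nonzero, so \<open>x\<close> has nonzero
  multiples in all degrees and is not torsion (\<open>not_torsion\<close>).
\<close>

section \<open>Linear maps between free vector spaces\<close>

lemma lookup_fscale [simp]: "Poly_Mapping.lookup (fscale c f) b = c * Poly_Mapping.lookup f b"
  unfolding fscale_def by (simp add: Poly_Mapping.map.rep_eq when_def)

interpretation fv: vector_space "fscale :: 'k::field \<Rightarrow> ('b \<Rightarrow>\<^sub>0 'k) \<Rightarrow> _"
  by unfold_locales
    (auto intro!: poly_mapping_eqI simp: lookup_add algebra_simps)

interpretation fp: vector_space_pair
  "fscale :: 'k::field \<Rightarrow> ('b \<Rightarrow>\<^sub>0 'k) \<Rightarrow> _" "fscale :: 'k::field \<Rightarrow> ('c \<Rightarrow>\<^sub>0 'k) \<Rightarrow> _"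
  by unfold_locales

abbreviation flin :: "(('b \<Rightarrow>\<^sub>0 'k::field) \<Rightarrow> ('c \<Rightarrow>\<^sub>0 'k)) \<Rightarrow> bool" where
  "flin \<equiv> Vector_Spaces.linear fscale fscale"

lemma flinI:
  assumes "\<And>x y. T (x + y) = T x + T y" and "\<And>c x. T (fscale c x) = fscale c (T x)"
  shows "flin T"
  using assms by unfold_locales auto

lemma flin_comp: "flin S \<Longrightarrow> flin T \<Longrightarrow> flin (\<lambda>x. S (T x))"
  using Vector_Spaces.linear_compose[of fscale fscale T fscale S] by (simp add: o_def)

lemmas flin_add = fp.linear_add and flin_scale = fp.linear_scale and flin_0 = fp.linear_0
  and flin_diff = fp.linear_diff and flin_neg = fp.linear_neg and flin_sum = fp.linear_sum

lemma flin_id: "flin (\<lambda>x. x)"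
  by (rule flinI) auto

lemma flin_sum_fun: "(\<And>i. i \<in> I \<Longrightarrow> flin (T i)) \<Longrightarrow> flin (\<lambda>x. \<Sum>i\<in>I. T i x)"
  by (rule flinI) (auto simp: flin_add flin_scale sum.distrib fv.scale_sum_right)

lemma flin_scale_fun: "flin T \<Longrightarrow> flin (\<lambda>x. fscale c (T x))"
  by (rule flinI) (auto simp: flin_add flin_scale fv.scale_right_distrib)

lemma fscale_minus1: "fscale (- 1) x = - x"
  by (simp add: fv.scale_minus_left)

lemma fscale_single: "fscale c (Poly_Mapping.single b a) = Poly_Mapping.single b (c * a)"
  by (rule poly_mapping_eqI) (simp add: lookup_single when_def)

lemma subspace_half:
  fixes W :: "('b \<Rightarrow>\<^sub>0 'k::field_char_0) set"
  assumes "fv.subspace W" "v + v \<in> W" shows "v \<in> W"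
proof -
  have "v = fscale (1/2) (v + v)"
    by (rule poly_mapping_eqI) (simp add: lookup_add)
  with assms show ?thesis using fv.subspace_scale by metis
qed

lemma subspace_scale_cancel:
  assumes "fv.subspace W" "fscale c v \<in> W" "c \<noteq> 0" shows "v \<in> W"
proof -
  have "v = fscale (inverse c) (fscale c v)" using assms(3) by simp
  with assms show ?thesis using fv.subspace_scale by metis
qed

lemma subspace_vimage:
  assumes "flin T" "fv.subspace W" shows "fv.subspace {x. T x \<in> W}"
  unfolding fv.subspace_def using assms
  by (auto simp: flin_0 flin_add flin_scale fv.subspace_0 fv.subspace_add fv.subspace_scale)

lemma flin_span_mem:
  assumes "flin T" "fv.subspace W" "\<And>g. g \<in> G \<Longrightarrow> T g \<in> W" "x \<in> fv.span G"
  shows "T x \<in> W"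
proof -
  have "fv.span G \<subseteq> {x. T x \<in> W}"
    by (rule fv.span_minimal) (use assms subspace_vimage in auto)
  with assms show ?thesis by auto
qed

lemma subspace_free_on: "fv.subspace (free_on B :: ('b \<Rightarrow>\<^sub>0 'k::field) set)"
  unfolding fv.subspace_def free_on_def
proof (intro conjI ballI allI; clarsimp)
  fix x y :: "'b \<Rightarrow>\<^sub>0 'k" and b
  assume "Poly_Mapping.keys x \<subseteq> B" "Poly_Mapping.keys y \<subseteq> B" "b \<in> Poly_Mapping.keys (x + y)"
  then show "b \<in> B" using keys_add[of x y] by blast
next
  fix c :: 'k and x :: "'b \<Rightarrow>\<^sub>0 'k" and b
  assume "Poly_Mapping.keys x \<subseteq> B" "b \<in> Poly_Mapping.keys (fscale c x)"
  then show "b \<in> B" by (auto simp: in_keys_iff)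
qed

lemma single_free_on: "b \<in> B \<Longrightarrow> Poly_Mapping.single b c \<in> free_on B"
  by (auto simp: free_on_def)

lemma fsum_representation:
  "f = (\<Sum>b\<in>Poly_Mapping.keys f. fscale (Poly_Mapping.lookup f b) (Poly_Mapping.single b 1))"
proof (rule poly_mapping_eqI)
  fix k
  show "Poly_Mapping.lookup f k = Poly_Mapping.lookup (\<Sum>b\<in>Poly_Mapping.keys f. fscale (Poly_Mapping.lookup f b) (Poly_Mapping.single b 1)) k"
    by (cases "k \<in> Poly_Mapping.keys f")
      (auto simp: lookup_sum lookup_single when_def sum.If_cases if_distrib[of "(*) _"] in_keys_iff cong: if_cong)
qed

lemma flin_mem:
  assumes "flin T" "fv.subspace W" "\<And>b. b \<in> B \<Longrightarrow> T (Poly_Mapping.single b 1) \<in> W" "f \<in> free_on B"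
  shows "T f \<in> W"
proof -
  have "T f = (\<Sum>b\<in>Poly_Mapping.keys f. fscale (Poly_Mapping.lookup f b) (T (Poly_Mapping.single b 1)))"
    by (subst fsum_representation) (simp add: flin_sum[OF assms(1)] flin_scale[OF assms(1)])
  also have "\<dots> \<in> W"
    using assms by (intro fv.subspace_sum fv.subspace_scale) (auto simp: free_on_def)
  finally show ?thesis .
qed

lemma flin_eq:
  assumes "flin S" "flin T" "\<And>b. b \<in> B \<Longrightarrow> S (Poly_Mapping.single b 1) = T (Poly_Mapping.single b 1)" "f \<in> free_on B"
  shows "S f = T f"
proof -
  have "S f = (\<Sum>b\<in>Poly_Mapping.keys f. fscale (Poly_Mapping.lookup f b) (S (Poly_Mapping.single b 1)))"
    by (subst fsum_representation) (simp add: flin_sum[OF assms(1)] flin_scale[OF assms(1)])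
  also have "\<dots> = (\<Sum>b\<in>Poly_Mapping.keys f. fscale (Poly_Mapping.lookup f b) (T (Poly_Mapping.single b 1)))"
    using assms by (intro sum.cong) (auto simp: free_on_def)
  also have "\<dots> = T f"
    by (subst (3) fsum_representation) (simp add: flin_sum[OF assms(2)] flin_scale[OF assms(2)])
  finally show ?thesis .
qed

lemma free_on_UNIV: "f \<in> free_on UNIV"
  by (simp add: free_on_def)

lemma lin_ext_superset:
  assumes "finite B" "Poly_Mapping.keys f \<subseteq> B"
  shows "lin_ext fscale g f = (\<Sum>b\<in>B. fscale (Poly_Mapping.lookup f b) (g b))"
  unfolding lin_ext_def
  by (rule sum.mono_neutral_left) (use assms in \<open>auto simp: in_keys_iff\<close>)

lemma flin_lin_ext:
  fixes g :: "'a \<Rightarrow> ('c \<Rightarrow>\<^sub>0 'b::field)"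
  shows "flin (lin_ext fscale g)"
proof (rule flinI)
  fix x y :: "'a \<Rightarrow>\<^sub>0 'b"
  let ?B = "Poly_Mapping.keys x \<union> Poly_Mapping.keys y"
  have "lin_ext fscale g (x + y) = (\<Sum>b\<in>?B. fscale (Poly_Mapping.lookup (x + y) b) (g b))"
    by (rule lin_ext_superset) (use keys_add[of x y] in auto)
  also have "\<dots> = lin_ext fscale g x + lin_ext fscale g y"
    by (simp add: lin_ext_superset[of ?B] lookup_add fv.scale_left_distrib sum.distrib)
  finally show "lin_ext fscale g (x + y) = lin_ext fscale g x + lin_ext fscale g y" .
next
  fix c :: 'b and x :: "'a \<Rightarrow>\<^sub>0 'b"
  have "lin_ext fscale g (fscale c x) = (\<Sum>b\<in>Poly_Mapping.keys x. fscale (Poly_Mapping.lookup (fscale c x) b) (g b))"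
    by (rule lin_ext_superset) (auto simp: in_keys_iff)
  then show "lin_ext fscale g (fscale c x) = fscale c (lin_ext fscale g x)"
    by (simp add: lin_ext_def fv.scale_sum_right)
qed

lemmas lin_ext_add = flin_add[OF flin_lin_ext] and lin_ext_scale = flin_scale[OF flin_lin_ext]
  and lin_ext_0 = flin_0[OF flin_lin_ext] and lin_ext_diff = flin_diff[OF flin_lin_ext]
  and lin_ext_neg = flin_neg[OF flin_lin_ext] and lin_ext_sum = flin_sum[OF flin_lin_ext]

lemma lin_ext_single [simp]: "lin_ext fscale g (Poly_Mapping.single b c) = fscale c (g b)"
  by (subst lin_ext_superset[of "{b}"]) auto

lemma lin_ext_fun_lin:
  assumes "\<And>b. flin (g b)" shows "flin (\<lambda>v. lin_ext fscale (\<lambda>b. g b v) f)"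
  unfolding lin_ext_def by (intro flin_sum_fun flin_scale_fun assms)

lemma lin_ext_mem:
  assumes "fv.subspace W" "\<And>b. b \<in> B \<Longrightarrow> g b \<in> W" "f \<in> free_on B"
  shows "lin_ext fscale g f \<in> W"
  by (rule flin_mem[OF flin_lin_ext assms(1) _ assms(3)]) (use assms in auto)

lemma flin_lin_ext_comp:
  assumes "flin T" shows "T (lin_ext fscale g f) = lin_ext fscale (\<lambda>b. T (g b)) f"
  unfolding lin_ext_def by (simp add: flin_sum[OF assms] flin_scale[OF assms])

lemma flin_bilin_left: "flin (\<lambda>e. bilin_ext fscale g e f)"
  unfolding bilin_ext_def by (rule flin_lin_ext)

lemma flin_bilin_right: "flin (\<lambda>f. bilin_ext fscale g e f)"
  unfolding bilin_ext_def by (intro lin_ext_fun_lin flin_lin_ext)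

lemma bilin_ext_single [simp]:
  "bilin_ext fscale g (Poly_Mapping.single a c) (Poly_Mapping.single b d) = fscale (c * d) (g a b)"
  by (simp add: bilin_ext_def)

lemma sum_apply3: "(\<Sum>i\<in>I. h i) xs fs m = (\<Sum>i\<in>I. h i xs fs m)"
  for h :: "'i \<Rightarrow> 'x \<Rightarrow> 'y \<Rightarrow> 'z \<Rightarrow> 'w::ab_group_add"
  by (induction I rule: infinite_finite_induct) auto

section \<open>Quotient projections\<close>

lemma quot_diff:
  assumes "vector_space s" "module.subspace s W"
  shows "v - quot_map s W v \<in> W"
proof -
  interpret vector_space s by fact
  interpret vp: vector_space_pair s s by unfold_locales
  have "quot_map s W (v - quot_map s W v) = 0"
    using quot_map_props[OF assms] vp.linear_diff by fastforce
  then show ?thesis using quot_map_props(3)[OF assms] by blast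
qed

lemma quot_zero_space:
  assumes "vector_space s" shows "quot_map s {0} v = v"
proof -
  interpret vector_space s by fact
  have "module.subspace s {0}" by (rule subspace_single_0)
  from quot_diff[OF assms this, of v] show ?thesis by simp
qed

lemmas fquot_lin = quot_map_props(1)[OF fv.vector_space_axioms]
  and fquot_0_iff = quot_map_props(3)[OF fv.vector_space_axioms]
  and fquot_diff = quot_diff[OF fv.vector_space_axioms]

lemma fquot_eqI:
  assumes "fv.subspace W" "x - y \<in> W" shows "quot_map fscale W x = quot_map fscale W y"
proof -
  have "quot_map fscale W (x - y) = 0" using assms fquot_0_iff by blast
  then show ?thesis using flin_diff[OF fquot_lin[OF assms(1)]] by simp
qed

lemma fquot_free_on:
  assumes "fv.subspace W" "W \<subseteq> free_on B" "x \<in> free_on B"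
  shows "quot_map fscale W x \<in> free_on B"
proof -
  have "quot_map fscale W x = x - (x - quot_map fscale W x)" by simp
  also have "\<dots> \<in> free_on B"
    by (rule fv.subspace_diff[OF subspace_free_on assms(3)]) (use fquot_diff[OF assms(1)] assms(2) in auto)
  finally show ?thesis .
qed

lemma quot_map_image_subspace:
  assumes "fv.subspace W" "fv.subspace V" shows "fv.subspace (quot_map fscale W ` V)"
  using fp.linear_subspace_image[OF fquot_lin[OF assms(1)] assms(2)] .

section \<open>Sums over colour-preserving permutations\<close>

text \<open>The Young subgroup whose blocks are the fibres of \<open>f\<close>.\<close>

definition cperm :: "nat set \<Rightarrow> (nat \<Rightarrow> nat) \<Rightarrow> (nat \<Rightarrow> nat) set" where
  "cperm X f = {p. p permutes X \<and> (\<forall>x\<in>X. f (p x) = f x)}"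

lemma cperm_permutes: "p \<in> cperm X f \<Longrightarrow> p permutes X"
  by (simp add: cperm_def)

lemma cperm_colour: "p \<in> cperm X f \<Longrightarrow> x \<in> X \<Longrightarrow> f (p x) = f x"
  by (simp add: cperm_def)

lemma finite_cperm [simp]: "finite X \<Longrightarrow> finite (cperm X f)"
  unfolding cperm_def by (rule finite_subset[OF _ finite_permutations[of X]]) auto

lemma cperm_id [simp]: "id \<in> cperm X f"
  by (simp add: cperm_def permutes_id)

lemma cperm_comp: "p \<in> cperm X f \<Longrightarrow> q \<in> cperm X f \<Longrightarrow> p \<circ> q \<in> cperm X f"
  by (auto simp: cperm_def permutes_compose permutes_in_image)

lemma cperm_inv:
  assumes "p \<in> cperm X f" shows "inv p \<in> cperm X f"
proof -
  have p: "p permutes X" using assms by (rule cperm_permutes)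
  have "f (inv p x) = f x" if "x \<in> X" for x
    using cperm_colour[OF assms, of "inv p x"] that permutes_inverses(1)[OF p]
      permutes_in_image[OF permutes_inv[OF p]] by simp
  then show ?thesis using permutes_inv[OF p] by (simp add: cperm_def)
qed

lemma cperm_transpose: "x \<in> X \<Longrightarrow> y \<in> X \<Longrightarrow> f x = f y \<Longrightarrow> transpose x y \<in> cperm X f"
  by (auto simp: cperm_def permutes_swap_id transpose_def)

lemma cperm_sum_right:
  assumes "t \<in> cperm X f"
  shows "(\<Sum>p\<in>cperm X f. h (p \<circ> t)) = (\<Sum>p\<in>cperm X f. h p)"
proof (rule sum.reindex_bij_witness[of _ "\<lambda>p. p \<circ> inv t" "\<lambda>p. p \<circ> t"])
  have t: "t permutes X" using assms by (rule cperm_permutes)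
  show "p \<circ> t \<circ> inv t = p" "p \<circ> inv t \<circ> t = p" for p
    using permutes_inv_o[OF t] by (simp_all add: comp_assoc)
qed (use assms in \<open>auto intro: cperm_comp cperm_inv\<close>)

lemma cperm_sum_left:
  assumes "t \<in> cperm X f"
  shows "(\<Sum>p\<in>cperm X f. h (t \<circ> p)) = (\<Sum>p\<in>cperm X f. h p)"
proof (rule sum.reindex_bij_witness[of _ "\<lambda>p. inv t \<circ> p" "\<lambda>p. t \<circ> p"])
  have t: "t permutes X" using assms by (rule cperm_permutes)
  show "inv t \<circ> (t \<circ> p) = p" "t \<circ> (inv t \<circ> p) = p" for p
    using permutes_inv_o[OF t] by (simp_all add: comp_assoc[symmetric])
qed (use assms in \<open>auto intro: cperm_comp cperm_inv\<close>)

lemma cperm_sum_inv: "(\<Sum>p\<in>cperm X f. h (inv p)) = (\<Sum>p\<in>cperm X f. h p)"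
  by (rule sum.reindex_bij_witness[of _ inv inv])
    (auto intro: cperm_inv simp: permutes_inv_inv[OF cperm_permutes])

abbreviation sg :: "(nat \<Rightarrow> nat) \<Rightarrow> 'k::field_char_0" where "sg p \<equiv> of_int (sign p)"

text \<open>The trivial character and the sign are treated together; both take the values \<open>1\<close> and
  \<open>-1\<close> only.\<close>

definition lin_char :: "nat set \<Rightarrow> ((nat \<Rightarrow> nat) \<Rightarrow> 'k::field_char_0) \<Rightarrow> bool" where
  "lin_char X \<chi> \<longleftrightarrow> (\<forall>p q. p permutes X \<longrightarrow> q permutes X \<longrightarrow> \<chi> (p \<circ> q) = \<chi> p * \<chi> q) \<and>
     (\<forall>p. \<chi> p * \<chi> p = 1)"

lemma sg_compose: "finite X \<Longrightarrow> p permutes X \<Longrightarrow> q permutes X \<Longrightarrow> sg (p \<circ> q) = sg p * sg q"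
  by (metis of_int_mult permutation_permutes sign_compose)

lemma sg_square: "sg p * sg p = 1"
  by (metis of_int_1 of_int_mult sign_idempotent)

lemma sg_inv: "finite X \<Longrightarrow> p permutes X \<Longrightarrow> sg (inv p) = sg p"
  using permutation_permutes sign_inverse by metis

lemma lin_char_sg: "finite X \<Longrightarrow> lin_char X sg"
  by (auto simp: lin_char_def sg_compose sg_square)

lemma lin_char_one: "lin_char X (\<lambda>_. 1)"
  by (simp add: lin_char_def)

text \<open>Up to the order of the group, the projection onto the isotypic part of the linear
  character \<open>\<chi>\<close>.\<close>

definition isum :: "((nat \<Rightarrow> nat) \<Rightarrow> ('b \<Rightarrow>\<^sub>0 'k::field) \<Rightarrow> ('b \<Rightarrow>\<^sub>0 'k)) \<Rightarrow> ((nat \<Rightarrow> nat) \<Rightarrow> 'k)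
    \<Rightarrow> (nat \<Rightarrow> nat) set \<Rightarrow> ('b \<Rightarrow>\<^sub>0 'k) \<Rightarrow> ('b \<Rightarrow>\<^sub>0 'k)" where
  "isum \<rho> \<chi> G v = (\<Sum>p\<in>G. fscale (\<chi> p) (\<rho> p v))"

text \<open>The two instances are the relabelling of matchings and the left multiplication in the
  group algebra.\<close>

locale perm_rep =
  fixes \<rho> :: "(nat \<Rightarrow> nat) \<Rightarrow> ('b \<Rightarrow>\<^sub>0 'k::field_char_0) \<Rightarrow> ('b \<Rightarrow>\<^sub>0 'k)"
  assumes lin: "flin (\<rho> p)"
    and comp: "\<rho> (p \<circ> q) v = \<rho> p (\<rho> q v)"
    and ident: "\<rho> id v = v"
begin

lemmas rho_scale = flin_scale[OF lin] and rho_0 = flin_0[OF lin]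
  and rho_diff = flin_diff[OF lin] and rho_sum = flin_sum[OF lin] and rho_neg = flin_neg[OF lin]

lemma isum_lin: "flin (isum \<rho> \<chi> G)"
  unfolding isum_def by (intro flin_sum_fun flin_scale_fun lin)

lemma isum_mem:
  assumes "fv.subspace W" "\<And>p w. p \<in> G \<Longrightarrow> w \<in> W \<Longrightarrow> \<rho> p w \<in> W" "v \<in> W"
  shows "isum \<rho> \<chi> G v \<in> W"
  unfolding isum_def using assms by (intro fv.subspace_sum fv.subspace_scale) auto

lemma isum_right:
  assumes "lin_char X \<chi>" "t \<in> cperm X f"
  shows "isum \<rho> \<chi> (cperm X f) (\<rho> t v) = fscale (\<chi> t) (isum \<rho> \<chi> (cperm X f) v)"
proof -
  have "\<chi> p = \<chi> t * \<chi> (p \<circ> t)" if "p \<in> cperm X f" for p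
    using assms that unfolding lin_char_def by (metis cperm_permutes mult.left_commute mult.right_neutral)
  then have "isum \<rho> \<chi> (cperm X f) (\<rho> t v)
      = (\<Sum>p\<in>cperm X f. fscale (\<chi> t) (fscale (\<chi> (p \<circ> t)) (\<rho> (p \<circ> t) v)))"
    unfolding isum_def by (intro sum.cong) (auto simp: comp)
  also have "\<dots> = fscale (\<chi> t) (isum \<rho> \<chi> (cperm X f) v)"
    unfolding isum_def fv.scale_sum_right
    by (rule cperm_sum_right[OF assms(2), of "\<lambda>p. fscale (\<chi> t) (fscale (\<chi> p) (\<rho> p v))"])
  finally show ?thesis .
qed

lemma isum_left:
  assumes "lin_char X \<chi>" "t \<in> cperm X f"
  shows "\<rho> t (isum \<rho> \<chi> (cperm X f) v) = fscale (\<chi> t) (isum \<rho> \<chi> (cperm X f) v)"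
proof -
  have "\<chi> p = \<chi> t * \<chi> (t \<circ> p)" if "p \<in> cperm X f" for p
    using assms that unfolding lin_char_def by (metis cperm_permutes mult.assoc mult.left_neutral)
  then have "\<rho> t (isum \<rho> \<chi> (cperm X f) v)
      = (\<Sum>p\<in>cperm X f. fscale (\<chi> t) (fscale (\<chi> (t \<circ> p)) (\<rho> (t \<circ> p) v)))"
    unfolding isum_def rho_sum by (intro sum.cong) (auto simp: comp rho_scale)
  also have "\<dots> = fscale (\<chi> t) (isum \<rho> \<chi> (cperm X f) v)"
    unfolding isum_def fv.scale_sum_right
    by (rule cperm_sum_left[OF assms(2), of "\<lambda>p. fscale (\<chi> t) (fscale (\<chi> p) (\<rho> p v))"])
  finally show ?thesis .
qed

lemma isum_equivariant:
  assumes "\<And>p. p \<in> G \<Longrightarrow> \<rho> p v = fscale (\<chi> p) v" "\<And>p. \<chi> p * \<chi> p = 1"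
  shows "isum \<rho> \<chi> G v = fscale (of_nat (card G)) v"
proof -
  have "isum \<rho> \<chi> G v = (\<Sum>p\<in>G. v)"
    unfolding isum_def by (rule sum.cong) (auto simp: assms)
  also have "\<dots> = fscale (of_nat (card G)) v"
    by (rule poly_mapping_eqI) (simp add: lookup_sum)
  finally show ?thesis .
qed

text \<open>An element \<open>t\<close> that acts on \<open>v\<close> by minus the character makes the isotypic sum of \<open>v\<close> its
  own negative. All vanishing results for coloured matchings rest on this.\<close>

lemma isum_kill:
  assumes W: "fv.subspace W" "\<And>p w. p \<in> cperm X f \<Longrightarrow> w \<in> W \<Longrightarrow> \<rho> p w \<in> W"
    and \<chi>: "lin_char X \<chi>" and t: "t \<in> cperm X f" "\<rho> t v + fscale (\<chi> t) v \<in> W"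
  shows "isum \<rho> \<chi> (cperm X f) v \<in> W"
proof -
  let ?E = "isum \<rho> \<chi> (cperm X f)"
  have "?E (\<rho> t v + fscale (\<chi> t) v) = fscale (\<chi> t) (?E v + ?E v)"
    by (simp add: flin_add[OF isum_lin] flin_scale[OF isum_lin] isum_right[OF \<chi> t(1)] fv.scale_right_distrib)
  then have "fscale (\<chi> t) (?E v + ?E v) \<in> W"
    using isum_mem[OF W t(2)] by metis
  moreover have "\<chi> t \<noteq> 0" using \<chi> by (metis lin_char_def mult_zero_left zero_neq_one)
  ultimately show ?thesis using subspace_half[OF W(1)] subspace_scale_cancel[OF W(1)] by blast
qed

text \<open>A Garnir relation that exchanges one element. The group preserving the colouring in which
  \<open>z\<close> has been moved into the class \<open>i\<close> is a union of the cosets of the stabilizer of \<open>z\<close> represented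
  by the transpositions \<open>(x z)\<close>, with \<open>x\<close> in the enlarged class.\<close>

lemma garnir:
  assumes X: "finite X" "z \<in> X" "i \<noteq> f z" and W: "fv.subspace W"
    and v: "\<And>q. q \<in> cperm X f \<Longrightarrow> \<rho> q v = fscale (sg q) v"
    and E: "isum \<rho> sg (cperm X (f(z := i))) v \<in> W"
  shows "v - (\<Sum>x | x \<in> X \<and> f x = i. \<rho> (transpose x z) v) \<in> W"
proof -
  let ?f = "f(z := i)"
  define G where "G = cperm X ?f"
  define H where "H = {p \<in> G. p z = z}"
  define B where "B = {x \<in> X. f x = i}"
  have finG: "finite G" using X by (simp add: G_def)
  have finB: "finite B" "z \<notin> B" using X by (auto simp: B_def)
  have HC: "p \<in> cperm X f" if "p \<in> H" for p
  proof -
    have p: "p permutes X" "p z = z" "\<And>x. x \<in> X \<Longrightarrow> ?f (p x) = ?f x"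
      using that by (auto simp: H_def G_def cperm_def)
    have "f (p x) = f x" if "x \<in> X" for x
    proof (cases "x = z")
      case False
      then have "p x \<noteq> z" using p(1,2) permutes_inj by (metis injD)
      with p(3)[OF that] False show ?thesis by simp
    qed (use p in auto)
    with p(1) show ?thesis by (simp add: cperm_def)
  qed
  have img: "(\<lambda>p. p z) ` G \<subseteq> insert z B"
  proof clarify
    fix p assume p: "p \<in> G" "p z \<notin> B" 
    have "?f (p z) = i" "p z \<in> X"
      using p X cperm_colour[of p X ?f z] permutes_in_image[OF cperm_permutes, of p X ?f z] by (auto simp: G_def)
    with p show "p z = z" by (auto simp: B_def split: if_splits)
  qed
  (* The coset of H represented by the transposition (x z) consists of the elements that send z to x. *)
  have coset: "(\<Sum>p\<in>{p\<in>G. p z = x}. h p) = (\<Sum>q\<in>H. h (transpose x z \<circ> q))" if "x \<in> insert z B" for x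
    and h :: "(nat \<Rightarrow> nat) \<Rightarrow> ('b \<Rightarrow>\<^sub>0 'k)"
  proof -
    have t: "transpose x z \<in> G"
      unfolding G_def using that X by (intro cperm_transpose) (auto simp: B_def)
    show ?thesis
      by (rule sum.reindex_bij_witness[of _ "\<lambda>q. transpose x z \<circ> q" "\<lambda>q. transpose x z \<circ> q"])
        (use t in \<open>auto simp: H_def G_def comp_assoc[symmetric] intro!: cperm_comp\<close>)
  qed
  have tr: "transpose x z permutes X" if "x \<in> insert z B" for x
    using that X by (intro permutes_swap_id) (auto simp: B_def)
  have "isum \<rho> sg G v = (\<Sum>x\<in>insert z B. \<Sum>p\<in>{p\<in>G. p z = x}. fscale (sg p) (\<rho> p v))"
    unfolding isum_def by (rule sum.group[symmetric]) (use finG finB img in auto)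
  also have "\<dots> = (\<Sum>x\<in>insert z B. \<Sum>q\<in>H. fscale (sg (transpose x z)) (\<rho> (transpose x z) v))"
  proof (rule sum.cong[OF refl], subst coset, assumption, rule sum.cong[OF refl])
    fix x q assume x: "x \<in> insert z B" and q: "q \<in> H"
    have e: "(sg (transpose x z \<circ> q) :: 'k) = sg (transpose x z) * sg q"
      by (rule sg_compose[OF X(1) tr[OF x] cperm_permutes[OF HC[OF q]]])
    have "fscale (sg (transpose x z \<circ> q)) (\<rho> (transpose x z \<circ> q) v)
        = fscale (sg (transpose x z) * (sg q * sg q)) (\<rho> (transpose x z) v)"
      by (simp only: e v[OF HC[OF q]] comp rho_scale fv.scale_scale mult.assoc)
    then show "fscale (sg (transpose x z \<circ> q)) (\<rho> (transpose x z \<circ> q) v)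
        = fscale (sg (transpose x z)) (\<rho> (transpose x z) v)"
      by (simp only: sg_square mult_1_right)
  qed
  also have "\<dots> = fscale (of_nat (card H)) (\<Sum>x\<in>insert z B. fscale (sg (transpose x z)) (\<rho> (transpose x z) v))"
    unfolding fv.scale_sum_right
    by (intro sum.cong refl, rule poly_mapping_eqI) (simp add: lookup_sum)
  also have "(\<Sum>x\<in>insert z B. fscale (sg (transpose x z)) (\<rho> (transpose x z) v))
      = v + (\<Sum>x\<in>B. fscale (sg (transpose x z)) (\<rho> (transpose x z) v))"
    using finB by (simp add: ident[unfolded id_def] ident)
  also have "(\<Sum>x\<in>B. fscale (sg (transpose x z)) (\<rho> (transpose x z) v)) = - (\<Sum>x\<in>B. \<rho> (transpose x z) v)"
    unfolding sum_negf[symmetric]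
    by (intro sum.cong refl) (use finB in \<open>auto simp: sign_swap_id fscale_minus1\<close>)
  finally have "fscale (of_nat (card H)) (v - (\<Sum>x\<in>B. \<rho> (transpose x z) v)) \<in> W"
    using E by (simp add: G_def)
  moreover have "card H \<noteq> 0"
    using finG by (auto simp: H_def G_def card_eq_0_iff intro!: exI[of _ id])
  ultimately show ?thesis
    using subspace_scale_cancel[OF W] by (simp add: B_def)
qed

end

section \<open>Jucys-Murphy elements\<close>

text \<open>The colourings that are constant on the cycles of \<open>q\<close>. Their number is \<open>r\<close> to the number
  of cycles of \<open>q\<close>, the trace of \<open>q\<close> on a tensor power of an \<open>r\<close>-dimensional space.\<close>

definition inv_col :: "nat \<Rightarrow> nat set \<Rightarrow> (nat \<Rightarrow> nat) \<Rightarrow> (nat \<Rightarrow> nat) set" where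
  "inv_col r A q = {f \<in> A \<rightarrow>\<^sub>E {..<r}. \<forall>x\<in>A. f (q x) = f x}"

text \<open>A new cycle consisting of \<open>z\<close> alone is coloured independently of the others.\<close>

lemma card_inv_col_fix:
  assumes "z \<notin> A" "q permutes A"
  shows "card (inv_col r (insert z A) q) = r * card (inv_col r A q)"
proof -
  have qz: "q z = z" using assms by (rule permutes_not_in[rotated])
  have qA: "q x \<in> A \<longleftrightarrow> x \<in> A" for x using permutes_in_image[OF assms(2)] .
  have "bij_betw (\<lambda>(c, g). g(z := c)) ({..<r} \<times> inv_col r A q) (inv_col r (insert z A) q)"
  proof (rule bij_betw_byWitness[where f' = "\<lambda>f. (f z, f(z := undefined))"])
    show "\<forall>a\<in>{..<r} \<times> inv_col r A q. (\<lambda>f. (f z, f(z := undefined))) ((\<lambda>(c, g). g(z := c)) a) = a"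
      using assms(1) by (auto simp: inv_col_def PiE_def extensional_def fun_eq_iff)
    show "\<forall>a'\<in>inv_col r (insert z A) q. (\<lambda>(c, g). g(z := c)) (a' z, a'(z := undefined)) = a'"
      by auto
    show "(\<lambda>(c, g). g(z := c)) ` ({..<r} \<times> inv_col r A q) \<subseteq> inv_col r (insert z A) q"
    proof (rule image_subsetI)
      fix cg assume "cg \<in> {..<r} \<times> inv_col r A q"
      then obtain c g where cg: "cg = (c, g)" and c: "c \<in> {..<r}" and g: "g \<in> inv_col r A q" by auto
      have "g(z := c) \<in> insert z A \<rightarrow>\<^sub>E {..<r}"
        using c g by (auto simp: inv_col_def PiE_def extensional_def)
      moreover have "(g(z := c)) (q x) = (g(z := c)) x" if "x \<in> insert z A" for x
        using that g qz qA[of x] assms(1) by (auto simp: inv_col_def)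
      ultimately show "(case cg of (c, g) \<Rightarrow> g(z := c)) \<in> inv_col r (insert z A) q"
        by (simp add: inv_col_def cg)
    qed
    show "(\<lambda>f. (f z, f(z := undefined))) ` inv_col r (insert z A) q \<subseteq> {..<r} \<times> inv_col r A q"
    proof (rule image_subsetI)
      fix f assume f: "f \<in> inv_col r (insert z A) q"
      have "f z < r" using f by (auto simp: inv_col_def PiE_def)
      moreover have "f(z := undefined) \<in> A \<rightarrow>\<^sub>E {..<r}"
        using f assms(1) by (auto simp: inv_col_def PiE_def extensional_def)
      moreover have "(f(z := undefined)) (q x) = (f(z := undefined)) x" if "x \<in> A" for x
        using that f qA[of x] assms(1) by (auto simp: inv_col_def)
      ultimately show "(f z, f(z := undefined)) \<in> {..<r} \<times> inv_col r A q" by (simp add: inv_col_def)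
    qed
  qed
  from bij_betw_same_card[OF this] show ?thesis by (simp add: card_cartesian_product)
qed

text \<open>Here \<open>z\<close> joins the cycle of \<open>b\<close>, which determines its colour.\<close>

lemma card_inv_col_swap:
  assumes "z \<notin> A" "q permutes A" "b \<in> A"
  shows "card (inv_col r (insert z A) (transpose z b \<circ> q)) = card (inv_col r A q)"
proof -
  have qz: "q z = z" using assms by (metis permutes_not_in)
  have qA: "q x \<in> A \<longleftrightarrow> x \<in> A" for x using permutes_in_image[OF assms(2)] .
  have zb: "z \<noteq> b" using assms by auto
  have sw: "f (transpose z b u) = f u" if "f z = f b" for f :: "nat \<Rightarrow> nat" and u
    using that by (auto simp: transpose_def)
  have "bij_betw (\<lambda>g. g(z := g b)) (inv_col r A q) (inv_col r (insert z A) (transpose z b \<circ> q))"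
  proof (rule bij_betw_byWitness[where f' = "\<lambda>f. f(z := undefined)"])
    show "\<forall>a\<in>inv_col r A q. (a(z := a b))(z := undefined) = a"
      using assms(1) by (auto simp: inv_col_def PiE_def extensional_def fun_eq_iff)
    have "f b = f z" if "f \<in> inv_col r (insert z A) (transpose z b \<circ> q)" for f
      using that qz by (auto simp: inv_col_def)
    then show "\<forall>a'\<in>inv_col r (insert z A) (transpose z b \<circ> q).
        (a'(z := undefined))(z := (a'(z := undefined)) b) = a'"
      using zb by auto
    show "(\<lambda>g. g(z := g b)) ` inv_col r A q \<subseteq> inv_col r (insert z A) (transpose z b \<circ> q)"
    proof clarify
      fix g assume g: "g \<in> inv_col r A q"
      let ?g = "g(z := g b)"
      have "?g \<in> insert z A \<rightarrow>\<^sub>E {..<r}"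
        using g assms by (auto simp: inv_col_def PiE_def extensional_def)
      moreover have "?g (transpose z b (q x)) = ?g x" if "x \<in> insert z A" for x
      proof -
        have "?g (transpose z b (q x)) = ?g (q x)" using zb by (intro sw) auto
        also have "\<dots> = ?g x" using that g qz qA[of x] assms(1) by (auto simp: inv_col_def)
        finally show ?thesis .
      qed
      ultimately show "?g \<in> inv_col r (insert z A) (transpose z b \<circ> q)" by (simp add: inv_col_def)
    qed
    show "(\<lambda>f. f(z := undefined)) ` inv_col r (insert z A) (transpose z b \<circ> q) \<subseteq> inv_col r A q"
    proof clarify
      fix f assume f: "f \<in> inv_col r (insert z A) (transpose z b \<circ> q)"
      have fz: "f z = f b" using f qz by (auto simp: inv_col_def)
      have "f(z := undefined) \<in> A \<rightarrow>\<^sub>E {..<r}"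
        using f assms(1) by (auto simp: inv_col_def PiE_def extensional_def)
      moreover have "(f(z := undefined)) (q x) = (f(z := undefined)) x" if "x \<in> A" for x
        using that f qA[of x] assms(1) sw[OF fz, of "q x"] by (auto simp: inv_col_def)
      ultimately show "f(z := undefined) \<in> inv_col r A q" by (simp add: inv_col_def)
    qed
  qed
  from bij_betw_same_card[OF this] show ?thesis by simp
qed

context perm_rep begin

text \<open>By \<open>jm_insert\<close> this operator is the product of the factors \<open>r + J\<^sub>z\<close>, where the \<open>J\<^sub>z\<close> are
  the Jucys-Murphy elements for an ordering of \<open>A\<close>. By \<open>jm_expand\<close> it is also a sum of row
  symmetrizers. Comparing the two expressions shows that some row symmetrizer acts nontrivially
  wherever all the factors are invertible.\<close>

definition jm :: "nat \<Rightarrow> nat set \<Rightarrow> ('b \<Rightarrow>\<^sub>0 'k) \<Rightarrow> ('b \<Rightarrow>\<^sub>0 'k)" where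
  "jm r A v = (\<Sum>q | q permutes A. fscale (of_nat (card (inv_col r A q))) (\<rho> (inv q) v))"

lemma jm_lin: "flin (jm r A)"
  unfolding jm_def by (intro flin_sum_fun flin_scale_fun lin)

lemma jm_empty: "jm r {} v = v"
  by (simp add: jm_def inv_col_def ident)

text \<open>Each permutation of \<open>insert z A\<close> is uniquely \<open>(z b) q\<close> with \<open>q\<close> a permutation of \<open>A\<close>. The
  case \<open>b = z\<close> creates a new cycle and contributes the summand \<open>r\<close>; in the other cases the
  number of cycles does not change.\<close>

lemma jm_insert:
  assumes "finite A" "z \<notin> A"
  shows "jm r (insert z A) v = jm r A (fscale (of_nat r) v + (\<Sum>b\<in>A. \<rho> (transpose z b) v))"
proof -
  let ?N = "\<lambda>A q. of_nat (card (inv_col r A q))"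
  have inv: "\<rho> (inv (transpose z b \<circ> q)) v = \<rho> (inv q) (\<rho> (transpose z b) v)" if "q permutes A" for q b
    using that by (simp add: o_inv_distrib permutes_bij comp)
  have "jm r (insert z A) v = (\<Sum>b\<in>insert z A. \<Sum>q | q permutes A.
      fscale (?N (insert z A) (transpose z b \<circ> q)) (\<rho> (inv (transpose z b \<circ> q)) v))"
    unfolding jm_def by (rule sum_over_permutations_insert) (use assms in auto)
  also have "\<dots> = (\<Sum>q | q permutes A. fscale (?N (insert z A) (transpose z z \<circ> q)) (\<rho> (inv (transpose z z \<circ> q)) v))
     + (\<Sum>b\<in>A. \<Sum>q | q permutes A.
      fscale (?N (insert z A) (transpose z b \<circ> q)) (\<rho> (inv (transpose z b \<circ> q)) v))"
    using assms by (simp add: sum.insert)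
  also have "(\<Sum>q | q permutes A. fscale (?N (insert z A) (transpose z z \<circ> q)) (\<rho> (inv (transpose z z \<circ> q)) v))
      = jm r A (fscale (of_nat r) v)"
    unfolding jm_def using assms
    by (intro sum.cong refl) (simp add: card_inv_col_fix rho_scale mult.commute)
  also have "(\<Sum>b\<in>A. \<Sum>q | q permutes A.
      fscale (?N (insert z A) (transpose z b \<circ> q)) (\<rho> (inv (transpose z b \<circ> q)) v))
      = (\<Sum>b\<in>A. jm r A (\<rho> (transpose z b) v))"
    unfolding jm_def using assms
    by (intro sum.cong refl) (simp add: card_inv_col_swap inv)
  finally show ?thesis
    by (simp add: flin_add[OF jm_lin] flin_sum[OF jm_lin])
qed

lemma jm_mem:
  assumes "fv.subspace W" "\<And>p w. p permutes A \<Longrightarrow> w \<in> W \<Longrightarrow> \<rho> p w \<in> W" "v \<in> W"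
  shows "jm r A v \<in> W"
  unfolding jm_def using assms
  by (intro fv.subspace_sum fv.subspace_scale) (auto intro: permutes_inv)

text \<open>The pairs of a permutation \<open>q\<close> and a colouring fixed by \<open>q\<close> are counted by the colouring
  instead of by \<open>q\<close>.\<close>

lemma jm_expand:
  assumes "finite A"
  shows "jm r A v = (\<Sum>f\<in>A \<rightarrow>\<^sub>E {..<r}. isum \<rho> (\<lambda>_. 1) (cperm A f) v)"
proof -
  let ?F = "A \<rightarrow>\<^sub>E {..<r}" and ?Q = "{q. q permutes A}"
  have fin: "finite ?F" "finite ?Q" using assms by (auto intro: finite_PiE finite_permutations)
  have "jm r A v = (\<Sum>q\<in>?Q. \<Sum>f\<in>?F. if \<forall>x\<in>A. f (q x) = f x then \<rho> (inv q) v else 0)"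
    unfolding jm_def
  proof (rule sum.cong[OF refl])
    fix q
    have "(\<Sum>f\<in>?F. if \<forall>x\<in>A. f (q x) = f x then \<rho> (inv q) v else 0) = (\<Sum>f\<in>inv_col r A q. \<rho> (inv q) v)"
      unfolding inv_col_def using fin by (simp add: sum.If_cases Int_def)
    also have "\<dots> = fscale (of_nat (card (inv_col r A q))) (\<rho> (inv q) v)"
      by (rule poly_mapping_eqI) (simp add: lookup_sum)
    finally show "fscale (of_nat (card (inv_col r A q))) (\<rho> (inv q) v)
      = (\<Sum>f\<in>?F. if \<forall>x\<in>A. f (q x) = f x then \<rho> (inv q) v else 0)" by simp
  qed
  also have "\<dots> = (\<Sum>f\<in>?F. \<Sum>q\<in>?Q. if \<forall>x\<in>A. f (q x) = f x then \<rho> (inv q) v else 0)"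
    by (rule sum.swap)
  also have "\<dots> = (\<Sum>f\<in>?F. \<Sum>q\<in>cperm A f. \<rho> (inv q) v)"
  proof (rule sum.cong[OF refl])
    fix f :: "nat \<Rightarrow> nat"
    have "cperm A f = ?Q \<inter> {q. \<forall>x\<in>A. f (q x) = f x}" by (auto simp: cperm_def)
    then show "(\<Sum>q\<in>?Q. if \<forall>x\<in>A. f (q x) = f x then \<rho> (inv q) v else 0) = (\<Sum>q\<in>cperm A f. \<rho> (inv q) v)"
      using fin by (simp add: sum.If_cases)
  qed
  also have "\<dots> = (\<Sum>f\<in>?F. isum \<rho> (\<lambda>_. 1) (cperm A f) v)"
    using cperm_sum_inv[where h = "\<lambda>p. \<rho> p v"] by (simp add: isum_def)
  finally show ?thesis .
qed

text \<open>The elements of the grid, with column \<open>c\<close> and row \<open>d\<close>, are inserted column by column,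
  each column in the order of the rows. When \<open>z\<close> is inserted, each element \<open>b\<close> before it in its
  own column contributes \<open>-1\<close> to \<open>J\<^sub>z\<close>, because \<open>v\<close> is antisymmetric, and each earlier column
  contributes \<open>1\<close>, because of the Garnir relation \<open>G\<close>. Hence \<open>r + J\<^sub>z\<close> acts as \<open>r + c z\<close> minus
  the number of elements before \<open>z\<close> in its column. There are at most \<open>d z < r\<close> of these, so the
  scalar is a positive integer.\<close>

lemma jm_scalar:
  assumes X: "finite X" and inj: "inj_on (\<lambda>x. (c x, d x)) X" and d: "\<And>x. x \<in> X \<Longrightarrow> d x < r"
    and W: "fv.subspace W" "\<And>p w. p permutes X \<Longrightarrow> w \<in> W \<Longrightarrow> \<rho> p w \<in> W"
    and v: "\<And>q. q \<in> cperm X c \<Longrightarrow> \<rho> q v = fscale (sg q) v"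
    and G: "\<And>z i. z \<in> X \<Longrightarrow> i < c z \<Longrightarrow> v - (\<Sum>x | x \<in> X \<and> c x = i. \<rho> (transpose x z) v) \<in> W"
  shows "\<exists>s. s \<noteq> 0 \<and> jm r {x \<in> X. c x * r + d x < m} v - fscale s v \<in> W"
proof (induction m)
  case 0
  have "jm r {x \<in> X. c x * r + d x < 0} v - fscale 1 v \<in> W"
    using jm_empty[of r v] fv.subspace_0[OF W(1)] by simp
  then show ?case by (intro exI[of _ 1] conjI zero_neq_one[symmetric])
next
  case (Suc m)
  define A where "A = {x \<in> X. c x * r + d x < m}"
  obtain s where s: "s \<noteq> 0" "jm r A v - fscale s v \<in> W" using Suc unfolding A_def by blast
  show ?case
  proof (cases "\<exists>z\<in>X. c z * r + d z = m")
    case False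
    then have ne: "c x * r + d x \<noteq> m" if "x \<in> X" for x by (rule contrapos_nn) (rule bexI[OF _ that])
    have "{x \<in> X. c x * r + d x < Suc m} = A"
    proof (unfold A_def, rule Collect_cong)
      fix x
      show "(x \<in> X \<and> c x * r + d x < Suc m) = (x \<in> X \<and> c x * r + d x < m)"
        using ne[of x] less_Suc_eq[of "c x * r + d x" m] by blast
    qed
    with s show ?thesis by auto
  next
    case True
    then obtain z where z: "z \<in> X" "c z * r + d z = m" by auto
    have key: "c x = c z \<and> d x = d z \<or> c x < c z \<or> c x = c z \<and> d x < d z" if "x \<in> X" "c x * r + d x \<le> m" for x
    proof (rule ccontr)
      assume not: "\<not> ?thesis"
      then consider "c z < c x" | "c z = c x" "d z < d x" by linarith
      then show False
      proof cases
        case 1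
        then have "Suc (c z) * r \<le> c x * r" by (intro mult_le_mono1) simp
        then show False using d[OF z(1)] z(2) that(2) by simp
      qed (use z(2) that(2) in auto)
    qed
    have keyA: "x \<in> A \<longleftrightarrow> x \<in> X \<and> (c x < c z \<or> c x = c z \<and> d x < d z)" for x
    proof
      assume "x \<in> A"
      then show "x \<in> X \<and> (c x < c z \<or> c x = c z \<and> d x < d z)"
        using key[of x] z by (auto simp: A_def)
    next
      assume x: "x \<in> X \<and> (c x < c z \<or> c x = c z \<and> d x < d z)"
      then have "c x * r + d x < c z * r + d z"
      proof (elim conjE disjE)
        assume "c x < c z"
        then have "Suc (c x) * r \<le> c z * r" by (intro mult_le_mono1) simp
        then show ?thesis using d[of x] x by simp
      qed auto
      with x z show "x \<in> A" by (simp add: A_def)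
    qed
    have insA: "{x \<in> X. c x * r + d x < Suc m} = insert z A"
    proof (intro set_eqI iffI)
      fix x assume "x \<in> {x \<in> X. c x * r + d x < Suc m}"
      then have x: "x \<in> X" "c x * r + d x \<le> m" by auto
      from key[OF x] consider "c x = c z \<and> d x = d z" | "c x < c z \<or> c x = c z \<and> d x < d z" by blast
      then show "x \<in> insert z A"
      proof cases
        case 1
        then have "x = z" using inj_onD[OF inj, of x z] x(1) z(1) by simp
        then show ?thesis by simp
      next
        case 2
        then show ?thesis using keyA[of x] x(1) by simp
      qed
    next
      fix x assume "x \<in> insert z A"
      then show "x \<in> {x \<in> X. c x * r + d x < Suc m}" using z by (auto simp: A_def)
    qed
    define B where "B = {x \<in> X. c x = c z \<and> d x < d z}"
    have fin: "finite A" "finite B" "z \<notin> A" using X by (auto simp: A_def B_def z)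
    have split: "A = {x \<in> X. c x < c z} \<union> B" "{x \<in> X. c x < c z} \<inter> B = {}"
    proof -
      show "A = {x \<in> X. c x < c z} \<union> B"
        by (rule set_eqI) (simp only: keyA B_def Un_iff mem_Collect_eq, blast)
      show "{x \<in> X. c x < c z} \<inter> B = {}" by (auto simp only: B_def)
    qed
    have cardB: "card B \<le> d z"
    proof -
      have "inj_on d B" using inj by (auto simp: B_def inj_on_def)
      then have "card B \<le> card {..<d z}" by (rule card_inj_on_le) (auto simp: B_def)
      then show ?thesis by simp
    qed
    (* The elements before z in its own column. *)
    have tB: "\<rho> (transpose z b) v = - v" if "b \<in> B" for b
    proof -
      have "transpose z b \<in> cperm X c" using that z by (intro cperm_transpose) (auto simp: B_def)
      moreover have "z \<noteq> b" using that by (auto simp: B_def)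
      ultimately show ?thesis using v by (simp add: sign_swap_id fscale_minus1)
    qed
    have sumB: "(\<Sum>b\<in>B. \<rho> (transpose z b) v) = - fscale (of_nat (card B)) v"
    proof -
      have "(\<Sum>b\<in>B. \<rho> (transpose z b) v) = (\<Sum>b\<in>B. - v)"
        by (rule sum.cong) (auto simp: tB)
      also have "\<dots> = - fscale (of_nat (card B)) v"
        by (rule poly_mapping_eqI) (simp add: lookup_sum sum_negf)
      finally show ?thesis .
    qed
    (* The elements of the earlier columns: one Garnir relation for each column. *)
    have sumL: "fscale (of_nat (c z)) v - (\<Sum>b | b \<in> X \<and> c b < c z. \<rho> (transpose z b) v) \<in> W"
    proof -
      have "(\<Sum>b | b \<in> X \<and> c b < c z. \<rho> (transpose z b) v)
          = (\<Sum>i<c z. \<Sum>b | b \<in> {b \<in> X. c b < c z} \<and> c b = i. \<rho> (transpose z b) v)"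
        by (rule sum.group[symmetric]) (use X in auto)
      also have "\<dots> = (\<Sum>i<c z. \<Sum>b | b \<in> X \<and> c b = i. \<rho> (transpose b z) v)"
        by (intro sum.cong) (auto simp: transpose_commute)
      also have "fscale (of_nat (c z)) v - \<dots> = (\<Sum>i<c z. v - (\<Sum>b | b \<in> X \<and> c b = i. \<rho> (transpose b z) v))"
        by (rule poly_mapping_eqI) (simp add: lookup_sum lookup_minus sum_subtractf)
      also have "\<dots> \<in> W" by (intro fv.subspace_sum W(1) G z(1)) auto
      finally show ?thesis .
    qed
    define s' :: 'k where "s' = of_nat (r + c z - card B)"
    have s'0: "s' \<noteq> 0"
      unfolding s'_def of_nat_eq_0_iff using cardB d[OF z(1)] by linarith
    let ?u = "fscale (of_nat r) v + (\<Sum>b\<in>A. \<rho> (transpose z b) v)"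
    have s'eq: "s' = of_nat r + of_nat (c z) - of_nat (card B)"
      using cardB d[OF z(1)] by (simp add: s'_def of_nat_diff)
    have A_sum: "(\<Sum>b\<in>A. \<rho> (transpose z b) v)
       = (\<Sum>b | b \<in> X \<and> c b < c z. \<rho> (transpose z b) v) - fscale (of_nat (card B)) v"
      unfolding split(1) using X fin split(2) by (simp add: sum.union_disjoint sumB)
    have "fscale s' v - ?u \<in> W"
      using sumL by (simp add: A_sum s'eq fv.scale_left_distrib fv.scale_left_diff_distrib algebra_simps)
    then have "jm r A (fscale s' v - ?u) \<in> W"
    proof (rule jm_mem[OF W(1), rotated])
      fix p w assume "p permutes A" "w \<in> W"
      moreover have "A \<subseteq> X" by (auto simp: A_def)
      ultimately show "\<rho> p w \<in> W" using W(2) permutes_subset by blast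
    qed
    then have 1: "fscale s' (jm r A v) - jm r (insert z A) v \<in> W"
      by (simp add: jm_insert[OF fin(1,3)] flin_diff[OF jm_lin] flin_scale[OF jm_lin])
    have 2: "fscale s' (jm r A v - fscale s v) \<in> W" using s(2) W(1) by (intro fv.subspace_scale)
    have 3: "fscale s' (jm r A v - fscale s v) - (fscale s' (jm r A v) - jm r (insert z A) v)
        = jm r (insert z A) v - fscale (s' * s) v"
      by (simp add: fv.scale_right_diff_distrib)
    have "jm r (insert z A) v - fscale (s' * s) v \<in> W"
      using fv.subspace_diff[OF W(1) 2 1] unfolding 3 .
    then show ?thesis unfolding insA using s'0 s(1) by (intro exI[of _ "s' * s"]) auto
  qed
qed

lemma jm_nonzero:
  assumes X: "finite X" and inj: "inj_on (\<lambda>x. (c x, d x)) X" and d: "\<And>x. x \<in> X \<Longrightarrow> d x < r"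
    and W: "fv.subspace W" "\<And>p w. p permutes X \<Longrightarrow> w \<in> W \<Longrightarrow> \<rho> p w \<in> W"
    and v: "\<And>q. q \<in> cperm X c \<Longrightarrow> \<rho> q v = fscale (sg q) v" "v \<notin> W"
    and G: "\<And>z i. z \<in> X \<Longrightarrow> i < c z \<Longrightarrow> v - (\<Sum>x | x \<in> X \<and> c x = i. \<rho> (transpose x z) v) \<in> W"
  shows "\<exists>f\<in>X \<rightarrow>\<^sub>E {..<r}. isum \<rho> (\<lambda>_. 1) (cperm X f) v \<notin> W"
proof -
  define m where "m = Suc (Max (insert 0 ((\<lambda>x. c x * r + d x) ` X)))"
  have "{x \<in> X. c x * r + d x < m} = X"
    using X by (auto simp: m_def less_Suc_eq_le)
  then obtain s where s: "s \<noteq> 0" "jm r X v - fscale s v \<in> W"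
    using jm_scalar[OF X inj d W v(1) G, of m] by auto
  have "jm r X v \<notin> W"
  proof
    assume "jm r X v \<in> W"
    then have "fscale s v \<in> W" using fv.subspace_diff[OF W(1) _ s(2)] by fastforce
    then show False using subspace_scale_cancel[OF W(1) _ s(1)] v(2) by blast
  qed
  then show ?thesis
    unfolding jm_expand[OF X] using fv.subspace_sum[OF W(1)] by metis
qed

end

lemma equal_classes:
  assumes "finite X" "f ` X \<subseteq> {..<r}" "\<And>i. i < r \<Longrightarrow> card {x \<in> X. f x = i} \<le> l" "card X = r * l" "i < r"
  shows "card {x \<in> X. f x = i} = (l::nat)"
proof (rule ccontr)
  assume "\<not> ?thesis"
  then have lt: "card {x \<in> X. f x = i} < l" using assms(3,5) by force
  have "card X = (\<Sum>i<r. card {x \<in> X. f x = i})"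
    using sum.group[of X "{..<r}" f "\<lambda>_. 1 :: nat"] assms by simp
  also have "\<dots> < (\<Sum>i<r. l)"
    by (rule sum_strict_mono_ex1) (use assms lt in auto)
  finally show False using assms(4) by simp
qed

lemma balanced_colourings_conjugate:
  assumes X: "finite X" "card X = r * l"
    and f: "f ` X \<subseteq> {..<r}" "\<And>i. i < r \<Longrightarrow> card {x \<in> X. f x = i} \<le> l"
    and d: "d ` X \<subseteq> {..<r}" "\<And>i. i < r \<Longrightarrow> card {x \<in> X. d x = i} \<le> l"
  obtains t where "t permutes X" "\<And>x. x \<in> X \<Longrightarrow> f x = d (t x)"
proof -
  have "image_mset f (mset_set X) = image_mset d (mset_set X)"
  proof (rule multiset_eqI)
    fix i
    show "count (image_mset f (mset_set X)) i = count (image_mset d (mset_set X)) i"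
    proof (cases "i < r")
      case True
      show ?thesis
        using equal_classes[OF X(1) f X(2) True] equal_classes[OF X(1) d X(2) True] X(1)
        by (simp add: count_image_mset_eq_card_vimage vimage_def Int_def conj_commute)
    next
      case False
      then have "i \<notin> f ` X" "i \<notin> d ` X" using f d by auto
      then have "i \<notin># image_mset f (mset_set X)" "i \<notin># image_mset d (mset_set X)" using X(1) by auto
      then show ?thesis by (metis not_in_iff)
    qed
  qed
  from image_mset_eq_implies_permutes[OF X(1) this] show ?thesis using that by metis
qed

context perm_rep begin

lemma isum_conjugate:
  assumes "t permutes X" "\<And>x. x \<in> X \<Longrightarrow> f x = d (t x)"
  shows "isum \<rho> (\<lambda>_. 1) (cperm X f) v = \<rho> (inv t) (isum \<rho> (\<lambda>_. 1) (cperm X d) (\<rho> t v))"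
proof -
  note t = assms(1)
  have d: "d x = f (inv t x)" if "x \<in> X" for x
    using assms(2)[of "inv t x"] that permutes_inverses(1)[OF t] permutes_in_image[OF permutes_inv[OF t]] by simp
  have "(\<Sum>p\<in>cperm X f. \<rho> p v) = (\<Sum>p\<in>cperm X d. \<rho> (inv t \<circ> p \<circ> t) v)"
  proof (rule sum.reindex_bij_witness[of _ "\<lambda>p. inv t \<circ> p \<circ> t" "\<lambda>p. t \<circ> p \<circ> inv t"])
    show "inv t \<circ> (t \<circ> p \<circ> inv t) \<circ> t = p" "t \<circ> (inv t \<circ> p \<circ> t) \<circ> inv t = p" for p
      using permutes_inverses[OF t] by (auto simp: fun_eq_iff)
    then show "\<rho> (inv t \<circ> (t \<circ> p \<circ> inv t) \<circ> t) v = \<rho> p v" for p by simp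
    show "t \<circ> p \<circ> inv t \<in> cperm X d" if p: "p \<in> cperm X f" for p
    proof -
      have "d (t (p (inv t x))) = d x" if x: "x \<in> X" for x
      proof -
        have y: "inv t x \<in> X" using x permutes_in_image[OF permutes_inv[OF t]] by simp
        have "d (t (p (inv t x))) = f (p (inv t x))"
          using assms(2)[of "p (inv t x)"] y permutes_in_image[OF cperm_permutes[OF p]] by simp
        also have "\<dots> = f (inv t x)" using cperm_colour[OF p y] .
        finally show ?thesis using d[OF x] by simp
      qed
      then show ?thesis
        using cperm_permutes[OF p] t permutes_inv[OF t] by (simp add: cperm_def permutes_compose)
    qed
    show "inv t \<circ> p \<circ> t \<in> cperm X f" if p: "p \<in> cperm X d" for p
    proof -
      have "f (inv t (p (t x))) = f x" if x: "x \<in> X" for x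
      proof -
        have y: "t x \<in> X" using x permutes_in_image[OF t] by simp
        have "f (inv t (p (t x))) = d (p (t x))"
          using d[of "p (t x)"] y permutes_in_image[OF cperm_permutes[OF p]] by simp
        also have "\<dots> = d (t x)" using cperm_colour[OF p y] .
        finally show ?thesis using assms(2)[OF x] by simp
      qed
      then show ?thesis
        using cperm_permutes[OF p] t permutes_inv[OF t] by (simp add: cperm_def permutes_compose)
    qed
  qed
  then show ?thesis by (simp add: isum_def comp rho_sum)
qed

text \<open>By \<open>jm_nonzero\<close> the symmetrizer of some colouring with \<open>r\<close> colours does not annihilate
  \<open>v\<close>. The assumption \<open>R\<close> bounds the classes of this colouring by \<open>l\<close>; since there are \<open>r * l\<close>
  elements, all classes have exactly \<open>l\<close> elements, so that the colouring is a translate of the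
  colouring \<open>d\<close> by rows. The assumption \<open>G\<close> supplies the Garnir relations.\<close>

lemma row_symmetrizer_nonzero:
  assumes X: "finite X" "card X = r * l" and inj: "inj_on (\<lambda>x. (c x, d x)) X"
    and d: "\<And>x. x \<in> X \<Longrightarrow> d x < r" and c: "\<And>x. x \<in> X \<Longrightarrow> c x < l"
    and W: "fv.subspace W" "\<And>p w. p permutes X \<Longrightarrow> w \<in> W \<Longrightarrow> \<rho> p w \<in> W"
    and v: "\<And>q. q \<in> cperm X c \<Longrightarrow> \<rho> q v = fscale (sg q) v" "v \<notin> W"
    and G: "\<And>z i. z \<in> X \<Longrightarrow> i < c z \<Longrightarrow> isum \<rho> sg (cperm X (c(z := i))) v \<in> W"
    and R: "\<And>f i. f ` X \<subseteq> {..<r} \<Longrightarrow> i < r \<Longrightarrow> card {x \<in> X. f x = i} > l \<Longrightarrow>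
      isum \<rho> (\<lambda>_. 1) (cperm X f) v \<in> W"
  obtains t where "t permutes X" "isum \<rho> (\<lambda>_. 1) (cperm X d) (\<rho> t v) \<notin> W"
proof -
  have Gn: "v - (\<Sum>x | x \<in> X \<and> c x = i. \<rho> (transpose x z) v) \<in> W" if "z \<in> X" "i < c z" for z i
    by (rule garnir[OF X(1) that(1) _ W(1)]) (use v(1) G that in auto)
  have "\<exists>f\<in>X \<rightarrow>\<^sub>E {..<r}. isum \<rho> (\<lambda>_. 1) (cperm X f) v \<notin> W"
    by (rule jm_nonzero[where c = c and d = d]; fact X(1) inj d W v Gn)
  then obtain f where f: "f \<in> X \<rightarrow>\<^sub>E {..<r}" "isum \<rho> (\<lambda>_. 1) (cperm X f) v \<notin> W" ..
  have fX: "f ` X \<subseteq> {..<r}" using f(1) by (auto simp: PiE_def)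
  have fl: "card {x \<in> X. f x = i} \<le> l" if "i < r" for i
    using R[OF fX that] f(2) by force
  have "card {x \<in> X. d x = i} \<le> card {..<l}" for i
    by (rule card_inj_on_le[of c]) (use inj c in \<open>auto simp: inj_on_def\<close>)
  then have dl: "card {x \<in> X. d x = i} \<le> l" for i by simp
  have dX: "d ` X \<subseteq> {..<r}" using d by auto
  obtain t where t: "t permutes X" "\<And>x. x \<in> X \<Longrightarrow> f x = d (t x)"
    by (rule balanced_colourings_conjugate[OF X fX fl dX dl]) blast+
  have "isum \<rho> (\<lambda>_. 1) (cperm X d) (\<rho> t v) \<notin> W"
    using f(2) W(2) permutes_inv[OF t(1)] by (metis isum_conjugate[where d = d, OF t])
  with t(1) show ?thesis by (rule that)
qed

end

section \<open>Matchings modulo reordering of the edges\<close>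

lemma decomp2_iff:
  "Us \<in> decomp2 X \<longleftrightarrow> (\<forall>U\<in>set Us. card U = 2) \<and> distinct Us \<and>
     (\<forall>U\<in>set Us. \<forall>V\<in>set Us. U \<noteq> V \<longrightarrow> U \<inter> V = {}) \<and> \<Union> (set Us) = X"
proof -
  have "sorted_wrt (\<lambda>U V. U \<inter> V = {}) Us \<longleftrightarrow> distinct Us \<and> (\<forall>U\<in>set Us. \<forall>V\<in>set Us. U \<noteq> V \<longrightarrow> U \<inter> V = {})"
    if "\<forall>U\<in>set Us. card U = 2"
    using that
  proof (induction Us)
    case (Cons U Us)
    have IH: "sorted_wrt (\<lambda>U V. U \<inter> V = {}) Us \<longleftrightarrow>
        distinct Us \<and> (\<forall>U\<in>set Us. \<forall>V\<in>set Us. U \<noteq> V \<longrightarrow> U \<inter> V = {})"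
      using Cons.IH Cons.prems by simp
    have ne: "U \<noteq> {}" using Cons.prems by auto
    show ?case
    proof
      assume "sorted_wrt (\<lambda>U V. U \<inter> V = {}) (U # Us)"
      then have a: "\<And>V. V \<in> set Us \<Longrightarrow> U \<inter> V = {}" and d: "distinct Us"
        and b: "\<And>A B. A \<in> set Us \<Longrightarrow> B \<in> set Us \<Longrightarrow> A \<noteq> B \<Longrightarrow> A \<inter> B = {}"
        using IH by simp_all
      have "A \<inter> B = {}" if "A \<in> set (U # Us)" "B \<in> set (U # Us)" "A \<noteq> B" for A B
        using that a[of B] a[of A] b[of A B] by (cases "A = U"; cases "B = U") (simp_all add: Int_commute)
      moreover have "distinct (U # Us)" using d a[of U] ne by auto
      ultimately show "distinct (U # Us) \<and> (\<forall>A\<in>set (U # Us). \<forall>B\<in>set (U # Us). A \<noteq> B \<longrightarrow> A \<inter> B = {})"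
        by blast
    next
      assume r: "distinct (U # Us) \<and> (\<forall>A\<in>set (U # Us). \<forall>B\<in>set (U # Us). A \<noteq> B \<longrightarrow> A \<inter> B = {})"
      then have "U \<inter> V = {}" if "V \<in> set Us" for V
        using that by (metis distinct.simps(2) list.set_intros)
      with r show "sorted_wrt (\<lambda>U V. U \<inter> V = {}) (U # Us)" using IH by simp
    qed
  qed simp
  then show ?thesis by (auto simp: decomp2_def)
qed

lemma decomp2_blocks:
  assumes "Us \<in> decomp2 X"
  shows "U \<in> set Us \<Longrightarrow> card U = 2" "distinct Us"
    "U \<in> set Us \<Longrightarrow> V \<in> set Us \<Longrightarrow> x \<in> U \<Longrightarrow> x \<in> V \<Longrightarrow> U = V" "\<Union> (set Us) = X"
    "U \<in> set Us \<Longrightarrow> U \<subseteq> X"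
  using assms unfolding decomp2_iff by blast+

lemma decomp2_permute:
  "s permutes {..<length Us} \<Longrightarrow> permute_list s Us \<in> decomp2 X \<longleftrightarrow> Us \<in> decomp2 X"
  by (simp add: decomp2_iff)

lemma decomp2_image:
  assumes "Us \<in> decomp2 X" "inj_on p X" shows "map (image p) Us \<in> decomp2 (p ` X)"
proof -
  note D = decomp2_blocks[OF assms(1)]
  have inj: "inj_on (image p) (set Us)"
    using assms(2) D(5) by (intro inj_onI) (metis inj_on_image_eq_iff)
  have "card (p ` U) = 2" if "U \<in> set Us" for U
    using D(1,5)[OF that] assms(2) by (metis card_image inj_on_subset)
  moreover have "p ` U \<inter> p ` V = {}" if "U \<in> set Us" "V \<in> set Us" "p ` U \<noteq> p ` V" for U V
    using D(3)[OF that(1,2)] D(5)[OF that(1)] D(5)[OF that(2)] that(3) assms(2)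
    by (metis disjoint_iff inj_on_image_Int image_empty)
  ultimately show ?thesis
    using D(2,4) inj by (simp add: decomp2_iff distinct_map image_Union[symmetric])
qed

lemma finite_block: "Us \<in> decomp2 X \<Longrightarrow> U \<in> set Us \<Longrightarrow> finite U"
  using decomp2_blocks(1)[of Us X U] by (intro card_ge_0_finite) simp

lemma finite_decomp2: "Us \<in> decomp2 X \<Longrightarrow> finite X"
  using finite_block[of Us X] decomp2_blocks(4)[of Us X] by (metis List.finite_set finite_Union)

lemma card_decomp2:
  assumes "Us \<in> decomp2 X" shows "card X = 2 * length Us"
proof -
  note D = decomp2_blocks[OF assms]
  have "card X = card (\<Union> (set Us))" using D(4) by simp
  also have "\<dots> = sum card (set Us)"
  proof (rule card_Union_disjoint)
    show "pairwise disjnt (set Us)" using D(3) unfolding pairwise_def disjnt_iff by blast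
    show "finite U" if "U \<in> set Us" for U using finite_block[OF assms that] .
  qed
  also have "\<dots> = (\<Sum>U\<in>set Us. 2)" using D(1) by (intro sum.cong) auto
  also have "\<dots> = 2 * length Us" using distinct_card[OF D(2)] by simp
  finally show ?thesis .
qed

abbreviation edges :: "nat set list \<Rightarrow> 'k::field lam" where "edges Us \<equiv> Poly_Mapping.single Us 1"

lemma subspace_lam_rel: "fv.subspace (lam_rel X)"
  by (simp add: lam_rel_def)

lemma lam_rel_permute:
  "Us \<in> decomp2 X \<Longrightarrow> s permutes {..<length Us} \<Longrightarrow>
    edges (permute_list s Us) - Poly_Mapping.single Us (of_int (sign s)) \<in> lam_rel X"
  unfolding lam_rel_def by (rule fv.span_base) blast

lemma lam_rel_free_on: "lam_rel X \<subseteq> free_on (decomp2 X)"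
  unfolding lam_rel_def
  by (rule fv.span_minimal)
    (auto intro!: fv.subspace_diff subspace_free_on single_free_on simp: decomp2_permute)

lemma lam_rel_swap:
  assumes "Us \<in> decomp2 X" "i < length Us" "j < length Us" "i \<noteq> j"
  shows "edges (permute_list (transpose i j) Us) + edges Us \<in> lam_rel X"
  using lam_rel_permute[OF assms(1), of "transpose i j"] assms
  by (simp add: permutes_swap_id sign_swap_id single_uminus)

lemma permute_list_adjacent:
  "permute_list (transpose (length A) (Suc (length A))) (A @ [U, V] @ B) = A @ [V, U] @ B"
proof (rule nth_equalityI)
  fix i assume "i < length (permute_list (transpose (length A) (Suc (length A))) (A @ [U, V] @ B))"
  then show "permute_list (transpose (length A) (Suc (length A))) (A @ [U, V] @ B) ! i = (A @ [V, U] @ B) ! i"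
    by (subst permute_list_nth)
      (auto intro!: permutes_swap_id simp: transpose_def nth_append nth_Cons' split: if_splits)
qed simp

lemma lam_rel_adjacent:
  assumes "A @ [U, V] @ B \<in> decomp2 X"
  shows "edges (A @ [V, U] @ B) + edges (A @ [U, V] @ B) \<in> lam_rel X"
  using lam_rel_swap[OF assms, of "length A" "Suc (length A)"]
  unfolding permute_list_adjacent by simp

subsection \<open>Alternating functions of lists\<close>

lemma apply_adj_transps_append: "apply_adj_transps (xs @ ys) = apply_adj_transps xs \<circ> apply_adj_transps ys"
  by (induction xs) (simp_all add: comp_assoc)

lemma permutes_adjacent_transpositions:
  assumes "s permutes {..<n}"
  obtains xs where "s = apply_adj_transps xs" "\<And>x. x \<in> set xs \<Longrightarrow> Suc x < n"
proof -
  have "\<exists>xs. s = apply_adj_transps xs \<and> (\<forall>x\<in>set xs. Suc x < n)"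
    using assms finite_lessThan
  proof (induction rule: permutes_induct)
    case id
    show ?case by (rule exI[of _ "[]"]) (simp add: id_def)
  next
    case (swap a b p)
    then obtain xs where xs: "p = apply_adj_transps xs" "\<forall>x\<in>set xs. Suc x < n" by blast
    let ?ys = "adj_transp_seq (min a b) (max a b)"
    have ys: "apply_adj_transps ?ys = transpose a b" "set ?ys = {min a b..<max a b}"
      using swap(3) adj_transp_seq_correct[of "min a b" "max a b"] set_adj_transp_seq[of "min a b" "max a b"]
      by (auto simp: min_def max_def transpose_commute split: if_splits)
    have "transpose a b \<circ> p = apply_adj_transps (?ys @ xs)"
      unfolding apply_adj_transps_append ys(1) xs(1) ..
    moreover have "\<forall>x\<in>set (?ys @ xs). Suc x < n" using swap(1,2) xs(2) by (auto simp: ys(2))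
    ultimately show ?case by blast
  qed
  then show ?thesis using that by blast
qed

text \<open>Adjacent transpositions generate the symmetric group, so antisymmetry need only be
  checked for neighbours. The predicate \<open>Q\<close> carries the side conditions on the list through the
  induction.\<close>

lemma alternating_permute:
  fixes g :: "'a list \<Rightarrow> 'b \<Rightarrow>\<^sub>0 'k::field_char_0"
  assumes W: "fv.subspace W"
    and alt: "\<And>A U V B. Q (A @ [U, V] @ B) \<Longrightarrow> g (A @ [V, U] @ B) + g (A @ [U, V] @ B) \<in> W"
    and Q: "\<And>A U V B. Q (A @ [U, V] @ B) \<Longrightarrow> Q (A @ [V, U] @ B)"
    and "Q Us" "s permutes {..<length Us}"
  shows "g (permute_list s Us) - fscale (sg s) (g Us) \<in> W"
proof -
  obtain xs where xs: "s = apply_adj_transps xs" "\<And>x. x \<in> set xs \<Longrightarrow> Suc x < length Us"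
    using permutes_adjacent_transpositions[OF assms(5)] by blast
  have "g (permute_list (apply_adj_transps xs) Us) - fscale (sg (apply_adj_transps xs)) (g Us) \<in> W"
    using xs(2) assms(4)
  proof (induction xs arbitrary: Us)
    case Nil
    then show ?case using fv.subspace_0[OF W] by (simp add: id_def[symmetric])
  next
    case (Cons x xs)
    let ?t = "transpose x (x + 1)" and ?p = "apply_adj_transps xs"
    have x: "Suc x < length Us" using Cons.prems(1) by simp
    define A where "A = take x Us"
    define U where "U = Us ! x"
    define V where "V = Us ! Suc x"
    define B where "B = drop (Suc (Suc x)) Us"
    have Us: "Us = A @ [U, V] @ B" "length A = x"
      using x id_take_nth_drop[of x Us] Cons_nth_drop_Suc[of "Suc x" Us]
      by (auto simp: A_def U_def V_def B_def)
    have t: "permute_list ?t Us = A @ [V, U] @ B"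
      unfolding Us(1) using permute_list_adjacent[of A U V B] by (simp add: Us(2))
    have p: "?p permutes {..<length Us}"
      using Cons.prems(1) by (intro permutes_apply_adj_transps) fastforce
    have tp: "?t permutes {..<length Us}" using x by (intro permutes_swap_id) auto
    have sg: "(sg (?t \<circ> ?p) :: 'k) = - sg ?p"
      using sg_compose[OF finite_lessThan tp p] by (simp add: sign_swap_id)
    have 1: "g (permute_list ?p (A @ [V, U] @ B)) - fscale (sg ?p) (g (A @ [V, U] @ B)) \<in> W"
    proof (rule Cons.IH)
      show "Suc y < length (A @ [V, U] @ B)" if "y \<in> set xs" for y
        using Cons.prems(1)[of y] that Us(1) by (metis length_permute_list list.set_intros(2) t)
      show "Q (A @ [V, U] @ B)" using Q Cons.prems(2) Us(1) by metis
    qed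
    have 2: "fscale (sg ?p) (g (A @ [V, U] @ B) + g Us) \<in> W"
      using alt[of A U V B] Cons.prems(2) Us(1) by (intro fv.subspace_scale[OF W]) auto
    have "permute_list (?t \<circ> ?p) Us = permute_list ?p (A @ [V, U] @ B)"
      using permute_list_compose[OF p] t by metis
    then have eq: "g (permute_list (?t \<circ> ?p) Us) - fscale (sg (?t \<circ> ?p)) (g Us)
       = (g (permute_list ?p (A @ [V, U] @ B)) - fscale (sg ?p) (g (A @ [V, U] @ B)))
         + fscale (sg ?p) (g (A @ [V, U] @ B) + g Us)"
      unfolding sg by (simp add: fv.scale_right_distrib)
    show ?case
      unfolding apply_adj_transps_Cons eq by (rule fv.subspace_add[OF W 1 2])
  qed
  then show ?thesis by (simp add: xs(1))
qed

subsection \<open>Relabelling\<close>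

definition relab :: "(nat \<Rightarrow> nat) \<Rightarrow> 'k::field lam \<Rightarrow> 'k lam" where
  "relab p = lin_ext fscale (\<lambda>Us. edges (map (image p) Us))"

lemma relab_edges [simp]: "relab p (edges Us) = edges (map (image p) Us)"
  by (simp add: relab_def)

lemma flin_relab: "flin (relab p)"
  unfolding relab_def by (rule flin_lin_ext)

lemma relab_comp: "relab (p \<circ> q) v = relab p (relab q v)"
  by (rule flin_eq[OF flin_relab flin_comp[OF flin_relab flin_relab] _ free_on_UNIV])
    (simp add: image_comp comp_def)

lemma relab_id: "relab id v = v"
  by (rule flin_eq[OF flin_relab flin_id _ free_on_UNIV]) simp

interpretation R: perm_rep "relab :: (nat \<Rightarrow> nat) \<Rightarrow> 'k::field_char_0 lam \<Rightarrow> 'k lam"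
  by (rule perm_rep.intro) (fact flin_relab relab_comp relab_id)+

lemma relab_cong:
  assumes "\<And>x. x \<in> X \<Longrightarrow> p x = q x" "v \<in> free_on (decomp2 X)"
  shows "relab p v = relab q v"
proof (rule flin_eq[OF flin_relab flin_relab _ assms(2)])
  fix Us assume "Us \<in> decomp2 X"
  then have "map (image p) Us = map (image q) Us"
    using decomp2_blocks(5)[of Us X] assms(1) by (intro map_cong image_cong) auto
  then show "relab p (edges Us) = relab q (edges Us)" by (simp only: relab_edges)
qed

lemma relab_free_on:
  assumes "inj_on p X" "v \<in> free_on (decomp2 X)" shows "relab p v \<in> free_on (decomp2 (p ` X))"
  by (rule flin_mem[OF flin_relab subspace_free_on _ assms(2)])
    (use assms(1) in \<open>auto intro!: single_free_on decomp2_image\<close>)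

lemma relab_lam_rel:
  fixes w :: "'k::field_char_0 lam"
  assumes "inj_on p X" "w \<in> lam_rel X" shows "relab p w \<in> lam_rel (p ` X)"
proof (rule flin_span_mem[OF flin_relab subspace_lam_rel _ assms(2)[unfolded lam_rel_def]], clarify)
  fix s and Us :: "nat set list"
  assume Us: "Us \<in> decomp2 X" and s: "s permutes {..<length Us}"
  have "relab p (edges (permute_list s Us) - Poly_Mapping.single Us (of_int (sign s)))
      = edges (permute_list s (map (image p) Us)) - Poly_Mapping.single (map (image p) Us) (of_int (sign s) :: 'k)"
    by (simp add: R.rho_diff permute_list_map[OF s]) (simp add: relab_def fscale_single)
  also have "\<dots> \<in> lam_rel (p ` X)"
    using decomp2_image[OF Us assms(1)] s by (intro lam_rel_permute) auto
  finally show "relab p (edges (permute_list s Us) - Poly_Mapping.single Us (of_int (sign s) :: 'k)) \<in> lam_rel (p ` X)" .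
qed

lemma relab_lam_rel_permutes:
  fixes w :: "'k::field_char_0 lam"
  shows "p permutes X \<Longrightarrow> w \<in> lam_rel X \<Longrightarrow> relab p w \<in> lam_rel X"
  using relab_lam_rel[of p X w] permutes_image permutes_inj_on by fastforce

subsection \<open>Contraction\<close>

lemma block_of_eq:
  assumes "Us \<in> decomp2 X" "i < length Us" "u \<in> Us ! i" shows "block_of Us u = i"
  unfolding block_of_def
proof (rule the_equality)
  fix j assume "j < length Us \<and> u \<in> Us ! j"
  then show "j = i"
    using decomp2_blocks(2,3)[OF assms(1)] assms(2,3) nth_eq_iff_index_eq nth_mem by metis
qed (use assms in simp)

lemma block_of:
  assumes "Us \<in> decomp2 X" "u \<in> X"
  shows "block_of Us u < length Us" "u \<in> Us ! block_of Us u"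
proof -
  obtain i where "i < length Us" "u \<in> Us ! i"
    using decomp2_blocks(4)[OF assms(1)] assms(2) by (metis UnionE in_set_conv_nth)
  with block_of_eq[OF assms(1) this] show "block_of Us u < length Us" "u \<in> Us ! block_of Us u" by auto
qed

lemma contract_same: "block_of Us u = block_of Us v \<Longrightarrow> contract u v Us = 0"
  by (simp add: contract_def)

lemma contract_diff: "block_of Us u = i \<Longrightarrow> block_of Us v = j \<Longrightarrow> i \<noteq> j \<Longrightarrow>
   contract u v Us = Poly_Mapping.single (nths Us (- {i, j}) @ [(Us ! i \<union> Us ! j) - {u, v}])
            ((-1) ^ (if i < j then i + j + 1 else i + j))"
  by (simp add: contract_def Let_def)

lemma nths_cong: "nths xs A = nths xs {i \<in> A. i < length xs}"
proof -
  have "filter (\<lambda>p. snd p \<in> A) (zip xs [0..<length xs])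
      = filter (\<lambda>p. snd p \<in> {i \<in> A. i < length xs}) (zip xs [0..<length xs])"
  proof (rule filter_cong[OF refl])
    fix p assume "p \<in> set (zip xs [0..<length xs])"
    then have "snd p \<in> set [0..<length xs]" by (metis prod.collapse set_zip_rightD)
    then show "(snd p \<in> A) = (snd p \<in> {i \<in> A. i < length xs})" by simp
  qed
  then show ?thesis by (simp only: nths_def)
qed

lemma nths_filter_blocks:
  assumes "Us \<in> decomp2 X" "u \<in> X" "v \<in> X"
  shows "nths Us (- {block_of Us u, block_of Us v}) = filter (\<lambda>U. u \<notin> U \<and> v \<notin> U) Us"
proof -
  have mem: "w \<notin> Us ! i \<longleftrightarrow> i \<noteq> block_of Us w" if "w \<in> X" "i < length Us" for w i
    using block_of_eq[OF assms(1) that(2)] block_of(2)[OF assms(1) that(1)] by blast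
  have "{i. i < length Us \<and> u \<notin> Us ! i \<and> v \<notin> Us ! i} = {i \<in> - {block_of Us u, block_of Us v}. i < length Us}"
    using mem[OF assms(2)] mem[OF assms(3)] by blast
  then show ?thesis
    unfolding filter_eq_nths using nths_cong[of Us "- {block_of Us u, block_of Us v}"] by simp
qed

lemma contract_in_decomp2:
  assumes D: "Us \<in> decomp2 X" and u: "u \<in> U" "U \<in> set Us" and v: "v \<in> V" "V \<in> set Us" and "U \<noteq> V"
  shows "filter (\<lambda>U. u \<notin> U \<and> v \<notin> U) Us @ [U \<union> V - {u, v}] \<in> decomp2 (X - {u, v})"
proof -
  note B = decomp2_blocks[OF D]
  have dis: "U \<inter> V = {}" using B(3)[OF u(2) v(2)] assms(6) by blast
  have fin: "finite U" "finite V" using finite_block[OF D] u v by auto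
  have card: "card (U \<union> V - {u, v}) = 2"
    using card_Un_disjoint[OF fin dis] B(1)[OF u(2)] B(1)[OF v(2)] fin dis u v
    by (subst card_Diff_subset) (auto simp: card_insert_if)
  have other: "W \<inter> (U \<union> V) = {}" if "W \<in> set Us" "u \<notin> W" "v \<notin> W" for W
    using that B(3)[OF that(1) u(2)] B(3)[OF that(1) v(2)] u v by blast
  have un: "\<Union> (set (filter (\<lambda>U. u \<notin> U \<and> v \<notin> U) Us)) \<union> (U \<union> V - {u, v}) = X - {u, v}"
  proof (intro set_eqI iffI)
    fix x assume "x \<in> \<Union> (set (filter (\<lambda>U. u \<notin> U \<and> v \<notin> U) Us)) \<union> (U \<union> V - {u, v})"
    then show "x \<in> X - {u, v}" using B(5)[of U] B(5)[of V] B(5) u v by auto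
  next
    fix x assume x: "x \<in> X - {u, v}"
    then obtain W where W: "W \<in> set Us" "x \<in> W" using B(4) by blast
    have "W = U \<or> W = V \<or> u \<notin> W \<and> v \<notin> W"
      using B(3)[OF W(1) u(2)] B(3)[OF W(1) v(2)] u v by blast
    with x W show "x \<in> \<Union> (set (filter (\<lambda>U. u \<notin> U \<and> v \<notin> U) Us)) \<union> (U \<union> V - {u, v})" by auto
  qed
  have ne: "U \<union> V - {u, v} \<noteq> {}" using card by (metis card.empty zero_neq_numeral)
  have nm: "U \<union> V - {u, v} \<notin> set (filter (\<lambda>U. u \<notin> U \<and> v \<notin> U) Us)"
  proof
    assume "U \<union> V - {u, v} \<in> set (filter (\<lambda>U. u \<notin> U \<and> v \<notin> U) Us)"
    then have "(U \<union> V - {u, v}) \<inter> (U \<union> V) = {}" by (intro other) auto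
    with ne show False by blast
  qed
  show ?thesis
    unfolding decomp2_iff
  proof (intro conjI)
    show "\<forall>U\<in>set (filter (\<lambda>U. u \<notin> U \<and> v \<notin> U) Us @ [U \<union> V - {u, v}]). card U = 2"
      using B(1) card by auto
    show "distinct (filter (\<lambda>U. u \<notin> U \<and> v \<notin> U) Us @ [U \<union> V - {u, v}])"
      using B(2) nm by simp
    show "\<Union> (set (filter (\<lambda>U. u \<notin> U \<and> v \<notin> U) Us @ [U \<union> V - {u, v}])) = X - {u, v}"
      using un by auto
    have "W \<inter> W' = {}" if "W \<in> set (filter (\<lambda>U. u \<notin> U \<and> v \<notin> U) Us)" "W' \<in> set (filter (\<lambda>U. u \<notin> U \<and> v \<notin> U) Us)" "W \<noteq> W'" for W W'
      using that B(3)[of W W'] by auto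
    moreover have "W \<inter> (U \<union> V - {u, v}) = {}" if "W \<in> set (filter (\<lambda>U. u \<notin> U \<and> v \<notin> U) Us)" for W
      using that other[of W] by auto
    ultimately show "\<forall>W\<in>set (filter (\<lambda>U. u \<notin> U \<and> v \<notin> U) Us @ [U \<union> V - {u, v}]).
       \<forall>W'\<in>set (filter (\<lambda>U. u \<notin> U \<and> v \<notin> U) Us @ [U \<union> V - {u, v}]). W \<noteq> W' \<longrightarrow> W \<inter> W' = {}"
      unfolding set_append ball_Un by (simp add: Int_commute)
  qed
qed

lemma contract_filter:
  assumes "Us \<in> decomp2 X" "u \<in> X" "v \<in> X" "block_of Us u = i" "block_of Us v = j" "i \<noteq> j"
  shows "contract u v Us = fscale ((-1) ^ (if i < j then i + j + 1 else i + j))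
     (edges (filter (\<lambda>U. u \<notin> U \<and> v \<notin> U) Us @ [(Us ! i \<union> Us ! j) - {u, v}]))"
  using contract_diff[OF assms(4,5,6)] nths_filter_blocks[OF assms(1,2,3)] assms(4,5)
  by (simp add: fscale_single)

lemma contract_free_on:
  assumes "Us \<in> decomp2 X" "u \<in> X" "v \<in> X"
  shows "contract u v Us \<in> free_on (decomp2 (X - {u, v}))"
proof (cases "block_of Us u = block_of Us v")
  case True
  then show ?thesis using contract_same[OF True] fv.subspace_0[OF subspace_free_on] by metis
next
  case False
  note B = block_of[OF assms(1,2)] block_of[OF assms(1,3)]
  have "Us ! block_of Us u \<noteq> Us ! block_of Us v"
    using False B(1,3) nth_eq_iff_index_eq[OF decomp2_blocks(2)[OF assms(1)]] by blast
  then show ?thesis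
    unfolding contract_filter[OF assms refl refl False]
    using contract_in_decomp2[OF assms(1) B(2) nth_mem[OF B(1)] B(4) nth_mem[OF B(3)]]
    by (intro fv.subspace_scale[OF subspace_free_on] single_free_on)
qed

lemma contract_skew: "contract v u Us = - contract u v Us"
proof (cases "block_of Us u = block_of Us v")
  case True
  then show ?thesis by (simp add: contract_same)
next
  case False
  let ?i = "block_of Us u" and ?j = "block_of Us v"
  have sets: "{?j, ?i} = {?i, ?j}" "Us ! ?j \<union> Us ! ?i - {v, u} = Us ! ?i \<union> Us ! ?j - {u, v}" by auto
  show ?thesis
    unfolding contract_diff[OF refl refl False] contract_diff[OF refl refl False[symmetric]] sets
      single_uminus[symmetric]
    using False by (intro arg_cong[where f = "Poly_Mapping.single _"]) (auto simp: add.commute)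
qed

lemma contract_image:
  fixes p :: "nat \<Rightarrow> nat"
  assumes "Us \<in> decomp2 X" "inj_on p X" "u \<in> X" "v \<in> X"
  shows "contract (p u) (p v) (map (image p) Us) = (relab p (contract u v Us) :: 'k::field_char_0 lam)"
proof -
  note D = decomp2_image[OF assms(1,2)]
  have b: "block_of (map (image p) Us) (p w) = block_of Us w" if "w \<in> X" for w
    using block_of[OF assms(1) that] by (intro block_of_eq[OF D]) auto
  show ?thesis
  proof (cases "block_of Us u = block_of Us v")
    case True
    then show ?thesis using b assms(3,4) by (simp add: contract_same R.rho_0)
  next
    case False
    let ?i = "block_of Us u" and ?j = "block_of Us v"
    have ij: "?i < length Us" "?j < length Us" using block_of[OF assms(1)] assms(3,4) by auto
    have sub: "Us ! ?i \<union> Us ! ?j \<subseteq> X" using decomp2_blocks(5)[OF assms(1)] ij by simp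
    have "p ` (Us ! ?i \<union> Us ! ?j) - p ` {u, v} = p ` (Us ! ?i \<union> Us ! ?j - {u, v})"
      using sub assms by (intro inj_on_image_set_diff[symmetric, OF assms(2)]) auto
    then have "map (image p) Us ! ?i \<union> map (image p) Us ! ?j - {p u, p v} = p ` (Us ! ?i \<union> Us ! ?j - {u, v})"
      using ij by (simp add: image_Un)
    then show ?thesis
      unfolding contract_diff[OF b[OF assms(3)] b[OF assms(4)] False] contract_diff[OF refl refl False]
      by (simp add: nths_map relab_def fscale_single)
  qed
qed

lemma decomp2_adjacent: "A @ [V, U] @ B \<in> decomp2 X \<longleftrightarrow> A @ [U, V] @ B \<in> decomp2 X"
proof -
  have "transpose (length A) (Suc (length A)) permutes {..<length (A @ [U, V] @ B)}"
    by (rule permutes_swap_id) auto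
  from decomp2_permute[OF this, of X] show ?thesis by (simp only: permute_list_adjacent)
qed

text \<open>The sign in the definition of the contraction is what makes it alternating in the edges.\<close>

lemma contract_adjacent:
  fixes u v :: nat
  assumes D: "A @ [U, V] @ B \<in> decomp2 X" and u: "u \<in> X" and v: "v \<in> X"
  shows "contract u v (A @ [V, U] @ B) + (contract u v (A @ [U, V] @ B) :: 'k::field lam) \<in> lam_rel (X - {u, v})"
proof -
  let ?L = "A @ [U, V] @ B" and ?M = "A @ [V, U] @ B" and ?k = "length A"
  have DM: "?M \<in> decomp2 X" using D by (simp only: decomp2_adjacent)
  have nth: "?M ! i = ?L ! transpose ?k (Suc ?k) i" if "i < length ?L" for i
  proof -
    have "transpose ?k (Suc ?k) permutes {..<length ?L}" by (rule permutes_swap_id) auto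
    from permute_list_nth[OF this that] show ?thesis by (simp only: permute_list_adjacent)
  qed
  have tl: "transpose ?k (Suc ?k) i < length ?L" if "i < length ?L" for i
    using that by (auto simp: transpose_def)
  have bM: "block_of ?M w = transpose ?k (Suc ?k) (block_of ?L w)" if "w \<in> X" for w
  proof (rule block_of_eq[OF DM])
    note b = block_of[OF D that]
    show "transpose ?k (Suc ?k) (block_of ?L w) < length ?M" using tl[OF b(1)] by simp
    have "?M ! transpose ?k (Suc ?k) (block_of ?L w) = ?L ! block_of ?L w"
      using nth[OF tl[OF b(1)]] by simp
    then show "w \<in> ?M ! transpose ?k (Suc ?k) (block_of ?L w)" using b(2) by metis
  qed
  have nthM: "?M ! block_of ?M w = ?L ! block_of ?L w" if "w \<in> X" for w
    unfolding bM[OF that] using nth[OF tl[OF block_of(1)[OF D that]]] by simp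
  show ?thesis
  proof (cases "block_of ?L u = block_of ?L v")
    case True
    then have "block_of ?M u = block_of ?M v" using bM u v by simp
    then show ?thesis
      unfolding contract_same[OF True] using contract_same fv.subspace_0[OF subspace_lam_rel] by (metis add_0)
  next
    case False
    define i where "i = block_of ?L u"
    define j where "j = block_of ?L v"
    define i' where "i' = transpose ?k (Suc ?k) i"
    define j' where "j' = transpose ?k (Suc ?k) j"
    have ij: "i \<noteq> j" using False by (simp add: i_def j_def)
    then have ij': "i' \<noteq> j'" unfolding i'_def j'_def by (metis transpose_involutory)
    have bi: "block_of ?M u = i'" "block_of ?M v = j'" using bM u v by (simp_all add: i_def j_def i'_def j'_def)
    define P where "P = (\<lambda>U. u \<notin> U \<and> v \<notin> U)"
    define Z where "Z = ?L ! i \<union> ?L ! j - {u, v}"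
    have ZM: "?M ! i' \<union> ?M ! j' - {u, v} = Z"
      using nthM[OF u] nthM[OF v] by (simp only: bi Z_def i_def j_def)
    define s where "s i j = (-1 :: 'k) ^ (if i < j then i + j + 1 else i + j)" for i j :: nat
    have cL: "contract u v ?L = fscale (s i j) (edges (filter P ?L @ [Z]))"
      using contract_filter[OF D u v i_def[symmetric] j_def[symmetric] ij] by (simp only: s_def P_def Z_def)
    have cM: "contract u v ?M = fscale (s i' j') (edges (filter P ?M @ [Z]))"
      using contract_filter[OF DM u v bi ij'] by (simp only: s_def P_def ZM)
    have lt: "?k < length ?L" "Suc ?k < length ?L" by auto
    have kk: "?L ! ?k = U" "?L ! Suc ?k = V" by (simp_all add: nth_append)
    have mem: "w \<in> ?L ! m \<longleftrightarrow> block_of ?L w = m" if "w \<in> X" "m < length ?L" for w m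
      using block_of_eq[OF D that(2)] block_of(2)[OF D that(1)] by blast
    have PU: "P U \<longleftrightarrow> i \<noteq> ?k \<and> j \<noteq> ?k" and PV: "P V \<longleftrightarrow> i \<noteq> Suc ?k \<and> j \<noteq> Suc ?k"
      using mem[OF u lt(1)] mem[OF v lt(1)] mem[OF u lt(2)] mem[OF v lt(2)]
      unfolding kk by (auto simp: P_def i_def j_def)
    (* If neither of the exchanged edges is contracted, they are still exchanged in the result. Otherwise
       the result is the same list, and the index of a contracted edge changes by one. *)
    show ?thesis
    proof (cases "P U \<and> P V")
      case True
      then have "i' = i" "j' = j" using PU PV by (auto simp: i'_def j'_def transpose_def)
      moreover have fL: "filter P ?L @ [Z] = filter P A @ [U, V] @ (filter P B @ [Z])"
        and fM: "filter P ?M @ [Z] = filter P A @ [V, U] @ (filter P B @ [Z])" using True by simp_all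
      moreover have "filter P ?L @ [Z] \<in> decomp2 (X - {u, v})"
      proof -
        note b = block_of[OF D u] block_of[OF D v]
        have "?L ! i \<noteq> ?L ! j"
          using ij b nth_eq_iff_index_eq[OF decomp2_blocks(2)[OF D]] by (simp add: i_def j_def)
        then show ?thesis
          using contract_in_decomp2[OF D b(2) nth_mem[OF b(1)] b(4) nth_mem[OF b(3)]]
          by (simp add: P_def Z_def i_def j_def)
      qed
      ultimately have "fscale (s i j) (edges (filter P ?M @ [Z]) + edges (filter P ?L @ [Z])) \<in> lam_rel (X - {u, v})"
        unfolding fL fM by (intro fv.subspace_scale[OF subspace_lam_rel] lam_rel_adjacent) simp
      then show ?thesis
        unfolding cL cM \<open>i' = i\<close> \<open>j' = j\<close> by (simp only: fv.scale_right_distrib)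
    next
      case False
      then have f: "filter P ?M = filter P ?L" by auto
      have "i = ?k \<or> j = ?k \<or> i = Suc ?k \<or> j = Suc ?k" using False PU PV by blast
      then have "s i' j' = - s i j"
        using ij unfolding s_def i'_def j'_def
        by (auto simp: transpose_def)
      then show ?thesis
        unfolding cL cM f using fv.subspace_0[OF subspace_lam_rel] by simp
    qed
  qed
qed

definition contraction :: "nat \<Rightarrow> nat \<Rightarrow> 'k::field lam \<Rightarrow> 'k lam" where
  "contraction u v = lin_ext fscale (contract u v)"

lemma flin_contraction: "flin (contraction u v)"
  unfolding contraction_def by (rule flin_lin_ext)

lemma contraction_edges [simp]: "contraction u v (edges Us) = contract u v Us"
  by (simp add: contraction_def)

lemma contraction_free_on:
  assumes "w \<in> free_on (decomp2 X)" "u \<in> X" "v \<in> X"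
  shows "contraction u v w \<in> free_on (decomp2 (X - {u, v}))"
  by (rule flin_mem[OF flin_contraction subspace_free_on _ assms(1)]) (simp add: contract_free_on assms)

lemma contraction_skew: "contraction v u w = - contraction u v w"
proof -
  have "flin (\<lambda>w. - contraction u v w)" using flin_scale_fun[OF flin_contraction, of "-1" u v] by (simp add: fscale_minus1)
  moreover have "contraction v u (edges Us) = - contraction u v (edges Us)" for Us
    unfolding contraction_edges by (rule contract_skew)
  ultimately show ?thesis using flin_eq[OF flin_contraction _ _ free_on_UNIV] by blast
qed

lemma contraction_relab:
  fixes w :: "'k::field_char_0 lam"
  assumes "w \<in> free_on (decomp2 X)" "inj_on p X" "u \<in> X" "v \<in> X"
  shows "contraction (p u) (p v) (relab p w) = relab p (contraction u v w)"
  by (rule flin_eq[OF flin_comp[OF flin_contraction flin_relab] flin_comp[OF flin_relab flin_contraction] _ assms(1)])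
    (simp add: contract_image[OF _ assms(2-4)])

lemma contraction_lam_rel:
  fixes w :: "'k::field_char_0 lam"
  assumes "w \<in> lam_rel X" "u \<in> X" "v \<in> X"
  shows "contraction u v w \<in> lam_rel (X - {u, v})"
proof (rule flin_span_mem[OF flin_contraction subspace_lam_rel _ assms(1)[unfolded lam_rel_def]], clarify)
  fix s and Us :: "nat set list"
  assume Us: "Us \<in> decomp2 X" and s: "s permutes {..<length Us}"
  have "contract u v (permute_list s Us) - fscale (sg s) (contract u v Us) \<in> (lam_rel (X - {u, v}) :: 'k lam set)"
  proof (rule alternating_permute[OF subspace_lam_rel _ _ _ s, of "\<lambda>Us. Us \<in> decomp2 X"])
    show "A @ [V, U] @ B \<in> decomp2 X" if "A @ [U, V] @ B \<in> decomp2 X" for A U V B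
      using that by (simp only: decomp2_adjacent)
  qed (use contract_adjacent assms Us in auto)
  moreover have "contraction u v (edges (permute_list s Us) - Poly_Mapping.single Us (of_int (sign s) :: 'k))
      = contract u v (permute_list s Us) - fscale (sg s) (contract u v Us)"
    by (simp add: flin_diff[OF flin_contraction]) (simp add: contraction_def)
  ultimately show "contraction u v (edges (permute_list s Us) - Poly_Mapping.single Us (of_int (sign s) :: 'k))
     \<in> lam_rel (X - {u, v})" by simp
qed

section \<open>Colourings that annihilate matchings\<close>

definition edge_at :: "nat set list \<Rightarrow> nat \<Rightarrow> nat set" where "edge_at Us x = Us ! block_of Us x"

lemma edge_at:
  assumes "Us \<in> decomp2 X"
  shows "x \<in> X \<Longrightarrow> edge_at Us x \<in> set Us" "x \<in> X \<Longrightarrow> x \<in> edge_at Us x" "U \<in> set Us \<Longrightarrow> x \<in> U \<Longrightarrow> edge_at Us x = U"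
proof -
  show 1: "x \<in> X \<Longrightarrow> edge_at Us x \<in> set Us" and 2: "x \<in> X \<Longrightarrow> x \<in> edge_at Us x"
    using block_of[OF assms] by (auto simp: edge_at_def)
  show "U \<in> set Us \<Longrightarrow> x \<in> U \<Longrightarrow> edge_at Us x = U"
    using decomp2_blocks[OF assms] 1 2 by (metis subsetD)
qed

lemma edges_cong_permute:
  assumes "Us \<in> decomp2 X" "U \<in> set Us" "U' \<in> set Us" "U \<noteq> U'"
    and "p ` U = U'" "p ` U' = U" "\<And>W. W \<in> set Us \<Longrightarrow> W \<noteq> U \<Longrightarrow> W \<noteq> U' \<Longrightarrow> p ` W = W"
  shows "edges (map (image p) Us) + edges Us \<in> lam_rel X"
proof -
  obtain i j where ij: "i < length Us" "Us ! i = U" "j < length Us" "Us ! j = U'"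
    using assms(2,3) by (metis in_set_conv_nth)
  have ne: "i \<noteq> j" using ij assms(4) by auto
  have dist: "Us ! m = Us ! k \<longleftrightarrow> m = k" if "m < length Us" "k < length Us" for m k
    using nth_eq_iff_index_eq[OF decomp2_blocks(2)[OF assms(1)]] that by blast
  have t: "transpose i j permutes {..<length Us}" using ij by (intro permutes_swap_id) auto
  have "map (image p) Us = permute_list (transpose i j) Us"
  proof (rule nth_equalityI)
    fix m assume "m < length (map (image p) Us)"
    then have m: "m < length Us" by simp
    have "p ` (Us ! m) = Us ! transpose i j m"
    proof (cases "m = i \<or> m = j")
      case True
      then show ?thesis using ij assms(5,6) by auto
    next
      case False
      then have "Us ! m \<noteq> U" "Us ! m \<noteq> U'" using dist m ij by metis+
      then show ?thesis using assms(7)[OF nth_mem[OF m]] False by (simp add: transpose_def)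
    qed
    then show "map (image p) Us ! m = permute_list (transpose i j) Us ! m"
      using m by (simp add: permute_list_nth[OF t])
  qed simp
  then show ?thesis using lam_rel_swap[OF assms(1) ij(1,3) ne] by simp
qed

text \<open>Exchanging two edges whose ends have the same colours is a product of two transpositions,
  hence even, but it transposes two edges and therefore acts by \<open>-1\<close>.\<close>

lemma isum_parallel:
  fixes \<chi> :: "(nat \<Rightarrow> nat) \<Rightarrow> 'k::field_char_0"
  assumes D: "Us \<in> decomp2 X" and \<chi>: "\<chi> = sg \<or> \<chi> = (\<lambda>_. 1)"
    and U: "U \<in> set Us" "U' \<in> set Us" "U \<noteq> U'" "f ` U = f ` U'"
  shows "isum relab \<chi> (cperm X f) (edges Us) \<in> lam_rel X"
proof -
  note B = decomp2_blocks[OF D]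
  have fX: "finite X" using D by (rule finite_decomp2)
  obtain x z where xz: "U = {x, z}" "x \<noteq> z" using B(1)[OF U(1)] by (meson card_2_iff)
  obtain x1 z1 where xz1: "U' = {x1, z1}" "x1 \<noteq> z1" using B(1)[OF U(2)] by (meson card_2_iff)
  have "{f x, f z} = {f x1, f z1}" using U(4) by (simp add: xz xz1)
  then obtain x' z' where xz': "U' = {x', z'}" "x' \<noteq> z'" "f x = f x'" "f z = f z'"
    using xz1 unfolding doubleton_eq_iff by (metis insert_commute)
  (* The ends are named such that x and x', as well as z and z', have the same colour. *)
  have dis: "x \<noteq> x'" "x \<noteq> z'" "z \<noteq> x'" "z \<noteq> z'" "x' \<notin> U" "z' \<notin> U"
    using B(3)[OF U(1,2)] U(3) xz xz' by blast+
  have inX: "x \<in> X" "z \<in> X" "x' \<in> X" "z' \<in> X" using B(5)[OF U(1)] B(5)[OF U(2)] xz xz' by auto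
  define t where "t = transpose x x' \<circ> transpose z z'"
  have tC: "t \<in> cperm X f"
    unfolding t_def using inX xz' by (intro cperm_comp cperm_transpose) auto
  have "(sg t :: 'k) = sg (transpose x x') * sg (transpose z z')"
    unfolding t_def by (rule sg_compose[OF fX permutes_swap_id permutes_swap_id]) (use inX in auto)
  then have sgt: "(sg t :: 'k) = 1" using dis by (simp add: sign_swap_id)
  have ti: "t x = x'" "t z = z'" "t x' = x" "t z' = z"
    using dis xz xz' by (auto simp: t_def transpose_def)
  have tid: "t y = y" if "y \<notin> U" "y \<notin> U'" for y
    using that xz xz' by (auto simp: t_def transpose_def)
  have other: "t ` W = W" if "W \<in> set Us" "W \<noteq> U" "W \<noteq> U'" for W
  proof -
    have "t y = y" if "y \<in> W" for y
      using B(3)[OF \<open>W \<in> set Us\<close> U(1) that] B(3)[OF \<open>W \<in> set Us\<close> U(2) that] \<open>W \<noteq> U\<close> \<open>W \<noteq> U'\<close> tid by blast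
    then show ?thesis by simp
  qed
  have "edges (map (image t) Us) + edges Us \<in> lam_rel X"
    by (rule edges_cong_permute[OF D U(1-3) _ _ other]) (auto simp: xz xz'(1) ti)
  then have "relab t (edges Us) + fscale (\<chi> t) (edges Us) \<in> (lam_rel X :: 'k lam set)"
    using \<chi> sgt by auto
  moreover have "lin_char X \<chi>" using \<chi> lin_char_sg[OF fX] lin_char_one by blast
  ultimately show ?thesis
    by (intro R.isum_kill[OF subspace_lam_rel _ _ tC]) (auto intro: relab_lam_rel_permutes cperm_permutes)
qed

text \<open>The transposition of the two ends of the edge fixes the matching and is odd.\<close>

lemma isum_monochromatic:
  fixes X :: "nat set"
  assumes D: "Us \<in> decomp2 X" and U: "U \<in> set Us" "card (f ` U) \<noteq> 2"
  shows "isum relab sg (cperm X f) (edges Us) \<in> (lam_rel X :: 'k::field_char_0 lam set)"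
proof -
  note B = decomp2_blocks[OF D]
  have fX: "finite X" using D by (rule finite_decomp2)
  obtain x z where xz: "U = {x, z}" "x \<noteq> z" using B(1)[OF U(1)] by (meson card_2_iff)
  have f: "f x = f z"
  proof (rule ccontr)
    assume "f x \<noteq> f z"
    then have "card (f ` U) = 2" by (simp add: xz)
    with U(2) show False by simp
  qed
  have inX: "x \<in> X" "z \<in> X" using B(5)[OF U(1)] xz by auto
  let ?t = "transpose x z"
  have "?t ` W = W" if "W \<in> set Us" for W
  proof (cases "W = U")
    case False
    then have "x \<notin> W" "z \<notin> W" using B(3)[OF that U(1)] xz by blast+
    then show ?thesis by (auto simp: transpose_def image_iff)
  qed (simp add: xz insert_commute)
  then have "map (image ?t) Us = Us" by (simp add: map_idI)
  then have "relab ?t (edges Us) + fscale (sg ?t) (edges Us) = (0 :: 'k lam)"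
    using xz by (simp add: sign_swap_id fscale_minus1)
  then have "relab ?t (edges Us) + fscale (sg ?t) (edges Us) \<in> (lam_rel X :: 'k lam set)"
    using fv.subspace_0[OF subspace_lam_rel] by metis
  then show ?thesis
    using inX f
    by (intro R.isum_kill[OF subspace_lam_rel _ lin_char_sg[OF fX] cperm_transpose])
      (auto intro: relab_lam_rel_permutes cperm_permutes)
qed

lemma edge_at_pair:
  assumes "Us \<in> decomp2 X" "x \<in> X"
  obtains y where "edge_at Us x = {x, y}" "x \<noteq> y" "y \<in> X"
proof -
  have c: "card (edge_at Us x) = 2" "x \<in> edge_at Us x" "edge_at Us x \<subseteq> X"
    using edge_at(1,2)[OF assms] decomp2_blocks(1,5)[OF assms(1)] by auto
  then obtain a b where "edge_at Us x = {a, b}" "a \<noteq> b" by (meson card_2_iff)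
  with c show ?thesis using that[of a] that[of b] by (auto simp: insert_commute)
qed

text \<open>By injectivity of the colouring on the edges, different edges that leave the colour class
  \<open>c\<close> lead to different colours.\<close>

lemma cross_inj:
  assumes D: "Us \<in> decomp2 X" and inj: "inj_on (image f) (set Us)"
  shows "inj_on (\<lambda>x. f ` edge_at Us x) {x \<in> X. f x = c \<and> f ` edge_at Us x \<noteq> {c}}"
proof (rule inj_onI, clarify)
  fix x y
  assume x: "x \<in> X" "f ` edge_at Us x \<noteq> {f x}" and y: "y \<in> X" "f y = f x" "f ` edge_at Us x = f ` edge_at Us y"
  have e: "edge_at Us x = edge_at Us y"
    using inj_onD[OF inj y(3)] edge_at(1)[OF D] x(1) y(1) by blast
  obtain x' where x': "edge_at Us x = {x, x'}" using edge_at_pair[OF D x(1)] by blast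
  show "x = y"
  proof (rule ccontr)
    assume "x \<noteq> y"
    then have "edge_at Us x = {x, y}" using x' edge_at(2)[OF D y(1)] e by auto
    with x(2) y(2) show False by auto
  qed
qed

lemma cross_image:
  assumes D: "Us \<in> decomp2 X" and f: "f ` X \<subseteq> {..<l}"
  shows "(\<lambda>x. f ` edge_at Us x) ` {x \<in> X. f x = c \<and> f ` edge_at Us x \<noteq> {c}} \<subseteq> (\<lambda>d. {c, d}) ` ({..<l} - {c})"
proof clarify
  fix x assume x: "x \<in> X" "f ` edge_at Us x \<noteq> {f x}" "c = f x"
  obtain x' where x': "edge_at Us x = {x, x'}" "x' \<in> X" using edge_at_pair[OF D x(1)] by blast
  then have "f x' \<in> {..<l} - {f x}" using x(2) f by auto
  then show "f ` edge_at Us x \<in> (\<lambda>d. {f x, d}) ` ({..<l} - {f x})" using x'(1) by auto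
qed

lemma card_other_colours: "c < l \<Longrightarrow> card ((\<lambda>d. {c, d}) ` ({..<l} - {c})) = l - (1 :: nat)"
  by (subst card_image) (auto simp: inj_on_def doubleton_eq_iff)

lemma cross_bound:
  assumes D: "Us \<in> decomp2 X" and inj: "inj_on (image f) (set Us)" and f: "f ` X \<subseteq> {..<l}" "c < l"
  shows "card {x \<in> X. f x = c \<and> f ` edge_at Us x \<noteq> {c}} \<le> l - 1"
proof -
  have "finite ((\<lambda>d. {c, d}) ` ({..<l} - {c}))" by simp
  from card_inj_on_le[OF cross_inj[OF D inj] cross_image[OF D f(1)] this] show ?thesis
    using card_other_colours[OF f(2)] by simp
qed

lemma cross_class:
  assumes D: "Us \<in> decomp2 X" and f: "\<And>U. U \<in> set Us \<Longrightarrow> card (f ` U) = 2"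
  shows "{x \<in> X. f x = c \<and> f ` edge_at Us x \<noteq> {c}} = {x \<in> X. f x = c}"
  using f edge_at(1)[OF D] by (intro Collect_cong) fastforce

text \<open>A matching of coloured points induces a multigraph on the set of colours. Only matchings
  that induce a graph without loops and without parallel edges survive antisymmetrization.\<close>

lemma isum_alt_mem:
  fixes v :: "'k::field_char_0 lam"
  assumes "\<And>Us. Us \<in> decomp2 X \<Longrightarrow> inj_on (image f) (set Us) \<Longrightarrow> (\<And>U. U \<in> set Us \<Longrightarrow> card (f ` U) = 2) \<Longrightarrow> False"
    and v: "v \<in> free_on (decomp2 X)"
  shows "isum relab sg (cperm X f) v \<in> lam_rel X"
proof (rule flin_mem[OF R.isum_lin subspace_lam_rel _ v])
  fix Us assume D: "Us \<in> decomp2 X"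
  show "isum relab sg (cperm X f) (edges Us) \<in> (lam_rel X :: 'k lam set)"
  proof (cases "inj_on (image f) (set Us)")
    case False
    then obtain U U' where "U \<in> set Us" "U' \<in> set Us" "U \<noteq> U'" "f ` U = f ` U'"
      by (auto simp: inj_on_def)
    then show ?thesis using isum_parallel[OF D, of sg] by blast
  next
    case True
    then obtain U where "U \<in> set Us" "card (f ` U) \<noteq> 2" using assms(1)[OF D] by blast
    then show ?thesis by (rule isum_monochromatic[OF D])
  qed
qed

text \<open>In a simple graph on \<open>l\<close> vertices every degree is at most \<open>l - 1\<close>.\<close>

lemma isum_alt_big_class:
  fixes v :: "'k::field_char_0 lam"
  assumes "f ` X \<subseteq> {..<l}" "c < l" "card {x \<in> X. f x = c} > l - 1" "v \<in> free_on (decomp2 X)"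
  shows "isum relab sg (cperm X f) v \<in> lam_rel X"
proof (rule isum_alt_mem[OF _ assms(4)])
  fix Us assume "Us \<in> decomp2 X" "inj_on (image f) (set Us)" "\<And>U. U \<in> set Us \<Longrightarrow> card (f ` U) = 2"
  then show False using cross_bound[of Us X f l c] cross_class[of Us X f c] assms by force
qed

lemma isum_alt_too_many:
  fixes v :: "'k::field_char_0 lam"
  assumes "finite X" "f ` X \<subseteq> {..<l}" "card X > l * (l - 1)" "v \<in> free_on (decomp2 X)"
  shows "isum relab sg (cperm X f) v \<in> lam_rel X"
proof -
  have "card X = (\<Sum>i<l. card {x \<in> X. f x = i})"
    using sum.group[of X "{..<l}" f "\<lambda>_. 1 :: nat"] assms by simp
  moreover have "(\<Sum>i<l. card {x \<in> X. f x = i}) \<le> l * (l - 1)" if "\<And>c. c < l \<Longrightarrow> card {x \<in> X. f x = c} \<le> l - 1"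
    using sum_bounded_above[of "{..<l}" "\<lambda>i. card {x \<in> X. f x = i}" "l - 1"] that by simp
  ultimately have "\<not> (\<forall>c<l. card {x \<in> X. f x = c} \<le> l - 1)" using assms(3) by force
  then obtain c where "c < l" "card {x \<in> X. f x = c} > l - 1" by (auto simp: not_le)
  then show ?thesis using isum_alt_big_class assms by blast
qed

text \<open>In a simple graph on \<open>l\<close> vertices in which all vertices except \<open>a\<close> have the full degree
  \<open>l - 1\<close>, each of them is joined to \<open>a\<close>, so that \<open>a\<close> has full degree as well.\<close>

lemma isum_alt_deficient:
  fixes v :: "'k::field_char_0 lam"
  assumes X: "finite X" and f: "f ` X \<subseteq> {..<l}" and a: "a < l" "card {x \<in> X. f x = a} < l - 1"
    and c: "\<And>c. c < l \<Longrightarrow> c \<noteq> a \<Longrightarrow> card {x \<in> X. f x = c} \<ge> l - 1"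
    and v: "v \<in> free_on (decomp2 X)"
  shows "isum relab sg (cperm X f) v \<in> lam_rel X"
proof (rule isum_alt_mem[OF _ v])
  fix Us assume D: "Us \<in> decomp2 X" and inj: "inj_on (image f) (set Us)"
    and two: "\<And>U. U \<in> set Us \<Longrightarrow> card (f ` U) = 2"
  have cls: "{x \<in> X. f x = c \<and> f ` edge_at Us x \<noteq> {c}} = {x \<in> X. f x = c}" for c
    by (rule cross_class[OF D two])
  have "(\<lambda>d. {a, d}) ` ({..<l} - {a}) \<subseteq> (\<lambda>x. f ` edge_at Us x) ` {x \<in> X. f x = a}"
  proof (rule image_subsetI)
    fix d assume "d \<in> {..<l} - {a}"
    then have d: "d < l" "d \<noteq> a" by auto
    have "(\<lambda>x. f ` edge_at Us x) ` {x \<in> X. f x = d} = (\<lambda>e. {d, e}) ` ({..<l} - {d})"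
    proof (rule card_seteq)
      show "(\<lambda>x. f ` edge_at Us x) ` {x \<in> X. f x = d} \<subseteq> (\<lambda>e. {d, e}) ` ({..<l} - {d})"
        using cross_image[OF D f, of d] unfolding cls .
      show "card ((\<lambda>e. {d, e}) ` ({..<l} - {d})) \<le> card ((\<lambda>x. f ` edge_at Us x) ` {x \<in> X. f x = d})"
        using card_image[OF cross_inj[OF D inj, of d]] c[OF d] card_other_colours[OF d(1)]
        unfolding cls by simp
    qed simp
    moreover have "{d, a} \<in> (\<lambda>e. {d, e}) ` ({..<l} - {d})"
      by (rule imageI) (use a(1) d in auto)
    ultimately have "{d, a} \<in> (\<lambda>x. f ` edge_at Us x) ` {x \<in> X. f x = d}" by (simp only:)
    then obtain x where x': "{d, a} = f ` edge_at Us x" "x \<in> {x \<in> X. f x = d}" by (rule imageE)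
    then have x: "x \<in> X" "f x = d" "f ` edge_at Us x = {d, a}" by simp_all
    then have "a \<in> f ` edge_at Us x" by auto
    then obtain y where y: "y \<in> edge_at Us x" "f y = a" by blast
    have "edge_at Us y = edge_at Us x" "y \<in> X"
      using edge_at(3)[OF D edge_at(1)[OF D x(1)] y(1)] decomp2_blocks(5)[OF D edge_at(1)[OF D x(1)]] y(1) by auto
    then have "f ` edge_at Us y = {a, d}" using x(3) by auto
    with y(2) \<open>y \<in> X\<close> show "{a, d} \<in> (\<lambda>x. f ` edge_at Us x) ` {x \<in> X. f x = a}" by force
  qed
  then have "card ((\<lambda>d. {a, d}) ` ({..<l} - {a})) \<le> card ((\<lambda>x. f ` edge_at Us x) ` {x \<in> X. f x = a})"
    using X by (intro card_mono) auto
  also have "\<dots> \<le> card {x \<in> X. f x = a}" using X by (intro card_image_le) auto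
  finally show False using a card_other_colours[OF a(1)] by simp
qed

text \<open>For the trivial character only parallel edges are excluded. A class of one of \<open>r\<close> colours
  then contains at most \<open>r - 1\<close> ends of edges to other colours, and the two ends of one edge
  within the class.\<close>

lemma isum_sym_big_class:
  fixes v :: "'k::field_char_0 lam"
  assumes f: "f ` X \<subseteq> {..<r}" "c < r" "card {x \<in> X. f x = c} > Suc r" and v: "v \<in> free_on (decomp2 X)"
  shows "isum relab (\<lambda>_. 1) (cperm X f) v \<in> lam_rel X"
proof (rule flin_mem[OF R.isum_lin subspace_lam_rel _ v])
  fix Us assume D: "Us \<in> decomp2 X"
  have X: "finite X" by (rule finite_decomp2[OF D])
  have "\<not> inj_on (image f) (set Us)"
  proof
    assume inj: "inj_on (image f) (set Us)"
    let ?M = "{x \<in> X. f x = c \<and> f ` edge_at Us x = {c}}"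
    have "card ?M \<le> 2"
    proof (cases "?M = {}")
      case False
      then obtain x where x: "x \<in> X" "f ` edge_at Us x = {c}" by blast
      have "?M \<subseteq> edge_at Us x"
      proof clarify
        fix y assume y: "y \<in> X" "f ` edge_at Us y = {f y}" "c = f y"
        then have "edge_at Us y = edge_at Us x" using inj_onD[OF inj] edge_at(1)[OF D] x by metis
        then show "y \<in> edge_at Us x" using edge_at(2)[OF D y(1)] by simp
      qed
      then have "card ?M \<le> card (edge_at Us x)"
        using finite_block[OF D edge_at(1)[OF D x(1)]] by (intro card_mono)
      then show ?thesis using decomp2_blocks(1)[OF D edge_at(1)[OF D x(1)]] by simp
    next
      case True
      show ?thesis unfolding True by simp
    qed
    moreover have un: "{x \<in> X. f x = c \<and> f ` edge_at Us x \<noteq> {c}} \<union> ?M = {x \<in> X. f x = c}" by blast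
    have "card {x \<in> X. f x = c} \<le> card {x \<in> X. f x = c \<and> f ` edge_at Us x \<noteq> {c}} + card ?M"
      using card_Un_le[of "{x \<in> X. f x = c \<and> f ` edge_at Us x \<noteq> {c}}" ?M] unfolding un .
    ultimately show False using cross_bound[OF D inj f(1,2)] f(2,3) by linarith
  qed
  then obtain U U' where "U \<in> set Us" "U' \<in> set Us" "U \<noteq> U'" "f ` U = f ` U'"
    by (auto simp: inj_on_def)
  then show "isum relab (\<lambda>_. 1) (cperm X f) (edges Us) \<in> (lam_rel X :: 'k lam set)"
    using isum_parallel[OF D, of "\<lambda>_. 1"] by blast
qed

section \<open>A matching whose antisymmetrization does not vanish\<close>

lemma permute_list_inj:
  assumes "length xs = length ys" "s permutes {..<length xs}" "permute_list s xs = permute_list s ys"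
  shows "xs = ys"
proof (rule nth_equalityI[OF assms(1)])
  fix i assume i: "i < length xs"
  have j: "inv s i < length xs" using permutes_in_image[OF permutes_inv[OF assms(2)], of i] i by simp
  have "xs ! s (inv s i) = ys ! s (inv s i)"
    using arg_cong[OF assms(3), of "\<lambda>zs. zs ! inv s i"] assms(1,2) j by (simp add: permute_list_nth)
  then show "xs ! i = ys ! i" by (simp add: permutes_inverses[OF assms(2)])
qed

text \<open>The functional \<open>\<Phi>\<close> adds up, with signs, the coordinates at all matchings that arise from
  \<open>Us0\<close> by a colour-preserving permutation \<open>q\<close> and a reordering \<open>s\<close> of the edges; it vanishes
  on the relations. Since the edges of \<open>Us0\<close> have distinct pairs of distinct colours, \<open>q\<close> and
  \<open>s\<close> can be recovered from the resulting list. So there is no cancellation, and the value of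
  \<open>\<Phi>\<close> at the antisymmetrization is the order of the group.\<close>

lemma isum_alt_nonzero:
  assumes D: "Us0 \<in> decomp2 X" and inj: "inj_on (image f) (set Us0)"
    and two: "\<And>U. U \<in> set Us0 \<Longrightarrow> card (f ` U) = 2"
  shows "isum relab sg (cperm X f) (edges Us0) \<notin> (lam_rel X :: 'k::field_char_0 lam set)"
proof
  let ?C = "cperm X f" and ?S = "{s. s permutes {..<length Us0}}"
  define F where "F q s = permute_list s (map (image q) Us0)" for q s :: "nat \<Rightarrow> nat"
  define \<Phi> :: "'k lam \<Rightarrow> 'k" where
    "\<Phi> v = (\<Sum>q\<in>?C. \<Sum>s\<in>?S. sg q * sg s * Poly_Mapping.lookup v (F q s))" for v
  have X: "finite X" by (rule finite_decomp2[OF D])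
  have add: "\<Phi> (x + y) = \<Phi> x + \<Phi> y" for x y
    by (simp add: \<Phi>_def lookup_add distrib_left sum.distrib)
  have scale: "\<Phi> (fscale c x) = c * \<Phi> x" for c x
    by (simp add: \<Phi>_def sum_distrib_left mult_ac)
  have sub: "fv.subspace {v. \<Phi> v = 0}"
    unfolding fv.subspace_def using scale[of 0 0] by (simp add: add scale)
  have diff: "\<Phi> (x - y) = \<Phi> x - \<Phi> y" for x y
    by (simp add: \<Phi>_def lookup_minus right_diff_distrib sum_subtractf)
  have "lam_rel X \<subseteq> {v. \<Phi> v = 0}"
    unfolding lam_rel_def
  proof (rule fv.span_minimal[OF _ sub], rule subsetI)
    fix w :: "'k lam" assume "w \<in> {edges (permute_list t Us) - Poly_Mapping.single Us (of_int (sign t)) |t Us.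
      Us \<in> decomp2 X \<and> t permutes {..<length Us}}"
    then obtain t Us where w: "w = edges (permute_list t Us) - Poly_Mapping.single Us (of_int (sign t))"
      and Us: "Us \<in> decomp2 X" and t: "t permutes {..<length Us}" by blast
    have len: "length Us = length Us0" using card_decomp2[OF D] card_decomp2[OF Us] by simp
    have tS: "t permutes {..<length Us0}" using t len by simp
    have "(\<Sum>s\<in>?S. (sg q :: 'k) * sg s * Poly_Mapping.lookup (edges (permute_list t Us)) (F q s))
        = (\<Sum>s\<in>?S. sg q * sg s * Poly_Mapping.lookup (Poly_Mapping.single Us (sg t)) (F q s))" for q
    proof -
      have "(\<Sum>s\<in>?S. (sg q :: 'k) * sg s * Poly_Mapping.lookup (edges (permute_list t Us)) (F q s))
          = (\<Sum>s\<in>?S. sg q * sg (s \<circ> t) * Poly_Mapping.lookup (edges (permute_list t Us)) (F q (s \<circ> t)))"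
        by (rule sum_permutations_compose_right[OF tS])
      also have "\<dots> = (\<Sum>s\<in>?S. sg q * sg s * Poly_Mapping.lookup (Poly_Mapping.single Us (sg t)) (F q s))"
      proof (rule sum.cong[OF refl])
        fix s assume "s \<in> ?S"
        then have s: "s permutes {..<length Us0}" by simp
        have "F q (s \<circ> t) = permute_list t (F q s)"
          unfolding F_def by (rule permute_list_compose) (use tS in simp)
        moreover have "permute_list t Us = permute_list t (F q s) \<longleftrightarrow> Us = F q s"
          using permute_list_inj[of Us "F q s" t] len t by (auto simp: F_def)
        moreover have "(sg (s \<circ> t) :: 'k) = sg s * sg t" by (rule sg_compose[OF finite_lessThan s tS])
        ultimately show "sg q * sg (s \<circ> t) * Poly_Mapping.lookup (edges (permute_list t Us)) (F q (s \<circ> t))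
           = sg q * sg s * Poly_Mapping.lookup (Poly_Mapping.single Us (sg t :: 'k)) (F q s)"
          by (simp add: lookup_single when_def)
      qed
      finally show ?thesis .
    qed
    then have "\<Phi> (edges (permute_list t Us)) = \<Phi> (Poly_Mapping.single Us (sg t))"
      unfolding \<Phi>_def by simp
    then show "w \<in> {v. \<Phi> v = 0}" by (simp add: diff w)
  qed
  moreover assume "isum relab sg ?C (edges Us0) \<in> (lam_rel X :: 'k lam set)"
  ultimately have 0: "\<Phi> (isum relab sg ?C (edges Us0)) = 0" by blast
  have colour: "map (image f) (map (image q) Us0) = map (image f) Us0" if "q \<in> ?C" for q
    using cperm_colour[OF that] decomp2_blocks(5)[OF D] by (auto simp: image_comp intro!: image_cong)
  have dist: "distinct (map (image f) Us0)"
    using inj decomp2_blocks(2)[OF D] by (simp add: distinct_map)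
  have key: "map (image q') Us0 = F q s \<longleftrightarrow> q' = q \<and> s = id" if q: "q \<in> ?C" "q' \<in> ?C" and s: "s \<in> ?S" for q q' s
  proof
    assume eq: "map (image q') Us0 = F q s"
    have s': "s permutes {..<length (map (image f) Us0)}" using s by simp
    have "map (image f) Us0 = map (image f) (F q s)" using colour[OF q(2)] eq by simp
    also have "\<dots> = permute_list s (map (image f) Us0)"
    proof -
      have "map (image f) (F q s) = permute_list s (map (image f) (map (image q) Us0))"
        unfolding F_def by (rule permute_list_map[symmetric]) (use s in simp)
      then show ?thesis by (simp only: colour[OF q(1)])
    qed
    finally have e: "map (image f) Us0 = permute_list s (map (image f) Us0)" .
    have "s i = i" if i: "i < length Us0" for i
    proof -
      have "s i < length Us0" using permutes_in_image[OF s', of i] i by simp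
      moreover have "map (image f) Us0 ! i = map (image f) Us0 ! s i"
        using arg_cong[OF e, of "\<lambda>zs. zs ! i"] i permute_list_nth[OF s', of i] by simp
      ultimately show ?thesis using nth_eq_iff_index_eq[OF dist, of i "s i"] i by simp
    qed
    moreover have "s i = i" if "\<not> i < length Us0" for i using s that by (auto intro: permutes_not_in)
    ultimately have sid: "s = id" by (auto simp: fun_eq_iff)
    then have qq: "map (image q') Us0 = map (image q) Us0" using eq by (simp add: F_def)
    have "q' x = q x" if x: "x \<in> X" for x
    proof -
      let ?U = "edge_at Us0 x"
      have U: "?U \<in> set Us0" "x \<in> ?U" "?U \<subseteq> X" using edge_at[OF D] decomp2_blocks(5)[OF D] x by auto
      have "q' ` ?U = q ` ?U" using qq U(1) by simp
      then obtain y where y: "y \<in> ?U" "q' x = q y" using U(2) by blast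
      have "f y = f x"
        using cperm_colour[OF q(1), of y] cperm_colour[OF q(2) x] y U(3) by auto
      moreover have "inj_on f ?U"
        using two[OF U(1)] decomp2_blocks(1)[OF D U(1)] finite_block[OF D U(1)] by (simp add: eq_card_imp_inj_on)
      ultimately have "y = x" using y(1) U(2) by (simp add: inj_on_def)
      then show ?thesis using y(2) by simp
    qed
    moreover have "q' x = q x" if "x \<notin> X" for x
      using that cperm_permutes q by (metis permutes_not_in)
    ultimately show "q' = q \<and> s = id" using sid by (auto simp: fun_eq_iff)
  next
    assume "q' = q \<and> s = id"
    then show "map (image q') Us0 = F q s" by (simp add: F_def)
  qed
  have look: "Poly_Mapping.lookup (isum relab sg ?C (edges Us0)) (F q s) = (if s = id then sg q else 0 :: 'k)"
    if q: "q \<in> ?C" and s: "s \<in> ?S" for q s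
  proof -
    have "Poly_Mapping.lookup (isum relab sg ?C (edges Us0)) (F q s)
        = (\<Sum>q'\<in>?C. if q' = q then (if s = id then sg q else 0 :: 'k) else 0)"
      unfolding isum_def lookup_sum
      by (rule sum.cong[OF refl]) (use key[OF q _ s] in \<open>auto simp: lookup_single when_def\<close>)
    also have "\<dots> = (if s = id then sg q else 0)" using q X by simp
    finally show ?thesis .
  qed
  have "\<Phi> (isum relab sg ?C (edges Us0)) = (\<Sum>q\<in>?C. \<Sum>s\<in>?S. if s = id then 1 else 0)"
    unfolding \<Phi>_def by (intro sum.cong refl) (use look in \<open>auto simp: sg_square\<close>)
  also have "\<dots> = of_nat (card ?C)" by (simp add: finite_permutations permutes_id)
  finally have "card ?C = 0" using 0 by simp
  then show False using X by (metis card_0_eq cperm_id empty_iff finite_cperm)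
qed

section \<open>The rectangular Young diagram\<close>

locale grid =
  fixes l :: nat
  assumes l2: "2 \<le> l"
begin

definition cells :: "nat set" where "cells = {1..l * (l - 1)}"
definition row :: "nat \<Rightarrow> nat" where "row i = (i - 1) div l"
definition col :: "nat \<Rightarrow> nat" where "col i = (i - 1) mod l"
definition cell :: "nat \<Rightarrow> nat \<Rightarrow> nat" where "cell r c = r * l + c + 1"

lemma finite_cells [simp]: "finite cells" by (simp add: cells_def)

lemma card_cells: "card cells = (l - 1) * l" by (simp add: cells_def mult.commute)

lemma col_less: "col x < l" using l2 by (simp add: col_def)

lemma row_less: "x \<in> cells \<Longrightarrow> row x < l - 1"
  unfolding row_def cells_def
  by (rule less_mult_imp_div_less) (auto simp: mult.commute)

lemma row_cell [simp]: "c < l \<Longrightarrow> row (cell r c) = r" by (simp add: row_def cell_def)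
lemma col_cell [simp]: "c < l \<Longrightarrow> col (cell r c) = c" by (simp add: col_def cell_def)

lemma cell_row_col: "x \<in> cells \<Longrightarrow> cell (row x) (col x) = x"
  by (simp add: cell_def row_def col_def cells_def)

lemma cell_in: 
  assumes "r < l - 1" "c < l" shows "cell r c \<in> cells"
proof -
  have "r * l + c + 1 \<le> Suc r * l" using assms(2) by simp
  also have "\<dots> \<le> (l - 1) * l" using assms(1) by (intro mult_le_mono1) simp
  finally show ?thesis by (simp add: cell_def cells_def mult.commute)
qed

lemma inj_grid: "inj_on (\<lambda>x. (col x, row x)) cells"
  using cell_row_col by (intro inj_onI) (metis prod.inject)

lemma card_col_class: "c < l \<Longrightarrow> card {x \<in> cells. col x = c} = l - 1"
proof (rule equal_classes)
  show "card {x \<in> cells. col x = i} \<le> l - 1" if "i < l" for i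
  proof -
    have "card {x \<in> cells. col x = i} \<le> card {..<l - 1}"
      by (rule card_inj_on_le[of row]) (use inj_grid row_less in \<open>auto simp: inj_on_def\<close>)
    then show ?thesis by simp
  qed
  show "card cells = l * (l - 1)" by (simp add: cells_def)
qed (use col_less in auto)

text \<open>The edges of the complete graph on the columns: the edge between the columns \<open>a < b\<close> joins
  the cell of column \<open>a\<close> in row \<open>b - 1\<close> to the cell of column \<open>b\<close> in row \<open>a\<close>.\<close>

definition kedge :: "nat \<times> nat \<Rightarrow> nat set" where
  "kedge = (\<lambda>(a, b). {cell (b - 1) a, cell a b})"

definition kpairs :: "(nat \<times> nat) list" where
  "kpairs = filter (\<lambda>(a, b). a < b) (List.product [0..<l] [0..<l])"

definition kmatch :: "nat set list" where "kmatch = map kedge kpairs"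

lemma set_kpairs: "set kpairs = {(a, b). a < b \<and> b < l}"
  by (auto simp: kpairs_def)

lemma kedge_colours: "a < b \<Longrightarrow> b < l \<Longrightarrow> col ` kedge (a, b) = {a, b}"
  by (simp add: kedge_def)

lemma kedge_inj: "inj_on kedge (set kpairs)" "inj_on (image col) (kedge ` set kpairs)"
proof -
  have "inj_on (\<lambda>p. col ` kedge p) (set kpairs)"
    by (auto simp: inj_on_def set_kpairs kedge_colours doubleton_eq_iff)
  then show "inj_on kedge (set kpairs)" "inj_on (image col) (kedge ` set kpairs)"
    using inj_on_imageI2[of "image col" kedge] inj_on_imageI[of "image col" kedge] by (auto simp: comp_def)
qed

lemma kmatch: "kmatch \<in> decomp2 cells"
  unfolding decomp2_iff
proof (intro conjI ballI impI)
  show "card U = 2" if U: "U \<in> set kmatch" for U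
  proof -
    obtain a b where ab: "U = kedge (a, b)" "a < b" "b < l" using U by (auto simp: kmatch_def set_kpairs)
    have "cell (b - 1) a \<noteq> cell a b"
      using ab col_cell[of a "b - 1"] col_cell[of b a] by (metis less_irrefl order_less_trans)
    then show ?thesis by (simp add: ab(1) kedge_def)
  qed
  have "distinct kpairs" by (simp add: kpairs_def distinct_product)
  then show "distinct kmatch" using kedge_inj(1) by (simp add: kmatch_def distinct_map)
  show "U \<inter> V = {}" if UV: "U \<in> set kmatch" "V \<in> set kmatch" "U \<noteq> V" for U V
  proof (rule ccontr)
    assume "U \<inter> V \<noteq> {}"
    then obtain x where x: "x \<in> U" "x \<in> V" by blast
    obtain a b where ab: "U = kedge (a, b)" "a < b" "b < l" using UV by (auto simp: kmatch_def set_kpairs)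
    obtain a' b' where ab': "V = kedge (a', b')" "a' < b'" "b' < l" using UV by (auto simp: kmatch_def set_kpairs)
    have 1: "row x = b - 1 \<and> col x = a \<or> row x = a \<and> col x = b" using x(1) ab by (auto simp: kedge_def)
    have 2: "row x = b' - 1 \<and> col x = a' \<or> row x = a' \<and> col x = b'" using x(2) ab' by (auto simp: kedge_def)
    have "a = a' \<and> b = b'" using 1 2 ab(2,3) ab'(2,3) by linarith
    then show False using UV(3) ab(1) ab'(1) by simp
  qed
  show "\<Union> (set kmatch) = cells"
  proof (intro set_eqI iffI)
    fix x assume "x \<in> \<Union> (set kmatch)"
    then obtain a b where ab: "x \<in> kedge (a, b)" "a < b" "b < l" by (auto simp: kmatch_def set_kpairs)
    then show "x \<in> cells" by (auto simp: kedge_def intro!: cell_in)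
  next
    fix x assume x: "x \<in> cells"
    note rc = row_less[OF x] col_less[of x] cell_row_col[OF x]
    (* The column of the other end is the row of x, shifted by one unless the row is smaller than the column. *)
    define p where "p = (if row x < col x then (row x, col x) else (col x, Suc (row x)))"
    have "p \<in> set kpairs" using rc by (auto simp: p_def set_kpairs)
    moreover have "x \<in> kedge p" using rc by (auto simp: p_def kedge_def)
    ultimately show "x \<in> \<Union> (set kmatch)" by (auto simp: kmatch_def)
  qed
qed

text \<open>The graph induced on the columns is the complete graph. On an odd vector space of
  dimension \<open>l\<close>, the functor that corresponds to \<open>Lambda_C\<close> consists of the exterior powers of
  the exterior square of an \<open>l\<close>-dimensional space, and this vector corresponds to the top
  exterior power.\<close>

definition y0 :: "'k::field_char_0 lam" where
  "y0 = isum relab sg (cperm cells col) (edges kmatch)"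

lemma y0_nonzero: "(y0 :: 'k::field_char_0 lam) \<notin> lam_rel cells"
  unfolding y0_def
proof (rule isum_alt_nonzero[OF kmatch])
  show "inj_on (image col) (set kmatch)" using kedge_inj(2) by (simp add: kmatch_def)
  show "card (col ` U) = 2" if "U \<in> set kmatch" for U
    using that by (auto simp: kmatch_def set_kpairs kedge_colours)
qed

lemma isum_free_on:
  fixes v :: "'k::field_char_0 lam"
  assumes "v \<in> free_on (decomp2 X)"
  shows "isum relab \<chi> (cperm X f) v \<in> free_on (decomp2 X)"
proof (rule R.isum_mem[OF subspace_free_on _ assms])
  fix p and w :: "'k lam" assume "p \<in> cperm X f" "w \<in> free_on (decomp2 X)"
  then show "relab p w \<in> free_on (decomp2 X)"
    using relab_free_on[of p X w] cperm_permutes permutes_inj_on permutes_image by metis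
qed

lemma y0_free_on: "y0 \<in> free_on (decomp2 cells)"
  unfolding y0_def by (intro isum_free_on single_free_on kmatch)

lemma y0_antisym: "q \<in> cperm cells col \<Longrightarrow> relab q y0 = fscale (sg q) y0"
  unfolding y0_def by (rule R.isum_left[OF lin_char_sg[OF finite_cells]])

lemma moved_class_big:
  assumes "z \<in> cells" "i < l" "i \<noteq> col z"
  shows "card {x \<in> cells. (col(z := i)) x = i} > l - 1"
proof -
  have "{x \<in> cells. (col(z := i)) x = i} = insert z {x \<in> cells. col x = i}" using assms by auto
  then show ?thesis using assms card_col_class[OF assms(2)] by simp
qed

text \<open>Moving \<open>z\<close> into the column \<open>i\<close> produces a colour class with \<open>l\<close> elements.\<close>

lemma y0_garnir:
  assumes "z \<in> cells" "i < l" "i \<noteq> col z"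
  shows "isum relab sg (cperm cells (col(z := i))) (y0 :: 'k::field_char_0 lam) \<in> lam_rel cells"
proof (rule isum_alt_big_class[OF _ assms(2) moved_class_big[OF assms] y0_free_on])
  show "(col(z := i)) ` cells \<subseteq> {..<l}" using col_less assms by auto
qed

lemma y0_row:
  obtains t where "t permutes cells" "isum relab (\<lambda>_. 1) (cperm cells row) (relab t (y0 :: 'k::field_char_0 lam)) \<notin> lam_rel cells"
proof (rule R.row_symmetrizer_nonzero[of cells "l - 1" l col row "lam_rel cells" "y0 :: 'k lam"])
  show "isum relab sg (cperm cells (col(z := i))) (y0 :: 'k lam) \<in> lam_rel cells"
    if "z \<in> cells" "i < col z" for z i
    using y0_garnir[of z i] that col_less[of z] by (metis less_irrefl order_less_trans)
  show "isum relab (\<lambda>_. 1) (cperm cells f) (y0 :: 'k lam) \<in> lam_rel cells"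
    if "f ` cells \<subseteq> {..<l - 1}" "i < l - 1" "l < card {x \<in> cells. f x = i}" for f i
    using that by (intro isum_sym_big_class[OF that(1,2) _ y0_free_on]) simp
  show "row x < l - 1" if "x \<in> cells" for x using that by (rule row_less)
qed (auto simp: card_cells inj_grid col_less subspace_lam_rel y0_antisym y0_nonzero intro: relab_lam_rel_permutes)

section \<open>Contractions of the antisymmetrized matching\<close>

text \<open>The contraction is antisymmetric under the permutations of the remaining cells that
  preserve the columns, while the column of \<open>u\<close> and \<open>v\<close> has become too short compared to the
  others. So \<open>isum_alt_deficient\<close> applies to a nonzero multiple of it.\<close>

lemma y0_contract_same:
  assumes uv: "u \<in> cells" "v \<in> cells" "u \<noteq> v" "col u = col v"
  shows "contraction u v (y0 :: 'k::field_char_0 lam) \<in> lam_rel (cells - {u, v})"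
proof -
  let ?X = "cells - {u, v}" and ?C = "cperm (cells - {u, v}) col"
  let ?w = "contraction u v (y0 :: 'k lam)"
  have free: "?w \<in> free_on (decomp2 ?X)" by (rule contraction_free_on[OF y0_free_on uv(1,2)])
  have "relab q ?w = fscale (sg q) ?w" if q: "q \<in> ?C" for q
  proof -
    have p: "q permutes ?X" using q by (rule cperm_permutes)
    have quv: "q u = u" "q v = v" using permutes_not_in[OF p] by auto
    have pc: "q permutes cells" using p by (rule permutes_subset) auto
    have "col (q x) = col x" if "x \<in> cells" for x
      using that cperm_colour[OF q, of x] quv by (cases "x \<in> {u, v}") auto
    then have qc: "q \<in> cperm cells col"
      using pc by (simp add: cperm_def)
    have "relab q ?w = contraction (q u) (q v) (relab q y0)"
      by (rule contraction_relab[OF y0_free_on permutes_inj_on[OF pc] uv(1,2), symmetric])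
    also have "\<dots> = fscale (sg q) ?w"
      unfolding quv y0_antisym[OF qc] by (rule flin_scale[OF flin_contraction])
    finally show ?thesis .
  qed
  then have "isum relab sg ?C ?w = fscale (of_nat (card ?C)) ?w"
    by (intro R.isum_equivariant) (auto simp: sg_square)
  moreover have "isum relab sg ?C ?w \<in> lam_rel ?X"
  proof (rule isum_alt_deficient[OF _ _ col_less[of u] _ _ free])
    show "col ` ?X \<subseteq> {..<l}" using col_less by auto
    have "{x \<in> ?X. col x = col u} = {x \<in> cells. col x = col u} - {u, v}" by auto
    then have "card {x \<in> ?X. col x = col u} = l - 1 - 2"
      using uv card_col_class[OF col_less, of u] by (simp add: card_Diff_subset)
    moreover have "card {u, v} \<le> card {x \<in> cells. col x = col u}" using uv by (intro card_mono) auto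
    ultimately show "card {x \<in> ?X. col x = col u} < l - 1"
      using uv(3) card_col_class[OF col_less, of u] by simp
    show "l - 1 \<le> card {x \<in> ?X. col x = c}" if "c < l" "c \<noteq> col u" for c
    proof -
      have "{x \<in> ?X. col x = c} = {x \<in> cells. col x = c}" using that uv by auto
      then show ?thesis using card_col_class[OF that(1)] by simp
    qed
  qed simp
  moreover have "card ?C \<noteq> 0" by (metis card_0_eq cperm_id empty_iff finite_Diff finite_cells finite_cperm)
  ultimately show ?thesis by (metis of_nat_eq_0_iff subspace_lam_rel subspace_scale_cancel)
qed

text \<open>For \<open>u\<close> and \<open>v\<close> in different columns, the Garnir relation that moves \<open>v\<close> into the column of
  \<open>u\<close> reduces the contraction to contractions within one column, and to its own negative.\<close>

lemma y0_contract:
  assumes uv: "u \<in> cells" "v \<in> cells" "u \<noteq> v"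
  shows "contraction u v (y0 :: 'k::field_char_0 lam) \<in> lam_rel (cells - {u, v})"
proof (cases "col u = col v")
  case True
  with uv show ?thesis by (rule y0_contract_same)
next
  case False
  let ?W = "lam_rel (cells - {u, v}) :: 'k lam set"
  let ?B = "{x \<in> cells. col x = col u}"
  have "(y0 :: 'k lam) - (\<Sum>x\<in>?B. relab (transpose x v) y0) \<in> lam_rel cells"
    by (rule R.garnir[OF finite_cells uv(2) False subspace_lam_rel y0_antisym y0_garnir[OF uv(2) col_less False]])
  then have 1: "contraction u v (y0 - (\<Sum>x\<in>?B. relab (transpose x v) y0)) \<in> ?W"
    by (rule contraction_lam_rel[OF _ uv(1,2)])
  have other: "contraction u v (relab (transpose x v) y0) \<in> ?W" if "x \<in> ?B - {u}" for x
  proof -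
    have x: "x \<in> cells" "x \<noteq> u" "x \<noteq> v" "col u = col x" using that False by auto
    have t: "transpose x v permutes cells" using x uv by (intro permutes_swap_id)
    have e: "contraction (transpose x v u) (transpose x v x) (relab (transpose x v) y0)
        = relab (transpose x v) (contraction u x (y0 :: 'k lam))"
      by (rule contraction_relab[OF y0_free_on permutes_inj_on[OF t] uv(1) x(1)])
    have tu: "transpose x v u = u" using x uv by (auto simp: transpose_def)
    have img: "transpose x v ` (cells - {u, x}) = cells - {u, v}"
    proof -
      have "transpose x v ` (cells - {u, x}) = transpose x v ` cells - transpose x v ` {u, x}"
        by (rule image_set_diff) simp
      then show ?thesis using permutes_image[OF t] tu by simp
    qed
    have "contraction u x (y0 :: 'k lam) \<in> lam_rel (cells - {u, x})"
      by (rule y0_contract_same) (use uv x in auto)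
    then have "relab (transpose x v) (contraction u x (y0 :: 'k lam)) \<in> lam_rel (transpose x v ` (cells - {u, x}))"
      by (rule relab_lam_rel[rotated]) simp
    then show ?thesis using e tu img by simp
  qed
  have self: "contraction u v (relab (transpose u v) y0) = - contraction u v (y0 :: 'k lam)"
  proof -
    have t: "transpose u v permutes cells" using uv by (intro permutes_swap_id)
    have "contraction (transpose u v v) (transpose u v u) (relab (transpose u v) y0)
        = relab (transpose u v) (contraction v u (y0 :: 'k lam))"
      by (rule contraction_relab[OF y0_free_on permutes_inj_on[OF t] uv(2,1)])
    also have "\<dots> = relab id (contraction v u y0)"
    proof (rule relab_cong)
      show "contraction v u y0 \<in> free_on (decomp2 (cells - {v, u}))"
        by (rule contraction_free_on[OF y0_free_on uv(2,1)])
    qed (auto simp: transpose_def)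
    finally show ?thesis by (simp add: relab_id contraction_skew[of v u])
  qed
  have B: "?B = insert u (?B - {u})" using uv by auto
  have "(\<Sum>x\<in>?B. contraction u v (relab (transpose x v) (y0 :: 'k lam)))
      = - contraction u v y0 + (\<Sum>x\<in>?B - {u}. contraction u v (relab (transpose x v) y0))"
    by (subst B, subst sum.insert) (auto simp: self)
  then have "contraction u v (y0 - (\<Sum>x\<in>?B. relab (transpose x v) (y0 :: 'k lam)))
      = (contraction u v y0 + contraction u v y0) - (\<Sum>x\<in>?B - {u}. contraction u v (relab (transpose x v) y0))"
    by (simp add: flin_diff[OF flin_contraction] flin_sum[OF flin_contraction])
  moreover have "(\<Sum>x\<in>?B - {u}. contraction u v (relab (transpose x v) (y0 :: 'k lam))) \<in> ?W"
    by (intro fv.subspace_sum[OF subspace_lam_rel] other)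
  ultimately have "contraction u v (y0 :: 'k lam) + contraction u v y0 \<in> ?W"
    using fv.subspace_add[OF subspace_lam_rel 1] by fastforce
  then show ?thesis by (rule subspace_half[OF subspace_lam_rel])
qed

end

section \<open>The group algebra and the Young symmetrizer\<close>

definition lmul :: "(nat \<Rightarrow> nat) \<Rightarrow> 'k::field bij_sp \<Rightarrow> 'k bij_sp" where
  "lmul p = lin_ext fscale (\<lambda>q. Poly_Mapping.single (p \<circ> q) 1)"

lemma flin_lmul: "flin (lmul p)"
  unfolding lmul_def by (rule flin_lin_ext)

lemma lmul_single [simp]: "lmul p (Poly_Mapping.single q c) = Poly_Mapping.single (p \<circ> q) c"
  by (simp add: lmul_def fscale_single)

lemma lmul_comp: "lmul (p \<circ> q) v = lmul p (lmul q v)"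
  by (rule flin_eq[OF flin_lmul flin_comp[OF flin_lmul flin_lmul] _ free_on_UNIV]) (simp add: comp_assoc)

lemma lmul_id: "lmul id v = v"
  by (rule flin_eq[OF flin_lmul flin_id _ free_on_UNIV]) simp

interpretation L: perm_rep "lmul :: (nat \<Rightarrow> nat) \<Rightarrow> 'k::field_char_0 bij_sp \<Rightarrow> 'k bij_sp"
  by (rule perm_rep.intro) (fact flin_lmul lmul_comp lmul_id)+

lemma grp_mult_lmul: "grp_mult a x = lin_ext fscale (\<lambda>p. lmul p x) a"
  by (simp add: grp_mult_def bilin_ext_def lmul_def)

lemma grp_mult_left: "flin (\<lambda>a. grp_mult a x)"
  unfolding grp_mult_lmul by (rule flin_lin_ext)

lemma grp_mult_right: "flin (grp_mult a)"
  unfolding grp_mult_lmul by (intro lin_ext_fun_lin flin_lmul)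

lemma grp_mult_single [simp]: "grp_mult (Poly_Mapping.single p 1) x = lmul p x"
  by (simp add: grp_mult_lmul)

lemma lmul_grp_mult: "lmul p (grp_mult a x) = grp_mult (lmul p a) x"
proof -
  have "flin (\<lambda>a. lmul p (grp_mult a x))" "flin (\<lambda>a. grp_mult (lmul p a) x)"
    using flin_comp[OF flin_lmul grp_mult_left] flin_comp[OF grp_mult_left flin_lmul] by auto
  then show ?thesis
    by (rule flin_eq[OF _ _ _ free_on_UNIV]) (simp add: lmul_comp[symmetric])
qed

lemma grp_mult_assoc: "grp_mult (grp_mult a b) x = grp_mult a (grp_mult b x)"
proof -
  have "flin (\<lambda>a. grp_mult (grp_mult a b) x)" by (rule flin_comp[OF grp_mult_left grp_mult_left])
  then show ?thesis
    by (rule flin_eq[OF _ grp_mult_left _ free_on_UNIV]) (simp add: lmul_grp_mult)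
qed

lemma isum_lmul_grp_mult: "isum lmul \<chi> G (grp_mult a x) = grp_mult (isum lmul \<chi> G a) x"
  by (simp add: isum_def flin_sum[OF grp_mult_left] flin_scale[OF grp_mult_left] lmul_grp_mult)

definition aact :: "'k::field bij_sp \<Rightarrow> 'k lam \<Rightarrow> 'k lam" where
  "aact a v = lin_ext fscale (\<lambda>p. relab p v) a"

lemma aact_left: "flin (\<lambda>a. aact a v)"
  unfolding aact_def by (rule flin_lin_ext)

lemma aact_single [simp]: "aact (Poly_Mapping.single p 1) v = relab p v"
  by (simp add: aact_def)

lemma aact_lmul: "aact (lmul p a) v = relab p (aact a v)"
  by (rule flin_eq[OF flin_comp[OF aact_left flin_lmul] flin_comp[OF flin_relab aact_left] _ free_on_UNIV])
    (simp add: relab_comp)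

lemma aact_grp_mult: "aact (grp_mult a b) v = aact a (aact b v)"
  by (rule flin_eq[OF flin_comp[OF aact_left grp_mult_left] aact_left _ free_on_UNIV])
    (simp add: aact_lmul)

lemma lookup_lmul:
  assumes "bij p" shows "Poly_Mapping.lookup (lmul p x) g = Poly_Mapping.lookup x (inv p \<circ> g)"
proof -
  have e: "p \<circ> q = g \<longleftrightarrow> q = inv p \<circ> g" for q
    using assms by (metis bij_is_inj bij_is_surj comp_assoc id_comp inv_o_cancel surj_iff)
  have "Poly_Mapping.lookup (lmul p x) g
      = (\<Sum>q\<in>Poly_Mapping.keys x. if q = inv p \<circ> g then Poly_Mapping.lookup x q else 0)"
    unfolding lmul_def lin_ext_def lookup_sum
    by (rule sum.cong) (auto simp: fscale_single lookup_single when_def e)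
  then show ?thesis by (simp add: sum.delta in_keys_iff)
qed

lemma lookup_rmul:
  assumes "bij q"
  shows "Poly_Mapping.lookup (grp_mult x (Poly_Mapping.single q 1)) g = Poly_Mapping.lookup x (g \<circ> inv q)"
proof -
  have e: "p \<circ> q = g \<longleftrightarrow> p = g \<circ> inv q" for p
    using assms by (metis bij_is_inj bij_is_surj comp_assoc comp_id inv_o_cancel surj_iff)
  have "Poly_Mapping.lookup (grp_mult x (Poly_Mapping.single q 1)) g
      = (\<Sum>p\<in>Poly_Mapping.keys x. if p = g \<circ> inv q then Poly_Mapping.lookup x p else 0)"
    unfolding grp_mult_lmul lin_ext_def lookup_sum
    by (rule sum.cong) (auto simp: fscale_single lookup_single when_def e)
  then show ?thesis by (simp add: sum.delta in_keys_iff)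
qed

context grid begin

definition perms :: "'k::field bij_sp set" where "perms = free_on {p. p permutes cells}"

text \<open>The row symmetrizer \<open>\<alpha>\<close> and the column antisymmetrizer \<open>\<beta>\<close> of the grid; their product is
  the Young symmetrizer.\<close>

definition \<alpha> :: "'k::field_char_0 bij_sp" where
  "\<alpha> = isum lmul (\<lambda>_. 1) (cperm cells row) (Poly_Mapping.single id 1)"

definition \<beta> :: "'k::field_char_0 bij_sp" where
  "\<beta> = isum lmul sg (cperm cells col) (Poly_Mapping.single id 1)"

lemma subspace_perms: "fv.subspace perms" unfolding perms_def by (rule subspace_free_on)

lemma single_perms: "p permutes cells \<Longrightarrow> Poly_Mapping.single p c \<in> perms"
  unfolding perms_def by (rule single_free_on) simp

lemma lmul_perms: "p permutes cells \<Longrightarrow> a \<in> perms \<Longrightarrow> lmul p a \<in> perms"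
  unfolding perms_def
  by (rule flin_mem[OF flin_lmul subspace_free_on]) (auto intro!: single_free_on permutes_compose)

lemma grp_mult_perms: "a \<in> perms \<Longrightarrow> b \<in> perms \<Longrightarrow> grp_mult a b \<in> perms"
  unfolding grp_mult_lmul perms_def
  by (rule lin_ext_mem[OF subspace_free_on]) (use lmul_perms in \<open>auto simp: perms_def\<close>)

lemma \<alpha>_perms: "\<alpha> \<in> perms" and \<beta>_perms: "\<beta> \<in> perms"
  unfolding \<alpha>_def \<beta>_def
  by (auto intro!: L.isum_mem[OF subspace_perms] lmul_perms single_perms dest: cperm_permutes simp: permutes_id)

lemma grp_mult_\<alpha>: "grp_mult \<alpha> x = isum lmul (\<lambda>_. 1) (cperm cells row) x"
  by (simp add: \<alpha>_def isum_lmul_grp_mult[symmetric] lmul_id)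

lemma grp_mult_\<beta>: "grp_mult \<beta> x = isum lmul sg (cperm cells col) x"
  by (simp add: \<beta>_def isum_lmul_grp_mult[symmetric] lmul_id)

lemma aact_\<alpha>: "aact \<alpha> v = isum relab (\<lambda>_. 1) (cperm cells row) v"
  by (simp add: \<alpha>_def isum_def flin_sum[OF aact_left])

lemma aact_\<beta>: "aact \<beta> v = isum relab sg (cperm cells col) v"
  unfolding \<beta>_def isum_def
  by (simp add: flin_sum[OF aact_left] flin_scale[OF aact_left] fscale_single[symmetric, of _ _ 1])

lemma \<alpha>_row: "p \<in> cperm cells row \<Longrightarrow> grp_mult \<alpha> (lmul p x) = grp_mult \<alpha> x"
  unfolding grp_mult_\<alpha> by (simp add: L.isum_right[OF lin_char_one])

lemma \<alpha>_row_left: "p \<in> cperm cells row \<Longrightarrow> lmul p \<alpha> = \<alpha>"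
  unfolding \<alpha>_def by (simp add: L.isum_left[OF lin_char_one])

lemma \<beta>_col: "q \<in> cperm cells col \<Longrightarrow> lmul q \<beta> = fscale (sg q) \<beta>"
  unfolding \<beta>_def by (rule L.isum_left[OF lin_char_sg[OF finite_cells]])

lemma transpose_conjugate:
  assumes "t permutes X"
  shows "transpose x y \<circ> t = t \<circ> transpose (inv t x) (inv t y)"
proof
  fix w
  have e: "w = inv t a \<longleftrightarrow> t w = a" for a using permutes_inv_eq[OF assms, of a w] by auto
  show "(transpose x y \<circ> t) w = (t \<circ> transpose (inv t x) (inv t y)) w"
    unfolding comp_apply transpose_def e by (simp add: permutes_inverses(1)[OF assms])
qed

text \<open>Young's lemma. For a rectangle it is a counting argument: if no row contains two cells of the
  same \<open>t\<close>-translated column, then each row meets each translated column exactly once, so that \<open>t\<close>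
  is the product of a row permutation and a column permutation.\<close>

lemma young_permutation:
  assumes t: "t permutes cells"
  shows "grp_mult \<alpha> (lmul t \<beta>) \<in> fv.span {grp_mult \<alpha> (\<beta> :: 'k::field_char_0 bij_sp)}"
proof (cases "inj_on (\<lambda>x. (row x, col (inv t x))) cells")
  case False
  then obtain x y where xy: "x \<in> cells" "y \<in> cells" "x \<noteq> y" "row x = row y" "col (inv t x) = col (inv t y)"
    unfolding inj_on_def by auto
  have ti: "inv t x \<in> cells" "inv t y \<in> cells" "inv t x \<noteq> inv t y"
    using xy permutes_in_image[OF permutes_inv[OF t]] permutes_inverses(1)[OF t] by (auto, metis)
  have s: "transpose (inv t x) (inv t y) \<in> cperm cells col" by (rule cperm_transpose[OF ti(1,2) xy(5)])
  have "grp_mult \<alpha> (lmul t \<beta>) = grp_mult \<alpha> (lmul (transpose x y) (lmul t (\<beta> :: 'k bij_sp)))"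
    by (rule \<alpha>_row[symmetric, OF cperm_transpose[OF xy(1,2,4)]])
  also have "\<dots> = grp_mult \<alpha> (lmul t (lmul (transpose (inv t x) (inv t y)) \<beta>))"
    unfolding lmul_comp[symmetric] transpose_conjugate[OF t] ..
  also have "\<dots> = - grp_mult \<alpha> (lmul t \<beta>)"
    unfolding \<beta>_col[OF s] using ti(3)
    by (simp add: sign_swap_id fscale_minus1 flin_neg[OF flin_lmul] flin_neg[OF grp_mult_right])
  finally have "grp_mult \<alpha> (lmul t \<beta>) + grp_mult \<alpha> (lmul t (\<beta> :: 'k bij_sp)) \<in> {0}" by simp
  then have "grp_mult \<alpha> (lmul t \<beta>) \<in> {0 :: 'k bij_sp}"
    by (rule subspace_half[OF fv.subspace_single_0])
  then show ?thesis using fv.span_zero by auto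
next
  case True
  let ?P = "{..<l - 1} \<times> {..<l}"
  have cardP: "card ?P = card cells" by (simp add: card_cells)
  have img: "f ` cells = ?P" if "inj_on f cells" "f ` cells \<subseteq> ?P" for f :: "nat \<Rightarrow> nat \<times> nat"
    by (rule card_subset_eq[OF _ that(2)]) (use card_image[OF that(1)] cardP in auto)
  have inj2: "inj_on (\<lambda>x. (row x, col x)) cells" using inj_grid by (auto simp: inj_on_def)
  have "image_mset (\<lambda>x. (row x, col x)) (mset_set cells) = mset_set ?P"
    unfolding image_mset_mset_set[OF inj2] using img[OF inj2] row_less col_less by auto
  moreover have "image_mset (\<lambda>x. (row x, col (inv t x))) (mset_set cells) = mset_set ?P"
    unfolding image_mset_mset_set[OF True] using img[OF True] row_less col_less by auto
  ultimately have "image_mset (\<lambda>x. (row x, col x)) (mset_set cells)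
     = image_mset (\<lambda>x. (row x, col (inv t x))) (mset_set cells)" by simp
  from image_mset_eq_implies_permutes[OF finite_cells this]
  obtain p where "p permutes cells"
    "\<forall>x\<in>cells. (row x, col x) = (row (p x), col (inv t (p x)))" by blast
  then have p: "p permutes cells"
    "\<And>x. x \<in> cells \<Longrightarrow> row x = row (p x) \<and> col x = col (inv t (p x))" by simp_all
  have pR: "p \<in> cperm cells row" using p by (simp add: cperm_def)
  define q where "q = inv t \<circ> p"
  have qC: "q \<in> cperm cells col"
    using p permutes_compose[OF p(1) permutes_inv[OF t]] by (simp add: cperm_def q_def)
  have tq: "t \<circ> q = p" unfolding q_def using permutes_inv_o[OF t] by (simp add: comp_assoc[symmetric])
  have "fscale (sg q) (grp_mult \<alpha> (lmul t \<beta>)) = grp_mult \<alpha> (lmul t (lmul q \<beta>))"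
    unfolding \<beta>_col[OF qC] by (simp add: flin_scale[OF flin_lmul] flin_scale[OF grp_mult_right])
  also have "\<dots> = grp_mult \<alpha> \<beta>" unfolding lmul_comp[symmetric] tq by (rule \<alpha>_row[OF pR])
  finally have e: "fscale (sg q) (grp_mult \<alpha> (lmul t \<beta>)) = grp_mult \<alpha> (\<beta> :: 'k bij_sp)" .
  have "grp_mult \<alpha> (lmul t \<beta>) = fscale (sg q) (grp_mult \<alpha> (\<beta> :: 'k bij_sp))"
    using arg_cong[OF e, of "fscale (sg q)"] by (simp only: fv.scale_scale sg_square fv.scale_one)
  then show ?thesis by (simp add: fv.span_scale fv.span_base)
qed

lemma young:
  assumes "x \<in> perms"
  obtains c where "grp_mult \<alpha> (grp_mult x \<beta>) = fscale c (grp_mult \<alpha> (\<beta> :: 'k::field_char_0 bij_sp))"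
proof -
  have "grp_mult \<alpha> (grp_mult x \<beta>) \<in> fv.span {grp_mult \<alpha> (\<beta> :: 'k bij_sp)}"
    by (rule flin_mem[OF flin_comp[OF grp_mult_right grp_mult_left] fv.subspace_span _ assms[unfolded perms_def]])
      (auto intro: young_permutation)
  then show ?thesis using that by (auto simp: fv.span_singleton)
qed

lemma aact_mem:
  fixes v :: "'k::field_char_0 lam"
  assumes "a \<in> perms" "v \<in> lam_rel cells" shows "aact a v \<in> lam_rel cells"
  unfolding aact_def
  by (rule lin_ext_mem[OF subspace_lam_rel _ assms(1)[unfolded perms_def]])
    (use relab_lam_rel_permutes assms(2) in blast)

lemma pigeonhole_colour:
  assumes "A \<subseteq> cells" "card A > m" "\<And>x. x \<in> A \<Longrightarrow> g x < m"
  obtains x y where "x \<in> A" "y \<in> A" "x \<noteq> y" "g x = (g y :: nat)"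
proof -
  have "\<not> inj_on g A"
  proof
    assume "inj_on g A"
    then have "card A \<le> card {..<m}" using assms(3) by (intro card_inj_on_le[of g]) auto
    then show False using assms(2) by simp
  qed
  then show ?thesis using that unfolding inj_on_def by blast
qed

text \<open>Among more than \<open>l - 1\<close> cells, two lie in a common row of a translated grid. Their
  transposition fixes the translated row symmetrizer and is odd.\<close>

lemma column_sum_kills_\<alpha>:
  assumes "x \<in> perms" "card {y \<in> cells. f y = i} > l - 1"
  shows "isum lmul sg (cperm cells f) (grp_mult x \<alpha>) = (0 :: 'k::field_char_0 bij_sp)"
proof -
  have "isum lmul sg (cperm cells f) (grp_mult x \<alpha>) \<in> {0 :: 'k bij_sp}"
  proof (rule flin_mem[OF flin_comp[OF L.isum_lin grp_mult_left] fv.subspace_single_0 _ assms(1)[unfolded perms_def]])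
    fix s assume "s \<in> {p. p permutes cells}"
    then have s: "s permutes cells" by simp
    obtain x y where "x \<in> {y \<in> cells. f y = i}" "y \<in> {y \<in> cells. f y = i}"
      and ne: "x \<noteq> y" and r: "row (inv s x) = row (inv s y)"
    proof (rule pigeonhole_colour[of "{y \<in> cells. f y = i}" "l - 1" "\<lambda>x. row (inv s x)"])
      show "row (inv s x) < l - 1" if "x \<in> {y \<in> cells. f y = i}" for x
        using that permutes_in_image[OF permutes_inv[OF s]] by (intro row_less) auto
    qed (use assms(2) in auto)
    then have xy: "x \<in> cells" "y \<in> cells" "f x = f y" by auto
    have R: "transpose (inv s x) (inv s y) \<in> cperm cells row"
      using xy r permutes_in_image[OF permutes_inv[OF s]] by (intro cperm_transpose) auto
    have "lmul (transpose x y) (lmul s \<alpha>) = lmul s (\<alpha> :: 'k bij_sp)"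
      unfolding lmul_comp[symmetric] transpose_conjugate[OF s]
      unfolding lmul_comp \<alpha>_row_left[OF R] ..
    then have "lmul (transpose x y) (lmul s \<alpha>) + fscale (sg (transpose x y)) (lmul s \<alpha>) \<in> {0 :: 'k bij_sp}"
      using ne by (simp add: sign_swap_id fscale_minus1)
    then show "isum lmul sg (cperm cells f) (grp_mult (Poly_Mapping.single s 1) \<alpha>) \<in> {0 :: 'k bij_sp}"
      unfolding grp_mult_single
      by (intro L.isum_kill[OF fv.subspace_single_0 _ lin_char_sg[OF finite_cells] cperm_transpose[OF xy]])
        (simp_all add: L.rho_0)
  qed
  then show ?thesis by simp
qed

text \<open>A translate of \<open>z\<close> has a nonzero coefficient at the identity. Since \<open>z\<close> is a right
  multiple of \<open>\<beta>\<close>, its coefficients at column permutations are this coefficient up to the sign,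
  and the multiplication by \<open>\<beta>\<close> adds them without cancellation.\<close>

lemma \<beta>_translate_nonzero:
  assumes z: "z = grp_mult w (\<beta> :: 'k::field_char_0 bij_sp)" "w \<in> perms" "z \<noteq> 0"
  obtains u where "u permutes cells" "grp_mult \<beta> (lmul u z) \<noteq> 0"
proof -
  let ?C = "cperm cells col"
  have "z \<in> perms" using z \<beta>_perms grp_mult_perms by auto
  moreover obtain g where g: "Poly_Mapping.lookup z g \<noteq> 0" using z(3) by (metis lookup_zero poly_mapping_eqI)
  ultimately have gp: "g permutes cells" by (auto simp: perms_def free_on_def in_keys_iff)
  (* Translation by the inverse of g moves the nonzero coefficient at g to the identity. *)
  define u where "u = inv g"
  have up: "u permutes cells" unfolding u_def by (rule permutes_inv[OF gp])
  define s where "s = lmul u z"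
  define w' where "w' = lmul u w"
  have s: "s = grp_mult w' \<beta>" by (simp add: s_def w'_def z(1) lmul_grp_mult)
  have s1: "Poly_Mapping.lookup s id \<noteq> 0"
    unfolding s_def lookup_lmul[OF permutes_bij[OF up]] using g permutes_inv_inv[OF gp] by (simp add: u_def)
  have ls: "Poly_Mapping.lookup s h = (\<Sum>q\<in>?C. sg q * Poly_Mapping.lookup w' (h \<circ> inv q))" for h
    unfolding s \<beta>_def isum_def flin_sum[OF grp_mult_right] flin_scale[OF grp_mult_right] lookup_sum lookup_fscale lmul_single comp_id
    by (intro sum.cong refl) (simp add: lookup_rmul[OF permutes_bij[OF cperm_permutes]])
  have inv: "Poly_Mapping.lookup s (inv p) = sg p * Poly_Mapping.lookup s id" if p: "p \<in> ?C" for p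
  proof -
    have "Poly_Mapping.lookup s (inv p) = (\<Sum>q\<in>?C. sg p * (sg (q \<circ> p) * Poly_Mapping.lookup w' (id \<circ> inv (q \<circ> p))))"
      unfolding ls
    proof (intro sum.cong refl)
      fix q assume q: "q \<in> ?C"
      have "inv (q \<circ> p) = inv p \<circ> inv q"
        using p q by (intro o_inv_distrib) (auto intro: permutes_bij cperm_permutes)
      moreover have "(sg (q \<circ> p) :: 'k) = sg q * sg p"
        by (rule sg_compose[OF finite_cells cperm_permutes[OF q] cperm_permutes[OF p]])
      moreover have "(sg p :: 'k) * (sg q * sg p) = sg q"
        by (metis mult.assoc mult.commute mult.right_neutral sg_square)
      ultimately show "sg q * Poly_Mapping.lookup w' (inv p \<circ> inv q)
         = sg p * (sg (q \<circ> p) * Poly_Mapping.lookup w' (id \<circ> inv (q \<circ> p)))"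
        by (simp add: mult.assoc[symmetric])
    qed
    also have "\<dots> = sg p * Poly_Mapping.lookup s id"
      unfolding sum_distrib_left[symmetric] ls
      by (rule arg_cong[where f = "\<lambda>x. sg p * x"],
          rule cperm_sum_right[OF p, of "\<lambda>q. sg q * Poly_Mapping.lookup w' (id \<circ> inv q)"])
    finally show ?thesis .
  qed
  have "Poly_Mapping.lookup (grp_mult \<beta> s) id = (\<Sum>q\<in>?C. sg q * Poly_Mapping.lookup s (inv q))"
    unfolding grp_mult_\<beta> isum_def lookup_sum lookup_fscale
    by (intro sum.cong refl) (simp add: lookup_lmul[OF permutes_bij[OF cperm_permutes]])
  also have "\<dots> = (\<Sum>q\<in>?C. Poly_Mapping.lookup s id)"
    by (intro sum.cong refl) (simp add: inv mult.assoc[symmetric] sg_square)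
  also have "\<dots> \<noteq> 0"
  proof -
    have "?C \<noteq> {}" using cperm_id by blast
    then have "card ?C \<noteq> 0" by simp
    then show ?thesis using s1 by simp
  qed
  finally have "grp_mult \<beta> s \<noteq> 0" by auto
  then show ?thesis using that[OF up] by (simp add: s_def)
qed

text \<open>The left factor \<open>\<beta>\<close> makes \<open>v\<close> antisymmetric in the columns, and the factor \<open>\<alpha>\<close> inside
  provides the Garnir relations.\<close>

lemma \<alpha>_translate_nonzero:
  assumes x: "x \<in> perms" and v: "v = grp_mult \<beta> (grp_mult x (grp_mult \<alpha> \<beta>))" "v \<noteq> (0 :: 'k::field_char_0 bij_sp)"
  obtains t where "t permutes cells" "grp_mult \<alpha> (lmul t v) \<noteq> 0"
proof (rule L.row_symmetrizer_nonzero[of cells "l - 1" l col row "{0}" v])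
  show anti: "lmul q v = fscale (sg q) v" if "q \<in> cperm cells col" for q
    using that unfolding v(1) lmul_grp_mult by (simp add: \<beta>_col flin_scale[OF grp_mult_left])
  show "isum lmul sg (cperm cells (col(z := i))) v \<in> {0}" if "z \<in> cells" "i < col z" for z i
  proof -
    have i: "i < l" "i \<noteq> col z" using that col_less[of z] by auto
    have vv: "v = grp_mult (grp_mult (grp_mult \<beta> x) \<alpha>) \<beta>" by (simp add: v(1) grp_mult_assoc)
    have "isum lmul sg (cperm cells (col(z := i))) v
        = grp_mult (isum lmul sg (cperm cells (col(z := i))) (grp_mult (grp_mult \<beta> x) \<alpha>)) \<beta>"
      unfolding vv by (rule isum_lmul_grp_mult)
    also have "\<dots> = 0"
      unfolding column_sum_kills_\<alpha>[OF grp_mult_perms[OF \<beta>_perms x] moved_class_big[OF that(1) i]]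
      by (rule flin_0[OF grp_mult_left])
    finally show ?thesis by simp
  qed
  show "isum lmul (\<lambda>_. 1) (cperm cells f) v \<in> {0}"
    if big: "f ` cells \<subseteq> {..<l - 1}" "i < l - 1" "l < card {x \<in> cells. f x = i}" for f i
  proof -
    obtain x y where "x \<in> {x \<in> cells. f x = i}" "y \<in> {x \<in> cells. f x = i}" "x \<noteq> y" "col x = col y"
      by (rule pigeonhole_colour[of "{x \<in> cells. f x = i}" l col]) (use big(3) col_less in auto)
    then have xy: "x \<in> cells" "y \<in> cells" "f x = f y" "x \<noteq> y" "col x = col y" by auto
    have "lmul (transpose x y) v + fscale 1 v \<in> {0}"
      using anti[OF cperm_transpose[OF xy(1,2,5)]] xy(4) by (simp add: sign_swap_id fscale_minus1)
    then show ?thesis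
      by (intro L.isum_kill[OF fv.subspace_single_0 _ lin_char_one cperm_transpose[OF xy(1-3)]])
        (simp_all add: L.rho_0)
  qed
  show "row x < l - 1" if "x \<in> cells" for x using that by (rule row_less)
  show thesis if "t permutes cells" "isum lmul (\<lambda>_. 1) (cperm cells row) (lmul t v) \<notin> {0}" for t
    using that(2) by (intro \<open>\<And>t. t permutes cells \<Longrightarrow> grp_mult \<alpha> (lmul t v) \<noteq> 0 \<Longrightarrow> thesis\<close>[OF that(1)])
      (simp add: grp_mult_\<alpha>)
qed (use v in \<open>auto simp: card_cells inj_grid col_less fv.subspace_single_0 L.rho_0\<close>)

lemma aact_\<beta>_kmatch: "aact \<beta> (edges kmatch) = y0"
  by (simp add: aact_\<beta> y0_def)

text \<open>By \<open>young\<close> all the elements \<open>\<alpha> t \<beta>\<close> are multiples of the Young symmetrizer, and by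
  \<open>y0_row\<close> one of them does not annihilate the matching.\<close>

lemma aact_young_nonzero:
  "aact (grp_mult \<alpha> \<beta>) (edges kmatch) \<notin> (lam_rel cells :: 'k::field_char_0 lam set)"
proof
  assume a: "aact (grp_mult \<alpha> \<beta>) (edges kmatch) \<in> (lam_rel cells :: 'k lam set)"
  obtain t where t: "t permutes cells"
    "isum relab (\<lambda>_. 1) (cperm cells row) (relab t (y0 :: 'k lam)) \<notin> lam_rel cells" by (rule y0_row)
  obtain c where c: "grp_mult \<alpha> (grp_mult (Poly_Mapping.single t 1) \<beta>) = fscale c (grp_mult \<alpha> (\<beta> :: 'k bij_sp))"
    by (rule young[OF single_perms[OF t(1)]])
  have "isum relab (\<lambda>_. 1) (cperm cells row) (relab t (y0 :: 'k lam))
      = aact (grp_mult \<alpha> (grp_mult (Poly_Mapping.single t 1) \<beta>)) (edges kmatch)"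
    by (simp only: aact_grp_mult aact_single aact_\<beta>_kmatch aact_\<alpha>)
  also have "\<dots> = fscale c (aact (grp_mult \<alpha> \<beta>) (edges kmatch))"
    unfolding c by (rule flin_scale[OF aact_left])
  also have "\<dots> \<in> lam_rel cells" using a by (rule fv.subspace_scale[OF subspace_lam_rel])
  finally show False using t(2) by contradiction
qed

text \<open>Every nonzero \<open>z\<close> in the left ideal can be multiplied from the left, first by \<open>\<beta> u\<close> and
  then by \<open>\<alpha> t\<close>, to a nonzero multiple of the Young symmetrizer, which acts nontrivially on the
  matching. This is the part of the simplicity of the Specht module that matters here.\<close>

lemma specht_injective:
  assumes w: "w \<in> perms" and z: "z = grp_mult w (grp_mult \<alpha> (\<beta> :: 'k::field_char_0 bij_sp))"
    and rel: "aact z (edges kmatch) \<in> lam_rel cells"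
  shows "z = 0"
proof (rule ccontr)
  assume nz: "z \<noteq> 0"
  have zb: "z = grp_mult (grp_mult w \<alpha>) \<beta>" by (simp add: z grp_mult_assoc)
  obtain u where u: "u permutes cells" "grp_mult \<beta> (lmul u z) \<noteq> 0"
    by (rule \<beta>_translate_nonzero[OF zb grp_mult_perms[OF w \<alpha>_perms] nz])
  have v: "grp_mult \<beta> (lmul u z) = grp_mult \<beta> (grp_mult (lmul u w) (grp_mult \<alpha> \<beta>))"
    by (simp add: z lmul_grp_mult)
  obtain t where t: "t permutes cells" "grp_mult \<alpha> (lmul t (grp_mult \<beta> (lmul u z))) \<noteq> 0"
    by (rule \<alpha>_translate_nonzero[OF lmul_perms[OF u(1) w] v u(2)])
  define x where "x = lmul t (grp_mult \<beta> (lmul u (grp_mult w \<alpha>)))"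
  have "x \<in> perms"
    unfolding x_def by (intro lmul_perms grp_mult_perms \<beta>_perms \<alpha>_perms w t(1) u(1))
  then obtain c where c: "grp_mult \<alpha> (grp_mult x \<beta>) = fscale c (grp_mult \<alpha> (\<beta> :: 'k bij_sp))"
    by (rule young)
  have eq: "grp_mult \<alpha> (lmul t (grp_mult \<beta> (lmul u z))) = grp_mult \<alpha> (grp_mult x \<beta>)"
    by (simp add: x_def zb lmul_grp_mult grp_mult_assoc)
  then have c0: "c \<noteq> 0" using t(2) c by auto
  have "fscale c (aact (grp_mult \<alpha> \<beta>) (edges kmatch)) = aact (grp_mult \<alpha> (lmul t (grp_mult \<beta> (lmul u z)))) (edges kmatch)"
    unfolding eq c by (rule flin_scale[OF aact_left, symmetric])
  also have "\<dots> = aact \<alpha> (relab t (aact \<beta> (relab u (aact z (edges kmatch)))))"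
    by (simp only: aact_grp_mult aact_lmul)
  also have "\<dots> \<in> lam_rel cells"
    by (intro aact_mem \<alpha>_perms \<beta>_perms relab_lam_rel_permutes t(1) u(1) rel)
  finally show False
    using subspace_scale_cancel[OF subspace_lam_rel _ c0] aact_young_nonzero by blast
qed

end

section \<open>Morphisms of the twisted Brauer categories\<close>

lemma db_simps [simp]:
  "obj (db e d) = {X. finite X}"
  "hom (db e d) X Y = ub_quot e d Y X ` free_on (D Y X)"
  "cmp (db e d) X Y Z g f = ub_quot e d Z X
     (bilin_ext fscale (\<lambda>g' f'. Poly_Mapping.single (D_comp Z Y X g' f') 1) f g)"
  "hscale (db e d) = fscale"
  by (simp_all add: db_def opposite_def ub_def)

lemma P_simps [simp]:
  "sp (P X) Y = free_on {p \<in> extensional X. bij_betw p X Y}"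
  "mscale (P X) = fscale"
  by (simp_all add: P_def)

lemma act_P: "act (P X) Y Z = (if card Y = card Z
       then bilin_ext fscale (\<lambda>b p. Poly_Mapping.single
              (restrict (\<lambda>x. inv_into Z (b \<circ> Inl) (p x)) X) 1)
       else (\<lambda>_ _. 0))"
  by (simp add: P_def)

lemma Lambda_simps [simp]:
  "sp Lambda_C X = quot_map fscale (lam_rel X) ` free_on (decomp2 X)"
  "mscale Lambda_C = fscale"
  by (simp_all add: Lambda_C_def)

lemma act_Lambda: "act Lambda_C X Z \<phi> y = quot_map fscale (lam_rel Z)
       (lin_ext fscale (\<lambda>b. relabel b Z (contract_pairs b ((card X - card Z) div 2) y)) \<phi>)"
  by (simp add: Lambda_C_def)

lemma D_bij: "b \<in> D Z X \<Longrightarrow> bij_betw b (Z <+> {1..card X - card Z}) X"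
  and D_card: "b \<in> D Z X \<Longrightarrow> card Z \<le> card X" "b \<in> D Z X \<Longrightarrow> 2 * ((card X - card Z) div 2) = card X - card Z"
  by (auto simp: D_def)

lemma D_image: "b \<in> D Z X \<Longrightarrow> b ` (Z <+> {1..2 * ((card X - card Z) div 2)}) = X"
  using D_bij[of b Z X] D_card(2)[of b Z X] by (simp add: bij_betw_def)

lemma D_inj: "b \<in> D Z X \<Longrightarrow> inj_on b (Z <+> {1..2 * ((card X - card Z) div 2)})"
  using D_bij[of b Z X] D_card(2)[of b Z X] by (simp add: bij_betw_def)

lemma subspace_ub_rel: "fv.subspace (ub_rel e d X Y)"
  by (simp add: ub_rel_def)

lemma D_permute_pairs:
  assumes "b \<in> D X Y" "h permutes {1..card Y - card X}"
  shows "case_sum (b \<circ> Inl) (b \<circ> Inr \<circ> h) \<in> D X Y"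
proof -
  let ?I = "{1..card Y - card X}"
  let ?g = "case_sum Inl (Inr \<circ> h) :: nat + nat \<Rightarrow> nat + nat"
  have bh: "case_sum (b \<circ> Inl) (b \<circ> Inr \<circ> h) = b \<circ> ?g" by (auto simp: fun_eq_iff split: sum.split)
  have h: "h ` ?I = ?I" "inj h" using permutes_image permutes_inj assms(2) by auto
  have "bij_betw ?g (X <+> ?I) (X <+> ?I)"
  proof (rule bij_betw_imageI)
    show "inj_on ?g (X <+> ?I)" using h(2) by (auto simp: inj_on_def dest: injD split: sum.splits)
    have "?g ` (X <+> ?I) = X <+> h ` ?I" by (auto simp: Plus_def image_Un image_image)
    then show "?g ` (X <+> ?I) = X <+> ?I" by (simp only: h(1))
  qed
  then have "bij_betw (b \<circ> ?g) (X <+> ?I) Y" using assms(1) by (auto simp: D_def intro: bij_betw_trans)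
  moreover have "b \<circ> ?g \<in> extensional (X <+> ?I)"
  proof (unfold extensional_def, clarify)
    fix x assume x: "x \<notin> X <+> ?I"
    then have "?g x = x" using permutes_not_in[OF assms(2)] by (cases x) (auto simp: Plus_def image_iff)
    with x show "(b \<circ> ?g) x = undefined" using assms(1) by (simp add: D_def extensional_def)
  qed
  ultimately show ?thesis using assms(1) unfolding bh D_def mem_Collect_eq by blast
qed

lemma ub_rel_free_on: "ub_rel e d X Y \<subseteq> free_on (D X Y)"
  unfolding ub_rel_def
proof (rule fv.span_minimal[OF _ subspace_free_on], clarify)
  fix b h assume b: "b \<in> D X Y" and h: "h \<in> wreath ((card Y - card X) div 2)"
  have "h permutes {1..card Y - card X}" using h D_card(2)[OF b] by (simp add: wreath_def)
  from D_permute_pairs[OF b this]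
  show "Poly_Mapping.single (case_sum (b \<circ> Inl) (b \<circ> Inr \<circ> h)) 1
        - Poly_Mapping.single b (of_int (twist e d ((card Y - card X) div 2) h)) \<in> free_on (D X Y)"
    using b by (intro fv.subspace_diff subspace_free_on single_free_on)
qed

lemma hom_free_on: "f \<in> ub_quot e d X Y ` free_on (D X Y) \<Longrightarrow> f \<in> free_on (D X Y)"
  using fquot_free_on[OF subspace_ub_rel ub_rel_free_on] by blast

lemma ub_rel_degree0:
  assumes "card X = card Y" shows "ub_rel e d X Y = ({0} :: 'k::field arr set)"
proof -
  have "ub_rel e d X Y \<subseteq> ({0} :: 'k arr set)"
    unfolding ub_rel_def
  proof (rule fv.span_minimal[OF _ fv.subspace_single_0], clarify)
    fix b h assume "b \<in> D X Y" and h: "h \<in> wreath ((card Y - card X) div 2)"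
    have h: "h = id" using h assms by (simp add: wreath_def)
    have "wreath_proj 0 h = id" by (auto simp: wreath_proj_def)
    then have "twist e d 0 h = 1" by (simp add: twist_def h)
    moreover have "case_sum (b \<circ> Inl) (b \<circ> Inr \<circ> h) = b"
      by (auto simp: h fun_eq_iff split: sum.split)
    ultimately show "Poly_Mapping.single (case_sum (b \<circ> Inl) (b \<circ> Inr \<circ> h)) 1
        - Poly_Mapping.single b (of_int (twist e d ((card Y - card X) div 2) h)) = (0 :: 'k arr)"
      using assms by simp
  qed
  then show ?thesis using fv.subspace_0[OF subspace_ub_rel] by blast
qed

lemma ub_quot_degree0: "card X = card Y \<Longrightarrow> ub_quot e d X Y f = f"
  by (simp add: ub_rel_degree0 quot_zero_space[OF fv.vector_space_axioms])

section \<open>The action on exterior powers\<close>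

lemma flin_quot_lam: "flin (quot_map fscale (lam_rel X))"
  by (rule fquot_lin[OF subspace_lam_rel])

lemma quot_lam_free_on: "v \<in> free_on (decomp2 X) \<Longrightarrow> quot_map fscale (lam_rel X) v \<in> free_on (decomp2 X)"
  by (rule fquot_free_on[OF subspace_lam_rel lam_rel_free_on])

lemma quot_lam_0: "quot_map fscale (lam_rel X) v = 0 \<longleftrightarrow> v \<in> lam_rel X"
  by (rule fquot_0_iff[OF subspace_lam_rel])

lemma flin_relabel: "flin (relabel b Z)"
  unfolding relabel_def by (rule flin_lin_ext)

lemma contract_pairs_Suc: "contract_pairs b (Suc t) y = contract_pairs b t (contraction (b (Inr (2 * t + 1))) (b (Inr (2 * t + 2))) y)"
  by (simp add: contraction_def)

lemma flin_contract_pairs: "flin (contract_pairs b t)"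
proof (induction t)
  case 0
  show ?case using flin_id by (simp add: contract_pairs.simps(1)[abs_def])
next
  case (Suc t)
  show ?case unfolding contract_pairs_Suc[abs_def] by (rule flin_comp[OF Suc flin_contraction])
qed

lemma flin_act: "flin (act Lambda_C X Z \<phi>)"
  unfolding act_Lambda
  by (intro flin_comp[OF flin_quot_lam] lin_ext_fun_lin flin_comp[OF flin_relabel flin_contract_pairs])

lemma flin_act_left: "flin (\<lambda>\<phi>. act Lambda_C X Z \<phi> y)"
  unfolding act_Lambda by (intro flin_comp[OF flin_quot_lam flin_lin_ext])

lemma Plus_remove_pair:
  assumes "inj_on b (Z <+> {1..2 * Suc t})"
  shows "b ` (Z <+> {1..2 * Suc t}) - {b (Inr (2 * t + 1)), b (Inr (2 * t + 2))} = b ` (Z <+> {1..2 * t})"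
    and "b (Inr (2 * t + 1)) \<in> b ` (Z <+> {1..2 * Suc t})" "b (Inr (2 * t + 2)) \<in> b ` (Z <+> {1..2 * Suc t})"
    and "b (Inr (2 * t + 1)) \<noteq> b (Inr (2 * t + 2))"
    and "inj_on b (Z <+> {1..2 * t})"
proof -
  have sub: "{Inr (2 * t + 1), Inr (2 * t + 2)} \<subseteq> Z <+> {1..2 * Suc t}" by (auto simp: Plus_def)
  have s: "Z <+> {1..2 * Suc t} - {Inr (2 * t + 1), Inr (2 * t + 2)} = Z <+> {1..2 * t}"
    by (auto simp: Plus_def image_iff)
  have "b ` (Z <+> {1..2 * Suc t} - {Inr (2 * t + 1), Inr (2 * t + 2)})
      = b ` (Z <+> {1..2 * Suc t}) - b ` {Inr (2 * t + 1), Inr (2 * t + 2)}"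
    by (rule inj_on_image_set_diff[OF assms _ sub]) auto
  then show "b ` (Z <+> {1..2 * Suc t}) - {b (Inr (2 * t + 1)), b (Inr (2 * t + 2))} = b ` (Z <+> {1..2 * t})"
    unfolding s by simp
  show "b (Inr (2 * t + 1)) \<in> b ` (Z <+> {1..2 * Suc t})" "b (Inr (2 * t + 2)) \<in> b ` (Z <+> {1..2 * Suc t})"
    using sub by auto
  show "b (Inr (2 * t + 1)) \<noteq> b (Inr (2 * t + 2))"
    using inj_on_eq_iff[OF assms, of "Inr (2 * t + 1)" "Inr (2 * t + 2)"] sub by auto
  show "inj_on b (Z <+> {1..2 * t})" using assms by (rule inj_on_subset) (auto simp: Plus_def)
qed

lemma contract_pairs_lam_rel:
  fixes y :: "'k::field_char_0 lam"
  assumes "inj_on b (Z <+> {1..2 * t})" "y \<in> lam_rel (b ` (Z <+> {1..2 * t}))"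
  shows "contract_pairs b t y \<in> lam_rel (b ` (Z <+> {}))"
  using assms
proof (induction t arbitrary: y)
  case (Suc t)
  note R = Plus_remove_pair[OF Suc.prems(1)]
  show ?case
    unfolding contract_pairs_Suc using contraction_lam_rel[OF Suc.prems(2) R(2,3)]
    by (intro Suc.IH R(5)) (simp only: R(1))
qed simp

lemma relabel_relab:
  assumes "bij_betw (b \<circ> Inl) Z W" "y \<in> free_on (decomp2 W)"
  shows "relabel b Z y = relab (inv_into Z (b \<circ> Inl)) y"
proof (rule flin_eq[OF flin_relabel flin_relab _ assms(2)])
  fix Us assume D: "Us \<in> decomp2 W"
  have "{z \<in> Z. b (Inl z) \<in> U} = inv_into Z (b \<circ> Inl) ` U" if U: "U \<in> set Us" for U
  proof (intro set_eqI iffI)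
    fix z assume z: "z \<in> {z \<in> Z. b (Inl z) \<in> U}"
    then have "z = inv_into Z (b \<circ> Inl) (b (Inl z))"
      using bij_betw_inv_into_left[OF assms(1), of z] by simp
    with z show "z \<in> inv_into Z (b \<circ> Inl) ` U" by blast
  next
    fix z assume "z \<in> inv_into Z (b \<circ> Inl) ` U"
    then obtain w where w: "w \<in> U" "z = inv_into Z (b \<circ> Inl) w" by blast
    have "w \<in> (b \<circ> Inl) ` Z" using w(1) decomp2_blocks(5)[OF D U] assms(1) by (auto simp: bij_betw_def)
    then show "z \<in> {z \<in> Z. b (Inl z) \<in> U}"
      using w inv_into_into[of w "b \<circ> Inl" Z] f_inv_into_f[of w "b \<circ> Inl" Z] by auto
  qed
  then have "map (\<lambda>U. {z \<in> Z. b (Inl z) \<in> U}) Us = map (image (inv_into Z (b \<circ> Inl))) Us"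
    by (intro map_cong refl)
  then show "relabel b Z (edges Us) = relab (inv_into Z (b \<circ> Inl)) (edges Us)"
    unfolding relabel_def relab_def lin_ext_single by (simp only:)
qed

lemma bij_betw_Inl:
  assumes "inj_on b (Z <+> A)" shows "bij_betw (b \<circ> Inl) Z (b ` (Z <+> {}))"
proof (rule bij_betw_imageI)
  show "inj_on (b \<circ> Inl) Z"
    using inj_onD[OF assms] by (intro inj_onI) (metis InlI comp_apply sum.inject(1))
  show "(b \<circ> Inl) ` Z = b ` (Z <+> {})" by (simp add: Plus_def image_comp)
qed

lemma relabel_lam_rel:
  fixes y :: "'k::field_char_0 lam"
  assumes "bij_betw (b \<circ> Inl) Z W" "y \<in> lam_rel W"
  shows "relabel b Z y \<in> lam_rel Z"
proof -
  have inv: "bij_betw (inv_into Z (b \<circ> Inl)) W Z" using assms(1) by (rule bij_betw_inv_into)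
  have "relab (inv_into Z (b \<circ> Inl)) y \<in> lam_rel (inv_into Z (b \<circ> Inl) ` W)"
    using inv assms(2) by (intro relab_lam_rel) (auto simp: bij_betw_def)
  then show ?thesis
    using inv relabel_relab[OF assms(1) subsetD[OF lam_rel_free_on assms(2)]] by (simp add: bij_betw_def)
qed

lemma act_eq_0I:
  fixes y :: "'k::field_char_0 lam"
  assumes "\<phi> \<in> free_on (D Z X)"
    and "\<And>b. b \<in> D Z X \<Longrightarrow> contract_pairs b ((card X - card Z) div 2) y \<in> lam_rel (b ` (Z <+> {}))"
  shows "act Lambda_C X Z \<phi> y = 0"
  unfolding act_Lambda quot_lam_0
  by (rule lin_ext_mem[OF subspace_lam_rel _ assms(1)])
    (use assms(2) D_inj in \<open>blast intro: relabel_lam_rel bij_betw_Inl\<close>)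

lemma act_lam_rel:
  fixes y :: "'k::field_char_0 lam"
  assumes "y \<in> lam_rel X" "\<phi> \<in> free_on (D Z X)"
  shows "act Lambda_C X Z \<phi> y = 0"
proof (rule act_eq_0I[OF assms(2)])
  fix b assume b: "b \<in> D Z X"
  show "contract_pairs b ((card X - card Z) div 2) y \<in> lam_rel (b ` (Z <+> {}))"
    by (rule contract_pairs_lam_rel[OF D_inj[OF b]]) (simp only: D_image[OF b] assms(1))
qed

lemma act_quot:
  fixes y :: "'k::field_char_0 lam"
  assumes "\<phi> \<in> free_on (D Z X)"
  shows "act Lambda_C X Z \<phi> (quot_map fscale (lam_rel X) y) = act Lambda_C X Z \<phi> y"
proof -
  have "act Lambda_C X Z \<phi> (y - quot_map fscale (lam_rel X) y) = 0"
    by (rule act_lam_rel[OF fquot_diff[OF subspace_lam_rel] assms])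
  then show ?thesis by (simp add: flin_diff[OF flin_act])
qed

definition killed_by_contractions :: "nat set \<Rightarrow> 'k::field_char_0 lam \<Rightarrow> bool" where
  "killed_by_contractions X y \<longleftrightarrow> (\<forall>u\<in>X. \<forall>v\<in>X. u \<noteq> v \<longrightarrow> contraction u v y \<in> lam_rel (X - {u, v}))"

text \<open>A morphism of positive degree starts with a contraction, which already gives zero.\<close>

lemma act_positive_degree:
  fixes y :: "'k::field_char_0 lam"
  assumes "killed_by_contractions X y" "\<phi> \<in> free_on (D Z X)" "card Z \<noteq> card X"
  shows "act Lambda_C X Z \<phi> y = 0"
proof (rule act_eq_0I[OF assms(2)])
  fix b assume b: "b \<in> D Z X"
  obtain t where t: "(card X - card Z) div 2 = Suc t"
    using D_card[OF b] assms(3) by (cases "(card X - card Z) div 2") auto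
  have inj: "inj_on b (Z <+> {1..2 * Suc t})" and img: "b ` (Z <+> {1..2 * Suc t}) = X"
    using D_inj[OF b] D_image[OF b] by (simp_all only: t)
  note R = Plus_remove_pair[OF inj, unfolded img]
  have "contraction (b (Inr (2 * t + 1))) (b (Inr (2 * t + 2))) y \<in> lam_rel (b ` (Z <+> {1..2 * t}))"
    using assms(1) R(2-4) unfolding killed_by_contractions_def R(1)[symmetric] by blast
  then show "contract_pairs b ((card X - card Z) div 2) y \<in> lam_rel (b ` (Z <+> {}))"
    unfolding t contract_pairs_Suc by (rule contract_pairs_lam_rel[OF R(5)])
qed

lemma D_degree0: "b \<in> D Z X \<Longrightarrow> card Z = card X \<Longrightarrow> bij_betw (b \<circ> Inl) Z X"
  using bij_betw_Inl[OF D_inj, of b Z X] D_image[of b Z X] by simp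

lemma act_degree0:
  assumes "b \<in> D Z X" "card Z = card X" "y \<in> free_on (decomp2 X)"
  shows "act Lambda_C X Z (Poly_Mapping.single b 1) y
    = quot_map fscale (lam_rel Z) (relab (inv_into Z (b \<circ> Inl)) y)"
  using relabel_relab[OF D_degree0[OF assms(1,2)] assms(3)] assms(2) by (simp add: act_Lambda)

section \<open>Cochains\<close>

abbreviation "dbmm \<equiv> db Minus Minus"

lemma vector_space_cscale: "vector_space (cscale (Lambda_C :: (nat set, 'k::field arr, 'k lam, 'k) linmod)
   :: 'k \<Rightarrow> (nat set, 'k arr, 'v, 'k lam) cochain \<Rightarrow> _)"
  by unfold_locales (auto simp: fun_eq_iff cscale_def fv.scale_right_distrib fv.scale_left_distrib)

lemma bar_diff_add:
  "bar_diff A M Lambda_C p (c + c') = bar_diff A M Lambda_C p c + bar_diff A M Lambda_C p c'"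
  by (intro ext) (simp add: bar_diff_def flin_add[OF flin_act] fv.scale_right_distrib algebra_simps
      sum.distrib sum_subtractf sum_negf)

lemma bar_diff_scale:
  "bar_diff A M Lambda_C p (cscale Lambda_C k c) = cscale Lambda_C k (bar_diff A M Lambda_C p c)"
  by (intro ext) (simp add: bar_diff_def cscale_def flin_scale[OF flin_act] fv.scale_right_distrib
      fv.scale_right_diff_distrib fv.scale_sum_right mult.commute)

lemma bar_diff_zero: "bar_diff A M Lambda_C p 0 = 0"
  by (intro ext) (simp add: bar_diff_def flin_0[OF flin_act])

lemma subspace_sp_Lambda: "fv.subspace (quot_map fscale (lam_rel X) ` free_on (decomp2 X))"
  by (rule quot_map_image_subspace[OF subspace_lam_rel subspace_free_on])

lemma cochains_zero: "0 \<in> cochains A M Lambda_C p"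
  using fv.subspace_0[OF subspace_sp_Lambda] by (auto simp: cochains_def)

lemma cochains_add:
  assumes "c \<in> cochains A M Lambda_C p" "c' \<in> cochains A M Lambda_C p"
  shows "c + c' \<in> cochains A M Lambda_C p"
  using assms unfolding cochains_def
  by (auto simp: fv.scale_right_distrib algebra_simps intro: fv.subspace_add[OF subspace_sp_Lambda])

lemma cochains_scale:
  assumes "c \<in> cochains A M Lambda_C p"
  shows "cscale Lambda_C k c \<in> cochains A M Lambda_C p"
  using assms unfolding cochains_def cscale_def
  by (auto simp: fv.scale_right_distrib mult.commute intro: fv.subspace_scale[OF subspace_sp_Lambda])

lemma subspace_coboundaries:
  fixes A :: "(nat set, 'k::field arr, 'k) lincat" and M :: "(nat set, 'k arr, 'v::ab_group_add, 'k) linmod"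
  shows "module.subspace (cscale Lambda_C) (coboundaries A M Lambda_C p)"
proof -
  interpret v: vector_space "cscale Lambda_C :: 'k \<Rightarrow> (nat set, 'k arr, 'v, 'k lam) cochain \<Rightarrow> _"
    by (rule vector_space_cscale)
  show ?thesis
  proof (cases p)
    case 0
    then show ?thesis by (simp add: coboundaries_def v.subspace_single_0)
  next
    case (Suc q)
    show ?thesis
      unfolding v.subspace_def coboundaries_def Suc nat.case
    proof (intro conjI ballI allI)
      show "0 \<in> bar_diff A M Lambda_C q ` cochains A M Lambda_C q"
        using cochains_zero bar_diff_zero by (metis image_eqI)
      fix x y assume xy: "x \<in> bar_diff A M Lambda_C q ` cochains A M Lambda_C q"
        "y \<in> bar_diff A M Lambda_C q ` cochains A M Lambda_C q"
      then show "x + y \<in> bar_diff A M Lambda_C q ` cochains A M Lambda_C q"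
        by (auto simp: bar_diff_add[symmetric] intro: cochains_add)
    next
      fix k x assume "x \<in> bar_diff A M Lambda_C q ` cochains A M Lambda_C q"
      then show "cscale Lambda_C k x \<in> bar_diff A M Lambda_C q ` cochains A M Lambda_C q"
        by (auto simp: bar_diff_scale[symmetric] intro: cochains_scale)
    qed
  qed
qed

lemma ext_class_0_iff: "ext_class A M Lambda_C p c = 0 \<longleftrightarrow> c \<in> coboundaries A M Lambda_C p"
  unfolding ext_class_def by (rule quot_map_props(3)[OF vector_space_cscale subspace_coboundaries])

lemma ext_class_zero [simp]:
  fixes A :: "(nat set, 'k::field arr, 'k) lincat" and M :: "(nat set, 'k arr, 'v::ab_group_add, 'k) linmod"
  shows "ext_class A M Lambda_C p 0 = 0"
proof -
  interpret v: vector_space "cscale Lambda_C :: 'k \<Rightarrow> (nat set, 'k arr, 'v, 'k lam) cochain \<Rightarrow> _"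
    by (rule vector_space_cscale)
  show ?thesis unfolding ext_class_0_iff by (rule v.subspace_0[OF subspace_coboundaries])
qed

lemma ext_class_degree0: "ext_class A M Lambda_C 0 c = c"
  by (simp add: ext_class_def coboundaries_def quot_zero_space[OF vector_space_cscale])

lemma Ext_degree0: "Ext A M Lambda_C 0 = cocycles A M Lambda_C 0"
  by (simp add: Ext_def ext_class_degree0)

lemma zero_in_Ext: "0 \<in> Ext A M Lambda_C p"
proof -
  have "0 \<in> cocycles A M Lambda_C p" by (simp add: cocycles_def cochains_zero bar_diff_zero)
  then show ?thesis unfolding Ext_def by (metis ext_class_zero image_eqI)
qed

section \<open>Degree zero classes\<close>

definition bijs :: "nat set \<Rightarrow> nat set \<Rightarrow> (nat \<Rightarrow> nat) set" where
  "bijs X Y = {p \<in> extensional X. bij_betw p X Y}"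

lemma sp_P: "sp (P X) Y = free_on (bijs X Y)" by (simp add: bijs_def)

definition relabs :: "'k::field lam \<Rightarrow> 'k bij_sp \<Rightarrow> 'k lam" where
  "relabs y m = lin_ext fscale (\<lambda>p. relab p y) m"

lemma flin_relabs: "flin (relabs y)" unfolding relabs_def by (rule flin_lin_ext)

lemma flin_relabs_left: "flin (\<lambda>y. relabs y m)"
  unfolding relabs_def by (intro lin_ext_fun_lin flin_relab)

lemma relabs_single [simp]: "relabs y (Poly_Mapping.single p 1) = relab p y"
  by (simp add: relabs_def)

lemma relabs_free_on:
  assumes "y \<in> free_on (decomp2 X)" "m \<in> free_on (bijs X Y)"
  shows "relabs y m \<in> free_on (decomp2 Y)"
  unfolding relabs_def
  by (rule lin_ext_mem[OF subspace_free_on _ assms(2)])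
    (use relab_free_on[OF _ assms(1)] in \<open>auto simp: bijs_def bij_betw_def\<close>)

text \<open>The natural transformation from \<open>P X\<close> that sends the identity of \<open>X\<close> to the class of \<open>y\<close>.\<close>

definition class_cochain :: "nat set \<Rightarrow> 'k::field lam \<Rightarrow> (nat set, 'k arr, 'k bij_sp, 'k lam) cochain" where
  "class_cochain X y xs fs m = (if bar_dom dbmm (P X) 0 xs fs m
     then quot_map fscale (lam_rel (hd xs)) (relabs y m) else 0)"

lemma bar_dom_0: "bar_dom A M 0 xs fs m \<longleftrightarrow> fs = [] \<and> (\<exists>W. xs = [W] \<and> W \<in> obj A \<and> m \<in> sp M W)"
  by (auto simp: bar_dom_def length_Suc_conv)

lemma bar_dom_1: "bar_dom A M (Suc 0) xs fs m \<longleftrightarrow>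
   (\<exists>V W f. xs = [V, W] \<and> fs = [f] \<and> V \<in> obj A \<and> W \<in> obj A \<and> f \<in> hom A V W \<and> m \<in> sp M V)"
  by (auto simp: bar_dom_def length_Suc_conv)

lemma bar_dom_db1: "bar_dom (db e d) (P X) (Suc 0) xs fs m \<longleftrightarrow>
   (\<exists>V W f. xs = [V, W] \<and> fs = [f] \<and> finite V \<and> finite W \<and>
     f \<in> ub_quot e d W V ` free_on (D W V) \<and> m \<in> free_on (bijs X V))"
  by (simp only: bar_dom_1 sp_P db_simps mem_Collect_eq)

lemma class_cochain_apply: "finite W \<Longrightarrow> m \<in> free_on (bijs X W) \<Longrightarrow>
    class_cochain X y [W] [] m = quot_map fscale (lam_rel W) (relabs y m)"
  by (simp add: class_cochain_def bar_dom_0 bijs_def)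

lemma class_cochain_add: "class_cochain X (y + y') = class_cochain X y + class_cochain X y'"
  by (intro ext) (simp add: class_cochain_def flin_add[OF flin_relabs_left] flin_add[OF flin_quot_lam])

lemma class_cochain_scale: "class_cochain X (fscale k y) = cscale Lambda_C k (class_cochain X y)"
  by (intro ext) (simp add: class_cochain_def cscale_def flin_scale[OF flin_relabs_left] flin_scale[OF flin_quot_lam])

lemma class_cochain_cochain:
  fixes y :: "'k::field lam"
  assumes y: "y \<in> free_on (decomp2 X)" shows "class_cochain X y \<in> cochains dbmm (P X) Lambda_C 0"
  unfolding cochains_def
proof (intro CollectI conjI allI impI)
  fix xs and fs :: "'k arr list" and m :: "'k bij_sp" assume "bar_dom dbmm (P X) 0 xs fs m"
  then obtain W where W: "xs = [W]" "fs = []" "finite W" "m \<in> free_on (bijs X W)"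
    by (auto simp: bar_dom_0 bijs_def)
  then show "class_cochain X y xs fs m \<in> sp Lambda_C (last xs)"
    using relabs_free_on[OF y W(4)] by (simp add: class_cochain_apply)
next
  fix xs and fs :: "'k arr list" and m :: "'k bij_sp" assume "\<not> bar_dom dbmm (P X) 0 xs fs m"
  then show "class_cochain X y xs fs m = 0" by (simp add: class_cochain_def)
next
  fix xs and fs :: "'k arr list" and m m' :: "'k bij_sp" and a b
  assume "bar_dom dbmm (P X) 0 xs fs m \<and> bar_dom dbmm (P X) 0 xs fs m'"
  then obtain W where W: "xs = [W]" "fs = []" "finite W" "m \<in> free_on (bijs X W)" "m' \<in> free_on (bijs X W)"
    by (auto simp: bar_dom_0 bijs_def)
  have "fscale a m + fscale b m' \<in> free_on (bijs X W)"
    using W by (intro fv.subspace_add fv.subspace_scale subspace_free_on)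
  then show "class_cochain X y xs fs (mscale (P X) a m + mscale (P X) b m') =
      mscale Lambda_C a (class_cochain X y xs fs m) + mscale Lambda_C b (class_cochain X y xs fs m')"
    using W by (simp add: class_cochain_apply flin_add[OF flin_relabs] flin_scale[OF flin_relabs]
        flin_add[OF flin_quot_lam] flin_scale[OF flin_quot_lam])
qed auto

lemma act_P_mem:
  assumes "finite X" "f \<in> free_on (D W V)" "m \<in> free_on (bijs X V)"
  shows "act (P X) V W f m \<in> free_on (bijs X W)"
proof (cases "card V = card W")
  case True
  have "lin_ext fscale (\<lambda>p. Poly_Mapping.single (restrict (\<lambda>x. inv_into W (b \<circ> Inl) (p x)) X) 1) m \<in> free_on (bijs X W)"
    if b: "b \<in> D W V" for b
  proof (rule lin_ext_mem[OF subspace_free_on single_free_on assms(3)])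
    fix p assume p: "p \<in> bijs X V"
    have "bij_betw (inv_into W (b \<circ> Inl)) V W"
      using D_degree0[OF b] True by (auto intro: bij_betw_inv_into)
    then have "bij_betw (\<lambda>x. inv_into W (b \<circ> Inl) (p x)) X W"
      using p bij_betw_trans[of p X V "inv_into W (b \<circ> Inl)" W] by (simp add: bijs_def comp_def)
    then show "restrict (\<lambda>x. inv_into W (b \<circ> Inl) (p x)) X \<in> bijs X W"
      by (simp add: bijs_def cong: bij_betw_cong)
  qed
  then have "lin_ext fscale (\<lambda>b. lin_ext fscale
      (\<lambda>p. Poly_Mapping.single (restrict (\<lambda>x. inv_into W (b \<circ> Inl) (p x)) X) 1) m) f \<in> free_on (bijs X W)"
    by (rule lin_ext_mem[OF subspace_free_on _ assms(2)])
  then show ?thesis using True by (simp add: act_P bilin_ext_def)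
next
  case False
  then show ?thesis using fv.subspace_0[OF subspace_free_on] by (simp add: act_P)
qed

lemma killed_by_contractions_relab:
  fixes y :: "'k::field_char_0 lam"
  assumes y: "y \<in> free_on (decomp2 X)" "killed_by_contractions X y" and p: "inj_on p X"
  shows "killed_by_contractions (p ` X) (relab p y)"
  unfolding killed_by_contractions_def
proof (intro ballI impI)
  fix u' v' assume "u' \<in> p ` X" "v' \<in> p ` X" and ne: "u' \<noteq> v'"
  then obtain u v where uv: "u' = p u" "v' = p v" "u \<in> X" "v \<in> X" by auto
  have "contraction u v y \<in> lam_rel (X - {u, v})"
  proof -
    have "u \<noteq> v" using ne uv by auto
    then show ?thesis using y(2) uv(3,4) unfolding killed_by_contractions_def by blast
  qed
  then have "relab p (contraction u v y) \<in> lam_rel (p ` (X - {u, v}))"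
    by (rule relab_lam_rel[OF inj_on_subset[OF p Diff_subset]])
  also have "p ` (X - {u, v}) = p ` X - {p u, p v}"
    using inj_on_image_set_diff[OF p, of X "{u, v}"] uv by auto
  finally show "contraction u' v' (relab p y) \<in> lam_rel (p ` X - {u', v'})"
    using contraction_relab[OF y(1) p uv(3,4)] by (simp add: uv(1,2))
qed

lemma killed_by_contractions_sum:
  fixes y :: "'k::field_char_0 lam"
  assumes "\<And>b. b \<in> B \<Longrightarrow> killed_by_contractions X (g b)" "a \<in> free_on B"
  shows "killed_by_contractions X (lin_ext fscale g a)"
  unfolding killed_by_contractions_def
proof (intro ballI impI)
  fix u v assume "u \<in> X" "v \<in> X" "u \<noteq> v"
  then show "contraction u v (lin_ext fscale g a) \<in> lam_rel (X - {u, v})"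
    unfolding flin_lin_ext_comp[OF flin_contraction]
    by (intro lin_ext_mem[OF subspace_lam_rel _ assms(2)])
      (use assms(1) in \<open>auto simp: killed_by_contractions_def\<close>)
qed

lemma class_cochain_cocycle:
  fixes y :: "'k::field_char_0 lam"
  assumes X: "finite X" and y: "y \<in> free_on (decomp2 X)" and cl: "killed_by_contractions X y"
  shows "class_cochain X y \<in> cocycles dbmm (P X) Lambda_C 0"
proof -
  have key: "class_cochain X y [W] [] (act (P X) V W f m) = act Lambda_C V W f (class_cochain X y [V] [] m)"
    if V: "finite V" "finite W" and f: "f \<in> free_on (D W V)" and m: "m \<in> free_on (bijs X V)" for V W f m
  proof -
    have L: "class_cochain X y [W] [] (act (P X) V W f m) = quot_map fscale (lam_rel W) (relabs y (act (P X) V W f m))"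
      by (rule class_cochain_apply[OF V(2) act_P_mem[OF X f m]])
    have R: "act Lambda_C V W f (class_cochain X y [V] [] m) = act Lambda_C V W f (relabs y m)"
      unfolding class_cochain_apply[OF V(1) m] by (rule act_quot[OF f])
    have "quot_map fscale (lam_rel W) (relabs y (act (P X) V W f m)) = act Lambda_C V W f (relabs y m)"
    proof (cases "card V = card W")
      case False
      have "killed_by_contractions V (relabs y m)"
        unfolding relabs_def
      proof (rule killed_by_contractions_sum[OF _ m])
        fix p assume "p \<in> bijs X V"
        then show "killed_by_contractions V (relab p y)"
          using killed_by_contractions_relab[OF y cl, of p] by (simp add: bijs_def bij_betw_def)
      qed
      then have "act Lambda_C V W f (relabs y m) = 0"
        using False by (intro act_positive_degree[OF _ f]) auto
      then show ?thesis using False by (simp add: act_P flin_0[OF flin_relabs] flin_0[OF flin_quot_lam])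
    next
      case True
      have lin1: "flin (\<lambda>f. quot_map fscale (lam_rel W) (relabs y (act (P X) V W f m)))"
        using True flin_comp[OF flin_quot_lam flin_comp[OF flin_relabs flin_bilin_left]] by (simp add: act_P)
      show ?thesis
      proof (rule flin_eq[OF lin1 flin_act_left _ f])
        fix b assume b: "b \<in> D W V"
        have lin2: "flin (\<lambda>m. quot_map fscale (lam_rel W) (relabs y (act (P X) V W (Poly_Mapping.single b 1) m)))"
          using True flin_comp[OF flin_quot_lam flin_comp[OF flin_relabs flin_bilin_right]] by (simp add: act_P)
        show "quot_map fscale (lam_rel W) (relabs y (act (P X) V W (Poly_Mapping.single b 1) m))
          = act Lambda_C V W (Poly_Mapping.single b 1) (relabs y m)"
        proof (rule flin_eq[OF lin2 flin_comp[OF flin_act flin_relabs] _ m])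
          fix p assume p: "p \<in> bijs X V"
          let ?g = "inv_into W (b \<circ> Inl)"
          have py: "relab p y \<in> free_on (decomp2 V)"
            using relab_free_on[OF _ y, of p] p by (simp add: bijs_def bij_betw_def)
          have "relab (restrict (\<lambda>x. ?g (p x)) X) y = relab (?g \<circ> p) y"
            by (rule relab_cong[OF _ y]) simp
          then show "quot_map fscale (lam_rel W) (relabs y (act (P X) V W (Poly_Mapping.single b 1) (Poly_Mapping.single p 1)))
            = act Lambda_C V W (Poly_Mapping.single b 1) (relabs y (Poly_Mapping.single p 1))"
            using True act_degree0[OF b _ py] by (simp add: act_P relab_comp)
        qed
      qed
    qed
    with L R show ?thesis by simp
  qed
  have "bar_diff dbmm (P X) Lambda_C 0 (class_cochain X y) xs fs m = 0" for xs fs m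
  proof (cases "bar_dom dbmm (P X) (Suc 0) xs fs m")
    case True
    from True[unfolded bar_dom_db1] obtain V W f where h: "xs = [V, W]" "fs = [f]"
      "finite V" "finite W" "f \<in> ub_quot Minus Minus W V ` free_on (D W V)" "m \<in> free_on (bijs X V)"
      by (elim exE conjE)
    have f: "f \<in> free_on (D W V)" by (rule hom_free_on[OF h(5)])
    have "bar_diff dbmm (P X) Lambda_C 0 (class_cochain X y) xs fs m
       = class_cochain X y [W] [] (act (P X) V W f m) - act Lambda_C V W f (class_cochain X y [V] [] m)"
      using True by (simp only: bar_diff_def h(1,2)) (simp add: fscale_minus1)
    then show ?thesis by (simp only: key[OF h(3,4) f h(6)] diff_self)
  qed (simp add: bar_diff_def)
  then have "bar_diff dbmm (P X) Lambda_C 0 (class_cochain X y) = 0" by (intro ext) simp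
  with class_cochain_cochain[OF y] show ?thesis by (simp add: cocycles_def)
qed

definition ext_elem :: "nat set \<Rightarrow> 'k::field lam \<Rightarrow> 'k ext_lam" where
  "ext_elem X y p = (if p = 0 then class_cochain X y else 0)"

lemma Ext_module_simps:
  "sp (Ext_module N) X = {e. (\<forall>p. e p \<in> Ext dbmm (P X) N p) \<and> finite {p. e p \<noteq> 0}}"
  "act (Ext_module N) X Y f e p = (let d = (card Y - card X) div 2 in
       if d \<le> p
       then ext_class dbmm (P Y) N p (yoneda d (e (p - d)) (koszul X Y f))
       else 0)"
  "mscale (Ext_module N) a e p = cscale N a (e p)"
  by (simp_all add: Ext_module_def)

lemma finite_only_zero: "(\<And>p. p > 0 \<Longrightarrow> e p = 0) \<Longrightarrow> finite {p :: nat. e p \<noteq> 0}"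
  by (rule finite_subset[of _ "{0}"]) auto

lemma ext_elem_Ext0:
  fixes y :: "'k::field_char_0 lam"
  assumes "finite X" "y \<in> free_on (decomp2 X)" "killed_by_contractions X y"
  shows "ext_elem X y \<in> Ext0 Lambda_C X"
  using class_cochain_cocycle[OF assms]
  by (auto simp: Ext0_def Ext_module_simps ext_elem_def Ext_degree0 zero_in_Ext intro!: finite_only_zero)

lemma Ext0_cochain: "e \<in> Ext0 Lambda_C X \<Longrightarrow> e 0 \<in> cocycles dbmm (P X) Lambda_C 0"
  by (auto simp: Ext0_def Ext_module_simps Ext_degree0[symmetric])

lemma Ext0_0: "e \<in> Ext0 Lambda_C X \<Longrightarrow> p > 0 \<Longrightarrow> e p = 0"
  by (simp add: Ext0_def)

section \<open>The symmetric group action in degree zero\<close>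

definition pre :: "(nat \<Rightarrow> nat) \<Rightarrow> nat set \<Rightarrow> 'k::field bij_sp \<Rightarrow> 'k bij_sp" where
  "pre s X = lin_ext fscale (\<lambda>p. Poly_Mapping.single (restrict (\<lambda>x. p (s x)) X) 1)"

lemma flin_pre: "flin (pre s X)" unfolding pre_def by (rule flin_lin_ext)

lemma pre_single [simp]: "pre s X (Poly_Mapping.single p 1) = Poly_Mapping.single (restrict (\<lambda>x. p (s x)) X) 1"
  by (simp add: pre_def)

lemma bijs_pre: "s permutes X \<Longrightarrow> p \<in> bijs X W \<Longrightarrow> restrict (\<lambda>x. p (s x)) X \<in> bijs X W"
  using bij_betw_trans[OF permutes_imp_bij, of s X p W] by (simp add: bijs_def comp_def cong: bij_betw_cong)

lemma pre_free_on:
  assumes "s permutes X" "m \<in> free_on (bijs X W)" shows "pre s X m \<in> free_on (bijs X W)"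
  unfolding pre_def
  by (rule lin_ext_mem[OF subspace_free_on _ assms(2)]) (auto intro: single_free_on bijs_pre[OF assms(1)])

definition perm_arr :: "nat set \<Rightarrow> (nat \<Rightarrow> nat) \<Rightarrow> brauer" where
  "perm_arr X s = restrict (case_sum s id) (X <+> {})"

lemma lin_ext_single_gen:
  assumes "\<And>v. s 1 v = v" shows "lin_ext s g (Poly_Mapping.single b (1 :: 'k::field)) = g b"
  using assms by (simp add: lin_ext_def)

lemma cscale_1: "cscale (P X) 1 c = (c :: (nat set, 'k::field arr, 'k bij_sp, 'k bij_sp) cochain)"
  by (intro ext) (simp add: cscale_def)

lemma koszul_perm:
  assumes "s permutes X"
  shows "koszul X X (Poly_Mapping.single (perm_arr X s) (1 :: 'k::field)) xs fs m
    = (if bar_dom dbmm (P X) 0 xs fs m then pre s X m else 0)"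
proof -
  have "perm_arr X s ` (X <+> {}) = s ` X" by (auto simp: perm_arr_def Plus_def image_iff)
  then have img: "perm_arr X s ` (X <+> {}) = X" using permutes_image[OF assms] by simp
  have r: "restrict (\<lambda>x. p (perm_arr X s (Inl x))) X = restrict (\<lambda>x. p (s x)) X" for p :: "nat \<Rightarrow> nat"
    by (auto simp: perm_arr_def restrict_def fun_eq_iff Plus_def)
  show ?thesis
    unfolding koszul_def by (simp add: lin_ext_single_gen cscale_1 img koszul_bij_def pre_def r)
qed

lemma cochain_zero_arg:
  assumes "c \<in> cochains A (P X) Lambda_C p"
  shows "c xs fs 0 = 0"
proof (cases "bar_dom A (P X) p xs fs 0")
  case True
  then have "c xs fs (mscale (P X) 0 0 + mscale (P X) 0 0) =
      mscale Lambda_C 0 (c xs fs 0) + mscale Lambda_C 0 (c xs fs 0)"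
    using assms unfolding cochains_def by blast
  then show ?thesis by simp
next
  case False
  then show ?thesis using assms unfolding cochains_def by blast
qed

lemma yoneda_perm:
  fixes c :: "(nat set, 'k::field arr, 'k bij_sp, 'k lam) cochain"
  assumes c: "c \<in> cochains dbmm (P X) Lambda_C 0" and s: "s permutes X"
  shows "yoneda 0 c (koszul X X (Poly_Mapping.single (perm_arr X s) 1)) xs fs m
    = (if bar_dom dbmm (P X) 0 xs fs m then c xs fs (pre s X m) else 0)"
proof (cases "\<exists>W. xs = [W] \<and> fs = []")
  case True
  then obtain W where W: "xs = [W]" "fs = []" by blast
  show ?thesis
    using cochain_zero_arg[OF c] by (simp add: yoneda_def koszul_perm[OF s] W)
next
  case False
  then have "\<not> bar_dom dbmm (P X) 0 xs fs m'" for m' by (auto simp: bar_dom_0)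
  then show ?thesis using c by (simp add: yoneda_def cochains_def)
qed

lemma sym_act_Ext0:
  fixes e :: "'k::field ext_lam"
  assumes e: "e \<in> Ext0 Lambda_C {1..d}" and s: "s permutes {1..d}"
  shows "sym_act Ext_Lambda d s e p xs fs m
    = (if p = 0 \<and> bar_dom dbmm (P {1..d}) 0 xs fs m then e 0 xs fs (pre s {1..d} m) else 0)"
proof (cases "p = 0")
  case True
  have c: "e 0 \<in> cochains dbmm (P {1..d}) Lambda_C 0" using Ext0_cochain[OF e] by (simp add: cocycles_def)
  show ?thesis
    by (simp del: One_nat_def add: sym_act_def Ext_Lambda_def Ext_module_simps Let_def ub_quot_degree0
        ext_class_degree0 True perm_arr_def[symmetric] yoneda_perm[OF c s])
next
  case False
  then have e0: "e p = 0" using Ext0_0[OF e] by simp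
  have y: "yoneda 0 (e p) K = 0" for K :: "(nat set, 'k arr, 'k bij_sp, 'k bij_sp) cochain"
    by (intro ext) (simp add: yoneda_def e0)
  show ?thesis
    using False y by (simp add: sym_act_def Ext_Lambda_def Ext_module_simps Let_def)
qed

lemma sym_act_ext_elem:
  fixes y :: "'k::field_char_0 lam"
  assumes y: "y \<in> free_on (decomp2 {1..d})" "killed_by_contractions {1..d} y" and s: "s permutes {1..d}"
  shows "sym_act Ext_Lambda d s (ext_elem {1..d} y) = ext_elem {1..d} (relab s y)"
proof (intro ext)
  fix p xs fs and m :: "'k bij_sp"
  let ?X = "{1..d}"
  have e: "ext_elem ?X y \<in> Ext0 Lambda_C ?X" by (rule ext_elem_Ext0[OF _ y]) simp
  show "sym_act Ext_Lambda d s (ext_elem ?X y) p xs fs m = ext_elem ?X (relab s y) p xs fs m"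
  proof (cases "p = 0 \<and> bar_dom dbmm (P ?X) 0 xs fs m")
    case True
    then obtain W where W: "xs = [W]" "fs = []" "finite W" "m \<in> free_on (bijs ?X W)"
      by (auto simp: bar_dom_0 bijs_def)
    have "relabs y (pre s ?X m) = relabs (relab s y) m"
    proof (rule flin_eq[OF flin_comp[OF flin_relabs flin_pre] flin_relabs _ W(4)])
      fix q assume "q \<in> bijs ?X W"
      have "relab (restrict (\<lambda>x. q (s x)) ?X) y = relab (q \<circ> s) y"
        by (rule relab_cong[OF _ y(1)]) simp
      then show "relabs y (pre s ?X (Poly_Mapping.single q 1)) = relabs (relab s y) (Poly_Mapping.single q 1)"
        by (simp add: relab_comp)
    qed
    then show ?thesis
      using True W pre_free_on[OF s W(4)]
      by (simp del: One_nat_def add: sym_act_Ext0[OF e s] ext_elem_def class_cochain_apply)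
  next
    case False
    then show ?thesis by (auto simp del: One_nat_def simp: sym_act_Ext0[OF e s] ext_elem_def class_cochain_def)
  qed
qed

lemma vector_space_Ext: "vector_space (mscale Ext_Lambda :: 'k::field \<Rightarrow> 'k ext_lam \<Rightarrow> _)"
  by unfold_locales
    (auto simp: fun_eq_iff Ext_Lambda_def Ext_module_simps cscale_def fv.scale_right_distrib fv.scale_left_distrib)

lemma ext_elem_add: "ext_elem X (y + y') = ext_elem X y + ext_elem X y'"
  by (intro ext) (simp add: ext_elem_def class_cochain_add)

lemma ext_elem_scale: "ext_elem X (fscale k y) = mscale Ext_Lambda k (ext_elem X y)"
  by (intro ext) (simp add: ext_elem_def class_cochain_scale Ext_Lambda_def Ext_module_simps cscale_def)

lemma ext_elem_eq_0:
  fixes y :: "'k::field_char_0 lam"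
  assumes "finite X" "y \<in> free_on (decomp2 X)" "ext_elem X y = 0"
  shows "y \<in> lam_rel X"
proof -
  let ?i = "restrict id X"
  have i: "?i \<in> bijs X X" by (simp add: bijs_def bij_betw_def inj_on_def)
  have "ext_elem X y 0 [X] [] (Poly_Mapping.single ?i 1) = 0" unfolding assms(3) by simp
  then have "relab ?i y \<in> lam_rel X"
    by (simp add: ext_elem_def class_cochain_apply[OF assms(1) single_free_on[OF i]] quot_lam_0)
  moreover have "relab ?i y = y" using relab_cong[OF _ assms(2), of ?i id] by (simp add: relab_id)
  ultimately show ?thesis by simp
qed

section \<open>The Specht module in degree zero\<close>

context grid begin

definition shape :: "nat list" where "shape = replicate (l - 1) l"

lemma sum_list_shape: "sum_list shape = l * (l - 1)"
  by (simp add: shape_def sum_list_replicate mult.commute)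

lemma cells_shape: "{1..sum_list shape} = cells"
  by (simp only: sum_list_shape cells_def)

lemma sum_take_shape: "sum_list (take k shape) = min k (l - 1) * l"
  by (simp add: shape_def sum_list_replicate)

lemma row_of_shape: "i \<in> cells \<Longrightarrow> row_of shape i = row i"
  unfolding row_of_def sum_take_shape
proof (rule Least_equality)
  assume i: "i \<in> cells"
  have m: "min (Suc (row i)) (l - 1) = Suc (row i)" using row_less[OF i] by simp
  have "cell (row i) (col i) \<le> Suc (row i) * l" using col_less[of i] by (simp add: cell_def)
  then show "i \<le> min (Suc (row i)) (l - 1) * l" unfolding m cell_row_col[OF i] .
  fix k assume "i \<le> min (Suc k) (l - 1) * l"
  also have "\<dots> \<le> Suc k * l" by (intro mult_le_mono1) simp
  finally have "i - 1 < Suc k * l" using l2 by (cases i) auto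
  then have "(i - 1) div l < Suc k" by (rule less_mult_imp_div_less)
  then show "row i \<le> k" by (simp add: row_def)
qed

lemma col_of_shape:
  assumes "i \<in> cells" shows "col_of shape i = Suc (col i)"
proof -
  have "min (row i) (l - 1) = row i" using row_less[OF assms] by simp
  then show ?thesis
    using cell_row_col[OF assms] by (simp add: col_of_def row_of_shape[OF assms] sum_take_shape cell_def)
qed

lemma stabilizer_row: "stabilizer (sum_list shape) (row_of shape) = cperm cells row"
  unfolding stabilizer_def cperm_def cells_shape
  by (auto simp: row_of_shape permutes_in_image)

lemma stabilizer_col: "stabilizer (sum_list shape) (col_of shape) = cperm cells col"
  unfolding stabilizer_def cperm_def cells_shape
  by (auto simp: col_of_shape permutes_in_image)

lemma young_symmetrizer_shape: "young_symmetrizer shape = grp_mult \<alpha> (\<beta> :: 'k::field_char_0 bij_sp)"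
  unfolding young_symmetrizer_def stabilizer_row stabilizer_col grp_mult_\<alpha>
  by (simp add: isum_def \<beta>_def L.rho_sum L.rho_scale fscale_single comp_def)

lemma specht_shape: "specht shape = (\<lambda>w. grp_mult w (grp_mult \<alpha> (\<beta> :: 'k::field_char_0 bij_sp))) ` perms"
  unfolding specht_def young_symmetrizer_shape cells_shape perms_def ..

lemma aact_free_on:
  assumes "w \<in> perms" "v \<in> free_on (decomp2 cells)"
  shows "aact w v \<in> free_on (decomp2 cells)"
  unfolding aact_def
proof (rule lin_ext_mem[OF subspace_free_on _ assms(1)[unfolded perms_def]])
  fix p assume "p \<in> {p. p permutes cells}"
  then show "relab p v \<in> free_on (decomp2 cells)"
    using relab_free_on[OF _ assms(2), of p] permutes_inj_on[of p cells] permutes_image[of p cells] by simp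
qed

lemma specht_vector:
  fixes z :: "'k::field_char_0 bij_sp"
  assumes "z \<in> specht shape"
  shows "aact z (edges kmatch) \<in> free_on (decomp2 cells)"
    and "killed_by_contractions cells (aact z (edges kmatch))"
proof -
  obtain w where w: "w \<in> perms" "z = grp_mult w (grp_mult \<alpha> \<beta>)" using assms by (auto simp: specht_shape)
  have e: "aact z (edges kmatch) = aact (grp_mult w \<alpha>) y0"
    by (simp add: w(2) aact_grp_mult aact_\<beta>_kmatch)
  have wa: "grp_mult w \<alpha> \<in> (perms :: 'k bij_sp set)" by (intro grp_mult_perms w(1) \<alpha>_perms)
  show "aact z (edges kmatch) \<in> free_on (decomp2 cells)"
    unfolding e by (rule aact_free_on[OF wa y0_free_on])
  show "killed_by_contractions cells (aact z (edges kmatch))"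
    unfolding e unfolding aact_def
  proof (rule killed_by_contractions_sum[OF _ wa[unfolded perms_def]])
    fix p assume "p \<in> {p. p permutes cells}"
    then have p: "p permutes cells" by simp
    have "killed_by_contractions cells (y0 :: 'k lam)"
      unfolding killed_by_contractions_def by (intro ballI impI y0_contract)
    from killed_by_contractions_relab[OF y0_free_on this permutes_inj_on[OF p]]
    show "killed_by_contractions cells (relab p (y0 :: 'k lam))" by (simp only: permutes_image[OF p])
  qed
qed

definition specht_class :: "'k::field_char_0 bij_sp \<Rightarrow> 'k ext_lam" where
  "specht_class z = ext_elem cells (aact z (edges kmatch))"

lemma specht_class_linear:
  "specht_class (a + fscale c b) = specht_class a + mscale Ext_Lambda c (specht_class b)"
  by (simp add: specht_class_def flin_add[OF aact_left] flin_scale[OF aact_left] ext_elem_add ext_elem_scale)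

lemma specht_class_Ext0: "z \<in> specht shape \<Longrightarrow> specht_class z \<in> Ext0 Lambda_C cells"
  unfolding specht_class_def by (intro ext_elem_Ext0 specht_vector finite_cells)

lemma subspace_specht: "fv.subspace (specht shape :: 'k::field_char_0 bij_sp set)"
  unfolding specht_shape by (rule fp.linear_subspace_image[OF grp_mult_left subspace_perms])

lemma specht_class_inj: "inj_on specht_class (specht shape :: 'k::field_char_0 bij_sp set)"
proof (rule inj_onI)
  fix a b :: "'k bij_sp" assume ab: "a \<in> specht shape" "b \<in> specht shape" "specht_class a = specht_class b"
  have d: "a - b \<in> specht shape" by (rule fv.subspace_diff[OF subspace_specht ab(1,2)])
  interpret E: vector_space "mscale Ext_Lambda :: 'k \<Rightarrow> 'k ext_lam \<Rightarrow> _" by (rule vector_space_Ext)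
  have "specht_class (a - b) = specht_class a + mscale Ext_Lambda (-1) (specht_class b)"
    using specht_class_linear[of a "-1" b] by (simp add: fscale_minus1)
  also have "\<dots> = 0" using ab(3) by simp
  finally have "ext_elem cells (aact (a - b) (edges kmatch)) = 0" by (simp add: specht_class_def)
  then have rel: "aact (a - b) (edges kmatch) \<in> lam_rel cells"
    by (rule ext_elem_eq_0[OF finite_cells specht_vector(1)[OF d]])
  obtain w where "w \<in> perms" "a - b = grp_mult w (grp_mult \<alpha> \<beta>)" using d by (auto simp: specht_shape)
  then have "a - b = 0" using rel by (rule specht_injective)
  then show "a = b" by simp
qed

lemma specht_class_equivariant:
  assumes "z \<in> specht shape" "s permutes cells"
  shows "specht_class (grp_mult (Poly_Mapping.single s 1) z) = sym_act Ext_Lambda (l * (l - 1)) s (specht_class z)"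
proof -
  have "sym_act Ext_Lambda (l * (l - 1)) s (ext_elem {1..l * (l - 1)} (aact z (edges kmatch)))
     = ext_elem {1..l * (l - 1)} (relab s (aact z (edges kmatch)))"
    using specht_vector[OF assms(1)] assms(2) unfolding cells_def by (rule sym_act_ext_elem)
  then show ?thesis by (simp only: specht_class_def grp_mult_single aact_lmul cells_def)
qed

lemma lmul_specht:
  "s permutes cells \<Longrightarrow> z \<in> specht shape \<Longrightarrow> grp_mult (Poly_Mapping.single s 1) z \<in> (specht shape :: 'k::field_char_0 bij_sp set)"
  unfolding specht_shape by (auto simp: lmul_grp_mult lmul_perms)

theorem specht_in_Ext0:
  defines "S \<equiv> specht_class ` (specht shape :: 'k::field_char_0 bij_sp set)"
  shows "S \<subseteq> Ext0 Lambda_C cells" "sym_submodule Ext_Lambda (l * (l - 1)) S" "iso_specht shape Ext_Lambda S"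
proof -
  show 1: "S \<subseteq> Ext0 Lambda_C cells" unfolding S_def using specht_class_Ext0 by blast
  interpret E: vector_space "mscale Ext_Lambda :: 'k \<Rightarrow> 'k ext_lam \<Rightarrow> _" by (rule vector_space_Ext)
  have lin: "Vector_Spaces.linear fscale (mscale Ext_Lambda) (specht_class :: 'k bij_sp \<Rightarrow> _)"
  proof unfold_locales
    show "specht_class (a + b) = specht_class a + specht_class b" for a b :: "'k bij_sp"
      using specht_class_linear[of a 1 b] by simp
    have "specht_class (0 :: 'k bij_sp) = 0"
      using specht_class_linear[of "0 :: 'k bij_sp" 1 0] by simp
    then show "specht_class (fscale c a) = mscale Ext_Lambda c (specht_class a)" for c and a :: "'k bij_sp"
      using specht_class_linear[of 0 c a] by simp
  qed
  interpret EP: vector_space_pair "fscale :: 'k \<Rightarrow> 'k bij_sp \<Rightarrow> _" "mscale Ext_Lambda :: 'k \<Rightarrow> 'k ext_lam \<Rightarrow> _"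
    by unfold_locales
  have sub: "E.subspace S" unfolding S_def by (rule EP.linear_subspace_image[OF lin subspace_specht])
  show "sym_submodule Ext_Lambda (l * (l - 1)) S"
    unfolding sym_submodule_def
  proof (intro conjI allI impI ballI sub)
    show "S \<subseteq> sp Ext_Lambda {1..l * (l - 1)}"
      using 1 by (auto simp: Ext0_def Ext_Lambda_def cells_def)
    fix s x assume s: "s permutes {1..l * (l - 1)}" and "x \<in> S"
    then obtain z where z: "z \<in> specht shape" "x = specht_class z" by (auto simp: S_def)
    have s': "s permutes cells" using s by (simp add: cells_def)
    show "sym_act Ext_Lambda (l * (l - 1)) s x \<in> S"
      unfolding z(2) S_def specht_class_equivariant[OF z(1) s', symmetric]
      by (rule imageI[OF lmul_specht[OF s' z(1)]])
  qed
  show "iso_specht shape Ext_Lambda S"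
    unfolding iso_specht_def
  proof (intro exI[of _ specht_class] conjI ballI allI impI)
    show "bij_betw specht_class (specht shape) S"
      using specht_class_inj by (simp add: bij_betw_def S_def)
    show "specht_class (a + fscale c b) = specht_class a + mscale Ext_Lambda c (specht_class b)" for a b and c :: 'k
      by (rule specht_class_linear)
    show "specht_class (grp_mult (Poly_Mapping.single s 1) a) = sym_act Ext_Lambda (sum_list shape) s (specht_class a)"
      if "s permutes {1..sum_list shape}" "a \<in> specht shape" for s and a :: "'k bij_sp"
      unfolding sum_list_shape by (rule specht_class_equivariant[OF that(2) that(1)[unfolded cells_shape]])
  qed
qed

text \<open>The vector is the image of the nonzero element \<open>\<beta> u \<alpha> \<beta>\<close> for a suitable permutation \<open>u\<close>.\<close>

lemma antisymmetric_vector: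
  assumes iso: "iso_specht shape Ext_Lambda (S :: 'k::field_char_0 ext_lam set)"
    and sym: "sym_submodule Ext_Lambda (l * (l - 1)) S"
  obtains x where "x \<in> S" "x \<noteq> 0"
    "\<And>q. q \<in> cperm cells col \<Longrightarrow> sym_act Ext_Lambda (l * (l - 1)) q x = mscale Ext_Lambda (sg q) x"
proof -
  obtain \<theta> where bij: "bij_betw \<theta> (specht shape) S"
    and lin: "\<And>a b c. a \<in> specht shape \<Longrightarrow> b \<in> specht shape \<Longrightarrow> \<theta> (a + fscale c b) = \<theta> a + mscale Ext_Lambda c (\<theta> b)"
    and eq: "\<And>s a. s permutes cells \<Longrightarrow> a \<in> specht shape \<Longrightarrow>
      \<theta> (grp_mult (Poly_Mapping.single s 1) a) = sym_act Ext_Lambda (l * (l - 1)) s (\<theta> a)"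
    using iso unfolding iso_specht_def cells_shape unfolding sum_list_shape by blast
  interpret E: vector_space "mscale Ext_Lambda :: 'k \<Rightarrow> 'k ext_lam \<Rightarrow> _" by (rule vector_space_Ext)
  define z :: "'k bij_sp" where "z = grp_mult \<alpha> \<beta>"
  have z0: "z \<noteq> 0"
  proof
    assume "z = 0"
    then have "aact z (edges kmatch) = (0 :: 'k lam)" using flin_0[OF aact_left] by metis
    then show False
      using aact_young_nonzero fv.subspace_0[OF subspace_lam_rel] unfolding z_def by metis
  qed
  obtain u where u: "u permutes cells" "grp_mult \<beta> (lmul u z) \<noteq> 0"
    by (rule \<beta>_translate_nonzero[OF z_def \<alpha>_perms z0])
  define b where "b = grp_mult \<beta> (lmul u z)"
  have b: "b \<in> specht shape"
  proof -
    have "b = grp_mult (grp_mult \<beta> (Poly_Mapping.single u 1)) (grp_mult \<alpha> \<beta>)"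
      by (simp add: b_def z_def grp_mult_assoc)
    then show ?thesis
      unfolding specht_shape using grp_mult_perms[OF \<beta>_perms single_perms[OF u(1)]] by blast
  qed
  have zero: "(0 :: 'k bij_sp) \<in> specht shape" by (rule fv.subspace_0[OF subspace_specht])
  have t0: "\<theta> 0 = 0" using lin[OF zero zero, of 1] by simp
  have b0: "\<theta> b \<noteq> 0"
  proof
    assume "\<theta> b = 0"
    then have "b = 0" using inj_onD[OF bij_betw_imp_inj_on[OF bij] _ b zero] t0 by simp
    then show False using u(2) by (simp add: b_def)
  qed
  have bS: "\<theta> b \<in> S" using bij b by (auto simp: bij_betw_def)
  have "sym_act Ext_Lambda (l * (l - 1)) q (\<theta> b) = mscale Ext_Lambda (sg q) (\<theta> b)" if q: "q \<in> cperm cells col" for q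
  proof -
    have "sym_act Ext_Lambda (l * (l - 1)) q (\<theta> b) = \<theta> (lmul q b)"
      using eq[OF cperm_permutes[OF q] b] by simp
    also have "lmul q b = 0 + fscale (sg q) b"
      by (simp add: b_def lmul_grp_mult \<beta>_col[OF q] flin_scale[OF grp_mult_left])
    also have "\<theta> (0 + fscale (sg q) b) = mscale Ext_Lambda (sg q) (\<theta> b)" using lin[OF zero b] t0 by simp
    finally show ?thesis .
  qed
  with bS b0 show ?thesis by (intro that[of "\<theta> b"])
qed

end

section \<open>Composition of two generators\<close>

abbreviation permute_pairs :: "brauer \<Rightarrow> (nat \<Rightarrow> nat) \<Rightarrow> brauer" where
  "permute_pairs b h \<equiv> case_sum (b \<circ> Inl) (b \<circ> Inr \<circ> h)"

lemma ub_rel_base: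
  "b \<in> D X Y \<Longrightarrow> h \<in> wreath ((card Y - card X) div 2) \<Longrightarrow>
     Poly_Mapping.single (permute_pairs b h) 1
        - Poly_Mapping.single b (of_int (twist e d ((card Y - card X) div 2) h)) \<in> ub_rel e d X Y"
  unfolding ub_rel_def by (rule fv.span_base) blast

lemma permute_pairs_id [simp]: "permute_pairs b id = b"
  by (auto simp: fun_eq_iff split: sum.split)

lemma wreath_1: "wreath 1 = {id, transpose 1 2}"
proof -
  have I: "{1..2 * 1} = {1, 2 :: nat}" by auto
  have "h ` {1, 2} = {1, 2 :: nat}" if "h permutes {1, 2}" for h using that by (rule permutes_image)
  then show ?thesis
    unfolding wreath_def I permutes_doubleton_iff by (auto simp: transpose_def)
qed

lemma twist_1: "twist Minus Minus 1 (transpose 1 2) = -1"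
proof -
  have "wreath_proj 1 (transpose 1 2) = id" by (auto simp: wreath_proj_def transpose_def fun_eq_iff)
  then show ?thesis by (simp add: twist_def sign_swap_id)
qed

lemma ub_rel_degree1:
  fixes T :: "'k::field arr \<Rightarrow> ('b \<Rightarrow>\<^sub>0 'k)"
  assumes c: "card Y = card X + 2" and T: "flin T" "fv.subspace W"
    and swap: "\<And>b. b \<in> D X Y \<Longrightarrow> T (Poly_Mapping.single (permute_pairs b (transpose 1 2)) 1)
      + T (Poly_Mapping.single b 1) \<in> W"
    and r: "r \<in> ub_rel Minus Minus X Y"
  shows "T r \<in> W"
proof (rule flin_span_mem[OF T _ r[unfolded ub_rel_def]], clarify)
  fix b h assume b: "b \<in> D X Y" and "h \<in> wreath ((card Y - card X) div 2)"
  then have h: "h = id \<or> h = transpose 1 2" using wreath_1 c by simp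
  have t: "(card Y - card X) div 2 = 1" using c by simp
  from h show "T (Poly_Mapping.single (permute_pairs b h) 1
      - Poly_Mapping.single b (of_int (twist Minus Minus ((card Y - card X) div 2) h))) \<in> W"
  proof
    assume h: "h = id"
    have "wreath_proj 1 id = id" by (auto simp: wreath_proj_def fun_eq_iff)
    then have tw: "twist Minus Minus 1 id = 1" by (simp add: twist_def)
    show ?thesis unfolding t h permute_pairs_id tw by (simp add: flin_0[OF T(1)] fv.subspace_0[OF T(2)])
  next
    assume h: "h = transpose 1 2"
    show ?thesis
      unfolding t h twist_1 using swap[OF b] by (simp add: single_uminus flin_add[OF T(1)])
  qed
qed

lemma D_comp_in_D:
  assumes f: "f \<in> D X Y" and g: "g \<in> D Y Z" and fin: "finite X" "finite Y"
  shows "D_comp X Y Z g f \<in> D X Z"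
proof -
  let ?a = "card Y - card X" and ?b = "card Z - card Y" and ?c = "card Z - card X"
  have c: "card X \<le> card Y" "card Y \<le> card Z" "even ?a" "even ?b" using f g by (auto simp: D_def)
  have abc: "?c = ?a + ?b" using c by simp
  define \<phi> :: "nat + nat \<Rightarrow> nat + nat" where
    "\<phi> = case_sum (\<lambda>x. Inl (f (Inl x))) (\<lambda>i. if i \<le> ?a then Inl (f (Inr i)) else Inr (i - ?a))"
  have fb: "inj_on f (X <+> {1..?a})" "f ` (X <+> {1..?a}) = Y" using f by (auto simp: D_def bij_betw_def)
  have inj: "inj_on \<phi> (X <+> {1..?c})"
  proof (rule inj_onI)
    fix x y assume xy: "x \<in> X <+> {1..?c}" "y \<in> X <+> {1..?c}" "\<phi> x = \<phi> y"
    have in1: "Inl a \<in> X <+> {1..?a} \<longleftrightarrow> a \<in> X" "Inr i \<in> X <+> {1..?a} \<longleftrightarrow> 1 \<le> i \<and> i \<le> ?a" for a i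
      by (auto simp: Plus_def)
    show "x = y"
      using xy inj_on_eq_iff[OF fb(1)]
      by (cases x; cases y) (auto simp: \<phi>_def in1 Plus_def split: if_splits)
  qed
  have sub: "\<phi> ` (X <+> {1..?c}) \<subseteq> Y <+> {1..?b}"
  proof clarify
    fix x assume x: "x \<in> X <+> {1..?c}"
    have "f (Inl a) \<in> Y" if "a \<in> X" for a using that fb(2) by blast
    moreover have "f (Inr i) \<in> Y" if "1 \<le> i" "i \<le> ?a" for i
    proof -
      have "f (Inr i) \<in> f ` (X <+> {1..?a})" by (rule imageI) (use that in auto)
      then show ?thesis by (simp only: fb(2))
    qed
    ultimately show "\<phi> x \<in> Y <+> {1..?b}" using x abc by (cases x) (auto simp: \<phi>_def)
  qed
  have cards: "card (X <+> {1..?c}) = card (Y <+> {1..?b})" using fin c abc by (simp add: card_Plus)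
  have "\<phi> ` (X <+> {1..?c}) = Y <+> {1..?b}"
    by (rule card_subset_eq[OF _ sub]) (use fin cards card_image[OF inj] in auto)
  then have bij: "bij_betw (g \<circ> \<phi>) (X <+> {1..?c}) Z"
    using inj D_bij[OF g] by (intro bij_betw_trans[of \<phi> _ "Y <+> {1..?b}"]) (simp_all only: bij_betw_def)
  have res: "D_comp X Y Z g f = restrict (g \<circ> \<phi>) (X <+> {1..?c})"
    unfolding D_comp_def by (rule arg_cong[where f = "\<lambda>h. restrict h _"])
      (auto simp: fun_eq_iff \<phi>_def split: sum.split)
  have "bij_betw (D_comp X Y Z g f) (X <+> {1..?c}) Z"
    unfolding res using bij_betw_cong[of "X <+> {1..?c}" "g \<circ> \<phi>" "restrict (g \<circ> \<phi>) (X <+> {1..?c})" Z] bij by simp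
  moreover have "D_comp X Y Z g f \<in> extensional (X <+> {1..?c})" unfolding res by (rule restrict_extensional)
  moreover have "even ?c" unfolding abc using c(3,4) by (rule dvd_add)
  ultimately show ?thesis using order_trans[OF c(1,2)] unfolding D_def by blast
qed

abbreviation comp_bilin :: "nat set \<Rightarrow> nat set \<Rightarrow> nat set \<Rightarrow> 'k::field arr \<Rightarrow> 'k arr \<Rightarrow> 'k arr" where
  "comp_bilin X Y Z \<equiv> bilin_ext fscale (\<lambda>g f. Poly_Mapping.single (D_comp X Y Z g f) 1)"

lemma wreath_2:
  assumes "h permutes {1..4}" "h ` {1, 2} = {1, 2} \<and> h ` {3, 4} = {3, 4} \<or> h ` {1, 2} = {3, 4} \<and> h ` {3, 4} = {1, 2}"
  shows "h \<in> wreath 2"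
proof -
  have two: "{1..2} = {1, 2 :: nat}" by auto
  show ?thesis using assms unfolding wreath_def two by (auto simp: numeral_eq_Suc)
qed

lemma wreath_2_elements:
  "transpose 1 2 \<in> wreath 2" "transpose 3 4 \<in> wreath 2" "transpose 1 3 \<circ> transpose 2 4 \<in> wreath 2"
  by (rule wreath_2; auto intro!: permutes_compose permutes_swap_id simp: transpose_def)+

lemma twist_2:
  "twist Minus Minus 2 (transpose 1 2) = -1" "twist Minus Minus 2 (transpose 3 4) = -1"
  "twist Minus Minus 2 (transpose 1 3 \<circ> transpose 2 4) = -1"
proof -
  have "wreath_proj 2 h = (\<lambda>i. if i = 1 then (h 2 + 1) div 2 else if i = 2 then (h 4 + 1) div 2 else i)" for h
  proof
    fix i :: nat
    consider "i = 1" | "i = 2" | "i \<notin> {1..2}" "i \<noteq> 1" "i \<noteq> 2" by fastforce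
    then show "wreath_proj 2 h i = (if i = 1 then (h 2 + 1) div 2 else if i = 2 then (h 4 + 1) div 2 else i)"
      by cases (auto simp: wreath_proj_def)
  qed
  then have "wreath_proj 2 (transpose 1 2) = id" "wreath_proj 2 (transpose 3 4) = id"
    "wreath_proj 2 (transpose 1 3 \<circ> transpose 2 4) = transpose 1 2"
    by (auto simp: transpose_def fun_eq_iff)
  moreover have "sign (transpose 1 3 \<circ> transpose 2 4 :: nat \<Rightarrow> nat) = 1"
    by (subst sign_compose) (auto simp: permutation_swap_id sign_swap_id)
  ultimately show "twist Minus Minus 2 (transpose 1 2) = -1" "twist Minus Minus 2 (transpose 3 4) = -1"
    "twist Minus Minus 2 (transpose 1 3 \<circ> transpose 2 4) = -1"
    by (simp_all add: twist_def sign_swap_id)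
qed

context
  fixes X Y Z :: "nat set"
  assumes fin: "finite X" "finite Y" and cY: "card Y = card X + 2" and cZ: "card Z = card X + 4"
begin

lemma ub_rel_degree2:
  assumes "b \<in> D X Z" "h \<in> wreath 2" "twist Minus Minus 2 h = -1"
  shows "Poly_Mapping.single (permute_pairs b h) 1 + Poly_Mapping.single b 1 \<in> ub_rel Minus Minus X Z"
  using ub_rel_base[OF assms(1), of h Minus Minus] assms(2,3) cZ by (simp add: single_uminus)

lemma D_comp_swap_left:
  "D_comp X Y Z (permute_pairs g (transpose 1 2)) f = permute_pairs (D_comp X Y Z g f) (transpose 3 4)"
  using cY cZ by (auto simp: D_comp_def fun_eq_iff restrict_def transpose_def Plus_def image_iff split: sum.split)

lemma D_comp_swap_right:
  "D_comp X Y Z g (permute_pairs f (transpose 1 2)) = permute_pairs (D_comp X Y Z g f) (transpose 1 2)"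
  using cY cZ by (auto simp: D_comp_def fun_eq_iff restrict_def transpose_def Plus_def image_iff split: sum.split)

lemma comp_rel_left:
  assumes "r \<in> ub_rel Minus Minus Y Z" "f \<in> free_on (D X Y)"
  shows "comp_bilin X Y Z r f \<in> (ub_rel Minus Minus X Z :: 'k::field arr set)"
proof (rule flin_mem[OF flin_bilin_right subspace_ub_rel _ assms(2)])
  fix b assume b: "b \<in> D X Y"
  show "comp_bilin X Y Z r (Poly_Mapping.single b 1) \<in> ub_rel Minus Minus X Z"
  proof (rule ub_rel_degree1[OF _ flin_bilin_left subspace_ub_rel _ assms(1)])
    fix g assume g: "g \<in> D Y Z"
    show "comp_bilin X Y Z (Poly_Mapping.single (permute_pairs g (transpose 1 2)) 1) (Poly_Mapping.single b 1)
      + comp_bilin X Y Z (Poly_Mapping.single g 1) (Poly_Mapping.single b 1) \<in> (ub_rel Minus Minus X Z :: 'k arr set)"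
      using ub_rel_degree2[OF D_comp_in_D[OF b g fin] wreath_2_elements(2) twist_2(2)]
      by (simp del: One_nat_def add: D_comp_swap_left)
  qed (use cY cZ in simp)
qed

lemma comp_rel_right:
  assumes "r \<in> ub_rel Minus Minus X Y" "g \<in> free_on (D Y Z)"
  shows "comp_bilin X Y Z g r \<in> (ub_rel Minus Minus X Z :: 'k::field arr set)"
proof (rule flin_mem[OF flin_bilin_left subspace_ub_rel _ assms(2)])
  fix b assume b: "b \<in> D Y Z"
  show "comp_bilin X Y Z (Poly_Mapping.single b 1) r \<in> ub_rel Minus Minus X Z"
  proof (rule ub_rel_degree1[OF _ flin_bilin_right subspace_ub_rel _ assms(1)])
    fix f assume f: "f \<in> D X Y"
    show "comp_bilin X Y Z (Poly_Mapping.single b 1) (Poly_Mapping.single (permute_pairs f (transpose 1 2)) 1)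
      + comp_bilin X Y Z (Poly_Mapping.single b 1) (Poly_Mapping.single f 1) \<in> (ub_rel Minus Minus X Z :: 'k arr set)"
      using ub_rel_degree2[OF D_comp_in_D[OF f b fin] wreath_2_elements(1) twist_2(1)]
      by (simp del: One_nat_def add: D_comp_swap_right)
  qed (use cY cZ in simp)
qed

lemma comp_quot:
  assumes f: "f \<in> D X Y" and g: "g \<in> D Y Z"
  shows "ub_quot Minus Minus X Z (comp_bilin X Y Z
       (ub_quot Minus Minus Y Z (Poly_Mapping.single g 1)) (ub_quot Minus Minus X Y (Poly_Mapping.single f 1)))
    = ub_quot Minus Minus X Z (Poly_Mapping.single (D_comp X Y Z g f) (1 :: 'k::field))"
proof (rule fquot_eqI[OF subspace_ub_rel])
  let ?g = "Poly_Mapping.single g (1 :: 'k)" and ?f = "Poly_Mapping.single f (1 :: 'k)"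
  let ?qg = "ub_quot Minus Minus Y Z ?g" and ?qf = "ub_quot Minus Minus X Y ?f"
  have qf: "?qf \<in> free_on (D X Y)" by (rule fquot_free_on[OF subspace_ub_rel ub_rel_free_on single_free_on[OF f]])
  have g1: "?g - ?qg \<in> ub_rel Minus Minus Y Z" and f1: "?f - ?qf \<in> ub_rel Minus Minus X Y"
    by (rule fquot_diff[OF subspace_ub_rel])+
  have "comp_bilin X Y Z ?qg ?qf - Poly_Mapping.single (D_comp X Y Z g f) 1
      = - (comp_bilin X Y Z (?g - ?qg) ?qf + comp_bilin X Y Z ?g (?f - ?qf))"
    by (simp add: flin_diff[OF flin_bilin_left] flin_diff[OF flin_bilin_right])
  also have "\<dots> \<in> ub_rel Minus Minus X Z"
    by (intro fv.subspace_neg[OF subspace_ub_rel] fv.subspace_add[OF subspace_ub_rel]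
        comp_rel_left[OF g1 qf] comp_rel_right[OF f1 single_free_on[OF g]])
  finally show "comp_bilin X Y Z ?qg ?qf - Poly_Mapping.single (D_comp X Y Z g f) 1 \<in> ub_rel Minus Minus X Z" .
qed

text \<open>Exchanging the two added pairs changes the sign in the quadratic part of the \<open>(-;-)\<close>-category.\<close>

lemma quot_exchange:
  assumes "b \<in> D X Z"
  shows "ub_quot Minus Minus X Z (Poly_Mapping.single (permute_pairs b (transpose 1 3 \<circ> transpose 2 4)) (1 :: 'k::field))
    = - ub_quot Minus Minus X Z (Poly_Mapping.single b 1)"
proof -
  have "ub_quot Minus Minus X Z (Poly_Mapping.single (permute_pairs b (transpose 1 3 \<circ> transpose 2 4)) (1 :: 'k))
      = ub_quot Minus Minus X Z (- Poly_Mapping.single b 1)"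
    using ub_rel_degree2[OF assms wreath_2_elements(3) twist_2(3)]
    by (intro fquot_eqI[OF subspace_ub_rel]) simp
  then show ?thesis by (simp add: flin_neg[OF fquot_lin[OF subspace_ub_rel]])
qed

end

section \<open>The generators indexed by permutations\<close>

text \<open>In the opposite category this morphism removes \<open>p (k + 1)\<close> and \<open>p (k + 2)\<close> and relabels
  the remaining elements by the inverse of \<open>p\<close>. Every element of \<open>D {1..k} {1..k + 2}\<close> is of
  this form.\<close>

definition perm_brauer :: "nat \<Rightarrow> (nat \<Rightarrow> nat) \<Rightarrow> brauer" where
  "perm_brauer k p = restrict (case_sum p (\<lambda>j. p (k + j))) ({1..k} <+> {1..2})"

definition perm_arrow :: "nat \<Rightarrow> (nat \<Rightarrow> nat) \<Rightarrow> 'k::field arr" where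
  "perm_arrow k p = ub_quot Minus Minus {1..k} {1..k + 2} (Poly_Mapping.single (perm_brauer k p) 1)"

lemma perm_brauer_D:
  assumes "p permutes {1..k + 2}" shows "perm_brauer k p \<in> D {1..k} {1..k + 2}"
proof -
  let ?g = "case_sum id (\<lambda>j. k + j) :: nat + nat \<Rightarrow> nat"
  have "bij_betw ?g ({1..k} <+> {1..2}) {1..k + 2}"
  proof (rule bij_betw_imageI)
    show "inj_on ?g ({1..k} <+> {1..2})" by (auto simp: inj_on_def Plus_def)
    have "?g ` ({1..k} <+> {1..2}) = {1..k} \<union> (\<lambda>j. k + j) ` {1..2}"
      by (simp add: Plus_def image_Un image_image)
    also have "(\<lambda>j. k + j) ` {1..2} = {k + 1..k + 2}" by (simp add: image_add_atLeastAtMost)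
    finally show "?g ` ({1..k} <+> {1..2}) = {1..k + 2}" by auto
  qed
  from bij_betw_trans[OF this permutes_imp_bij[OF assms]]
  have bij: "bij_betw (p \<circ> ?g) ({1..k} <+> {1..2}) {1..k + 2}" .
  have res: "perm_brauer k p = restrict (p \<circ> ?g) ({1..k} <+> {1..2})"
    unfolding perm_brauer_def by (rule arg_cong[where f = "\<lambda>h. restrict h _"]) (auto simp: fun_eq_iff split: sum.split)
  have "bij_betw (perm_brauer k p) ({1..k} <+> {1..2}) {1..k + 2}"
    unfolding res
    using bij_betw_cong[of "{1..k} <+> {1..2}" "p \<circ> ?g" "restrict (p \<circ> ?g) ({1..k} <+> {1..2})" "{1..k + 2}"] bij
    by simp
  then show ?thesis by (simp add: D_def perm_brauer_def)
qed

lemma perm_brauer_Inl: "x \<in> {1..k} \<Longrightarrow> perm_brauer k p (Inl x) = p x"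
  and perm_brauer_Inr: "perm_brauer k p (Inr 1) = p (k + 1)" "perm_brauer k p (Inr 2) = p (k + 2)"
  by (auto simp: perm_brauer_def Plus_def)

lemma perm_arrow_hom: "p permutes {1..k + 2} \<Longrightarrow> perm_arrow k p \<in> hom dbmm {1..k + 2} {1..k}"
  unfolding perm_arrow_def db_simps by (intro imageI single_free_on perm_brauer_D)

lemma perm_arrow_rel: "Poly_Mapping.single (perm_brauer k p) 1 - perm_arrow k p \<in> ub_rel Minus Minus {1..k} {1..k + 2}"
  unfolding perm_arrow_def by (rule fquot_diff[OF subspace_ub_rel])

text \<open>Composing \<open>p\<close> with this permutation exchanges the two pairs that are removed by the two
  successive arrows given by \<open>p\<close> and \<open>p'\<close>.\<close>

definition pair_exchange :: "nat \<Rightarrow> (nat \<Rightarrow> nat) \<Rightarrow> nat \<Rightarrow> nat" where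
  "pair_exchange k p' = transpose (p' (k + 1)) (k + 3) \<circ> transpose (p' (k + 2)) (k + 4)"

lemma in_Plus_iff: "Inl a \<in> A <+> B \<longleftrightarrow> a \<in> A" "Inr b \<in> A <+> B \<longleftrightarrow> b \<in> B"
  by auto

lemma D_comp_perm_brauer:
  assumes p': "p' permutes {1..k + 2}"
  shows "D_comp {1..k} {1..k + 2} {1..k + 4} (perm_brauer (k + 2) q) (perm_brauer k p') = restrict (case_sum (\<lambda>x. q (p' x))
      (\<lambda>i. if i = 1 then q (p' (k + 1)) else if i = 2 then q (p' (k + 2)) else q (k + i))) ({1..k} <+> {1..4})"
    (is "?L = ?R")
proof
  fix x
  have b: "p' x \<in> {1..k + 2}" if "x \<in> {1..k + 2}" for x using permutes_in_image[OF p'] that by simp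
  have a: "perm_brauer (k + 2) q (Inl (p' x)) = q (p' x)" if "x \<in> {1..k + 2}" for x
    by (rule perm_brauer_Inl[OF b[OF that]])
  have c: "perm_brauer (k + 2) q (Inr 1) = q (k + 3)" "perm_brauer (k + 2) q (Inr 2) = q (k + 4)"
    using perm_brauer_Inr[of "k + 2" q] by (simp_all add: numeral_eq_Suc)
  show "?L x = ?R x"
  proof (cases x)
    case (Inl y)
    show ?thesis
      unfolding Inl D_comp_def restrict_def in_Plus_iff sum.case using perm_brauer_Inl[of y k p'] a[of y] by simp
  next
    case (Inr i)
    consider "i = 1" | "i = 2" | "i = 3" | "i = 4" | "i \<notin> {1..4}" by fastforce
    then show ?thesis
      unfolding Inr D_comp_def restrict_def in_Plus_iff sum.case
      using perm_brauer_Inr[of k p'] a[of "k + 1"] a[of "k + 2"] c by cases auto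
  qed
qed

lemma cmp_exchange:
  assumes p: "p permutes {1..k + 4}" and p': "p' permutes {1..k + 2}"
  shows "cmp dbmm {1..k + 4} {1..k + 2} {1..k} (perm_arrow k p') (perm_arrow (k + 2) (p \<circ> pair_exchange k p'))
    = - cmp dbmm {1..k + 4} {1..k + 2} {1..k} (perm_arrow k p') (perm_arrow (k + 2) p :: 'k::field arr)"
proof -
  let ?X = "{1..k}" and ?Y = "{1..k + 2}" and ?Z = "{1..k + 4}" and ?s = "pair_exchange k p'"
  have e: "k + 2 + 2 = k + 4" by simp
  have cmp: "cmp dbmm ?Z ?Y ?X (perm_arrow k p') (perm_arrow (k + 2) q :: 'k arr)
      = ub_quot Minus Minus ?X ?Z (Poly_Mapping.single (D_comp ?X ?Y ?Z (perm_brauer (k + 2) q) (perm_brauer k p')) 1)"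
    if q: "q permutes ?Z" for q
    unfolding db_simps perm_arrow_def e
    by (rule comp_quot[OF _ _ _ _ perm_brauer_D[OF p'] perm_brauer_D[of q "k + 2", unfolded e, OF q]]) auto
  have im: "p' (k + 1) \<in> ?Y" "p' (k + 2) \<in> ?Y" "p' (k + 1) \<noteq> p' (k + 2)"
    using permutes_in_image[OF p'] inj_eq[OF permutes_inj[OF p'], of "k + 1" "k + 2"] by auto
  have sp: "?s permutes ?Z"
    unfolding pair_exchange_def using im by (intro permutes_compose permutes_swap_id) auto
  have s1: "?s (p' (k + 1)) = k + 3" "?s (p' (k + 2)) = k + 4" "?s (k + 3) = p' (k + 1)" "?s (k + 4) = p' (k + 2)"
    using im by (auto simp: pair_exchange_def transpose_def)
  have s2: "?s (p' x) = p' x" if "x \<in> ?X" for x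
  proof -
    have "p' x \<in> ?Y" using permutes_in_image[OF p', of x] that by auto
    moreover have "p' x \<noteq> p' (k + 1)" "p' x \<noteq> p' (k + 2)"
      using that inj_eq[OF permutes_inj[OF p']] by auto
    ultimately show ?thesis by (auto simp: pair_exchange_def transpose_def)
  qed
  let ?c = "D_comp ?X ?Y ?Z (perm_brauer (k + 2) p) (perm_brauer k p')"
  have Dc: "?c \<in> D ?X ?Z"
    by (rule D_comp_in_D[OF perm_brauer_D[OF p'] perm_brauer_D[of p "k + 2", unfolded e, OF p]]) auto
  have eq: "D_comp ?X ?Y ?Z (perm_brauer (k + 2) (p \<circ> ?s)) (perm_brauer k p') = permute_pairs ?c (transpose 1 3 \<circ> transpose 2 4)"
    (is "?L = ?R")
  proof
    fix x
    show "?L x = ?R x"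
    proof (cases x)
      case (Inl y)
      show ?thesis unfolding D_comp_perm_brauer[OF p'] Inl using s2[of y] by (auto simp: restrict_def in_Plus_iff)
    next
      case (Inr i)
      consider "i = 1" | "i = 2" | "i = 3" | "i = 4" | "i \<notin> {1..4}" "i \<noteq> 1" "i \<noteq> 2" "i \<noteq> 3" "i \<noteq> 4" by fastforce
      then show ?thesis
        unfolding D_comp_perm_brauer[OF p'] Inr using s1
        by cases (simp_all add: restrict_def in_Plus_iff transpose_def)
    qed
  qed
  show ?thesis
    unfolding cmp[OF permutes_compose[OF sp p]] cmp[OF p] eq
    by (rule quot_exchange[OF _ _ _ _ Dc, of ?Y]) auto
qed

section \<open>A cycle of the bar complex\<close>

definition cycle_objs :: "nat \<Rightarrow> nat \<Rightarrow> nat set list" where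
  "cycle_objs k t = map (\<lambda>i. {1..k + 2 * (t - i)}) [0..<Suc t]"

definition cycle_arrows :: "nat \<Rightarrow> nat \<Rightarrow> (nat \<Rightarrow> nat) list \<Rightarrow> 'k::field arr list" where
  "cycle_arrows k t ps = map (\<lambda>i. perm_arrow (k + 2 * (t - Suc i)) (ps ! i)) [0..<t]"

definition perm_seqs :: "(nat \<Rightarrow> nat) \<Rightarrow> nat \<Rightarrow> nat \<Rightarrow> (nat \<Rightarrow> nat) list set" where
  "perm_seqs f k t = {ps. length ps = t \<and> (\<forall>i<t. ps ! i \<in> cperm {1..k + 2 * (t - i)} f)}"

definition prod_sg :: "(nat \<Rightarrow> nat) list \<Rightarrow> 'k::field_char_0" where
  "prod_sg ps = prod_list (map sg ps)"

lemma cycle_objs_0: "cycle_objs k 0 = [{1..k}]" by (simp add: cycle_objs_def)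

lemma cycle_objs_Cons: "cycle_objs k (Suc t) = {1..k + 2 * Suc t} # cycle_objs k t"
  unfolding cycle_objs_def by (subst upt_conv_Cons) (simp_all add: map_Suc_upt[symmetric] del: upt_Suc)

lemma length_cycle_objs [simp]: "length (cycle_objs k t) = Suc t" by (simp add: cycle_objs_def)
lemma nth_cycle_objs: "i \<le> t \<Longrightarrow> cycle_objs k t ! i = {1..k + 2 * (t - i)}"
  unfolding cycle_objs_def by (subst nth_map) (simp_all del: upt_Suc)
lemma length_cycle_arrows [simp]: "length (cycle_arrows k t ps) = t" by (simp add: cycle_arrows_def)
lemma nth_cycle_arrows: "i < t \<Longrightarrow> cycle_arrows k t ps ! i = perm_arrow (k + 2 * (t - Suc i)) (ps ! i)" by (simp add: cycle_arrows_def)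

lemma cycle_objs_nonempty [simp]: "cycle_objs k t \<noteq> []" using length_cycle_objs[of k t] by (metis list.size(3) nat.distinct(1))

lemma hd_cycle_objs: "hd (cycle_objs k t) = {1..k + 2 * t}"
  using nth_cycle_objs[of 0 t k] by (simp add: hd_conv_nth)

lemma last_cycle_objs: "last (cycle_objs k t) = {1..k}"
  using nth_cycle_objs[of t t k] by (simp add: last_conv_nth)

lemma butlast_cycle_objs: "butlast (cycle_objs k (Suc t)) = cycle_objs (k + 2) t"
  by (rule nth_equalityI) (auto simp: nth_butlast nth_cycle_objs Suc_diff_le)

lemma butlast_cycle_arrows: "butlast (cycle_arrows k (Suc t) (ps @ [p])) = cycle_arrows (k + 2) t ps" if "length ps = t"
  using that by (intro nth_equalityI) (auto simp: nth_butlast nth_cycle_arrows nth_append Suc_diff_Suc[symmetric] simp del: Suc_diff_Suc)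

lemma cycle_arrows_Cons: "cycle_arrows k (Suc t) (p # ps) = perm_arrow (k + 2 * t) p # cycle_arrows k t ps"
  by (rule nth_equalityI) (auto simp: nth_cycle_arrows nth_Cons split: nat.split)

lemma perm_seqs_0: "perm_seqs f k 0 = {[]}" by (auto simp: perm_seqs_def)

lemma perm_seqs_Cons: "p # ps \<in> perm_seqs f k (Suc t) \<longleftrightarrow> p \<in> cperm {1..k + 2 * Suc t} f \<and> ps \<in> perm_seqs f k t"
  by (auto simp: perm_seqs_def All_less_Suc2)

lemma sum_perm_seqs_Cons:
  "(\<Sum>ps\<in>perm_seqs f k (Suc t). h ps) = (\<Sum>p\<in>cperm {1..k + 2 * Suc t} f. \<Sum>ps\<in>perm_seqs f k t. h (p # ps))"
proof -
  have "perm_seqs f k (Suc t) = (\<lambda>(p, ps). p # ps) ` (cperm {1..k + 2 * Suc t} f \<times> perm_seqs f k t)"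
  proof (intro set_eqI iffI)
    fix ps assume ps: "ps \<in> perm_seqs f k (Suc t)"
    then obtain p qs where "ps = p # qs" by (cases ps) (auto simp: perm_seqs_def)
    with ps show "ps \<in> (\<lambda>(p, ps). p # ps) ` (cperm {1..k + 2 * Suc t} f \<times> perm_seqs f k t)"
      using perm_seqs_Cons[of p qs f k t] by force
  next
    fix ps assume "ps \<in> (\<lambda>(p, ps). p # ps) ` (cperm {1..k + 2 * Suc t} f \<times> perm_seqs f k t)"
    then show "ps \<in> perm_seqs f k (Suc t)" using perm_seqs_Cons by auto
  qed
  moreover have inj: "inj_on (\<lambda>(p, ps). p # ps) (cperm {1..k + 2 * Suc t} f \<times> perm_seqs f k t)"
    by (auto simp: inj_on_def)
  ultimately show ?thesis
    by (simp only: sum.reindex[OF inj] sum.cartesian_product comp_def) (auto intro: sum.cong)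
qed

lemma perm_seqs_snoc:
  assumes "length ps = t"
  shows "ps @ [p] \<in> perm_seqs f k (Suc t) \<longleftrightarrow> ps \<in> perm_seqs f (k + 2) t \<and> p \<in> cperm {1..k + 2} f"
proof -
  have e: "k + 2 * (Suc t - i) = k + 2 + 2 * (t - i)" if "i < t" for i using that by simp
  have "(\<forall>i<Suc t. (ps @ [p]) ! i \<in> cperm {1..k + 2 * (Suc t - i)} f) \<longleftrightarrow>
     (\<forall>i<t. ps ! i \<in> cperm {1..k + 2 + 2 * (t - i)} f) \<and> p \<in> cperm {1..k + 2} f"
    using assms e by (auto simp: less_Suc_eq nth_append)
  then show ?thesis using assms by (simp add: perm_seqs_def)
qed

lemma sum_perm_seqs_snoc:
  "(\<Sum>ps\<in>perm_seqs f k (Suc t). h ps) = (\<Sum>ps\<in>perm_seqs f (k + 2) t. \<Sum>p\<in>cperm {1..k + 2} f. h (ps @ [p]))"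
proof -
  have "perm_seqs f k (Suc t) = (\<lambda>(ps, p). ps @ [p]) ` (perm_seqs f (k + 2) t \<times> cperm {1..k + 2} f)"
  proof (intro set_eqI iffI)
    fix ps assume ps: "ps \<in> perm_seqs f k (Suc t)"
    then obtain qs p where qs: "ps = qs @ [p]" by (cases ps rule: rev_cases) (auto simp: perm_seqs_def)
    then have "length qs = t" using ps by (simp add: perm_seqs_def)
    with ps qs show "ps \<in> (\<lambda>(ps, p). ps @ [p]) ` (perm_seqs f (k + 2) t \<times> cperm {1..k + 2} f)"
      using perm_seqs_snoc[of qs t p f k] by force
  next
    fix ps assume "ps \<in> (\<lambda>(ps, p). ps @ [p]) ` (perm_seqs f (k + 2) t \<times> cperm {1..k + 2} f)"
    then obtain qs p where q: "ps = qs @ [p]" "qs \<in> perm_seqs f (k + 2) t" "p \<in> cperm {1..k + 2} f" by auto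
    then have "length qs = t" by (simp add: perm_seqs_def)
    with q show "ps \<in> perm_seqs f k (Suc t)" using perm_seqs_snoc by blast
  qed
  moreover have inj: "inj_on (\<lambda>(ps, p). ps @ [p]) (perm_seqs f (k + 2) t \<times> cperm {1..k + 2} f)"
    by (auto simp: inj_on_def)
  ultimately show ?thesis
    by (simp only: sum.reindex[OF inj] sum.cartesian_product comp_def) (auto intro: sum.cong)
qed

lemma prod_sg_Cons: "prod_sg (p # ps) = sg p * prod_sg ps" by (simp add: prod_sg_def)
lemma prod_sg_snoc: "prod_sg (ps @ [p]) = prod_sg ps * sg p" by (simp add: prod_sg_def)

definition id_bij :: "nat set \<Rightarrow> 'k::field bij_sp" where "id_bij Y = Poly_Mapping.single (restrict id Y) 1"

lemma restrict_id_bijs: "restrict id Y \<in> bijs Y Y"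
  by (simp add: bijs_def bij_betw_def inj_on_def)

lemma id_bij_free_on: "id_bij Y \<in> free_on (bijs Y Y)"
  unfolding id_bij_def by (rule single_free_on[OF restrict_id_bijs])

text \<open>The pairing of a cochain with the bar chain that is the sum of the terms
  \<open>[p\<^sub>1 | \<dots> | p\<^sub>t]\<close>, weighted by the product of the signs, over all sequences of
  colour-preserving permutations. In this chain every arrow removes the two largest elements
  after a permutation.\<close>

definition bar_cycle :: "(nat \<Rightarrow> nat) \<Rightarrow> nat \<Rightarrow> nat
    \<Rightarrow> (nat set, 'k::field_char_0 arr, 'k bij_sp, 'k lam) cochain \<Rightarrow> 'k lam" where
  "bar_cycle f k t c = (\<Sum>ps\<in>perm_seqs f k t. fscale (prod_sg ps) (c (cycle_objs k t) (cycle_arrows k t ps) (id_bij {1..k + 2 * t})))"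

lemma perm_seqs_nth_permutes: "ps \<in> perm_seqs f k t \<Longrightarrow> i < t \<Longrightarrow> ps ! i permutes {1..k + 2 * (t - i)}"
  by (auto simp: perm_seqs_def dest: cperm_permutes)

lemma cycle_arrows_hom:
  assumes "ps \<in> perm_seqs f k t" "i < t"
  shows "cycle_arrows k t ps ! i \<in> hom dbmm (cycle_objs k t ! i) (cycle_objs k t ! Suc i)"
proof -
  have e: "k + 2 * (t - Suc i) + 2 = k + 2 * (t - i)" using assms(2) by simp
  have "perm_arrow (k + 2 * (t - Suc i)) (ps ! i) \<in> hom dbmm {1..k + 2 * (t - Suc i) + 2} {1..k + 2 * (t - Suc i)}"
    by (rule perm_arrow_hom) (use perm_seqs_nth_permutes[OF assms] in \<open>simp only: e\<close>)
  then show ?thesis unfolding e using assms(2) by (simp only: nth_cycle_arrows nth_cycle_objs Suc_leI less_imp_le)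
qed

lemma cycle_objs_obj: "set (cycle_objs k t) \<subseteq> obj dbmm"
  by (auto simp: cycle_objs_def)

lemma bar_dom_seq:
  assumes "ps \<in> perm_seqs f k t" "m \<in> free_on (bijs Y {1..k + 2 * t})"
  shows "bar_dom dbmm (P Y) t (cycle_objs k t) (cycle_arrows k t ps) m"
  unfolding bar_dom_def hd_cycle_objs sp_P
  by (intro conjI allI impI length_cycle_arrows length_cycle_objs cycle_objs_obj cycle_arrows_hom[OF assms(1)] assms(2))

subsection \<open>The cycle condition\<close>

lemma pair_exchange_cperm:
  assumes p': "p' \<in> cperm {1..k + 2} f" and f: "f (k + 1) = f (k + 3)" "f (k + 2) = f (k + 4)"
  shows "pair_exchange k p' \<in> cperm {1..k + 4} f" "sg (pair_exchange k p') = (1 :: 'k::field_char_0)"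
    "pair_exchange k p' \<circ> pair_exchange k p' = id"
proof -
  have p: "p' permutes {1..k + 2}" using p' by (rule cperm_permutes)
  have im: "p' (k + 1) \<in> {1..k + 2}" "p' (k + 2) \<in> {1..k + 2}" "p' (k + 1) \<noteq> p' (k + 2)"
    using permutes_in_image[OF p] inj_eq[OF permutes_inj[OF p], of "k + 1" "k + 2"] by auto
  have c: "f (p' (k + 1)) = f (k + 3)" "f (p' (k + 2)) = f (k + 4)"
    using cperm_colour[OF p', of "k + 1"] cperm_colour[OF p', of "k + 2"] f by auto
  show "pair_exchange k p' \<in> cperm {1..k + 4} f"
    unfolding pair_exchange_def using im c by (intro cperm_comp cperm_transpose) auto
  have "(sg (pair_exchange k p') :: 'k) = sg (transpose (p' (k + 1)) (k + 3)) * sg (transpose (p' (k + 2)) (k + 4))"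
    unfolding pair_exchange_def by (rule sg_compose[of "{1..k + 4}"]) (use im in \<open>auto intro!: permutes_swap_id\<close>)
  then show "sg (pair_exchange k p') = (1 :: 'k)" using im by (auto simp: sign_swap_id)
  show "pair_exchange k p' \<circ> pair_exchange k p' = id"
    using im by (auto simp: pair_exchange_def transpose_def fun_eq_iff)
qed

lemma cochain_neg_arrow:
  assumes c: "c \<in> cochains A (P Y) Lambda_C p" and d: "bar_dom A (P Y) p xs fs m" and i: "i < p"
    and A: "hscale A = fscale"
  shows "c xs (fs[i := - (fs ! i)]) m = - c xs fs m"
proof -
  have h: "fs ! i \<in> hom A (xs ! i) (xs ! Suc i)" using d i by (simp add: bar_dom_def)
  have "c xs (fs[i := hscale A (-1) (fs ! i) + hscale A 0 (fs ! i)]) m =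
      mscale Lambda_C (-1) (c xs fs m) + mscale Lambda_C 0 (c xs (fs[i := fs ! i]) m)"
    using c d i h unfolding cochains_def by blast
  then show ?thesis by (simp add: A fscale_minus1)
qed

text \<open>Composition with \<open>pair_exchange\<close> is an involution on the index set of the sum. It
  preserves signs and colours, because all elements beyond \<open>k\<close> have the same colour, and it
  changes the sign of the composite of two successive arrows. The sum over an inner face is
  therefore its own negative.\<close>

lemma bar_cycle_middle:
  fixes c :: "(nat set, 'k::field_char_0 arr, 'k bij_sp, 'k lam) cochain"
  assumes c: "c \<in> cochains dbmm (P {1..k + 2 * Suc t}) Lambda_C t" and i: "i < t"
    and f: "\<And>x. x > k \<Longrightarrow> f x = f (Suc k)"
  defines "G ps \<equiv> c (take (Suc i) (cycle_objs k (Suc t)) @ drop (Suc (Suc i)) (cycle_objs k (Suc t)))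
     (take i (cycle_arrows k (Suc t) ps) @ [cmp dbmm (cycle_objs k (Suc t) ! i) (cycle_objs k (Suc t) ! Suc i) (cycle_objs k (Suc t) ! Suc (Suc i))
        (cycle_arrows k (Suc t) ps ! Suc i) (cycle_arrows k (Suc t) ps ! i)] @ drop (Suc (Suc i)) (cycle_arrows k (Suc t) ps))
     (id_bij {1..k + 2 * Suc t})"
  shows "(\<Sum>ps\<in>perm_seqs f k (Suc t). fscale (prod_sg ps) (G ps)) = 0"
proof -
  let ?T = "Suc t"
  define q where "q = k + 2 * (?T - Suc (Suc i))"
  have q: "k + 2 * (?T - i) = q + 4" "k + 2 * (?T - Suc i) = q + 2" "q \<ge> k" using i by (auto simp: q_def)
  let ?xs = "cycle_objs k ?T" and ?id = "id_bij {1..k + 2 * ?T} :: 'k bij_sp"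
  have x: "?xs ! i = {1..q + 4}" "?xs ! Suc i = {1..q + 2}" "?xs ! Suc (Suc i) = {1..q}"
    using i q nth_cycle_objs[of i ?T k] nth_cycle_objs[of "Suc i" ?T k] nth_cycle_objs[of "Suc (Suc i)" ?T k] by (simp_all add: q_def)
  define e where "e ps = pair_exchange q (ps ! Suc i)" for ps
  define \<iota> where "\<iota> ps = ps[i := ps ! i \<circ> e ps]" for ps
  have fc: "f (q + 1) = f (q + 3)" "f (q + 2) = f (q + 4)" using f[of "q + 1"] f[of "q + 3"] f[of "q + 2"] f[of "q + 4"] q(3) by auto
  have mem: "ps ! i \<in> cperm {1..q + 4} f" "ps ! Suc i \<in> cperm {1..q + 2} f" "length ps = ?T" if "ps \<in> perm_seqs f k ?T" for ps
  proof -
    have a: "\<And>j. j < ?T \<Longrightarrow> ps ! j \<in> cperm {1..k + 2 * (?T - j)} f" and "length ps = ?T" using that by (auto simp: perm_seqs_def)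
    then show "length ps = ?T" by simp
    show "ps ! i \<in> cperm {1..q + 4} f" using a[of i] i unfolding q(1) by simp
    show "ps ! Suc i \<in> cperm {1..q + 2} f" using a[of "Suc i"] i unfolding q(2) by simp
  qed
  have \<iota>_mem: "\<iota> ps \<in> perm_seqs f k ?T" if ps: "ps \<in> perm_seqs f k ?T" for ps
  proof -
    have "ps ! i \<circ> e ps \<in> cperm {1..k + 2 * (?T - i)} f"
      unfolding q(1) e_def using mem[OF ps] pair_exchange_cperm(1)[OF mem(2)[OF ps] fc] by (intro cperm_comp)
    then show ?thesis using ps i by (auto simp: \<iota>_def perm_seqs_def nth_list_update)
  qed
  have \<iota>\<iota>: "\<iota> (\<iota> ps) = ps" if ps: "ps \<in> perm_seqs f k ?T" for ps
  proof -
    have "e (\<iota> ps) = e ps" by (simp add: e_def \<iota>_def)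
    moreover have "ps ! i \<circ> e ps \<circ> e ps = ps ! i"
      unfolding comp_assoc e_def pair_exchange_cperm(3)[OF mem(2)[OF ps] fc] by simp
    ultimately show ?thesis using mem(3)[OF ps] i by (simp add: \<iota>_def)
  qed
  have prod_sg: "(prod_sg (\<iota> ps) :: 'k) = prod_sg ps" if ps: "ps \<in> perm_seqs f k ?T" for ps
  proof -
    have il: "i < length ps" using mem(3)[OF ps] i by simp
    have "(sg (ps ! i \<circ> e ps) :: 'k) = sg (ps ! i) * sg (e ps)"
      unfolding e_def by (rule sg_compose[of "{1..q + 4}"])
        (use cperm_permutes[OF mem(1)[OF ps]] cperm_permutes[OF pair_exchange_cperm(1)[OF mem(2)[OF ps] fc]] in auto)
    moreover have "(sg (e ps) :: 'k) = 1" unfolding e_def by (rule pair_exchange_cperm(2)[OF mem(2)[OF ps] fc])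
    ultimately have s: "(sg (ps ! i \<circ> e ps) :: 'k) = sg (ps ! i)" by simp
    have "map sg (\<iota> ps) = (map sg ps :: 'k list)"
      unfolding \<iota>_def map_update s using il by (metis list_update_id nth_map)
    then show ?thesis by (simp add: prod_sg_def)
  qed
  have neg: "G (\<iota> ps) = - G ps" if ps: "ps \<in> perm_seqs f k ?T" for ps
  proof -
    let ?fs = "cycle_arrows k ?T ps :: 'k arr list" and ?gs = "cycle_arrows k ?T (\<iota> ps) :: 'k arr list"
    define C where "C = cmp dbmm {1..q + 4} {1..q + 2} {1..q} (?fs ! Suc i) (?fs ! i :: 'k arr)"
    define L where "L = take i ?fs @ [C] @ drop (Suc (Suc i)) ?fs"
    define xs where "xs = take (Suc i) ?xs @ drop (Suc (Suc i)) ?xs"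
    have il: "i < length ps" "Suc i < ?T" using mem(3)[OF ps] i by simp_all
    have nth: "?gs ! j = ?fs ! j" if "j < ?T" "j \<noteq> i" for j
      using that by (simp add: nth_cycle_arrows \<iota>_def)
    have gi: "?gs ! i = perm_arrow (q + 2) (ps ! i \<circ> e ps)" "?fs ! i = perm_arrow (q + 2) (ps ! i)"
      using il q by (auto simp: nth_cycle_arrows \<iota>_def)
    have fi: "?fs ! Suc i = perm_arrow q (ps ! Suc i)" using il by (simp add: nth_cycle_arrows q_def)
    have pp: "ps ! i permutes {1..q + 4}" "ps ! Suc i permutes {1..q + 2}"
      using mem[OF ps] by (auto dest: cperm_permutes)
    have C': "cmp dbmm {1..q + 4} {1..q + 2} {1..q} (?gs ! Suc i) (?gs ! i :: 'k arr) = - C"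
      unfolding C_def nth[OF il(2) n_not_Suc_n[symmetric]] gi fi e_def by (rule cmp_exchange[OF pp])
    have tk: "take i ?gs = take i ?fs" "drop (Suc (Suc i)) ?gs = drop (Suc (Suc i)) ?fs"
      using nth il by (auto intro!: nth_equalityI)
    have li: "L ! i = C" "length L = t" using il by (auto simp: L_def nth_append)
    have "take i ?gs @ [- C] @ drop (Suc (Suc i)) ?gs = L[i := - (L ! i)]"
      unfolding li(1) tk using il by (simp add: L_def list_update_append)
    then have Gi: "G (\<iota> ps) = c xs (L[i := - (L ! i)]) ?id"
      unfolding G_def x C' xs_def by simp
    have G: "G ps = c xs L ?id" unfolding G_def x C_def L_def xs_def ..
    have Ch: "C \<in> hom dbmm {1..q + 4} {1..q}"
    proof -
      have h: "?fs ! i \<in> hom dbmm {1..q + 4} {1..q + 2}" "?fs ! Suc i \<in> hom dbmm {1..q + 2} {1..q}"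
        using cycle_arrows_hom[OF ps, of i] cycle_arrows_hom[OF ps, of "Suc i"] il unfolding x by simp_all
      have "comp_bilin {1..q} {1..q + 2} {1..q + 4} (?fs ! i) (?fs ! Suc i :: 'k arr) \<in> free_on (D {1..q} {1..q + 4})"
        unfolding bilin_ext_def
      proof (rule lin_ext_mem[OF subspace_free_on lin_ext_mem[OF subspace_free_on]])
        show "?fs ! i \<in> free_on (D {1..q + 2} {1..q + 4})" using h(1) unfolding db_simps by (rule hom_free_on)
        show "?fs ! Suc i \<in> free_on (D {1..q} {1..q + 2})" using h(2) unfolding db_simps by (rule hom_free_on)
        show "Poly_Mapping.single (D_comp {1..q} {1..q + 2} {1..q + 4} g f) 1 \<in> free_on (D {1..q} {1..q + 4})"
          if "g \<in> D {1..q + 2} {1..q + 4}" "f \<in> D {1..q} {1..q + 2}" for g f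
          by (rule single_free_on, rule D_comp_in_D[OF that(2,1)]) auto
      qed
      then show ?thesis unfolding C_def db_simps by (rule imageI)
    qed
    have nx: "xs ! j = (if j \<le> i then ?xs ! j else ?xs ! Suc j)" if "j \<le> t" for j
      using that il by (auto simp: xs_def nth_append min_def)
    have nL: "L ! j = (if j < i then ?fs ! j else if j = i then C else ?fs ! Suc j)" if "j < t" for j
      using that il by (auto simp: L_def nth_append nth_Cons' min_def)
    have dom: "bar_dom dbmm (P {1..k + 2 * ?T}) t xs L ?id"
      unfolding bar_dom_def
    proof (intro conjI allI impI)
      show "length L = t" by (rule li(2))
      show "length xs = Suc t" using il by (simp add: xs_def)
      show "set xs \<subseteq> obj dbmm" using cycle_objs_obj[of k ?T] set_take_subset set_drop_subset by (fastforce simp: xs_def)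
      have "hd xs = hd ?xs" by (cases ?xs) (auto simp: xs_def cycle_objs_def)
      then show "?id \<in> sp (P {1..k + 2 * ?T}) (hd xs)" unfolding hd_cycle_objs sp_P by (simp add: id_bij_free_on)
      fix j assume j: "j < t"
      consider "j < i" | "j = i" | "i < j" by linarith
      then show "L ! j \<in> hom dbmm (xs ! j) (xs ! Suc j)"
      proof cases
        case 1
        then show ?thesis using cycle_arrows_hom[OF ps, of j] j nx[of j] nx[of "Suc j"] nL[of j] by simp
      next
        case 2
        then show ?thesis using Ch j nx[of j] nx[of "Suc j"] nL[of j] x by simp
      next
        case 3
        then show ?thesis using cycle_arrows_hom[OF ps, of "Suc j"] j nx[of j] nx[of "Suc j"] nL[of j] by simp
      qed
    qed
    show ?thesis unfolding Gi G by (rule cochain_neg_arrow[OF c dom i]) simp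
  qed
  let ?S = "\<Sum>ps\<in>perm_seqs f k ?T. fscale (prod_sg ps) (G ps)"
  have "?S = (\<Sum>ps\<in>perm_seqs f k ?T. fscale (prod_sg (\<iota> ps)) (G (\<iota> ps)))"
    by (rule sum.reindex_bij_witness[of _ \<iota> \<iota>]) (auto simp: \<iota>\<iota> \<iota>_mem)
  also have "\<dots> = - ?S"
    unfolding sum_negf[symmetric] by (intro sum.cong refl) (simp add: prod_sg neg fv.scale_right_diff_distrib)
  finally have "?S + ?S = 0" by (simp only: add_eq_0_iff)
  then have "?S + ?S \<in> {0}" by simp
  then show ?thesis using subspace_half[OF fv.subspace_single_0] by blast
qed

lemma act_ub_rel:
  fixes w :: "'k::field_char_0 lam"
  assumes "card X = card Z + 2" "r \<in> ub_rel Minus Minus Z X"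
  shows "act Lambda_C X Z r w = 0"
proof -
  have one: "contract_pairs b 1 w = contraction (b (Inr 1)) (b (Inr 2)) w" for b
    using contract_pairs_Suc[of b 0 w] by (simp add: numeral_2_eq_2)
  have t: "(card X - card Z) div 2 = 1" using assms(1) by simp
  have "act Lambda_C X Z r w \<in> {0}"
  proof (rule ub_rel_degree1[OF assms(1) flin_act_left fv.subspace_single_0 _ assms(2)])
    fix b :: brauer
    have "relabel (permute_pairs b (transpose 1 2)) Z = (relabel b Z :: 'k lam \<Rightarrow> 'k lam)"
      by (simp add: relabel_def)
    moreover have "contract_pairs (permute_pairs b (transpose 1 2)) 1 w = - contract_pairs b 1 w"
      unfolding one by (simp add: transpose_def contraction_skew[of "b (Inr 2)"])
    ultimately show "act Lambda_C X Z (Poly_Mapping.single (permute_pairs b (transpose 1 2)) 1) w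
        + act Lambda_C X Z (Poly_Mapping.single b 1) w \<in> {0}"
      unfolding act_Lambda t by (simp add: flin_neg[OF flin_relabel] flin_neg[OF flin_quot_lam])
  qed
  then show ?thesis by simp
qed

lemma act_perm_arrow:
  fixes w :: "'k::field_char_0 lam"
  assumes p: "p permutes {1..k + 2}" and w: "w \<in> free_on (decomp2 {1..k + 2})"
  shows "act Lambda_C {1..k + 2} {1..k} (perm_arrow k p) w
    = quot_map fscale (lam_rel {1..k}) (contraction (k + 1) (k + 2) (relab (inv p) w))"
proof -
  let ?b = "perm_brauer k p" and ?X = "{1..k + 2}" and ?Z = "{1..k}"
  have "act Lambda_C ?X ?Z (Poly_Mapping.single ?b 1 - perm_arrow k p) w = 0"
    by (rule act_ub_rel[OF _ perm_arrow_rel]) simp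
  then have "act Lambda_C ?X ?Z (perm_arrow k p) w = act Lambda_C ?X ?Z (Poly_Mapping.single ?b 1) w"
    using flin_diff[OF flin_act_left] by (metis eq_iff_diff_eq_0)
  also have "\<dots> = quot_map fscale (lam_rel ?Z) (relabel ?b ?Z (contraction (p (k + 1)) (p (k + 2)) w))"
  proof -
    have "contract_pairs ?b 1 w = contraction (p (k + 1)) (p (k + 2)) w"
      using contract_pairs_Suc[of ?b 0 w] perm_brauer_Inr[of k p] by (simp add: numeral_2_eq_2)
    then show ?thesis unfolding act_Lambda by simp
  qed
  also have "relabel ?b ?Z (contraction (p (k + 1)) (p (k + 2)) w) = relab (inv p) (contraction (p (k + 1)) (p (k + 2)) w)"
  proof -
    let ?W = "p ` ?Z"
    have pin: "p (k + 1) \<in> ?X" "p (k + 2) \<in> ?X" using permutes_in_image[OF p] by auto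
    have W: "?X - {p (k + 1), p (k + 2)} = ?W"
    proof -
      have "p ` (?X - {k + 1, k + 2}) = p ` ?X - p ` {k + 1, k + 2}"
        by (rule image_set_diff[OF permutes_inj[OF p]])
      moreover have "?X - {k + 1, k + 2} = ?Z" by auto
      ultimately show ?thesis using permutes_image[OF p] by simp
    qed
    have free: "contraction (p (k + 1)) (p (k + 2)) w \<in> free_on (decomp2 ?W)"
      using contraction_free_on[OF w pin] by (simp only: W)
    have val: "(?b \<circ> Inl) x = p x" if "x \<in> ?Z" for x using perm_brauer_Inl[OF that] by simp
    have bij: "bij_betw (?b \<circ> Inl) ?Z ?W"
      using bij_betw_cong[of ?Z "?b \<circ> Inl" p ?W] val permutes_inj_on[OF p] by (simp add: bij_betw_def)
    have "relab (inv_into ?Z (?b \<circ> Inl)) (contraction (p (k + 1)) (p (k + 2)) w)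
        = relab (inv p) (contraction (p (k + 1)) (p (k + 2)) w)"
    proof (rule relab_cong[OF _ free])
      fix x assume "x \<in> ?W"
      then obtain z where z: "z \<in> ?Z" "x = p z" by blast
      have "inv_into ?Z (?b \<circ> Inl) x = z"
        using bij_betw_inv_into_left[OF bij z(1)] val[OF z(1)] z(2) by simp
      then show "inv_into ?Z (?b \<circ> Inl) x = inv p x" using z(2) permutes_inverses(2)[OF p] by simp
    qed
    then show ?thesis using relabel_relab[OF bij free] by simp
  qed
  also have "\<dots> = contraction (k + 1) (k + 2) (relab (inv p) w)"
    using contraction_relab[OF w permutes_inj_on[OF permutes_inv[OF p]], of "p (k + 1)" "p (k + 2)"]
      permutes_in_image[OF p] permutes_inverses(2)[OF p] by simp
  finally show ?thesis .
qed

context grid begin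

definition deg :: nat where "deg = l * (l - 1)"

lemma cells_deg: "cells = {1..deg}" by (simp add: cells_def deg_def)

text \<open>The cells are coloured by their columns, all further elements by the first column.\<close>

definition cell_colour :: "nat \<Rightarrow> nat" where "cell_colour i = (if i \<in> cells then col i else 0)"

lemma cell_colour_big: "x > deg \<Longrightarrow> cell_colour x = 0" by (simp add: cell_colour_def cells_deg)

lemma cperm_cell_colour: "cperm cells cell_colour = cperm cells col"
  by (auto simp: cperm_def cell_colour_def permutes_in_image)

lemma cell_colour_less: "cell_colour x < l" using col_less[of x] l2 by (simp add: cell_colour_def)

text \<open>The sum is a contraction of an antisymmetrization over \<open>l\<close> colours of more than
  \<open>l * (l - 1)\<close> points.\<close>

lemma sum_act_perm_arrow:
  fixes w :: "'k::field_char_0 lam"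
  assumes w: "w \<in> free_on (decomp2 {1..deg + 2})"
  shows "(\<Sum>p\<in>cperm {1..deg + 2} cell_colour. fscale (sg p) (act Lambda_C {1..deg + 2} {1..deg} (perm_arrow deg p) w)) = 0"
proof -
  let ?X = "{1..deg + 2}" and ?C = "cperm {1..deg + 2} cell_colour"
  let ?q = "quot_map fscale (lam_rel {1..deg}) :: 'k lam \<Rightarrow> _"
  have "(\<Sum>p\<in>?C. fscale (sg p) (act Lambda_C ?X {1..deg} (perm_arrow deg p) w))
      = (\<Sum>p\<in>?C. ?q (contraction (deg + 1) (deg + 2) (fscale (sg p) (relab (inv p) w))))"
  proof (intro sum.cong refl)
    fix p assume "p \<in> ?C"
    then have p: "p permutes ?X" by (rule cperm_permutes)
    show "fscale (sg p) (act Lambda_C ?X {1..deg} (perm_arrow deg p) w)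
        = ?q (contraction (deg + 1) (deg + 2) (fscale (sg p) (relab (inv p) w)))"
      by (simp only: act_perm_arrow[OF p w] flin_scale[OF flin_contraction] flin_scale[OF flin_quot_lam])
  qed
  also have "\<dots> = ?q (contraction (deg + 1) (deg + 2) (\<Sum>p\<in>?C. fscale (sg p) (relab (inv p) w)))"
    by (simp add: flin_sum[OF flin_contraction] flin_sum[OF flin_quot_lam])
  also have "(\<Sum>p\<in>?C. fscale (sg p) (relab (inv p) w)) = isum relab sg ?C w"
    unfolding isum_def
    by (subst cperm_sum_inv[symmetric, of "\<lambda>p. fscale (sg p) (relab p w)"])
      (auto intro!: sum.cong simp: sg_inv[OF finite_atLeastAtMost cperm_permutes])
  also have "?q (contraction (deg + 1) (deg + 2) (isum relab sg ?C w)) = 0"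
  proof -
    have "isum relab sg ?C w \<in> lam_rel ?X"
      by (rule isum_alt_too_many[of _ cell_colour l, OF _ _ _ w]) (use cell_colour_less in \<open>auto simp: deg_def\<close>)
    then have "contraction (deg + 1) (deg + 2) (isum relab sg ?C w) \<in> lam_rel (?X - {deg + 1, deg + 2})"
      by (rule contraction_lam_rel) auto
    also have "?X - {deg + 1, deg + 2} = {1..deg}" by auto
    finally show ?thesis by (simp add: quot_lam_0)
  qed
  finally show ?thesis .
qed

text \<open>The chain is a cycle for coefficients in \<open>Lambda_C\<close>: the first face vanishes since
  morphisms of positive degree act by zero on \<open>P\<close>, the inner faces by \<open>bar_cycle_middle\<close>, and
  the last face by \<open>sum_act_perm_arrow\<close>.\<close>

theorem bar_cycle_coboundary:
  fixes c :: "(nat set, 'k::field_char_0 arr, 'k bij_sp, 'k lam) cochain"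
  assumes c: "c \<in> cochains dbmm (P {1..deg + 2 * Suc t}) Lambda_C t"
  shows "bar_cycle cell_colour deg (Suc t) (bar_diff dbmm (P {1..deg + 2 * Suc t}) Lambda_C t c) = 0"
proof -
  let ?T = "Suc t" and ?Y = "{1..deg + 2 * Suc t}"
  let ?xs = "cycle_objs deg ?T" and ?id = "id_bij ?Y :: 'k bij_sp"
  define fs :: "(nat \<Rightarrow> nat) list \<Rightarrow> 'k arr list" where "fs ps = cycle_arrows deg ?T ps" for ps
  define G where "G i ps = c (take (Suc i) ?xs @ drop (Suc (Suc i)) ?xs)
     (take i (fs ps) @ [cmp dbmm (?xs ! i) (?xs ! Suc i) (?xs ! Suc (Suc i)) (fs ps ! Suc i) (fs ps ! i)]
       @ drop (Suc (Suc i)) (fs ps)) ?id" for i ps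
  define H where "H ps = act Lambda_C (?xs ! t) (?xs ! Suc t) (fs ps ! t) (c (butlast ?xs) (butlast (fs ps)) ?id)" for ps
  have first: "act (P ?Y) (?xs ! 0) (?xs ! 1) f ?id = 0" for f
    by (simp add: act_P nth_cycle_objs)
  have eval: "bar_diff dbmm (P ?Y) Lambda_C t c ?xs (fs ps) ?id
      = (\<Sum>i<t. fscale ((-1) ^ Suc i) (G i ps)) + fscale ((-1) ^ Suc t) (H ps)" if ps: "ps \<in> perm_seqs cell_colour deg ?T" for ps
  proof -
    have dom: "bar_dom dbmm (P ?Y) ?T ?xs (fs ps) ?id"
      unfolding fs_def by (rule bar_dom_seq[OF ps id_bij_free_on])
    show ?thesis
      unfolding bar_diff_def first cochain_zero_arg[OF c] Lambda_simps(2) G_def H_def using dom by simp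
  qed
  have mid: "(\<Sum>ps\<in>perm_seqs cell_colour deg ?T. fscale (prod_sg ps) (G i ps)) = 0" if "i < t" for i
    unfolding G_def fs_def by (rule bar_cycle_middle[OF c that]) (simp add: cell_colour_big)
  have last: "(\<Sum>ps\<in>perm_seqs cell_colour deg ?T. fscale (prod_sg ps) (H ps)) = 0"
  proof -
    have "(\<Sum>p\<in>cperm {1..deg + 2} cell_colour. fscale (prod_sg (ps @ [p])) (H (ps @ [p]))) = 0"
      if ps: "ps \<in> perm_seqs cell_colour (deg + 2) t" for ps
    proof -
      have len: "length ps = t" using ps by (simp add: perm_seqs_def)
      define w where "w = c (cycle_objs (deg + 2) t) (cycle_arrows (deg + 2) t ps) ?id"
      have Y: "deg + 2 + 2 * t = deg + 2 * Suc t" by simp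
      have "bar_dom dbmm (P ?Y) t (cycle_objs (deg + 2) t) (cycle_arrows (deg + 2) t ps) ?id"
        by (rule bar_dom_seq[OF ps]) (simp only: Y id_bij_free_on)
      then have "w \<in> sp Lambda_C (last (cycle_objs (deg + 2) t))" using c unfolding cochains_def w_def by blast
      then have w: "w \<in> free_on (decomp2 {1..deg + 2})"
        using quot_lam_free_on unfolding last_cycle_objs Lambda_simps by blast
      have "H (ps @ [p]) = act Lambda_C {1..deg + 2} {1..deg} (perm_arrow deg p) w" for p
        using len nth_cycle_objs[of t ?T deg] nth_cycle_objs[of ?T ?T deg]
        by (simp add: H_def fs_def butlast_cycle_objs butlast_cycle_arrows w_def nth_cycle_arrows nth_append)
      then have "(\<Sum>p\<in>cperm {1..deg + 2} cell_colour. fscale (prod_sg (ps @ [p])) (H (ps @ [p])))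
         = fscale (prod_sg ps) (\<Sum>p\<in>cperm {1..deg + 2} cell_colour. fscale (sg p) (act Lambda_C {1..deg + 2} {1..deg} (perm_arrow deg p) w))"
        by (simp add: prod_sg_snoc fv.scale_sum_right)
      then show ?thesis using sum_act_perm_arrow[OF w] by simp
    qed
    then show ?thesis unfolding sum_perm_seqs_snoc by (simp add: sum.neutral)
  qed
  have "bar_cycle cell_colour deg ?T (bar_diff dbmm (P ?Y) Lambda_C t c)
      = (\<Sum>ps\<in>perm_seqs cell_colour deg ?T. \<Sum>i<t. fscale ((-1) ^ Suc i) (fscale (prod_sg ps) (G i ps)))
        + (\<Sum>ps\<in>perm_seqs cell_colour deg ?T. fscale ((-1) ^ Suc t) (fscale (prod_sg ps) (H ps)))"
    unfolding bar_cycle_def sum.distrib[symmetric]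
  proof (intro sum.cong refl)
    fix ps assume ps: "ps \<in> perm_seqs cell_colour deg ?T"
    show "fscale (prod_sg ps) (bar_diff dbmm (P ?Y) Lambda_C t c ?xs (cycle_arrows deg ?T ps) ?id)
        = (\<Sum>i<t. fscale ((-1) ^ Suc i) (fscale (prod_sg ps) (G i ps))) + fscale ((-1) ^ Suc t) (fscale (prod_sg ps) (H ps))"
      unfolding fs_def[symmetric] eval[OF ps]
      by (simp only: fv.scale_right_distrib fv.scale_sum_right fv.scale_scale mult.commute[of "prod_sg ps"])
  qed
  also have "(\<Sum>ps\<in>perm_seqs cell_colour deg ?T. \<Sum>i<t. fscale ((-1) ^ Suc i) (fscale (prod_sg ps) (G i ps)))
      = (\<Sum>i<t. fscale ((-1) ^ Suc i) (\<Sum>ps\<in>perm_seqs cell_colour deg ?T. fscale (prod_sg ps) (G i ps)))"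
    unfolding fv.scale_sum_right by (rule sum.swap)
  also have "\<dots> = 0" by (simp add: mid)
  finally show ?thesis unfolding fv.scale_sum_right[symmetric] last by simp
qed

end

section \<open>Evaluation of the Koszul classes on the cycle\<close>

lemma koszul_apply: "koszul X Y f xs fs m
   = lin_ext fscale (\<lambda>b. koszul_pairs b X ((card Y - card X) div 2) xs fs m) f"
  by (simp add: koszul_def lin_ext_def sum_apply3 cscale_def)

lemma koszul_pairs_0: "koszul_pairs b X 0 xs fs m = koszul_bij b X (b ` (X <+> {})) xs fs m"
  by simp

lemma koszul_pairs_Suc: "koszul_pairs b X (Suc t) (Y # Z # xs) (f # fs) m =
    koszul_pairs b X t (Z # xs) fs
      (koszul_gen (b (Inr (2 * t + 1))) (b (Inr (2 * t + 2))) (b ` (X <+> {1..2 * Suc t})) [Y, Z] [f] m)"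
  by (simp add: yoneda_def numeral_2_eq_2)

lemma koszul_bij_mem:
  assumes "bij_betw (b \<circ> Inl) X Y"
  shows "koszul_bij b X Y [W] fs m \<in> free_on (bijs X W)"
proof (cases "bar_dom dbmm (P Y) 0 [W] fs m")
  case True
  then have m: "m \<in> free_on (bijs Y W)" by (simp add: bar_dom_0 bijs_def)
  have "lin_ext fscale (\<lambda>p. Poly_Mapping.single (restrict (\<lambda>x. p (b (Inl x))) X) 1) m \<in> free_on (bijs X W)"
  proof (rule lin_ext_mem[OF subspace_free_on single_free_on m])
    fix p assume "p \<in> bijs Y W"
    then show "restrict (\<lambda>x. p (b (Inl x))) X \<in> bijs X W"
      using bij_betw_trans[OF assms, of p W] by (simp add: bijs_def comp_def cong: bij_betw_cong)
  qed
  with True show ?thesis by (simp add: koszul_bij_def)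
next
  case False
  then show ?thesis using fv.subspace_0[OF subspace_free_on] by (simp add: koszul_bij_def)
qed

lemma koszul_pairs_mem:
  assumes "bij_betw (b \<circ> Inl) X (b ` (X <+> {}))" "length xs = Suc t" "length fs = t"
  shows "koszul_pairs b X t xs fs m \<in> free_on (bijs X (last xs))"
  using assms(2,3)
proof (induction t arbitrary: xs fs m)
  case 0
  then obtain W where "xs = [W]" by (auto simp: length_Suc_conv)
  then show ?case using koszul_bij_mem[OF assms(1)] by simp
next
  case (Suc t)
  from Suc.prems obtain Y Z ys where xs: "xs = Y # Z # ys" by (metis length_Suc_conv)
  from Suc.prems obtain f gs where fs: "fs = f # gs" by (metis length_Suc_conv)
  show ?case
    unfolding xs fs koszul_pairs_Suc using Suc.IH[of "Z # ys" gs] Suc.prems xs fs by simp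
qed

lemma free_on_neg: "- m \<in> free_on B \<longleftrightarrow> m \<in> free_on B"
  using fv.subspace_neg[OF subspace_free_on, of m B] fv.subspace_neg[OF subspace_free_on, of "- m" B] by auto

lemma bar_dom_neg: "bar_dom A (P Y) p xs fs (- m) \<longleftrightarrow> bar_dom A (P Y) p xs fs m"
  by (simp add: bar_dom_def free_on_neg)

lemma koszul_gen_neg: "koszul_gen u v Y xs fs (- m) = - koszul_gen u v Y xs fs m"
  unfolding koszul_gen_def bar_dom_neg by (simp add: flin_neg[OF flin_bilin_right])

lemma koszul_gen_zero: "koszul_gen u v Y xs fs 0 = 0"
  by (simp add: koszul_gen_def flin_0[OF flin_bilin_right])

lemma koszul_bij_neg: "koszul_bij b X Y xs fs (- m) = - koszul_bij b X Y xs fs m"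
  unfolding koszul_bij_def bar_dom_neg by (simp add: lin_ext_neg)

lemma koszul_bij_zero: "koszul_bij b X Y xs fs 0 = 0"
  by (simp add: koszul_bij_def lin_ext_0)

lemma koszul_pairs_neg: "koszul_pairs b X t xs fs (- m) = - koszul_pairs b X t xs fs m"
  by (induction t arbitrary: xs fs m) (simp_all add: koszul_bij_neg yoneda_def koszul_gen_neg)

lemma koszul_pairs_zero: "koszul_pairs b X t xs fs 0 = 0"
  by (induction t arbitrary: xs fs) (simp_all add: koszul_bij_zero yoneda_def koszul_gen_zero)

lemma koszul_gen_perm_arrow:
  assumes p: "p permutes {1..k + 2}" and m: "\<mu> \<in> bijs Y {1..k + 2}" and uv: "u \<noteq> v" "u \<in> Y" "v \<in> Y"
  defines "\<mu>' \<equiv> restrict (\<lambda>y. inv_into {1..k} (perm_brauer k p \<circ> Inl) (\<mu> y)) (Y - {u, v})"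
  shows "koszul_gen u v Y [{1..k + 2}, {1..k}] [perm_arrow k p] (Poly_Mapping.single \<mu> (1 :: 'k::field))
    = Poly_Mapping.single \<mu>' (if p (k + 1) = \<mu> u \<and> p (k + 2) = \<mu> v then 1
            else if p (k + 1) = \<mu> v \<and> p (k + 2) = \<mu> u then - 1 else 0)"
proof -
  let ?m = "Poly_Mapping.single \<mu> (1 :: 'k)"
  let ?h = "\<lambda>b p. Poly_Mapping.single (restrict (\<lambda>y. inv_into {1..k} (b \<circ> Inl) (p y)) (Y - {u, v}))
           (if b (Inr 1) = p u \<and> b (Inr 2) = p v then 1
            else if b (Inr 1) = p v \<and> b (Inr 2) = p u then - 1 else (0 :: 'k)) :: 'k bij_sp"
  have a: "perm_arrow k p \<in> hom (dbmm :: (nat set, 'k arr, 'k) lincat) {1..k + 2} {1..k}" by (rule perm_arrow_hom[OF p])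
  have m1: "?m \<in> free_on (bijs Y {1..k + 2})" by (rule single_free_on[OF m])
  have "bar_dom dbmm (P Y) (Suc 0) [{1..k + 2}, {1..k}] [perm_arrow k p] ?m"
    unfolding bar_dom_1 sp_P by (intro exI conjI) (rule refl a m1 | simp)+
  then have "koszul_gen u v Y [{1..k + 2}, {1..k}] [perm_arrow k p] ?m = bilin_ext fscale ?h (perm_arrow k p) ?m"
    by (simp add: koszul_gen_def)
  also have "\<dots> = bilin_ext fscale ?h (Poly_Mapping.single (perm_brauer k p) 1) ?m"
  proof -
    have "bilin_ext fscale ?h (Poly_Mapping.single (perm_brauer k p) 1 - perm_arrow k p) ?m \<in> {0}"
    proof (rule ub_rel_degree1[OF _ flin_bilin_left fv.subspace_single_0 _ perm_arrow_rel])
      fix b assume b: "b \<in> D {1..k} {1..k + 2}"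
      have bij: "inj_on b ({1..k} <+> {1..2})" using b by (auto simp: D_def bij_betw_def)
      have "b (Inr 1) \<noteq> b (Inr 2)" using inj_onD[OF bij, of "Inr 1" "Inr 2"] by (auto simp: in_Plus_iff)
      moreover have "\<mu> u \<noteq> \<mu> v" using m uv by (auto simp: bijs_def bij_betw_def inj_on_def)
      moreover have "permute_pairs b (transpose 1 2) \<circ> Inl = b \<circ> Inl" by (simp add: fun_eq_iff)
      ultimately show "bilin_ext fscale ?h (Poly_Mapping.single (permute_pairs b (transpose 1 2)) 1) ?m
        + bilin_ext fscale ?h (Poly_Mapping.single b 1) ?m \<in> {0}"
        by (auto simp: transpose_def single_add[symmetric])
    qed simp
    then show ?thesis by (simp add: flin_diff[OF flin_bilin_left])
  qed
  also have "\<dots> = ?h (perm_brauer k p) \<mu>" by simp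
  finally show ?thesis unfolding perm_brauer_Inr \<mu>'_def .
qed

subsection \<open>A recursion for the values\<close>

text \<open>If \<open>b\<close> adds \<open>t\<close> pairs to \<open>{1..N}\<close> and \<open>\<mu>\<close> identifies the result with \<open>{1..N + 2 * t}\<close>,
  then \<open>glue N b \<mu> t\<close> is the resulting permutation, where the added elements are numbered after
  those of \<open>{1..N}\<close>.\<close>

definition glue :: "nat \<Rightarrow> brauer \<Rightarrow> (nat \<Rightarrow> nat) \<Rightarrow> nat \<Rightarrow> nat \<Rightarrow> nat" where
  "glue N b \<mu> t i = (if i \<in> {1..N} then \<mu> (b (Inl i)) else if i \<in> {N<..N + 2 * t} then \<mu> (b (Inr (i - N))) else i)"

lemma glue_permutes:
  assumes b: "inj_on b ({1..N} <+> {1..2 * t})" and m: "\<mu> \<in> bijs (b ` ({1..N} <+> {1..2 * t})) {1..N + 2 * t}"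
  shows "glue N b \<mu> t permutes {1..N + 2 * t}"
proof (rule bij_imp_permutes)
  define s where "s i = (if i \<le> N then Inl i else Inr (i - N))" for i :: nat
  have s: "bij_betw s {1..N + 2 * t} ({1..N} <+> {1..2 * t})"
  proof (rule bij_betw_byWitness[where f' = "case_sum id (\<lambda>j. N + j)"])
    show "s ` {1..N + 2 * t} \<subseteq> {1..N} <+> {1..2 * t}" by (auto simp: s_def in_Plus_iff)
  qed (auto simp: s_def)
  have bb: "bij_betw b ({1..N} <+> {1..2 * t}) (b ` ({1..N} <+> {1..2 * t}))"
    using b by (simp add: bij_betw_def)
  have "bij_betw \<mu> (b ` ({1..N} <+> {1..2 * t})) {1..N + 2 * t}" using m by (simp add: bijs_def)
  from bij_betw_trans[OF bij_betw_trans[OF s bb] this]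
  have "bij_betw (\<mu> \<circ> (b \<circ> s)) {1..N + 2 * t} {1..N + 2 * t}" .
  then show "bij_betw (glue N b \<mu> t) {1..N + 2 * t} {1..N + 2 * t}"
    using bij_betw_cong[of "{1..N + 2 * t}" "glue N b \<mu> t" "\<mu> \<circ> (b \<circ> s)" "{1..N + 2 * t}"]
    by (simp add: glue_def s_def)
qed (auto simp: glue_def)

text \<open>The linear map \<open>E\<close> stands for the value of a degree zero cocycle at the object
  \<open>{1..deg}\<close>.\<close>

locale koszul_evaluation = grid +
  fixes E :: "'k::field_char_0 bij_sp \<Rightarrow> 'k lam"
  assumes E: "flin E"
begin

text \<open>Extended by zero, \<open>E\<close> becomes a function \<open>phi\<close> on all permutations, and \<open>Phi k\<close> is its
  antisymmetrization over the colour-preserving permutations of \<open>{1..k}\<close>.\<close>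

definition phi :: "(nat \<Rightarrow> nat) \<Rightarrow> 'k lam" where
  "phi r = (if r permutes {1..deg} then E (Poly_Mapping.single (restrict r {1..deg}) 1) else 0)"

definition Phi :: "nat \<Rightarrow> (nat \<Rightarrow> nat) \<Rightarrow> 'k lam" where
  "Phi k m = (\<Sum>p\<in>cperm {1..k} cell_colour. fscale (sg p) (phi (inv p \<circ> m)))"

text \<open>The cocycle \<open>koszul_gen\<close> detects whether an arrow removes a given pair. After relabelling
  the pair consists of \<open>k + 1\<close> and \<open>k + 2\<close>, and it can be removed in the given or in the
  reversed order.\<close>

definition kstep :: "((nat \<Rightarrow> nat) \<Rightarrow> 'k lam) \<Rightarrow> nat \<Rightarrow> (nat \<Rightarrow> nat) \<Rightarrow> 'k lam" where
  "kstep g k r = (if r (k + 1) = k + 1 \<and> r (k + 2) = k + 2 then g r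
     else if r (k + 1) = k + 2 \<and> r (k + 2) = k + 1 then - g (r \<circ> transpose (k + 1) (k + 2)) else 0)"

primrec cycle_rec :: "nat \<Rightarrow> (nat \<Rightarrow> nat) \<Rightarrow> 'k lam" where
  "cycle_rec 0 m = phi m"
| "cycle_rec (Suc t) m = (\<Sum>p\<in>cperm {1..deg + 2 * Suc t} cell_colour. fscale (sg p) (kstep (cycle_rec t) (deg + 2 * t) (inv p \<circ> m)))"

text \<open>The contribution of a single bijection \<open>b\<close> to the pairing of the product of a cocycle and
  a Koszul class with the cycle.\<close>

definition koszul_value :: "nat \<Rightarrow> brauer \<Rightarrow> 'k bij_sp \<Rightarrow> 'k lam" where
  "koszul_value t b v = (\<Sum>ps\<in>perm_seqs cell_colour deg t. fscale (prod_sg ps) (E (koszul_pairs b {1..deg} t (cycle_objs deg t) (cycle_arrows deg t ps) v)))"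

lemma koszul_value_neg: "koszul_value t b (- v) = - koszul_value t b v"
  by (simp add: koszul_value_def koszul_pairs_neg flin_neg[OF E] sum_negf)

lemma koszul_value_zero: "koszul_value t b 0 = 0"
  by (simp add: koszul_value_def koszul_pairs_zero flin_0[OF E])

text \<open>Each step of the recursion evaluates one generator \<open>koszul_gen\<close> on the first arrow of the
  chain and removes the last pair of \<open>b\<close>.\<close>

lemma koszul_value_eval:
  assumes "inj_on b ({1..deg} <+> {1..2 * t})" "\<mu> \<in> bijs (b ` ({1..deg} <+> {1..2 * t})) {1..deg + 2 * t}"
  shows "koszul_value t b (Poly_Mapping.single \<mu> 1) = cycle_rec t (glue deg b \<mu> t)"
  using assms
proof (induction t arbitrary: \<mu>)
  case 0
  let ?X = "{1..deg}"
  have Y: "?X <+> {1..2 * (0 :: nat)} = ?X <+> ({} :: nat set)" by auto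
  have g: "glue deg b \<mu> 0 permutes ?X" using glue_permutes[OF 0] by simp
  have m: "\<mu> \<in> bijs (b ` (?X <+> {})) ?X" using 0(2) unfolding Y by simp
  have "bar_dom dbmm (P (b ` (?X <+> {}))) 0 [?X] [] (Poly_Mapping.single \<mu> (1 :: 'k))"
    unfolding bar_dom_0 sp_P using single_free_on[OF m] by simp
  then have "koszul_pairs b ?X 0 [?X] [] (Poly_Mapping.single \<mu> (1 :: 'k))
      = Poly_Mapping.single (restrict (\<lambda>x. \<mu> (b (Inl x))) ?X) 1"
    unfolding koszul_pairs_0 koszul_bij_def by simp
  also have "restrict (\<lambda>x. \<mu> (b (Inl x))) ?X = restrict (glue deg b \<mu> 0) ?X"
    by (rule restrict_ext) (simp add: glue_def)
  finally have "koszul_pairs b ?X 0 [?X] [] (Poly_Mapping.single \<mu> (1 :: 'k))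
      = Poly_Mapping.single (restrict (glue deg b \<mu> 0) ?X) 1" .
  then show ?case using g by (simp add: koszul_value_def perm_seqs_0 cycle_objs_0 cycle_arrows_def prod_sg_def phi_def del: koszul_pairs.simps)
next
  case (Suc t)
  let ?X = "{1..deg}" and ?k = "deg + 2 * t"
  let ?u = "b (Inr (2 * t + 1))" and ?v = "b (Inr (2 * t + 2))" and ?Y = "b ` (?X <+> {1..2 * Suc t})"
  note R = Plus_remove_pair[OF Suc.prems(1)]
  have k2: "deg + 2 * Suc t = ?k + 2" by simp
  have m: "\<mu> \<in> bijs ?Y {1..?k + 2}" using Suc.prems(2) by (simp only: k2)
  have mb: "bij_betw \<mu> ?Y {1..?k + 2}" using m by (simp add: bijs_def)
  let ?M = "glue deg b \<mu> (Suc t)"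
  have Mk: "?M (?k + 1) = \<mu> ?u" "?M (?k + 2) = \<mu> ?v" by (simp_all add: glue_def)
  obtain xs where xs: "cycle_objs deg t = {1..?k} # xs"
    using hd_cycle_objs[of deg t] cycle_objs_nonempty[of deg t] by (metis list.collapse)
  have main: "(\<Sum>ps\<in>perm_seqs cell_colour deg t. fscale (prod_sg (p # ps)) (E (koszul_pairs b ?X (Suc t) (cycle_objs deg (Suc t))
      (cycle_arrows deg (Suc t) (p # ps)) (Poly_Mapping.single \<mu> 1)))) = fscale (sg p) (kstep (cycle_rec t) ?k (inv p \<circ> ?M))"
    if "p \<in> cperm {1..deg + 2 * Suc t} cell_colour" for p
  proof -
    have p: "p permutes {1..?k + 2}" using cperm_permutes[OF that] by (simp only: k2)
    define \<mu>' where "\<mu>' = restrict (\<lambda>y. inv_into {1..?k} (perm_brauer ?k p \<circ> Inl) (\<mu> y)) (?Y - {?u, ?v})"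
    define \<epsilon> :: 'k where "\<epsilon> = (if p (?k + 1) = \<mu> ?u \<and> p (?k + 2) = \<mu> ?v then 1
            else if p (?k + 1) = \<mu> ?v \<and> p (?k + 2) = \<mu> ?u then - 1 else 0)"
    have gen: "koszul_gen ?u ?v ?Y [{1..?k + 2}, {1..?k}] [perm_arrow ?k p] (Poly_Mapping.single \<mu> (1 :: 'k))
      = Poly_Mapping.single \<mu>' \<epsilon>"
      unfolding \<mu>'_def \<epsilon>_def by (rule koszul_gen_perm_arrow[OF p m R(4,2,3)])
    have "koszul_pairs b ?X (Suc t) (cycle_objs deg (Suc t)) (cycle_arrows deg (Suc t) (p # ps)) (Poly_Mapping.single \<mu> (1 :: 'k))
        = koszul_pairs b ?X t (cycle_objs deg t) (cycle_arrows deg t ps) (Poly_Mapping.single \<mu>' \<epsilon>)" for ps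
      unfolding cycle_objs_Cons cycle_arrows_Cons xs koszul_pairs_Suc k2 gen ..
    then have lhs: "(\<Sum>ps\<in>perm_seqs cell_colour deg t. fscale (prod_sg (p # ps)) (E (koszul_pairs b ?X (Suc t) (cycle_objs deg (Suc t))
      (cycle_arrows deg (Suc t) (p # ps)) (Poly_Mapping.single \<mu> 1)))) = fscale (sg p) (koszul_value t b (Poly_Mapping.single \<mu>' \<epsilon>))"
      by (simp add: koszul_value_def prod_sg_Cons fv.scale_sum_right del: koszul_pairs.simps)
    have ip: "inv p y = z \<longleftrightarrow> y = p z" for y z using permutes_inv_eq[OF p, of y z] by auto
    define r where "r = inv p \<circ> ?M"
    have r12: "r (?k + 1) = z \<longleftrightarrow> p z = \<mu> ?u" "r (?k + 2) = z \<longleftrightarrow> p z = \<mu> ?v" for z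
      unfolding r_def comp_apply Mk ip by auto
    have fix_big: "r i = i" if "i \<notin> {1..?k + 2}" for i
    proof -
      have "?M i = i" using that by (auto simp: glue_def)
      then show ?thesis using permutes_not_in[OF permutes_inv[OF p] that] by (simp add: r_def)
    qed
    have removed: "\<mu>' \<in> bijs (b ` (?X <+> {1..2 * t})) {1..?k}"
      "\<And>y. y \<in> b ` (?X <+> {1..2 * t}) \<Longrightarrow> \<mu>' y = inv p (\<mu> y)"
      if e: "\<epsilon> \<noteq> 0"
    proof -
      have set: "{p (?k + 1), p (?k + 2)} = \<mu> ` {?u, ?v}" using e by (auto simp: \<epsilon>_def split: if_splits)
      have val: "(perm_brauer ?k p \<circ> Inl) x = p x" if "x \<in> {1..?k}" for x using perm_brauer_Inl[OF that] by simp
      have inj: "inj_on (perm_brauer ?k p \<circ> Inl) {1..?k}"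
        using permutes_inj_on[OF p, of "{1..?k}"] val by (metis inj_on_cong)
      have iv: "inv_into {1..?k} (perm_brauer ?k p \<circ> Inl) (\<mu> y) = inv p (\<mu> y) \<and> inv p (\<mu> y) \<in> {1..?k}"
        if y: "y \<in> ?Y - {?u, ?v}" for y
      proof -
        have my: "\<mu> y \<in> {1..?k + 2}" using bij_betw_apply[OF mb] y by blast
        have "\<mu> y \<notin> \<mu> ` {?u, ?v}"
          using inj_on_image_mem_iff[OF bij_betw_imp_inj_on[OF mb], of y "{?u, ?v}"] y R(2,3) by auto
        then have "inv p (\<mu> y) \<noteq> ?k + 1" "inv p (\<mu> y) \<noteq> ?k + 2" unfolding ip set[symmetric] by auto
        moreover have "inv p (\<mu> y) \<in> {1..?k + 2}" using my permutes_in_image[OF permutes_inv[OF p]] by simp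
        ultimately have in_k: "inv p (\<mu> y) \<in> {1..?k}" by auto
        have "inv_into {1..?k} (perm_brauer ?k p \<circ> Inl) ((perm_brauer ?k p \<circ> Inl) (inv p (\<mu> y))) = inv p (\<mu> y)"
          by (rule inv_into_f_f[OF inj in_k])
        then show ?thesis using in_k val[OF in_k] permutes_inverses(1)[OF p] by simp
      qed
      have Y': "?Y - {?u, ?v} = b ` (?X <+> {1..2 * t})" by (rule R(1))
      show eq: "\<mu>' y = inv p (\<mu> y)" if "y \<in> b ` (?X <+> {1..2 * t})" for y
        using that iv[of y] unfolding Y'[symmetric] by (simp add: \<mu>'_def)
      have "inj_on \<mu>' (?Y - {?u, ?v})"
      proof (rule inj_onI)
        fix y z assume yz: "y \<in> ?Y - {?u, ?v}" "z \<in> ?Y - {?u, ?v}" "\<mu>' y = \<mu>' z"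
        then have "inv p (\<mu> y) = inv p (\<mu> z)" using eq unfolding Y' by simp
        then have "\<mu> y = \<mu> z" using permutes_inj[OF permutes_inv[OF p]] by (simp add: inj_eq)
        then show "y = z" using inj_onD[OF bij_betw_imp_inj_on[OF mb]] yz by blast
      qed
      moreover have "\<mu>' ` (?Y - {?u, ?v}) = {1..?k}"
      proof (rule card_subset_eq)
        show "\<mu>' ` (?Y - {?u, ?v}) \<subseteq> {1..?k}"
        proof (rule image_subsetI)
          fix y assume y: "y \<in> ?Y - {?u, ?v}"
          show "\<mu>' y \<in> {1..?k}" unfolding \<mu>'_def restrict_apply'[OF y] using iv[OF y] by simp
        qed
        have "card ?Y = ?k + 2" using bij_betw_same_card[OF mb] by simp
        moreover have "finite ?Y" by simp
        ultimately have "card (?Y - {?u, ?v}) = ?k" using R(2,3,4) by (simp add: card_Diff_subset)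
        then show "card (\<mu>' ` (?Y - {?u, ?v})) = card {1..?k}" using card_image[OF \<open>inj_on \<mu>' (?Y - {?u, ?v})\<close>] by simp
      qed simp
      ultimately show "\<mu>' \<in> bijs (b ` (?X <+> {1..2 * t})) {1..?k}"
        unfolding Y'[symmetric] by (simp add: bijs_def bij_betw_def \<mu>'_def)
    qed
    have small: "glue deg b \<mu>' t i = r i" if e: "\<epsilon> \<noteq> 0" and i: "i \<noteq> ?k + 1" "i \<noteq> ?k + 2" for i
    proof -
      consider "i \<in> ?X" | "i \<in> {deg<..?k}" | "i \<notin> {1..?k + 2}" using i by force
      then show ?thesis
      proof cases
        case 1
        then have "b (Inl i) \<in> b ` (?X <+> {1..2 * t})" by (intro imageI) (simp add: in_Plus_iff)
        with 1 show ?thesis using removed(2)[OF e] by (simp add: glue_def r_def)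
      next
        case 2
        then have "b (Inr (i - deg)) \<in> b ` (?X <+> {1..2 * t})" by (intro imageI) (auto simp: in_Plus_iff)
        with 2 show ?thesis using removed(2)[OF e] by (simp add: glue_def r_def)
      next
        case 3
        then have "glue deg b \<mu>' t i = i" by (auto simp: glue_def)
        then show ?thesis using fix_big[OF 3] by simp
      qed
    qed
    have big: "glue deg b \<mu>' t (?k + 1) = ?k + 1" "glue deg b \<mu>' t (?k + 2) = ?k + 2" by (auto simp: glue_def)
    have "koszul_value t b (Poly_Mapping.single \<mu>' \<epsilon>) = kstep (cycle_rec t) ?k r"
    proof -
      consider (a) "p (?k + 1) = \<mu> ?u" "p (?k + 2) = \<mu> ?v"
        | (b) "\<not> (p (?k + 1) = \<mu> ?u \<and> p (?k + 2) = \<mu> ?v)" "p (?k + 1) = \<mu> ?v" "p (?k + 2) = \<mu> ?u"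
        | (c) "\<not> (p (?k + 1) = \<mu> ?u \<and> p (?k + 2) = \<mu> ?v)" "\<not> (p (?k + 1) = \<mu> ?v \<and> p (?k + 2) = \<mu> ?u)" by blast
      then show ?thesis
      proof cases
        case a
        then have e: "\<epsilon> = 1" by (simp add: \<epsilon>_def)
        then have e0: "\<epsilon> \<noteq> 0" by simp
        have rr: "r (?k + 1) = ?k + 1" "r (?k + 2) = ?k + 2" unfolding r12 using a by auto
        have "glue deg b \<mu>' t = r"
        proof
          fix i show "glue deg b \<mu>' t i = r i"
            using small[OF e0, of i] big rr by (cases "i = ?k + 1 \<or> i = ?k + 2") auto
        qed
        then show ?thesis using Suc.IH[OF R(5) removed(1)[OF e0]] rr by (simp only: e kstep_def simp_thms if_True)
      next
        case b
        then have e: "\<epsilon> = -1" by (simp add: \<epsilon>_def)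
        then have e0: "\<epsilon> \<noteq> 0" by simp
        have rr: "r (?k + 1) = ?k + 2" "r (?k + 2) = ?k + 1" unfolding r12 using b by auto
        have "glue deg b \<mu>' t = r \<circ> transpose (?k + 1) (?k + 2)"
        proof
          fix i show "glue deg b \<mu>' t i = (r \<circ> transpose (?k + 1) (?k + 2)) i"
            using small[OF e0, of i] big rr by (cases "i = ?k + 1 \<or> i = ?k + 2") (auto simp: transpose_def)
        qed
        then have "koszul_value t b (- Poly_Mapping.single \<mu>' 1) = - cycle_rec t (r \<circ> transpose (?k + 1) (?k + 2))"
          using Suc.IH[OF R(5) removed(1)[OF e0]] by (simp only: koszul_value_neg)
        moreover have "kstep (cycle_rec t) ?k r = - cycle_rec t (r \<circ> transpose (?k + 1) (?k + 2))"
          unfolding kstep_def rr by simp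
        ultimately show ?thesis by (simp only: e single_uminus)
      next
        case c
        then have e: "\<epsilon> = 0" by (simp add: \<epsilon>_def)
        have "\<not> (r (?k + 1) = ?k + 1 \<and> r (?k + 2) = ?k + 2)" "\<not> (r (?k + 1) = ?k + 2 \<and> r (?k + 2) = ?k + 1)"
          unfolding r12 using c by blast+
        then have "kstep (cycle_rec t) ?k r = 0" unfolding kstep_def by (simp only: if_False)
        then show ?thesis by (simp add: e koszul_value_zero)
      qed
    qed
    then show ?thesis unfolding lhs r_def by simp
  qed
  have "koszul_value (Suc t) b (Poly_Mapping.single \<mu> 1) = (\<Sum>p\<in>cperm {1..deg + 2 * Suc t} cell_colour.
      fscale (sg p) (kstep (cycle_rec t) ?k (inv p \<circ> ?M)))"
    unfolding koszul_value_def sum_perm_seqs_Cons by (intro sum.cong refl main)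
  then show ?case by simp
qed

definition fixpart :: "((nat \<Rightarrow> nat) \<Rightarrow> 'k lam) \<Rightarrow> nat \<Rightarrow> (nat \<Rightarrow> nat) \<Rightarrow> 'k lam" where
  "fixpart g k r = (if r (k + 1) = k + 1 \<and> r (k + 2) = k + 2 then g r else 0)"

lemma kstep_split:
  assumes r: "r permutes {1..k + 2}"
  shows "kstep g k r = fixpart g k r - fixpart g k (transpose (k + 1) (k + 2) \<circ> r)"
proof -
  let ?t = "transpose (k + 1) (k + 2)"
  have t: "?t x = k + 1 \<longleftrightarrow> x = k + 2" "?t x = k + 2 \<longleftrightarrow> x = k + 1" for x
    by (auto simp: transpose_def)
  have comm: "?t \<circ> r = r \<circ> ?t" if "r (k + 1) = k + 2" "r (k + 2) = k + 1"
  proof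
    fix i
    have "r i = k + 2 \<longleftrightarrow> i = k + 1" "r i = k + 1 \<longleftrightarrow> i = k + 2"
      using that permutes_inj[OF r] by (metis injD)+
    then show "(?t \<circ> r) i = (r \<circ> ?t) i" using that by (auto simp: transpose_def)
  qed
  have "kstep g k r = (if r (k + 1) = k + 1 \<and> r (k + 2) = k + 2 then g r
     else if r (k + 1) = k + 2 \<and> r (k + 2) = k + 1 then - g (?t \<circ> r) else 0)"
    unfolding kstep_def
    by (intro if_cong refl arg_cong[of _ _ uminus] arg_cong[of _ _ g]) (metis comm)
  then show ?thesis unfolding fixpart_def comp_apply t by auto
qed

lemma transpose_cperm: "k \<ge> deg \<Longrightarrow> transpose (k + 1) (k + 2) \<in> cperm {1..k + 2} cell_colour"
  by (rule cperm_transpose) (auto simp: cell_colour_big)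

text \<open>The transposition of \<open>k + 1\<close> and \<open>k + 2\<close> preserves the colours and is odd. Reindexing by
  it turns the terms with the pair in reversed order into those with the pair in the given
  order, so that both halves of the sum agree.\<close>

lemma cycle_rec_Suc:
  assumes m: "m permutes {1..deg + 2 * Suc t}"
  shows "cycle_rec (Suc t) m = fscale 2 (\<Sum>p\<in>cperm {1..deg + 2 * Suc t} cell_colour.
    fscale (sg p) (fixpart (cycle_rec t) (deg + 2 * t) (inv p \<circ> m)))"
proof -
  define k where "k = deg + 2 * t"
  have k2: "deg + 2 * Suc t = k + 2" "k \<ge> deg" by (simp_all add: k_def)
  let ?t = "transpose (k + 1) (k + 2)" and ?C = "cperm {1..k + 2} cell_colour"
  define F where "F p = fscale (sg p) (fixpart (cycle_rec t) k (inv p \<circ> m))" for p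
  have tC: "?t \<in> ?C" by (rule transpose_cperm[OF k2(2)])
  have step: "fscale (sg p) (kstep (cycle_rec t) k (inv p \<circ> m)) = F p + F (p \<circ> ?t)" if "p \<in> ?C" for p
  proof -
    have p: "p permutes {1..k + 2}" using that by (rule cperm_permutes)
    have r: "inv p \<circ> m permutes {1..k + 2}"
      using m unfolding k2 by (rule permutes_compose[OF _ permutes_inv[OF p]])
    have "inv (p \<circ> ?t) = ?t \<circ> inv p"
      using permutes_bij[OF p] by (simp add: o_inv_distrib)
    then have i: "inv (p \<circ> ?t) \<circ> m = ?t \<circ> (inv p \<circ> m)" by (simp add: comp_assoc)
    have s: "(sg (p \<circ> ?t) :: 'k) = - sg p"
      using sg_compose[OF finite_atLeastAtMost p cperm_permutes[OF tC]] by (simp add: sign_swap_id)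
    show ?thesis
      unfolding kstep_split[OF r] F_def i s by (simp add: fv.scale_right_diff_distrib)
  qed
  have "cycle_rec (Suc t) m = (\<Sum>p\<in>?C. F p + F (p \<circ> ?t))"
    unfolding cycle_rec.simps k_def[symmetric] k2 by (intro sum.cong refl step)
  also have "\<dots> = (\<Sum>p\<in>?C. F p) + (\<Sum>p\<in>?C. F p)"
    unfolding sum.distrib cperm_sum_right[OF tC] ..
  also have "\<dots> = fscale 2 (\<Sum>p\<in>?C. F p)" by (rule poly_mapping_eqI) (simp add: lookup_add)
  finally show ?thesis unfolding F_def k_def[symmetric] k2 .
qed

lemma phi_fixes:
  assumes "phi (inv p \<circ> r) \<noteq> 0" "p permutes {1..k}" "k \<ge> deg" "i > k"
  shows "r i = i"
proof -
  have "inv p \<circ> r permutes {1..deg}" using assms(1) by (auto simp: phi_def split: if_splits)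
  then have "inv p (r i) = i" using permutes_not_in[of "inv p \<circ> r" "{1..deg}" i] assms(3,4) by simp
  then have "r i = p i" using permutes_inv_eq[OF assms(2)] by metis
  also have "p i = i" using permutes_not_in[OF assms(2)] assms(4) by simp
  finally show ?thesis .
qed

lemma fixpart_phi: "k \<ge> deg \<Longrightarrow> fixpart phi k r = phi r"
  using phi_fixes[of id r k "k + 1"] phi_fixes[of id r k "k + 2"]
  by (auto simp: fixpart_def permutes_id inv_id)

text \<open>Where a summand of \<open>Phi k\<close> is nonzero, \<open>r\<close> fixes all elements beyond \<open>k\<close> anyway.\<close>

lemma fixpart_Phi:
  assumes "k \<ge> deg" shows "fixpart (Phi k) k r = Phi k r"
proof (cases "r (k + 1) = k + 1 \<and> r (k + 2) = k + 2")
  case False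
  have "phi (inv p \<circ> r) = 0" if "p \<in> cperm {1..k} cell_colour" for p
    using phi_fixes[OF _ cperm_permutes[OF that] assms, of r "k + 1"]
      phi_fixes[OF _ cperm_permutes[OF that] assms, of r "k + 2"] False by auto
  then have "Phi k r = 0" by (simp add: Phi_def sum.neutral)
  with False show ?thesis unfolding fixpart_def by (simp only: if_False)
next
  case True
  then show ?thesis unfolding fixpart_def by (simp only: if_True simp_thms)
qed

lemma cperm_mono: "X \<subseteq> Y \<Longrightarrow> cperm X f \<subseteq> cperm Y f"
  by (auto simp: cperm_def intro: permutes_subset) (metis permutes_not_in)

lemma Phi_average:
  assumes "k \<le> k'"
  shows "(\<Sum>p\<in>cperm {1..k'} cell_colour. fscale (sg p) (Phi k (inv p \<circ> m)))
    = fscale (of_nat (card (cperm {1..k} cell_colour))) (Phi k' m)"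
proof -
  let ?C = "cperm {1..k} cell_colour" and ?C' = "cperm {1..k'} cell_colour"
  have sub: "?C \<subseteq> ?C'" using assms by (intro cperm_mono) auto
  have "(\<Sum>p\<in>?C'. fscale (sg p) (Phi k (inv p \<circ> m)))
      = (\<Sum>q\<in>?C. \<Sum>p\<in>?C'. fscale (sg p) (fscale (sg q) (phi (inv q \<circ> (inv p \<circ> m)))))"
    unfolding Phi_def fv.scale_sum_right by (rule sum.swap)
  also have "\<dots> = (\<Sum>q\<in>?C. \<Sum>p\<in>?C'. fscale (sg (p \<circ> q)) (phi (inv (p \<circ> q) \<circ> m)))"
  proof (intro sum.cong refl)
    fix q p assume "q \<in> ?C" and p: "p \<in> ?C'"
    then have q: "q \<in> ?C'" using sub by blast
    have "inv (p \<circ> q) = inv q \<circ> inv p"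
      using permutes_bij[OF cperm_permutes[OF p]] permutes_bij[OF cperm_permutes[OF q]] by (rule o_inv_distrib)
    moreover have "(sg (p \<circ> q) :: 'k) = sg p * sg q"
      by (rule sg_compose[OF finite_atLeastAtMost cperm_permutes[OF p] cperm_permutes[OF q]])
    ultimately show "fscale (sg p) (fscale (sg q) (phi (inv q \<circ> (inv p \<circ> m))))
        = fscale (sg (p \<circ> q)) (phi (inv (p \<circ> q) \<circ> m))"
      by (simp add: comp_assoc)
  qed
  also have "\<dots> = (\<Sum>q\<in>?C. Phi k' m)"
  proof (rule sum.cong[OF refl])
    fix q assume "q \<in> ?C"
    then have q: "q \<in> ?C'" using sub by blast
    show "(\<Sum>p\<in>?C'. fscale (sg (p \<circ> q)) (phi (inv (p \<circ> q) \<circ> m))) = Phi k' m"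
      unfolding Phi_def by (rule cperm_sum_right[OF q])
  qed
  also have "\<dots> = fscale (of_nat (card ?C)) (Phi k' m)"
    by (rule poly_mapping_eqI) (simp add: lookup_sum)
  finally show ?thesis .
qed

text \<open>The antisymmetrizations over the growing sets collapse into the one over the largest set,
  and every step only contributes a positive integer.\<close>

theorem cycle_rec_eq_Phi:
  "\<exists>K :: nat. K \<noteq> 0 \<and> (\<forall>m. m permutes {1..deg + 2 * Suc t} \<longrightarrow> cycle_rec (Suc t) m = fscale (of_nat K) (Phi (deg + 2 * Suc t) m))"
proof (induction t)
  case 0
  have "cycle_rec (Suc 0) m = fscale (of_nat 2) (Phi (deg + 2 * Suc 0) m)" if "m permutes {1..deg + 2 * Suc 0}" for m
  proof -
    have "cycle_rec 0 = phi" by (rule ext) simp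
    then show ?thesis unfolding cycle_rec_Suc[OF that] Phi_def using fixpart_phi[of "deg + 2 * 0"] by simp
  qed
  then show ?case by (intro exI[of _ 2]) simp
next
  case (Suc t)
  then obtain K :: nat where K: "K \<noteq> 0"
    "\<And>m. m permutes {1..deg + 2 * Suc t} \<Longrightarrow> cycle_rec (Suc t) m = fscale (of_nat K) (Phi (deg + 2 * Suc t) m)" by blast
  define k where "k = deg + 2 * Suc t"
  have k2: "deg + 2 * Suc (Suc t) = k + 2" "k \<ge> deg" by (simp_all add: k_def)
  let ?C = "cperm {1..k} cell_colour"
  have fixp: "fixpart (cycle_rec (Suc t)) k r = fscale (of_nat K) (Phi k r)" if r: "r permutes {1..k + 2}" for r
  proof -
    have "r permutes {1..k}" if f: "r (k + 1) = k + 1 \<and> r (k + 2) = k + 2"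
    proof (rule permutes_superset[OF r])
      fix x assume "x \<in> {1..k + 2} - {1..k}"
      then have "x = k + 1 \<or> x = k + 2" by auto
      then show "r x = x" using f by auto
    qed
    then have "fixpart (cycle_rec (Suc t)) k r = fscale (of_nat K) (fixpart (Phi k) k r)"
      using K(2)[of r] unfolding fixpart_def k_def[symmetric] by simp
    then show ?thesis by (simp only: fixpart_Phi[OF k2(2)])
  qed
  have "cycle_rec (Suc (Suc t)) m = fscale (of_nat (2 * K * card ?C)) (Phi (k + 2) m)" if m: "m permutes {1..k + 2}" for m
  proof -
    have "cycle_rec (Suc (Suc t)) m = fscale 2 (\<Sum>p\<in>cperm {1..k + 2} cell_colour. fscale (sg p) (fixpart (cycle_rec (Suc t)) k (inv p \<circ> m)))"
      using cycle_rec_Suc[of m "Suc t"] m unfolding k_def[symmetric] k2 by simp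
    also have "\<dots> = fscale 2 (\<Sum>p\<in>cperm {1..k + 2} cell_colour. fscale (of_nat K) (fscale (sg p) (Phi k (inv p \<circ> m))))"
    proof (intro arg_cong[of _ _ "fscale 2"] sum.cong refl)
      fix p assume "p \<in> cperm {1..k + 2} cell_colour"
      then have "inv p \<circ> m permutes {1..k + 2}" by (intro permutes_compose[OF m] permutes_inv cperm_permutes)
      then show "fscale (sg p) (fixpart (cycle_rec (Suc t)) k (inv p \<circ> m))
          = fscale (of_nat K) (fscale (sg p) (Phi k (inv p \<circ> m)))"
        by (simp add: fixp mult.commute)
    qed
    also have "\<dots> = fscale 2 (fscale (of_nat K) (fscale (of_nat (card ?C)) (Phi (k + 2) m)))"
      unfolding fv.scale_sum_right[symmetric] Phi_average[OF le_add1] ..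
    finally show ?thesis by (simp add: mult_ac)
  qed
  moreover have "2 * K * card ?C \<noteq> 0"
  proof -
    have "?C \<noteq> {}" using cperm_id[of "{1..k}" cell_colour] by (metis empty_iff)
    then have "card ?C \<noteq> 0" by simp
    then show ?thesis using K(1) by simp
  qed
  ultimately show ?case unfolding k2 by blast
qed

subsection \<open>Invariance under the wreath product\<close>

definition shift_perm :: "nat \<Rightarrow> (nat \<Rightarrow> nat) \<Rightarrow> nat \<Rightarrow> nat" where
  "shift_perm t h = map_permutation {1..2 * t} (\<lambda>j. deg + j) h"

lemma shift_perm:
  assumes h: "h permutes {1..2 * t}"
  shows "shift_perm t h permutes {deg<..deg + 2 * t}"
    and "j \<in> {1..2 * t} \<Longrightarrow> shift_perm t h (deg + j) = deg + h j"
    and "sign (shift_perm t h) = sign h"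
proof -
  have inj: "inj_on (\<lambda>j. deg + j) {1..2 * t}" by simp
  have im: "(\<lambda>j. deg + j) ` {1..2 * t} = {deg<..deg + 2 * t}"
    by (simp add: atLeastSucAtMost_greaterThanAtMost)
  show "shift_perm t h permutes {deg<..deg + 2 * t}"
    using map_permutation_permutes[of "\<lambda>j. deg + j" "{1..2 * t}" "{deg<..deg + 2 * t}" h] h inj im
    by (simp add: shift_perm_def bij_betw_def)
  show "j \<in> {1..2 * t} \<Longrightarrow> shift_perm t h (deg + j) = deg + h j"
    unfolding shift_perm_def by (rule map_permutation_apply[OF inj])
  show "sign (shift_perm t h) = sign h"
    unfolding shift_perm_def by (rule sign_map_permutation[OF inj h]) simp
qed

lemma shift_perm_cperm:
  assumes h: "h permutes {1..2 * t}" shows "shift_perm t h \<in> cperm {1..deg + 2 * t} cell_colour"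
proof -
  note s = shift_perm(1)[OF h]
  have "cell_colour (shift_perm t h x) = cell_colour x" for x
  proof (cases "x \<in> {deg<..deg + 2 * t}")
    case True
    then have "shift_perm t h x \<in> {deg<..deg + 2 * t}" using permutes_in_image[OF s] by blast
    with True show ?thesis by (simp add: cell_colour_big)
  next
    case False
    then show ?thesis using permutes_not_in[OF s] by simp
  qed
  moreover have "shift_perm t h permutes {1..deg + 2 * t}" using s by (rule permutes_subset) auto
  ultimately show ?thesis by (simp add: cperm_def)
qed

lemma glue_permute_pairs:
  assumes h: "h permutes {1..2 * t}"
  shows "glue deg (permute_pairs b h) \<mu> t = glue deg b \<mu> t \<circ> shift_perm t h"
proof
  fix i
  note s = shift_perm[OF h]
  show "glue deg (permute_pairs b h) \<mu> t i = (glue deg b \<mu> t \<circ> shift_perm t h) i"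
  proof (cases "i \<in> {deg<..deg + 2 * t}")
    case True
    define j where "j = i - deg"
    have j: "i = deg + j" "j \<in> {1..2 * t}" using True by (auto simp: j_def)
    have hj: "h j \<in> {1..2 * t}" using permutes_in_image[OF h] j(2) by blast
    show ?thesis using j(2) hj by (simp add: j(1) s(2)[OF j(2)] glue_def)
  next
    case False
    then have "shift_perm t h i = i" by (rule permutes_not_in[OF s(1)])
    with False show ?thesis by (auto simp: glue_def)
  qed
qed

lemma phi_commute:
  assumes s: "s permutes {deg<..k}" shows "phi (r \<circ> s) = phi (s \<circ> r)"
proof -
  have comm: "q \<circ> s = s \<circ> q" if q: "q permutes {1..deg}" for q
  proof
    fix x
    show "(q \<circ> s) x = (s \<circ> q) x"
    proof (cases "x \<in> {1..deg}")
      case True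
      then have "q x \<in> {1..deg}" using permutes_in_image[OF q] by blast
      then show ?thesis using True permutes_not_in[OF s, of x] permutes_not_in[OF s, of "q x"] by simp
    next
      case False
      then have qx: "q x = x" by (rule permutes_not_in[OF q])
      have "s x \<notin> {1..deg}"
      proof
        assume sx: "s x \<in> {1..deg}"
        then have "s x \<notin> {deg<..k}" by simp
        then have "x \<notin> {deg<..k}" using permutes_in_image[OF s] by blast
        then show False using False sx permutes_not_in[OF s] by simp
      qed
      then show ?thesis using permutes_not_in[OF q] by (simp add: qx)
    qed
  qed
  have "r \<circ> s = s \<circ> r" if "r \<circ> s permutes {1..deg}"
  proof -
    have "s \<circ> r = s \<circ> (r \<circ> s) \<circ> inv s" using permutes_inv_o(1)[OF s] by (simp add: comp_assoc)
    also have "\<dots> = r \<circ> s \<circ> s \<circ> inv s" unfolding comm[OF that, symmetric] ..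
    also have "\<dots> = r \<circ> s" using permutes_inv_o(1)[OF s] by (simp add: comp_assoc)
    finally show ?thesis ..
  qed
  moreover have "r \<circ> s = s \<circ> r" if "s \<circ> r permutes {1..deg}"
  proof -
    have "r \<circ> s = inv s \<circ> ((s \<circ> r) \<circ> s)" using permutes_inv_o(2)[OF s] by (simp add: comp_assoc[symmetric])
    also have "\<dots> = (inv s \<circ> s) \<circ> (s \<circ> r)" unfolding comm[OF that] by (simp only: comp_assoc)
    also have "\<dots> = s \<circ> r" using permutes_inv_o(2)[OF s] by simp
    finally show ?thesis .
  qed
  ultimately show ?thesis unfolding phi_def by metis
qed

lemma Phi_shift:
  assumes h: "h permutes {1..2 * t}"
  shows "Phi (deg + 2 * t) (m \<circ> shift_perm t h) = fscale (sg h) (Phi (deg + 2 * t) m)"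
proof -
  let ?s = "shift_perm t h" and ?C = "cperm {1..deg + 2 * t} cell_colour"
  note s = shift_perm[OF h]
  have sC: "inv ?s \<in> ?C" by (rule cperm_inv[OF shift_perm_cperm[OF h]])
  have "Phi (deg + 2 * t) (m \<circ> ?s) = (\<Sum>p\<in>?C. fscale (sg h) (fscale (sg (p \<circ> inv ?s)) (phi (inv (p \<circ> inv ?s) \<circ> m))))"
    unfolding Phi_def
  proof (rule sum.cong[OF refl])
    fix p assume p: "p \<in> ?C"
    have "inv (p \<circ> inv ?s) = inv (inv ?s) \<circ> inv p"
      using permutes_bij[OF cperm_permutes[OF p]] permutes_bij[OF cperm_permutes[OF sC]] by (rule o_inv_distrib)
    then have i: "inv (p \<circ> inv ?s) \<circ> m = ?s \<circ> (inv p \<circ> m)"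
      by (simp add: permutes_inv_inv[OF s(1)] comp_assoc)
    have e: "(sg (p \<circ> inv ?s) :: 'k) = sg p * sg h"
      using sg_compose[OF finite_atLeastAtMost cperm_permutes[OF p] cperm_permutes[OF sC]]
        sg_inv[OF finite_greaterThanAtMost s(1)] by (simp add: s(3))
    have "phi (inv p \<circ> (m \<circ> ?s)) = phi (?s \<circ> (inv p \<circ> m))"
      using phi_commute[OF s(1), of "inv p \<circ> m"] by (simp add: comp_assoc)
    moreover have "(sg h :: 'k) * (sg p * sg h) = sg p" by (simp add: sg_square mult.left_commute)
    ultimately show "fscale (sg p) (phi (inv p \<circ> (m \<circ> ?s)))
        = fscale (sg h) (fscale (sg (p \<circ> inv ?s)) (phi (inv (p \<circ> inv ?s) \<circ> m)))"
      unfolding i e by simp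
  qed
  also have "\<dots> = fscale (sg h) (\<Sum>p\<in>?C. fscale (sg (p \<circ> inv ?s)) (phi (inv (p \<circ> inv ?s) \<circ> m)))"
    by (simp only: fv.scale_sum_right)
  also have "(\<Sum>p\<in>?C. fscale (sg (p \<circ> inv ?s)) (phi (inv (p \<circ> inv ?s) \<circ> m))) = Phi (deg + 2 * t) m"
    unfolding Phi_def by (rule cperm_sum_right[OF sC])
  finally show ?thesis .
qed

definition koszul_pairing :: "nat \<Rightarrow> 'k arr \<Rightarrow> 'k lam" where
  "koszul_pairing t = lin_ext fscale (\<lambda>b. koszul_value t b (id_bij {1..deg + 2 * t}))"

lemma koszul_value_D:
  assumes b: "b \<in> D {1..deg} {1..deg + 2 * t}"
  shows "koszul_value t b (id_bij {1..deg + 2 * t}) = cycle_rec t (glue deg b (restrict id {1..deg + 2 * t}) t)"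
    and "glue deg b (restrict id {1..deg + 2 * t}) t permutes {1..deg + 2 * t}"
proof -
  have d: "(card {1..deg + 2 * t} - card {1..deg}) div 2 = t" by simp
  note bb = D_inj[OF b, unfolded d] D_image[OF b, unfolded d]
  have m: "restrict id {1..deg + 2 * t} \<in> bijs (b ` ({1..deg} <+> {1..2 * t})) {1..deg + 2 * t}"
    unfolding bb(2) by (rule restrict_id_bijs)
  show "koszul_value t b (id_bij {1..deg + 2 * t}) = cycle_rec t (glue deg b (restrict id {1..deg + 2 * t}) t)"
    unfolding id_bij_def by (rule koszul_value_eval[OF bb(1) m])
  show "glue deg b (restrict id {1..deg + 2 * t}) t permutes {1..deg + 2 * t}"
    by (rule glue_permutes[OF bb(1) m])
qed

text \<open>All added elements have the same colour, so the antisymmetrization \<open>Phi\<close> transforms by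
  the sign under all their permutations. The restriction of the sign is the character that
  defines the category \<open>ub Minus Plus\<close>.\<close>

lemma koszul_pairing_ub_rel:
  assumes "f \<in> ub_rel Minus Plus {1..deg} {1..deg + 2 * Suc t}"
  shows "koszul_pairing (Suc t) f = 0"
proof -
  let ?Y = "{1..deg + 2 * Suc t}"
  obtain K :: nat where K: "\<And>m. m permutes ?Y \<Longrightarrow> cycle_rec (Suc t) m = fscale (of_nat K) (Phi (deg + 2 * Suc t) m)"
    using cycle_rec_eq_Phi[of t] by blast
  have d: "(card ?Y - card {1..deg}) div 2 = Suc t" "card ?Y - card {1..deg} = 2 * Suc t" by simp_all
  have lin: "flin (koszul_pairing (Suc t))" unfolding koszul_pairing_def by (rule flin_lin_ext)
  have "koszul_pairing (Suc t) f \<in> {0}"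
  proof (rule flin_span_mem[OF lin fv.subspace_single_0 _ assms[unfolded ub_rel_def d(1)]])
    fix g assume "g \<in> {Poly_Mapping.single (permute_pairs b h) 1 - Poly_Mapping.single b (of_int (twist Minus Plus (Suc t) h)) :: 'k arr |b h.
              b \<in> D {1..deg} ?Y \<and> h \<in> wreath (Suc t)}"
    then obtain b h where g: "g = Poly_Mapping.single (permute_pairs b h) 1 - Poly_Mapping.single b (sg h)"
      and b: "b \<in> D {1..deg} ?Y" and "h \<in> wreath (Suc t)" by (auto simp: twist_def)
    then have h: "h permutes {1..2 * Suc t}" by (simp add: wreath_def)
    have b': "permute_pairs b h \<in> D {1..deg} ?Y"
      by (rule D_permute_pairs[OF b]) (simp only: d(2) h)
    have "koszul_value (Suc t) (permute_pairs b h) (id_bij ?Y) = fscale (sg h) (koszul_value (Suc t) b (id_bij ?Y))"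
      using K[OF koszul_value_D(2)[OF b]] K[OF koszul_value_D(2)[OF b']]
      unfolding koszul_value_D(1)[OF b] koszul_value_D(1)[OF b'] unfolding glue_permute_pairs[OF h] Phi_shift[OF h]
      by (simp only: fv.scale_scale mult.commute)
    then show "koszul_pairing (Suc t) g \<in> {0}"
      unfolding g by (simp add: koszul_pairing_def lin_ext_diff)
  qed
  then show ?thesis by simp
qed

text \<open>The added pairs are \<open>(deg + 1, deg + 2)\<close>, \<open>(deg + 3, deg + 4)\<close>, and so on.\<close>

definition add_pairs :: "nat \<Rightarrow> brauer" where
  "add_pairs t = restrict (case_sum id (\<lambda>j. deg + j)) ({1..deg} <+> {1..2 * t})"

lemma add_pairs_D: "add_pairs t \<in> D {1..deg} {1..deg + 2 * t}"
proof -
  let ?S = "{1..deg} <+> {1..2 * t}"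
  have d: "card {1..deg + 2 * t} - card {1..deg} = 2 * t" by simp
  have "bij_betw (case_sum id (\<lambda>j. deg + j)) ?S {1..deg + 2 * t}"
    by (rule bij_betw_byWitness[where f' = "\<lambda>i. if i \<le> deg then Inl i else Inr (i - deg)"])
      (auto simp: in_Plus_iff split: sum.split)
  then have "bij_betw (add_pairs t) ?S {1..deg + 2 * t}"
    using bij_betw_cong[of ?S "add_pairs t" "case_sum id (\<lambda>j. deg + j)" "{1..deg + 2 * t}"]
    unfolding add_pairs_def restrict_apply by (simp only: if_True simp_thms)
  moreover have "add_pairs t \<in> extensional ?S" by (simp add: add_pairs_def)
  ultimately show ?thesis unfolding D_def mem_Collect_eq d by simp
qed

lemma glue_add_pairs: "glue deg (add_pairs t) (restrict id {1..deg + 2 * t}) t = id"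
  by (rule ext) (auto simp: glue_def add_pairs_def in_Plus_iff)

text \<open>Only permutations of the original cells contribute, and by antisymmetry they all
  contribute \<open>y\<close>.\<close>

lemma Phi_id:
  assumes k: "k \<ge> deg"
    and y: "\<And>q. q \<in> cperm cells col \<Longrightarrow> E (Poly_Mapping.single (restrict q {1..deg}) 1) = fscale (sg q) y"
  shows "Phi k id = fscale (of_nat (card (cperm cells col))) y"
proof -
  let ?C = "cperm {1..deg} cell_colour"
  have C: "?C = cperm cells col" using cperm_cell_colour by (simp add: cells_deg)
  have sub: "?C \<subseteq> cperm {1..k} cell_colour" using k by (intro cperm_mono) auto
  have "Phi k id = (\<Sum>p\<in>?C. fscale (sg p) (phi (inv p)))"
    unfolding Phi_def comp_id
  proof (rule sum.mono_neutral_right[OF _ sub], simp, rule ballI)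
    fix p assume p: "p \<in> cperm {1..k} cell_colour - ?C"
    have pk: "p permutes {1..k}" using p by (auto dest: cperm_permutes)
    have "\<not> inv p permutes {1..deg}"
    proof
      assume "inv p permutes {1..deg}"
      then have "p permutes {1..deg}" using permutes_inv permutes_inv_inv[OF pk] by metis
      moreover have "\<forall>x\<in>{1..deg}. cell_colour (p x) = cell_colour x" using p k by (auto simp: cperm_def)
      ultimately show False using p by (simp add: cperm_def)
    qed
    then show "fscale (sg p) (phi (inv p)) = 0" by (simp add: phi_def)
  qed
  also have "\<dots> = (\<Sum>p\<in>?C. y)"
  proof (rule sum.cong[OF refl])
    fix p assume p: "p \<in> ?C"
    have i: "inv p \<in> ?C" by (rule cperm_inv[OF p])
    have e: "(sg (inv p) :: 'k) = sg p" by (rule sg_inv[OF finite_atLeastAtMost cperm_permutes[OF p]])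
    have "phi (inv p) = fscale (sg p) y"
      using y[of "inv p"] i cperm_permutes[OF i] unfolding C by (simp add: phi_def e)
    then show "fscale (sg p) (phi (inv p)) = y" by (simp add: sg_square)
  qed
  also have "\<dots> = fscale (of_nat (card ?C)) y" by (rule poly_mapping_eqI) (simp add: lookup_sum)
  finally show ?thesis unfolding C .
qed

lemma koszul_pairing_nonzero:
  assumes y: "\<And>q. q \<in> cperm cells col \<Longrightarrow> E (Poly_Mapping.single (restrict q {1..deg}) 1) = fscale (sg q) y"
    and y0: "y \<noteq> 0"
  obtains f where "f \<in> hom (ub Minus Plus) {1..deg} {1..deg + 2 * Suc t}" "f \<in> free_on (D {1..deg} {1..deg + 2 * Suc t})"
    "koszul_pairing (Suc t) f \<noteq> 0"
proof -
  let ?X = "{1..deg}" and ?Y = "{1..deg + 2 * Suc t}"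
  define b where "b = add_pairs (Suc t)"
  define f :: "'k arr" where "f = ub_quot Minus Plus ?X ?Y (Poly_Mapping.single b 1)"
  have b: "b \<in> D ?X ?Y" unfolding b_def by (rule add_pairs_D)
  obtain K :: nat where K: "K \<noteq> 0"
    "\<And>m. m permutes ?Y \<Longrightarrow> cycle_rec (Suc t) m = fscale (of_nat K) (Phi (deg + 2 * Suc t) m)"
    using cycle_rec_eq_Phi[of t] by blast
  have lin: "flin (koszul_pairing (Suc t))" unfolding koszul_pairing_def by (rule flin_lin_ext)
  have "koszul_pairing (Suc t) (Poly_Mapping.single b 1 - f) = 0"
    unfolding f_def by (rule koszul_pairing_ub_rel[OF fquot_diff[OF subspace_ub_rel]])
  then have "koszul_pairing (Suc t) f = koszul_pairing (Suc t) (Poly_Mapping.single b 1)"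
    by (simp add: flin_diff[OF lin])
  also have "\<dots> = koszul_value (Suc t) b (id_bij ?Y)" by (simp add: koszul_pairing_def)
  also have "\<dots> = cycle_rec (Suc t) id"
    unfolding koszul_value_D(1)[OF b] unfolding b_def glue_add_pairs ..
  also have "\<dots> = fscale (of_nat K) (Phi (deg + 2 * Suc t) id)" by (rule K(2)[OF permutes_id])
  also have "\<dots> = fscale (of_nat K) (fscale (of_nat (card (cperm cells col))) y)"
    by (subst Phi_id[OF _ y]) simp_all
  also have "\<dots> \<noteq> 0"
  proof -
    have "cperm cells col \<noteq> {}" using cperm_id[of cells col] by (metis empty_iff)
    then show ?thesis using K(1) y0 finite_cells by simp
  qed
  finally have "koszul_pairing (Suc t) f \<noteq> 0" .
  moreover have "f \<in> hom (ub Minus Plus) ?X ?Y"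
    unfolding f_def ub_def lincat.simps by (intro imageI single_free_on b)
  moreover have "f \<in> free_on (D ?X ?Y)"
    unfolding f_def by (rule fquot_free_on[OF subspace_ub_rel ub_rel_free_on single_free_on[OF b]])
  ultimately show ?thesis by (intro that[of f])
qed

end

section \<open>Degree zero classes are not torsion\<close>

lemma cochain0_lin_ext:
  fixes c :: "(nat set, 'k::field arr, 'k bij_sp, 'k lam) cochain"
  assumes c: "c \<in> cochains dbmm (P X) Lambda_C 0" and W: "finite W" and v: "v \<in> free_on (bijs X W)"
  shows "c [W] [] v = lin_ext fscale (\<lambda>p. c [W] [] (Poly_Mapping.single p 1)) v"
proof -
  let ?L = "lin_ext fscale (\<lambda>p. c [W] [] (Poly_Mapping.single p 1))"
  have dom: "bar_dom dbmm (P X) 0 [W] [] m" if "m \<in> free_on (bijs X W)" for m :: "'k bij_sp"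
    using W that unfolding bar_dom_0 sp_P by simp
  have lin: "c [W] [] (fscale a m + fscale b m') = fscale a (c [W] [] m) + fscale b (c [W] [] m')"
    if "m \<in> free_on (bijs X W)" "m' \<in> free_on (bijs X W)" for a b m m'
  proof -
    have "c [W] [] (mscale (P X) a m + mscale (P X) b m') =
        mscale Lambda_C a (c [W] [] m) + mscale Lambda_C b (c [W] [] m')"
      using c dom[OF that(1)] dom[OF that(2)] unfolding cochains_def by blast
    then show ?thesis by simp
  qed
  let ?V = "{v \<in> free_on (bijs X W). c [W] [] v = ?L v}"
  have sub: "fv.subspace ?V"
    unfolding fv.subspace_def
  proof (intro conjI ballI allI)
    show "0 \<in> ?V" using cochain_zero_arg[OF c] fv.subspace_0[OF subspace_free_on] by (simp add: lin_ext_0)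
  next
    fix m m' assume "m \<in> ?V" "m' \<in> ?V"
    then show "m + m' \<in> ?V"
      using lin[of m m' 1 1] fv.subspace_add[OF subspace_free_on, of m "bijs X W" m'] by (simp add: lin_ext_add)
  next
    fix a m assume "m \<in> ?V"
    then show "fscale a m \<in> ?V"
      using lin[of m m a 0] fv.subspace_scale[OF subspace_free_on, of m "bijs X W" a] by (simp add: lin_ext_scale)
  qed
  have "v \<in> ?V"
    by (rule flin_mem[OF flin_id sub _ v]) (simp add: single_free_on)
  then show ?thesis by simp
qed

text \<open>A degree zero cocycle is a natural transformation, and \<open>P X\<close> is generated by the identity
  of \<open>X\<close>.\<close>

lemma cocycle0_eq_0:
  fixes c :: "(nat set, 'k::field arr, 'k bij_sp, 'k lam) cochain"
  assumes c: "c \<in> cocycles dbmm (P X) Lambda_C 0" and X: "finite X" and 0: "c [X] [] (id_bij X) = 0"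
  shows "c = 0"
proof -
  have cc: "c \<in> cochains dbmm (P X) Lambda_C 0" and d: "bar_diff dbmm (P X) Lambda_C 0 c = 0"
    using c by (auto simp: cocycles_def)
  have basis: "c [W] [] (Poly_Mapping.single p 1) = 0" if W: "finite W" and p: "p \<in> bijs X W" for W p
  proof -
    have pb: "bij_betw p X W" and pe: "p \<in> extensional X" using p by (auto simp: bijs_def)
    have card: "card W = card X" using bij_betw_same_card[OF pb] by simp
    (* The arrow that acts on P X as the bijection p. *)
    define b :: brauer where "b = restrict (case_sum (inv_into X p) id) (W <+> {})"
    have bI: "b (Inl w) = inv_into X p w" if "w \<in> W" for w using that by (simp add: b_def in_Plus_iff)
    have ib: "bij_betw (inv_into X p) W X" by (rule bij_betw_inv_into[OF pb])
    have "bij_betw b (W <+> {}) X"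
    proof (rule bij_betw_imageI)
      show "inj_on b (W <+> {})"
        using bij_betw_imp_inj_on[OF ib] bI by (auto simp: inj_on_def Plus_def)
      have "b ` (W <+> {}) = inv_into X p ` W" using bI by (auto simp: Plus_def image_iff)
      then show "b ` (W <+> {}) = X" using ib by (simp add: bij_betw_def)
    qed
    then have b: "b \<in> D W X" by (simp add: D_def card b_def)
    let ?f = "Poly_Mapping.single b 1 :: 'k arr"
    have "?f \<in> ub_quot Minus Minus W X ` free_on (D W X)"
      using ub_quot_degree0[OF card, of Minus Minus ?f] single_free_on[OF b] by (metis image_eqI)
    then have dom: "bar_dom dbmm (P X) (Suc 0) [X, W] [?f] (id_bij X)"
      unfolding bar_dom_db1 using X W id_bij_free_on by blast
    have act: "act (P X) X W ?f (id_bij X) = Poly_Mapping.single p 1"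
    proof -
      have "inv_into W (b \<circ> Inl) x = p x" if "x \<in> X" for x
      proof (rule inv_into_f_eq)
        show "inj_on (b \<circ> Inl) W" using bij_betw_imp_inj_on[OF ib] bI by (auto simp: inj_on_def)
        show "p x \<in> W" using bij_betw_apply[OF pb that] .
        then show "(b \<circ> Inl) (p x) = x" using bI bij_betw_inv_into_left[OF pb that] by simp
      qed
      then have "restrict (\<lambda>x. inv_into W (b \<circ> Inl) (restrict id X x)) X = p"
        using pe by (auto simp: restrict_def extensional_def fun_eq_iff)
      then show ?thesis using card by (simp add: act_P id_bij_def)
    qed
    have "bar_diff dbmm (P X) Lambda_C 0 c [X, W] [?f] (id_bij X) = 0" unfolding d by simp
    then show ?thesis
      using dom by (simp add: bar_diff_def act 0 flin_0[OF flin_act])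
  qed
  show "c = 0"
  proof (intro ext)
    fix xs and fs :: "'k arr list" and m :: "'k bij_sp"
    show "c xs fs m = 0 xs fs m"
    proof (cases "bar_dom dbmm (P X) 0 xs fs m")
      case True
      then obtain W where W: "xs = [W]" "fs = []" "finite W" "m \<in> free_on (bijs X W)"
        by (auto simp: bar_dom_0 bijs_def)
      have "lin_ext fscale (\<lambda>p. c [W] [] (Poly_Mapping.single p 1)) m \<in> {0}"
        by (rule lin_ext_mem[OF fv.subspace_single_0 _ W(4)]) (simp add: basis[OF W(3)])
      then show ?thesis using cochain0_lin_ext[OF cc W(3,4)] by (simp add: W(1,2))
    next
      case False
      then show ?thesis using cc by (simp add: cochains_def)
    qed
  qed
qed

context grid begin

lemma bar_cycle_yoneda_nonzero:
  fixes c :: "(nat set, 'k::field_char_0 arr, 'k bij_sp, 'k lam) cochain"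
  assumes c: "c \<in> cochains dbmm (P {1..deg}) Lambda_C 0"
    and y: "\<And>q. q \<in> cperm cells col \<Longrightarrow> c [{1..deg}] [] (Poly_Mapping.single (restrict q {1..deg}) 1) = fscale (sg q) y"
    and y0: "y \<noteq> 0"
  obtains f where "f \<in> hom (ub Minus Plus) {1..deg} {1..deg + 2 * Suc t}"
    "bar_cycle cell_colour deg (Suc t) (yoneda (Suc t) c (koszul {1..deg} {1..deg + 2 * Suc t} f)) \<noteq> 0"
proof -
  let ?X = "{1..deg}" and ?Y = "{1..deg + 2 * Suc t}" and ?T = "Suc t"
  define E where "E = lin_ext fscale (\<lambda>p. c [?X] [] (Poly_Mapping.single p 1))"
  interpret koszul_evaluation l E by unfold_locales (simp_all add: E_def flin_lin_ext flin_add[OF flin_lin_ext] flin_scale[OF flin_lin_ext])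
  have "E (Poly_Mapping.single (restrict q ?X) 1) = fscale (sg q) y" if "q \<in> cperm cells col" for q
    using y[OF that] by (simp add: E_def)
  then obtain f where f: "f \<in> hom (ub Minus Plus) ?X ?Y" "f \<in> free_on (D ?X ?Y)" "koszul_pairing ?T f \<noteq> 0"
    using koszul_pairing_nonzero[of y t] y0 by blast
  have d: "(card ?Y - card ?X) div 2 = ?T" by simp
  have each: "yoneda ?T c (koszul ?X ?Y f) (cycle_objs deg ?T) (cycle_arrows deg ?T ps) (id_bij ?Y)
      = lin_ext fscale (\<lambda>b. E (koszul_pairs b ?X ?T (cycle_objs deg ?T) (cycle_arrows deg ?T ps) (id_bij ?Y))) f" for ps
  proof -
    let ?v = "lin_ext fscale (\<lambda>b. koszul_pairs b ?X ?T (cycle_objs deg ?T) (cycle_arrows deg ?T ps) (id_bij ?Y :: 'k bij_sp)) f"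
    have v: "?v \<in> free_on (bijs ?X ?X)"
    proof (rule lin_ext_mem[OF subspace_free_on _ f(2)])
      fix b assume b: "b \<in> D ?X ?Y"
      have "koszul_pairs b ?X ?T (cycle_objs deg ?T) (cycle_arrows deg ?T ps) (id_bij ?Y :: 'k bij_sp) \<in> free_on (bijs ?X (last (cycle_objs deg ?T)))"
        by (rule koszul_pairs_mem[OF bij_betw_Inl[OF D_inj[OF b]]]) simp_all
      then show "koszul_pairs b ?X ?T (cycle_objs deg ?T) (cycle_arrows deg ?T ps) (id_bij ?Y :: 'k bij_sp) \<in> free_on (bijs ?X ?X)"
        unfolding last_cycle_objs .
    qed
    have dr: "drop ?T (cycle_objs deg ?T) = [?X]"
    proof -
      have "drop ?T (cycle_objs deg ?T) = [last (cycle_objs deg ?T)]"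
        by (rule nth_equalityI) (simp_all add: last_conv_nth del: length_0_conv)
      then show ?thesis unfolding last_cycle_objs .
    qed
    have "yoneda ?T c (koszul ?X ?Y f) (cycle_objs deg ?T) (cycle_arrows deg ?T ps) (id_bij ?Y) = c [?X] [] ?v"
      unfolding yoneda_def dr koszul_apply d by simp
    also have "\<dots> = E ?v" unfolding E_def by (rule cochain0_lin_ext[OF c _ v]) simp
    finally show ?thesis unfolding flin_lin_ext_comp[OF E] .
  qed
  have "bar_cycle cell_colour deg ?T (yoneda ?T c (koszul ?X ?Y f)) = koszul_pairing ?T f"
    unfolding bar_cycle_def each koszul_pairing_def koszul_value_def lin_ext_def fv.scale_sum_right
    by (subst sum.swap) (simp only: fv.scale_scale mult.commute)
  with f(1,3) show ?thesis by (intro that[of f]) simp_all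
qed

text \<open>For every \<open>t\<close> there is a morphism that adds \<open>t + 1\<close> pairs and whose product with \<open>x\<close>
  pairs nontrivially with the cycle. Since the cycle annihilates coboundaries, the product is
  nonzero in \<open>Ext\<close>.\<close>

theorem not_torsion:
  fixes x :: "'k::field_char_0 ext_lam"
  assumes x: "x \<in> Ext0 Lambda_C {1..deg}" and x0: "x \<noteq> 0"
    and anti: "\<And>q. q \<in> cperm cells col \<Longrightarrow> sym_act Ext_Lambda deg q x = mscale Ext_Lambda (sg q) x"
  shows "\<not> torsion_elem Ext_Lambda {1..deg} x"
proof
  let ?X = "{1..deg}"
  assume "torsion_elem Ext_Lambda ?X x"
  then obtain t where t: "\<And>s. s \<ge> t \<Longrightarrow> generated (ub Minus Plus) Ext_Lambda ?X x {1..s} = {0}"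
    unfolding torsion_elem_def by blast
  let ?T = "Suc t" and ?Y = "{1..deg + 2 * Suc t}"
  have c: "x 0 \<in> cocycles dbmm (P ?X) Lambda_C 0" by (rule Ext0_cochain[OF x])
  then have cc: "x 0 \<in> cochains dbmm (P ?X) Lambda_C 0" by (simp add: cocycles_def)
  define y where "y = x 0 [?X] [] (id_bij ?X)"
  have "x 0 \<noteq> 0"
  proof
    assume "x 0 = 0"
    then have "x p = 0" for p using Ext0_0[OF x, of p] by (cases "p = 0") auto
    then show False using x0 by (auto simp: fun_eq_iff)
  qed
  then have y0: "y \<noteq> 0" using cocycle0_eq_0[OF c] unfolding y_def by blast
  have y: "x 0 [?X] [] (Poly_Mapping.single (restrict q ?X) 1) = fscale (sg q) y" if q: "q \<in> cperm cells col" for q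
  proof -
    have qX: "q permutes ?X" using cperm_permutes[OF q] by (simp add: cells_deg)
    have "restrict (\<lambda>i. restrict id ?X (q i)) ?X = restrict q ?X"
      by (rule restrict_ext) (metis permutes_in_image[OF qX] restrict_apply' id_apply)
    then have pre: "pre q ?X (id_bij ?X) = (Poly_Mapping.single (restrict q ?X) 1 :: 'k bij_sp)"
      unfolding id_bij_def pre_single by (simp only:)
    have dom: "bar_dom dbmm (P ?X) 0 [?X] [] (id_bij ?X :: 'k bij_sp)"
      unfolding bar_dom_0 sp_P using id_bij_free_on by simp
    have "sym_act Ext_Lambda deg q x 0 [?X] [] (id_bij ?X) = x 0 [?X] [] (pre q ?X (id_bij ?X))"
      unfolding sym_act_Ext0[OF x qX] using dom by (simp only: if_True simp_thms)
    then show ?thesis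
      unfolding anti[OF q] pre y_def by (simp add: Ext_Lambda_def Ext_module_simps cscale_def)
  qed
  obtain f where f: "f \<in> hom (ub Minus Plus) ?X ?Y" "bar_cycle cell_colour deg ?T (yoneda ?T (x 0) (koszul ?X ?Y f)) \<noteq> 0"
    by (rule bar_cycle_yoneda_nonzero[OF cc y y0])
  have "act Ext_Lambda ?X ?Y f x \<in> generated (ub Minus Plus) Ext_Lambda ?X x ?Y"
    unfolding generated_def
  proof (rule InterI)
    fix V assume "V \<in> {U ?Y |U. submodule (ub Minus Plus) Ext_Lambda U \<and> x \<in> U ?X}"
    then obtain U where U: "V = U ?Y" "submodule (ub Minus Plus) Ext_Lambda U" "x \<in> U ?X" by blast
    have "?X \<in> obj (ub Minus Plus)" "?Y \<in> obj (ub Minus Plus)" by (simp_all add: ub_def)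
    then show "act Ext_Lambda ?X ?Y f x \<in> V" using U f(1) unfolding submodule_def by blast
  qed
  then have "act Ext_Lambda ?X ?Y f x = 0" using t[of "deg + 2 * Suc t"] by simp
  then have "act Ext_Lambda ?X ?Y f x ?T = 0" by simp
  moreover have d: "(card ?Y - card ?X) div 2 = ?T" by simp
  ultimately have "ext_class dbmm (P ?Y) Lambda_C ?T (yoneda ?T (x 0) (koszul ?X ?Y f)) = 0"
    unfolding Ext_Lambda_def Ext_module_simps Let_def d by simp
  then have "yoneda ?T (x 0) (koszul ?X ?Y f) \<in> coboundaries dbmm (P ?Y) Lambda_C ?T"
    by (simp only: ext_class_0_iff)
  then obtain c' where "c' \<in> cochains dbmm (P ?Y) Lambda_C t"
    "yoneda ?T (x 0) (koszul ?X ?Y f) = bar_diff dbmm (P ?Y) Lambda_C t c'"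
    by (auto simp: coboundaries_def simp del: One_nat_def)
  then show False using f(2) bar_cycle_coboundary[of c' t] by simp
qed

end

theorem theorem7:
  fixes l n :: nat
  assumes "2 \<le> l" and "2 * n = l * (l - 1)"
  shows "(\<exists>S :: 'k::field_char_0 ext_lam set.
            S \<subseteq> Ext0 Lambda_C {1..2 * n} \<and> sym_submodule Ext_Lambda (2 * n) S
            \<and> iso_specht (replicate (l - 1) l) Ext_Lambda S)
       \<and> (\<forall>S :: 'k ext_lam set.
            S \<subseteq> Ext0 Lambda_C {1..2 * n} \<and> sym_submodule Ext_Lambda (2 * n) S
            \<and> iso_specht (replicate (l - 1) l) Ext_Lambda S
            \<longrightarrow> \<not> torsion_set Ext_Lambda {1..2 * n} S)"
proof -
  interpret grid l by unfold_locales (rule assms(1))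
  have n: "2 * n = deg" by (simp only: deg_def assms(2))
  show ?thesis
    unfolding n shape_def[symmetric]
  proof (intro conjI allI impI)
    show "\<exists>S :: 'k ext_lam set. S \<subseteq> Ext0 Lambda_C {1..deg} \<and> sym_submodule Ext_Lambda deg S \<and> iso_specht shape Ext_Lambda S"
      using specht_in_Ext0[where 'k = 'k] unfolding cells_deg deg_def[symmetric] by blast
    fix S :: "'k ext_lam set"
    assume S: "S \<subseteq> Ext0 Lambda_C {1..deg} \<and> sym_submodule Ext_Lambda deg S \<and> iso_specht shape Ext_Lambda S"
    then obtain x where x: "x \<in> S" "x \<noteq> 0"
      "\<And>q. q \<in> cperm cells col \<Longrightarrow> sym_act Ext_Lambda deg q x = mscale Ext_Lambda (sg q) x"
      using antisymmetric_vector[of S] unfolding deg_def[symmetric] by blast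
    have "\<not> torsion_elem Ext_Lambda {1..deg} x"
      by (rule not_torsion[OF _ x(2,3)]) (use S x(1) in blast)
    then show "\<not> torsion_set Ext_Lambda {1..deg} S" unfolding torsion_set_def using x(1) by blast
  qed
qed

end
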